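(* Let $D\subset\mathbb{R}^n$ be a bounded $C^2$ domain with inward unit normal $n(\cdot)$ on $\partial D$, let $\mu$ be a probability measure on $D$, let $B$ be a standard Brownian motion on $\mathbb{R}^n$, and let $\nu$ be a Poisson random measure on $\mathbb{R}_+\times D$ with intensity $\mathrm{d}\ell\otimes\mu(\mathrm{d}x)$, independent of $B$, with atoms $\{(\ell_k,Z_k)\}_{k\ge1}$, $\ell_1<\ell_2<\cdots$. Let $x\in D$ and let $(X,L)$ be the pathwise unique strong solution of $$X_t=x+B_t+\int_0^t n(X_s)\,\mathrm{d}L_s+\sum_{k:\,\ell_k\le L_t}\bigl(Z_k-X_{\tau_k-}\bigr),\qquad t\ge 0 .$$ Set $\ell_0:=0$, $\Delta\ell_k:=\ell_k-\ell_{k-1}$, $\tau_0:=0$ and $\tau_k:=\inf\{t\ge0:\ L_t\ge\ell_k\}$ for $k\ge1$. For each $k\ge0$, let $(W^k,L^{(k)})$ be a reflected Brownian motion in $\overline D$ together with its boundary local time, starting from $W^0_0=x$ and from $W^k_0=Z_k$ for $k\ge1$, driven by the Brownian increment $t\mapsto B_{\tau_k+t}-B_{\tau_k}$, and define the $k$-th lifetime by $$\xi_k:=\inf\{t\ge0:\ L^{(k)}_t\ge\Delta\ell_{k+1}\}\in(0,\infty],$$ where $\Delta\ell_{k+1}\sim\mathrm{Exp}(1)$. Then, almost surely, on every compact time interval there are only finitely many jumps, and $X$ coincides with the concatenation $$X_t=\sum_{k=0}^\infty \mathbf 1_{[\tau_k,\tau_{k+1})}(t)\,W^k_{t-\tau_k},\qquad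 t\ge0,$$ with $\tau_{k+1}=\tau_k+\xi_k$ and $X_{\tau_{k+1}}=Z_{k+1}$. In particular, $X$ is obtained by concatenating elastic reflected Brownian motions: for each $k$, the process behaves as a reflected Brownian motion killed when its boundary local time reaches an independent $\mathrm{Exp}(1)$ level, and it is then restarted at the independent position $Z_{k+1}\sim\mu$.
   Context: The displayed equation is the integrated form of the SDE $\mathrm{d}X_t=\mathrm{d}B_t+n(X_t)\,\mathrm{d}L_t+\int_D(x-X_{t-})\,\nu(\mathrm{d}L_t,\mathrm{d}x)$. A solution consists of a c\`adl\`ag process $X$ with $X_t\in\overline D$ for all $t$ and a continuous nondecreasing process $L$ (the boundary local time), $L_0=0$, with $\int_0^\infty\mathbf 1_{\{X_t\in D\}}\,\mathrm{d}L_t=0$ a.s. Since $\mu$ is a probability measure, the $\Delta\ell_k$ are i.i.d. $\mathrm{Exp}(1)$ and the $Z_k$ are i.i.d. with law $\mu$. The reflected Brownian motion $(W^k,L^{(k)})$ driven by a Brownian motion $\beta$ is the (pathwise unique, strong) solution of the Skorokhod problem $W^k_t=W^k_0+\beta_t+\int_0^t n(W^k_s)\,\mathrm{d}L^{(k)}_s$ with $W^k_t\in\overline D$, $L^{(k)}$ continuous, nondecreasing, $L^{(k)}_0=0$, increasing only when $W^k\in\partial D$. *)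

theory Defs
  imports "HOL-Probability.Probability"
begin

section \<open>Domains of class \<open>C\<^sup>2\<close> and the inward unit normal\<close>

definition C2_on :: "'a::euclidean_space set \<Rightarrow> ('a \<Rightarrow> real) \<Rightarrow> bool" where
  "C2_on U \<phi> \<longleftrightarrow> (\<exists>(G :: 'a \<Rightarrow> 'a) (H :: 'a \<Rightarrow> 'a \<Rightarrow>\<^sub>L 'a).
     (\<forall>y\<in>U. (\<phi> has_derivative (\<lambda>h. G y \<bullet> h)) (at y) \<and>
            (G has_derivative blinfun_apply (H y)) (at y)) \<and>
     continuous_on U H)"

definition C2_defining_function :: "'a::euclidean_space set \<Rightarrow> 'a set \<Rightarrow> ('a \<Rightarrow> real) \<Rightarrow> bool" where
  "C2_defining_function D U \<phi> \<longleftrightarrow>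
     open U \<and> C2_on U \<phi> \<and> (\<forall>y\<in>U. \<not> (\<phi> has_derivative (\<lambda>_. 0)) (at y)) \<and>
     D \<inter> U = {y\<in>U. 0 < \<phi> y}"

definition C2_domain :: "'a::euclidean_space set \<Rightarrow> bool" where
  "C2_domain D \<longleftrightarrow> open D \<and> connected D \<and> D \<noteq> {} \<and>
     (\<forall>p\<in>frontier D. \<exists>U \<phi>. p \<in> U \<and> C2_defining_function D U \<phi>)"

text \<open>The normal is the normalised gradient (\<open>sgn g = g / norm g\<close>) of a local defining function that
  is positive inside \<open>D\<close>; its direction does not depend on the defining function. The value \<open>0\<close> away
  from the boundary is a convention: it is only ever integrated against measures carried by the
  times spent on the boundary.\<close>

definition inward_normal :: "'a::euclidean_space set \<Rightarrow> 'a \<Rightarrow> 'a" where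
  "inward_normal D p = (if p \<in> frontier D then
     (THE v. \<exists>U \<phi> g. p \<in> U \<and> C2_defining_function D U \<phi> \<and>
        (\<phi> has_derivative (\<lambda>h. g \<bullet> h)) (at p) \<and> v = sgn g)
     else 0)"

section \<open>Processes, generated sigma-algebras, Brownian motion, Poisson random measures\<close>

text \<open>Processes are functions of a real time parameter; only times \<open>t \<ge> 0\<close> are meaningful.\<close>

abbreviation path_space :: "real set \<Rightarrow> (real \<Rightarrow> 'a::topological_space) measure" where
  "path_space T \<equiv> PiM T (\<lambda>_. borel)"

definition path :: "real set \<Rightarrow> (real \<Rightarrow> 'w \<Rightarrow> 'a) \<Rightarrow> 'w \<Rightarrow> real \<Rightarrow> 'a" where
  "path T Y \<omega> = restrict (\<lambda>t. Y t \<omega>) T"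

definition gen :: "'w measure \<Rightarrow> 's measure \<Rightarrow> ('w \<Rightarrow> 's) \<Rightarrow> 'w set set" where
  "gen M N f = sets (vimage_algebra (space M) f N)"

abbreviation gen_path :: "'w measure \<Rightarrow> real set \<Rightarrow> (real \<Rightarrow> 'w \<Rightarrow> 'a::topological_space) \<Rightarrow> 'w set set" where
  "gen_path M T Y \<equiv> gen M (path_space T) (path T Y)"

definition augmented :: "'w measure \<Rightarrow> 'w set set \<Rightarrow> 'w measure" where
  "augmented M G = sigma (space M) (G \<union> null_sets M)"

definition standard_BM :: "'w measure \<Rightarrow> (real \<Rightarrow> 'w \<Rightarrow> 'a::euclidean_space) \<Rightarrow> bool" where
  "standard_BM M B \<longleftrightarrow>
     (\<forall>t\<ge>0. B t \<in> borel_measurable M) \<and>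
     (\<forall>\<omega>\<in>space M. B 0 \<omega> = 0 \<and> continuous_on {0..} (\<lambda>t. B t \<omega>)) \<and>
     (\<forall>s t. 0 \<le> s \<and> s < t \<longrightarrow> distributed M lborel (\<lambda>\<omega>. B t \<omega> - B s \<omega>)
        (\<lambda>y. \<Prod>b\<in>Basis. normal_density 0 (sqrt (t - s)) (y \<bullet> b))) \<and>
     (\<forall>t :: nat \<Rightarrow> real. 0 \<le> t 0 \<and> mono t \<longrightarrow>
        prob_space.indep_vars M (\<lambda>_. borel) (\<lambda>i \<omega>. B (t (Suc i)) \<omega> - B (t i) \<omega>) UNIV)"

definition poisson_random_measure :: "'w measure \<Rightarrow> 's measure \<Rightarrow> ('w \<Rightarrow> 's measure) \<Rightarrow> bool" where
  "poisson_random_measure M \<Lambda> \<nu> \<longleftrightarrow>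
     (\<forall>\<omega>\<in>space M. sets (\<nu> \<omega>) = sets \<Lambda>) \<and>
     (\<forall>A\<in>sets \<Lambda>. (\<lambda>\<omega>. emeasure (\<nu> \<omega>) A) \<in> borel_measurable M) \<and>
     (\<forall>A\<in>sets \<Lambda>. emeasure \<Lambda> A < \<infinity> \<longrightarrow> (\<forall>m :: nat.
        measure M {\<omega>\<in>space M. emeasure (\<nu> \<omega>) A = of_nat m} =
          exp (- measure \<Lambda> A) * measure \<Lambda> A ^ m / fact m)) \<and>
     (\<forall>A :: nat \<Rightarrow> 's set. range A \<subseteq> sets \<Lambda> \<and> disjoint_family A \<longrightarrow>
        prob_space.indep_vars M (\<lambda>_. borel) (\<lambda>i \<omega>. emeasure (\<nu> \<omega>) (A i)) UNIV)"

definition gen_random_measure :: "'w measure \<Rightarrow> 's measure \<Rightarrow> ('w \<Rightarrow> 's measure) \<Rightarrow> 'w set set" where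
  "gen_random_measure M \<Lambda> \<nu> =
     gen M (PiM (sets \<Lambda>) (\<lambda>_. borel)) (\<lambda>\<omega>. restrict (\<lambda>A. emeasure (\<nu> \<omega>) A) (sets \<Lambda>))"

text \<open>For \<open>\<mu>\<close> with \<open>space \<mu> = D\<close> this is a measure on \<open>{0..} \<times> D\<close>.\<close>

definition jump_intensity :: "'a measure \<Rightarrow> (real \<times> 'a) measure" where
  "jump_intensity \<mu> = restrict_space lborel {0..} \<Otimes>\<^sub>M \<mu>"

section \<open>Path functionals\<close>

definition left_limit :: "(real \<Rightarrow> 'a::t2_space) \<Rightarrow> real \<Rightarrow> 'a" where
  "left_limit f t = Lim (at_left t) f"

definition cadlag :: "(real \<Rightarrow> 'a::t2_space) \<Rightarrow> bool" where
  "cadlag f \<longleftrightarrow> (\<forall>t\<ge>0. (f \<longlongrightarrow> f t) (at_right t)) \<and> (\<forall>t>0. \<exists>l. (f \<longlongrightarrow> l) (at_left t))"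

definition local_time_path :: "(real \<Rightarrow> real) \<Rightarrow> bool" where
  "local_time_path l \<longleftrightarrow> l 0 = 0 \<and> continuous_on {0..} l \<and> mono_on {0..} l"

text \<open>The measure \<open>dl\<close> on \<open>{0..}\<close>; \<^const>\<open>interval_measure\<close> needs a function that is monotone on the whole line.\<close>

definition stieltjes :: "(real \<Rightarrow> real) \<Rightarrow> real measure" where
  "stieltjes l = interval_measure (\<lambda>s. l (max 0 s))"

text \<open>\<open>\<infinity>\<close> if the level is never reached.\<close>

definition hitting_time :: "(real \<Rightarrow> 'w \<Rightarrow> real) \<Rightarrow> ('w \<Rightarrow> real) \<Rightarrow> 'w \<Rightarrow> ereal" where
  "hitting_time L a \<omega> = Inf {ereal t |t. 0 \<le> t \<and> a \<omega> \<le> L t \<omega>}"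

definition jump_time :: "(real \<Rightarrow> 'w \<Rightarrow> real) \<Rightarrow> (nat \<Rightarrow> 'w \<Rightarrow> real) \<Rightarrow> nat \<Rightarrow> 'w \<Rightarrow> ereal" where
  "jump_time L \<l> k \<omega> = (if k = 0 then 0 else hitting_time L (\<l> k) \<omega>)"

definition lifetime :: "(nat \<Rightarrow> real \<Rightarrow> 'w \<Rightarrow> real) \<Rightarrow> (nat \<Rightarrow> 'w \<Rightarrow> real) \<Rightarrow> nat \<Rightarrow> 'w \<Rightarrow> ereal" where
  "lifetime LW \<l> k = hitting_time (LW k) (\<lambda>\<omega>. \<l> (Suc k) \<omega> - \<l> k \<omega>)"

text \<open>\<open>B\<close> restarted at \<open>\<tau>\<close>; the value on \<open>{\<tau> = \<infinity>}\<close> is a convention.\<close>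

definition increment_after :: "(real \<Rightarrow> 'w \<Rightarrow> 'a::real_vector) \<Rightarrow> ('w \<Rightarrow> ereal) \<Rightarrow> real \<Rightarrow> 'w \<Rightarrow> 'a" where
  "increment_after B \<tau> t \<omega> = (if \<tau> \<omega> < \<infinity>
     then B (real_of_ereal (\<tau> \<omega>) + t) \<omega> - B (real_of_ereal (\<tau> \<omega>)) \<omega> else 0)"

text \<open>\<open>(X, L)\<close> strictly before \<open>\<tau>\<close>: \<open>X\<close> is killed (sent to \<open>0\<close>) and \<open>L\<close> is stopped at \<open>\<tau>\<close>.\<close>

definition before :: "('w \<Rightarrow> ereal) \<Rightarrow> (real \<Rightarrow> 'w \<Rightarrow> 'a::real_vector) \<Rightarrow> (real \<Rightarrow> 'w \<Rightarrow> real) \<Rightarrow>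
    real \<Rightarrow> 'w \<Rightarrow> 'a \<times> real" where
  "before \<tau> X L t \<omega> =
     (if ereal t < \<tau> \<omega> then X t \<omega> else 0, L (real_of_ereal (min (ereal t) (\<tau> \<omega>))) \<omega>)"

definition pair_process :: "(real \<Rightarrow> 'w \<Rightarrow> 'a) \<Rightarrow> (real \<Rightarrow> 'w \<Rightarrow> 'b) \<Rightarrow> real \<Rightarrow> 'w \<Rightarrow> 'a \<times> 'b" where
  "pair_process Y L t \<omega> = (Y t \<omega>, L t \<omega>)"

section \<open>Reflected Brownian motion\<close>

text \<open>Strong solution of the Skorokhod problem: it is adapted to the augmented filtration
  generated by the initial position and the driving process.\<close>

definition strong_skorokhod_solution :: "'w measure \<Rightarrow> 'a::euclidean_space set \<Rightarrow> ('w \<Rightarrow> 'a) \<Rightarrow>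
    (real \<Rightarrow> 'w \<Rightarrow> 'a) \<Rightarrow> (real \<Rightarrow> 'w \<Rightarrow> 'a) \<Rightarrow> (real \<Rightarrow> 'w \<Rightarrow> real) \<Rightarrow> bool" where
  "strong_skorokhod_solution M D W\<^sub>0 \<beta> W L \<longleftrightarrow>
     (\<forall>\<omega>\<in>space M. continuous_on {0..} (\<lambda>t. W t \<omega>) \<and> (\<forall>t\<ge>0. W t \<omega> \<in> closure D) \<and>
        local_time_path (\<lambda>t. L t \<omega>)) \<and>
     (\<forall>t\<ge>0. pair_process W L t \<in>
        borel_measurable (augmented M (gen M borel W\<^sub>0 \<union> gen_path M {0..t} \<beta>))) \<and>
     (AE \<omega> in M. \<forall>t\<ge>0. W t \<omega> = W\<^sub>0 \<omega> + \<beta> t \<omega> +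
        (LINT s:{0..t}|stieltjes (\<lambda>s. L s \<omega>). inward_normal D (W s \<omega>))) \<and>
     (AE \<omega> in M. (\<integral>\<^sup>+ s\<in>{0..}. indicator (- frontier D) (W s \<omega>) \<partial>stieltjes (\<lambda>s. L s \<omega>)) = 0)"

definition reflected_BM :: "'w measure \<Rightarrow> 'a::euclidean_space set \<Rightarrow> ('w \<Rightarrow> 'a) \<Rightarrow>
    (real \<Rightarrow> 'w \<Rightarrow> 'a) \<Rightarrow> (real \<Rightarrow> 'w \<Rightarrow> 'a) \<Rightarrow> (real \<Rightarrow> 'w \<Rightarrow> real) \<Rightarrow> bool" where
  "reflected_BM M D W\<^sub>0 \<beta> W L \<longleftrightarrow>
     standard_BM M \<beta> \<and> prob_space.indep_set M (gen M borel W\<^sub>0) (gen_path M {0..} \<beta>) \<and>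
     strong_skorokhod_solution M D W\<^sub>0 \<beta> W L"

section \<open>The equation with jumps from the boundary\<close>

text \<open>The jump sum has only finitely many terms almost surely (the Poisson atoms \<open>\<l> k\<close> tend to
  infinity), so the value \<open>0\<close> of \<^const>\<open>sum\<close> on infinite index sets matters only on a null set.
  If \<open>\<l> k \<omega> \<le> L t \<omega>\<close> then \<open>jump_time L \<l> k \<omega> \<le> t\<close> is finite.
  A strong solution at time \<open>t\<close> is, up to null sets, a function of \<open>B\<close> up to time \<open>t\<close> and of \<open>\<nu>\<close>.\<close>

definition strong_jump_solution :: "'w measure \<Rightarrow> 'a::euclidean_space set \<Rightarrow> 'a measure \<Rightarrow>
    'a \<Rightarrow> (real \<Rightarrow> 'w \<Rightarrow> 'a) \<Rightarrow> ('w \<Rightarrow> (real \<times> 'a) measure) \<Rightarrow>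
    (nat \<Rightarrow> 'w \<Rightarrow> real) \<Rightarrow> (nat \<Rightarrow> 'w \<Rightarrow> 'a) \<Rightarrow>
    (real \<Rightarrow> 'w \<Rightarrow> 'a) \<Rightarrow> (real \<Rightarrow> 'w \<Rightarrow> real) \<Rightarrow> bool" where
  "strong_jump_solution M D \<mu> x B \<nu> \<l> Z X L \<longleftrightarrow>
     (\<forall>\<omega>\<in>space M. cadlag (\<lambda>t. X t \<omega>) \<and> (\<forall>t\<ge>0. X t \<omega> \<in> closure D) \<and>
        local_time_path (\<lambda>t. L t \<omega>)) \<and>
     (\<forall>t\<ge>0. pair_process X L t \<in> borel_measurable
        (augmented M (gen_path M {0..t} B \<union> gen_random_measure M (jump_intensity \<mu>) \<nu>))) \<and>
     (AE \<omega> in M. \<forall>t\<ge>0. X t \<omega> = x + B t \<omega> +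
        (LINT s:{0..t}|stieltjes (\<lambda>s. L s \<omega>). inward_normal D (X s \<omega>)) +
        (\<Sum>k | 1 \<le> k \<and> \<l> k \<omega> \<le> L t \<omega>.
           Z k \<omega> - left_limit (\<lambda>s. X s \<omega>) (real_of_ereal (jump_time L \<l> k \<omega>)))) \<and>
     (AE \<omega> in M. (\<integral>\<^sup>+ s\<in>{0..}. indicator D (X s \<omega>) \<partial>stieltjes (\<lambda>s. L s \<omega>)) = 0)"

definition restart_position :: "'a \<Rightarrow> (nat \<Rightarrow> 'w \<Rightarrow> 'a) \<Rightarrow> nat \<Rightarrow> 'w \<Rightarrow> 'a" where
  "restart_position x Z k \<omega> = (if k = 0 then x else Z k \<omega>)"

end

theory Submission
  imports Defs
begin

text \<open>Replace the integral of the normal by the family of inequalities it satisfies. With the exterior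
  ball property of a bounded \<open>C\<^sup>2\<close> domain they give pathwise uniqueness of the deterministic
  Skorokhod problem, up to any finite time. Between two consecutive jump times the shifted process
  \<open>X (\<tau> k + t)\<close> and the reflected Brownian motion \<open>W k t\<close> solve the same problem, hence agree, and
  induction on \<open>k\<close> yields the concatenation. Every level is reached, since otherwise the equation
  would keep the Brownian path bounded.

  For the laws, a Poisson random measure restarts at deterministic levels, so the gaps and marks are
  independent of earlier atoms after rounding \<open>\<l> k\<close> up to a grid. Each \<open>\<tau> k\<close> is a stopping time of the
  filtration of \<open>B\<close> enlarged by \<open>\<nu>\<close>, whence the strong Markov property: the increment of \<open>B\<close> after \<open>\<tau> k\<close>
  is a Brownian motion independent of the past and of all atoms. The path before \<open>\<tau> k\<close> is a
  function of \<open>B\<close>, the first \<open>k\<close> levels and the marks preceding \<open>Z k\<close>, hence independent of the new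
  starting point, gap and mark.\<close>

section \<open>Exterior balls and the inward normal of a \<open>C\<^sup>2\<close> domain\<close>

text \<open>Local times need not be absolutely continuous, so uniqueness works with increments over
  short pieces of the clock instead of differentiating along the path. Positions come first: once
  the paths agree, the pushing terms agree, and only then can the local times be compared. The
  obstacle in the laws is that a strong solution \<open>X\<close> may a priori depend, before
  \<open>\<tau> k\<close>, on all of \<open>\<nu>\<close>, including \<open>Z k\<close> and later
  atoms. Adaptedness alone therefore cannot give the independence. The identification of
  \<open>X\<close> with the pieces \<open>W j\<close>, \<open>j < k\<close>, each adapted to its own
  start and driving noise, removes that dependence. The path before \<open>\<tau> k\<close> is
  placed in two sigma-algebras: the past of \<open>\<tau> k\<close>, from which later Brownian
  increments are independent, and \<open>base k\<close>, which has the whole of \<open>B\<close> but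
  only atoms preceding \<open>Z k\<close>, and from which the new atom is independent.
  Sigma-algebras are completed by null sets, because levels, marks and jump times are identified
  with counts or with sums of lifetimes only almost surely.\<close>

lemma has_derivative_imp_pos_right:
  fixes g v p :: "'a::euclidean_space"
  assumes "(\<phi> has_derivative (\<lambda>h. g \<bullet> h)) (at p)" "g \<bullet> v > 0"
  shows "eventually (\<lambda>t. \<phi> (p + t *\<^sub>R v) > \<phi> p) (at_right (0::real))"
proof -
  have 1: "((\<lambda>t::real. p + t *\<^sub>R v) has_derivative (\<lambda>t. t *\<^sub>R v)) (at 0)"
    by (auto intro!: derivative_eq_intros)
  have "((\<lambda>t::real. \<phi> (p + t *\<^sub>R v)) has_derivative (\<lambda>t. g \<bullet> (t *\<^sub>R v))) (at 0)"
    using has_derivative_compose[OF 1, of \<phi> "\<lambda>h. g \<bullet> h"] assms(1) by simp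
  then have "((\<lambda>t::real. \<phi> (p + t *\<^sub>R v)) has_real_derivative (g \<bullet> v)) (at 0)"
    by (simp add: has_field_derivative_def mult.commute[of _ "g \<bullet> v"])
  from DERIV_pos_inc_right[OF this assms(2)] obtain d
    where d: "d > 0" "\<forall>h>0. h < d \<longrightarrow> \<phi> (p + 0 *\<^sub>R v) < \<phi> (p + (0 + h) *\<^sub>R v)"
    by auto
  then show ?thesis
    unfolding eventually_at_right_field by (intro exI[of _ d]) auto
qed

lemma has_derivative_imp_nonneg_right:
  fixes g v p :: "'a::euclidean_space"
  assumes "(\<phi> has_derivative (\<lambda>h. g \<bullet> h)) (at p)"
    and "eventually (\<lambda>t. \<phi> (p + t *\<^sub>R v) > \<phi> p) (at_right (0::real))"
  shows "g \<bullet> v \<ge> 0"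
proof (rule ccontr)
  assume "\<not> ?thesis"
  moreover have "((\<lambda>x. - \<phi> x) has_derivative (\<lambda>h. (- g) \<bullet> h)) (at p)"
    using has_derivative_minus[OF assms(1)] by simp
  ultimately have "eventually (\<lambda>t. - \<phi> (p + t *\<^sub>R v) > - \<phi> p) (at_right (0::real))"
    by (intro has_derivative_imp_pos_right[where g = "- g"]) auto
  with assms(2) have "eventually (\<lambda>t. False) (at_right (0::real))"
    by eventually_elim simp
  then show False by simp
qed

lemma C2_defining_function_gradient_nonzero:
  assumes "C2_defining_function D U \<phi>" "p \<in> U" "(\<phi> has_derivative (\<lambda>h. g \<bullet> h)) (at p)"
  shows "g \<noteq> 0"
  using assms unfolding C2_defining_function_def by auto

lemma C2_defining_function_nonneg:
  assumes "C2_defining_function D U \<phi>" "y \<in> U" "y \<in> closure D"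
  shows "\<phi> y \<ge> 0"
proof (rule ccontr)
  assume "\<not> ?thesis"
  then have neg: "\<phi> y < 0" by simp
  from assms(1) obtain G where
    "open U" and G: "\<And>y. y \<in> U \<Longrightarrow> (\<phi> has_derivative (\<lambda>h. G y \<bullet> h)) (at y)"
    and D: "D \<inter> U = {y\<in>U. 0 < \<phi> y}"
    unfolding C2_defining_function_def C2_on_def by blast
  have D': "z \<in> D \<longleftrightarrow> 0 < \<phi> z" if "z \<in> U" for z using D that by blast
  have "continuous (at y) \<phi>" using G[OF assms(2)] by (rule has_derivative_continuous)
  then have "eventually (\<lambda>z. \<phi> z < 0) (at y)"
    using neg by (simp add: continuous_within order_tendstoD)
  moreover have "eventually (\<lambda>z. z \<in> U) (at y)"
    using \<open>open U\<close> assms(2) by (rule eventually_at_in_open')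
  ultimately have "eventually (\<lambda>z. z \<notin> D) (at y)"
    by eventually_elim (simp add: D')
  moreover have "y \<notin> D" using D'[OF assms(2)] neg by simp
  ultimately have "y \<notin> closure D"
    unfolding closure_def islimpt_conv_frequently_at frequently_def by auto
  with assms(3) show False by simp
qed

lemma C2_defining_function_frontier:
  assumes "C2_defining_function D U \<phi>" "p \<in> U" "p \<in> frontier D" "open D"
  shows "\<phi> p = 0"
proof -
  have "p \<in> closure D" "p \<notin> D" using assms by (auto simp: frontier_def interior_open)
  then show ?thesis
    using C2_defining_function_nonneg[OF assms(1,2)] assms(1,2)
    unfolding C2_defining_function_def by force
qed

text \<open>A ray along which \<open>\<phi>\<close> increases from \<open>p\<close> enters
  \<open>D\<close>, where \<open>\<psi>\<close> is positive as well. Only the weak inequality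
  survives for \<open>g'\<close>, since \<open>\<psi>\<close> may increase along the ray to higher
  order.\<close>

lemma C2_defining_function_gradient_direction_aux:
  assumes "C2_defining_function D U \<phi>" "p \<in> U" "(\<phi> has_derivative (\<lambda>h. g \<bullet> h)) (at p)"
    and "C2_defining_function D V \<psi>" "p \<in> V" "(\<psi> has_derivative (\<lambda>h. g' \<bullet> h)) (at p)"
    and "p \<in> frontier D" "open D" "g \<bullet> v > 0"
  shows "g' \<bullet> v \<ge> 0"
proof (rule has_derivative_imp_nonneg_right[OF assms(6)])
  have UV: "open U" "D \<inter> U = {y\<in>U. 0 < \<phi> y}" "open V" "D \<inter> V = {y\<in>V. 0 < \<psi> y}"
    using assms(1,4) unfolding C2_defining_function_def by auto
  have lim: "((\<lambda>t::real. p + t *\<^sub>R v) \<longlongrightarrow> p) (at_right 0)"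
    by (rule tendsto_eq_intros refl | simp)+
  have "eventually (\<lambda>t. p + t *\<^sub>R v \<in> U) (at_right 0)"
    using lim UV(1) assms(2) by (rule topological_tendstoD)
  moreover have "eventually (\<lambda>t. p + t *\<^sub>R v \<in> V) (at_right 0)"
    using lim UV(3) assms(5) by (rule topological_tendstoD)
  moreover have "eventually (\<lambda>t. \<phi> (p + t *\<^sub>R v) > \<phi> p) (at_right (0::real))"
    by (rule has_derivative_imp_pos_right[OF assms(3,9)])
  ultimately show "eventually (\<lambda>t. \<psi> (p + t *\<^sub>R v) > \<psi> p) (at_right (0::real))"
  proof eventually_elim
    case (elim t)
    then show ?case
      using UV C2_defining_function_frontier[OF assms(1,2,7,8)]
        C2_defining_function_frontier[OF assms(4,5,7,8)] by auto
  qed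
qed

text \<open>A nonstrict inclusion of half-spaces already excludes two different unit normals; the
  nonstrict form is what comparing two defining functions provides.\<close>

lemma sgn_eqI_halfspace:
  fixes g g' :: "'a::euclidean_space"
  assumes "g \<noteq> 0" "g' \<noteq> 0" "\<And>v. g \<bullet> v > 0 \<Longrightarrow> g' \<bullet> v \<ge> 0"
  shows "sgn g = sgn g'"
proof (rule ccontr)
  assume ne: "sgn g \<noteq> sgn g'"
  \<comment> \<open>Distinct unit vectors have inner product below 1, so this difference has a
    positive product with \<open>g\<close> and a negative one with \<open>g'\<close>.\<close>
  define v where "v = sgn g - sgn g'"
  have n: "norm (sgn g) = 1" "norm (sgn g') = 1" using assms by (auto simp: norm_sgn)
  then have sq: "sgn g \<bullet> sgn g = 1" "sgn g' \<bullet> sgn g' = 1" by (simp_all add: dot_square_norm)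
  have "v \<bullet> v > 0" using ne by (simp add: v_def)
  then have lt: "sgn g \<bullet> sgn g' < 1"
    by (simp add: v_def inner_diff_left inner_diff_right sq inner_commute)
  have g: "g = norm g *\<^sub>R sgn g" "g' = norm g' *\<^sub>R sgn g'" by (simp_all add: sgn_div_norm assms)
  have "g \<bullet> v = norm g * (1 - sgn g \<bullet> sgn g')"
    by (subst g(1), simp only: inner_scaleR_left) (simp add: v_def inner_diff_right sq)
  then have "g \<bullet> v > 0" using lt assms by simp
  moreover have "g' \<bullet> v = norm g' * (sgn g \<bullet> sgn g' - 1)"
    by (subst g(2), simp only: inner_scaleR_left) (simp add: v_def inner_diff_right sq inner_commute)
  then have "g' \<bullet> v < 0" using lt assms by (simp add: mult_less_0_iff)
  ultimately show False using assms(3)[of v] by simp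
qed

text \<open>Justifies the definite description: all local defining functions have gradients of one
  direction, so any of them may be used to compute the normal.\<close>

lemma inward_normal_eq:
  assumes "C2_domain D" "p \<in> frontier D" "p \<in> U" "C2_defining_function D U \<phi>"
    and "(\<phi> has_derivative (\<lambda>h. g \<bullet> h)) (at p)"
  shows "inward_normal D p = sgn g"
proof -
  have "open D" using assms(1) by (simp add: C2_domain_def)
  have "(THE v. \<exists>U \<phi> g. p \<in> U \<and> C2_defining_function D U \<phi> \<and>
        (\<phi> has_derivative (\<lambda>h. g \<bullet> h)) (at p) \<and> v = sgn g) = sgn g"
  proof (rule the_equality)
    show "\<exists>U \<phi> g'. p \<in> U \<and> C2_defining_function D U \<phi> \<and>
        (\<phi> has_derivative (\<lambda>h. g' \<bullet> h)) (at p) \<and> sgn g = sgn g'"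
      using assms by blast
  next
    fix v assume "\<exists>U \<phi> g. p \<in> U \<and> C2_defining_function D U \<phi> \<and>
        (\<phi> has_derivative (\<lambda>h. g \<bullet> h)) (at p) \<and> v = sgn g"
    then obtain V \<psi> h where V: "p \<in> V" "C2_defining_function D V \<psi>"
      "(\<psi> has_derivative (\<lambda>k. h \<bullet> k)) (at p)" "v = sgn h" by blast
    have "sgn h = sgn g"
      using C2_defining_function_gradient_direction_aux[OF V(2,1,3) assms(4,3,5,2) \<open>open D\<close>]
        C2_defining_function_gradient_nonzero[OF V(2,1,3)]
        C2_defining_function_gradient_nonzero[OF assms(4,3,5)]
      by (intro sgn_eqI_halfspace) auto
    with V show "v = sgn g" by simp
  qed
  then show ?thesis using assms(2) by (simp add: inward_normal_def)
qed

text \<open>One gradient field \<open>G\<close> represents the normal at all boundary points near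
  \<open>p\<close>; continuity of the normal and the quadratic estimate below both come from this
  common field.\<close>

lemma C2_domain_local:
  assumes "C2_domain D" "p \<in> frontier D"
  obtains U \<phi> G H where "p \<in> U" "C2_defining_function D U \<phi>" "open U"
    "\<And>y. y \<in> U \<Longrightarrow> (\<phi> has_derivative (\<lambda>h. G y \<bullet> h)) (at y)"
    "\<And>y. y \<in> U \<Longrightarrow> (G has_derivative blinfun_apply (H y)) (at y)"
    "continuous_on U H" "\<And>y. y \<in> U \<Longrightarrow> y \<in> frontier D \<Longrightarrow> inward_normal D y = sgn (G y)"
    "\<And>y. y \<in> U \<Longrightarrow> G y \<noteq> 0" "continuous_on U G"
proof -
  obtain U \<phi> where U: "p \<in> U" "C2_defining_function D U \<phi>"
    using assms unfolding C2_domain_def by blast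
  then obtain G and H :: "'a \<Rightarrow> 'a \<Rightarrow>\<^sub>L 'a" where GH: "open U"
    "\<And>y. y \<in> U \<Longrightarrow> (\<phi> has_derivative (\<lambda>h. G y \<bullet> h)) (at y)"
    "\<And>y. y \<in> U \<Longrightarrow> (G has_derivative blinfun_apply (H y)) (at y)" "continuous_on U H"
    unfolding C2_defining_function_def C2_on_def by blast
  have "continuous_on U G"
    using GH(3) has_derivative_continuous continuous_at_imp_continuous_on by blast
  then show thesis
    using inward_normal_eq[OF assms(1)] U GH C2_defining_function_gradient_nonzero[OF U(2)]
    by (intro that[of U \<phi> G H]) blast+
qed

lemma norm_inward_normal:
  assumes "C2_domain D" "p \<in> frontier D"
  shows "norm (inward_normal D p) = 1"
proof -
  obtain U \<phi> G and H :: "'a \<Rightarrow> 'a \<Rightarrow>\<^sub>L 'a" where "p \<in> U"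
    "\<And>y. y \<in> U \<Longrightarrow> y \<in> frontier D \<Longrightarrow> inward_normal D y = sgn (G y)" "\<And>y. y \<in> U \<Longrightarrow> G y \<noteq> 0"
    using C2_domain_local[OF assms] by metis
  then show ?thesis using assms by (simp add: norm_sgn)
qed

lemma continuous_on_inward_normal:
  assumes "C2_domain D"
  shows "continuous_on (frontier D) (inward_normal D)"
  unfolding continuous_on_eq_continuous_within
proof
  fix p assume p: "p \<in> frontier D"
  obtain U \<phi> G and H :: "'a \<Rightarrow> 'a \<Rightarrow>\<^sub>L 'a" where *: "p \<in> U" "open U" "continuous_on U G"
    "\<And>y. y \<in> U \<Longrightarrow> y \<in> frontier D \<Longrightarrow> inward_normal D y = sgn (G y)" "\<And>y. y \<in> U \<Longrightarrow> G y \<noteq> 0"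
    using C2_domain_local[OF assms p] by metis
  have "continuous (at p) G" using * by (simp add: continuous_on_eq_continuous_at)
  then have "((\<lambda>y. sgn (G y)) \<longlongrightarrow> sgn (G p)) (at p)"
    using *(1,5) by (intro tendsto_sgn) (auto simp: continuous_within)
  then have "((\<lambda>y. sgn (G y)) \<longlongrightarrow> sgn (G p)) (at p within frontier D)"
    by (rule tendsto_within_subset) simp
  moreover have "eventually (\<lambda>y. y \<in> U) (at p within frontier D)"
    using *(1,2) by (meson UNIV_I eventually_at_topological)
  then have "eventually (\<lambda>y. sgn (G y) = inward_normal D y) (at p within frontier D)"
    unfolding eventually_at_filter by eventually_elim (use * in auto)
  ultimately have "(inward_normal D \<longlongrightarrow> sgn (G p)) (at p within frontier D)"
    by (rule Lim_transform_eventually)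
  then show "continuous (at p within frontier D) (inward_normal D)"
    using *(1,4) p by (simp add: continuous_within)
qed

lemma borel_measurable_inward_normal:
  assumes "C2_domain D"
  shows "inward_normal D \<in> borel_measurable borel"
proof -
  have "(\<lambda>p. if p \<in> frontier D then inward_normal D p else 0) \<in> borel_measurable borel"
    by (intro borel_measurable_continuous_on_if continuous_on_inward_normal assms
        borel_closed frontier_closed continuous_on_const)
  moreover have "(\<lambda>p. if p \<in> frontier D then inward_normal D p else 0) = inward_normal D"
    by (auto simp: inward_normal_def)
  ultimately show ?thesis by simp
qed

text \<open>\<open>\<phi>\<close> is 0 at \<open>p\<close> and nonnegative at \<open>y\<close>, so
  the gradient at some point between them has a nonnegative product with \<open>y - p\<close>.
  Replacing that gradient by the one at \<open>p\<close> costs a Lipschitz error, quadratic in the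
  distance. For positive \<open>C\<close> the inequality says that a ball of radius
  \<open>1 / (2 * C)\<close> touches \<open>D\<close> from outside at \<open>p\<close>.\<close>

lemma exterior_ball_local:
  fixes D :: "'a::euclidean_space set"
  assumes "C2_domain D" "p0 \<in> frontier D"
  shows "\<exists>r>0. \<exists>C\<ge>0. \<forall>p\<in>frontier D \<inter> ball p0 r. \<forall>y\<in>closure D.
     inward_normal D p \<bullet> (p - y) \<le> C * (norm (p - y))\<^sup>2"
proof -
  have "open D" using assms(1) by (simp add: C2_domain_def)
  obtain U \<phi> G and H :: "'a \<Rightarrow> 'a \<Rightarrow>\<^sub>L 'a" where U: "p0 \<in> U" "C2_defining_function D U \<phi>" "open U"
    "\<And>y. y \<in> U \<Longrightarrow> (\<phi> has_derivative (\<lambda>h. G y \<bullet> h)) (at y)"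
    "\<And>y. y \<in> U \<Longrightarrow> (G has_derivative blinfun_apply (H y)) (at y)"
    "continuous_on U H" "\<And>y. y \<in> U \<Longrightarrow> y \<in> frontier D \<Longrightarrow> inward_normal D y = sgn (G y)"
    "\<And>y. y \<in> U \<Longrightarrow> G y \<noteq> 0" "continuous_on U G"
    using C2_domain_local[OF assms] by metis
  obtain e where e: "e > 0" "cball p0 e \<subseteq> U"
    using U(1,3) open_contains_cball by blast
  have "bounded (H ` cball p0 e)"
    by (intro compact_imp_bounded compact_continuous_image continuous_on_subset[OF U(6) e(2)]) auto
  then obtain K where K: "\<And>y. y \<in> cball p0 e \<Longrightarrow> norm (H y) \<le> K" "K > 0"
    unfolding bounded_pos by (metis imageI)
  obtain c where c: "c > 0" "\<And>y. y \<in> cball p0 e \<Longrightarrow> c \<le> norm (G y)"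
  proof -
    have "continuous_on (cball p0 e) (\<lambda>y. norm (G y))"
      using U(9) e(2) by (intro continuous_intros) (rule continuous_on_subset)
    then obtain y0 where "y0 \<in> cball p0 e" "\<forall>y\<in>cball p0 e. norm (G y0) \<le> norm (G y)"
      using continuous_attains_inf[of "cball p0 e" "\<lambda>y. norm (G y)"] e(1) by auto
    then show thesis using U(8) e(2) by (intro that[of "norm (G y0)"]) auto
  qed
  \<comment> \<open>\<open>K / c\<close> serves points \<open>y\<close> in
    \<open>cball p0 e\<close>, where the segment argument applies (\<open>K\<close> bounds the
    second derivative, \<open>c\<close> the gradient from below); \<open>2 / e\<close> makes the
    claim trivial elsewhere, where \<open>y\<close> is at distance at least \<open>e / 2\<close>
    from \<open>p\<close>.\<close>
  define C where "C = max (K / c) (2 / e)"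
  have "inward_normal D p \<bullet> (p - y) \<le> C * (norm (p - y))\<^sup>2"
    if p: "p \<in> frontier D" "p \<in> ball p0 (e/2)" and y: "y \<in> closure D" for p y
  proof (cases "y \<in> cball p0 e")
    case True
    have pe: "p \<in> cball p0 e" using p e by auto
    have seg: "closed_segment p y \<subseteq> cball p0 e"
      using pe True by (intro closed_segment_subset) auto
    have "\<exists>t\<in>{0<..<1}. \<phi> y - \<phi> p = G (p + t *\<^sub>R (y - p)) \<bullet> (y - p)"
    proof -
      have inseg: "p + t *\<^sub>R (y - p) \<in> cball p0 e" if "0 \<le> t" "t \<le> 1" for t :: real
      proof -
        have "p + t *\<^sub>R (y - p) \<in> closed_segment p y"
          using that unfolding closed_segment_def
          by (auto intro!: exI[of _ t] simp: algebra_simps)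
        with seg show ?thesis by blast
      qed
      have der: "((\<lambda>t::real. \<phi> (p + t *\<^sub>R (y - p))) has_derivative
          (\<lambda>s. G (p + t *\<^sub>R (y - p)) \<bullet> (s *\<^sub>R (y - p)))) (at t)" if "0 \<le> t" "t \<le> 1" for t
      proof -
        have 1: "((\<lambda>t::real. p + t *\<^sub>R (y - p)) has_derivative (\<lambda>s. s *\<^sub>R (y - p))) (at t)"
          by (auto intro!: derivative_eq_intros)
        have "p + t *\<^sub>R (y - p) \<in> U" using inseg[OF that] e(2) by blast
        from has_derivative_compose[OF 1 U(4)[OF this]] show ?thesis .
      qed
      have "\<exists>t\<in>{0<..<1}. (\<lambda>t. \<phi> (p + t *\<^sub>R (y - p))) 1 - (\<lambda>t. \<phi> (p + t *\<^sub>R (y - p))) 0 =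
          (\<lambda>t s. G (p + t *\<^sub>R (y - p)) \<bullet> (s *\<^sub>R (y - p))) t (1 - 0)"
        using has_derivative_at_withinI[OF der] by (intro mvt_simple) simp
      then show ?thesis by simp
    qed
    then obtain t where t: "t \<in> {0<..<1}" "\<phi> y - \<phi> p = G (p + t *\<^sub>R (y - p)) \<bullet> (y - p)" by blast
    define q where "q = p + t *\<^sub>R (y - p)"
    have "q \<in> closed_segment p y" using t(1) unfolding q_def closed_segment_def
      by (auto intro!: exI[of _ t] simp: algebra_simps)
    with seg have q: "q \<in> cball p0 e" by blast
    have d: "(G has_derivative blinfun_apply (H z)) (at z within cball p0 e)" if z: "z \<in> cball p0 e" for z
      using U(5)[OF subsetD[OF e(2) z]] by (rule has_derivative_at_withinI)
    have o: "onorm (blinfun_apply (H z)) \<le> K" if z: "z \<in> cball p0 e" for z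
      using K(1)[OF z] by (simp only: norm_blinfun.rep_eq)
    have "norm (G q - G p) \<le> K * norm (q - p)"
      by (rule differentiable_bound[OF convex_cball d o q pe])
    also have "norm (q - p) \<le> norm (y - p)"
      using t(1) by (auto simp: q_def mult_left_le_one_le)
    finally have GL: "norm (G q - G p) \<le> K * norm (y - p)" using K(2) by simp
    have "\<phi> p = 0" using C2_defining_function_frontier[OF U(2)] pe p e(2) \<open>open D\<close> by auto
    moreover have "\<phi> y \<ge> 0" using C2_defining_function_nonneg[OF U(2)] True y e(2) by auto
    ultimately have "0 \<le> G q \<bullet> (y - p)" using t(2) by (simp add: q_def)
    then have "G p \<bullet> (p - y) \<le> (G q - G p) \<bullet> (y - p)" by (simp add: algebra_simps inner_diff_left inner_diff_right)
    also have "\<dots> \<le> norm (G q - G p) * norm (y - p)" by (rule norm_cauchy_schwarz)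
    also have "\<dots> \<le> K * norm (y - p) * norm (y - p)" using GL by (rule mult_right_mono) simp
    finally have main: "G p \<bullet> (p - y) \<le> K * (norm (p - y))\<^sup>2"
      by (simp add: power2_eq_square norm_minus_commute mult.assoc)
    have "inward_normal D p = sgn (G p)" using U(7) p pe e(2) by auto
    then have "inward_normal D p \<bullet> (p - y) = (G p \<bullet> (p - y)) / norm (G p)"
      by (simp add: sgn_div_norm divide_inverse)
    also have "\<dots> \<le> (K * (norm (p - y))\<^sup>2) / norm (G p)"
      using main by (rule divide_right_mono) simp
    also have "\<dots> \<le> (K * (norm (p - y))\<^sup>2) / c"
      using c(1) c(2)[OF pe] K(2) by (intro divide_left_mono mult_nonneg_nonneg mult_pos_pos) (auto intro: less_le_trans)
    also have "\<dots> = K / c * (norm (p - y))\<^sup>2" by simp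
    also have "\<dots> \<le> C * (norm (p - y))\<^sup>2" by (rule mult_right_mono) (auto simp: C_def)
    finally show ?thesis .
  next
    case False
    then have far: "norm (p - y) \<ge> e / 2"
      using p dist_triangle[of p0 y p] by (auto simp: dist_norm[symmetric])
    have "inward_normal D p \<bullet> (p - y) \<le> norm (inward_normal D p) * norm (p - y)"
      by (rule norm_cauchy_schwarz)
    also have "\<dots> = norm (p - y) * 1" using norm_inward_normal[OF assms(1) p(1)] by simp
    also have "\<dots> \<le> norm (p - y) * (2 / e * norm (p - y))"
      using far e(1) by (intro mult_left_mono) (auto simp: field_simps)
    also have "\<dots> = 2 / e * (norm (p - y))\<^sup>2" by (simp add: power2_eq_square)
    also have "\<dots> \<le> C * (norm (p - y))\<^sup>2" by (rule mult_right_mono) (auto simp: C_def)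
    finally show ?thesis .
  qed
  moreover have "C \<ge> 0" using e(1) by (auto simp: C_def le_max_iff_disj)
  ultimately show ?thesis using e(1) by (intro exI[of _ "e/2"] conjI exI[of _ C]) auto
qed

text \<open>The frontier of a bounded domain is compact, so finitely many local constants suffice;
  being nonnegative, their sum dominates each of them.\<close>

lemma exterior_ball:
  fixes D :: "'a::euclidean_space set"
  assumes "C2_domain D" "bounded D"
  obtains C where "C \<ge> 0" "\<And>p y. p \<in> frontier D \<Longrightarrow> y \<in> closure D \<Longrightarrow>
     inward_normal D p \<bullet> (p - y) \<le> C * (norm (p - y))\<^sup>2"
proof -
  have "\<forall>p0\<in>frontier D. \<exists>r C. r > 0 \<and> C \<ge> 0 \<and> (\<forall>p\<in>frontier D \<inter> ball p0 r. \<forall>y\<in>closure D.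
     inward_normal D p \<bullet> (p - y) \<le> C * (norm (p - y))\<^sup>2)"
    using exterior_ball_local[OF assms(1)] by meson
  from bchoice[OF this] obtain r where "\<forall>p0\<in>frontier D. \<exists>C. r p0 > 0 \<and> C \<ge> 0 \<and>
     (\<forall>p\<in>frontier D \<inter> ball p0 (r p0). \<forall>y\<in>closure D.
       inward_normal D p \<bullet> (p - y) \<le> C * (norm (p - y))\<^sup>2)" ..
  from bchoice[OF this] obtain C where rC: "\<And>p0. p0 \<in> frontier D \<Longrightarrow> r p0 > 0 \<and> C p0 \<ge> 0 \<and>
     (\<forall>p\<in>frontier D \<inter> ball p0 (r p0). \<forall>y\<in>closure D.
       inward_normal D p \<bullet> (p - y) \<le> C p0 * (norm (p - y))\<^sup>2)"
    by blast
  have "compact (frontier D)" using assms(2) by (rule compact_frontier_bounded)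
  then obtain P where P: "P \<subseteq> frontier D" "finite P" "frontier D \<subseteq> (\<Union>p\<in>P. ball p (r p))"
  proof (rule compactE_image[of _ "frontier D" "\<lambda>p. ball p (r p)"])
    show "frontier D \<subseteq> (\<Union>p\<in>frontier D. ball p (r p))"
      using rC[THEN conjunct1] by (meson UN_I centre_in_ball subsetI)
  qed auto
  define K where "K = (\<Sum>p\<in>P. C p)"
  have "K \<ge> 0" unfolding K_def using rC P(1) by (intro sum_nonneg) auto
  moreover have "inward_normal D p \<bullet> (p - y) \<le> K * (norm (p - y))\<^sup>2"
    if py: "p \<in> frontier D" "y \<in> closure D" for p y
  proof -
    obtain p0 where p0: "p0 \<in> P" "p \<in> ball p0 (r p0)" using py P(3) by blast
    then have "inward_normal D p \<bullet> (p - y) \<le> C p0 * (norm (p - y))\<^sup>2"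
      using rC[of p0] P(1) py by blast
    also have "C p0 \<le> K" unfolding K_def using rC P p0(1) by (intro member_le_sum) auto
    finally show ?thesis by (simp add: mult_right_mono)
  qed
  ultimately show thesis by (rule that)
qed

section \<open>Uniqueness of reflected paths\<close>

text \<open>Replaces integration of the normal against the local time: \<open>k\<close> plays the role of
  \<open>\<integral> n(y) dl\<close>, and every estimate needed for uniqueness is an instance of this inequality.\<close>

definition reflecting :: "'a::euclidean_space set \<Rightarrow> real \<Rightarrow> (real \<Rightarrow> 'a) \<Rightarrow> (real \<Rightarrow> 'a) \<Rightarrow>
    (real \<Rightarrow> real) \<Rightarrow> bool" where
  "reflecting D T y k l \<longleftrightarrow> (\<forall>s t v c. 0 \<le> s \<and> s \<le> t \<and> t \<le> T \<and>
     (\<forall>r\<in>{s..t}. y r \<in> frontier D \<longrightarrow> inward_normal D (y r) \<bullet> v \<le> c) \<longrightarrow>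
     (k t - k s) \<bullet> v \<le> c * (l t - l s))"

lemma reflectingD:
  assumes "reflecting D T y k l" "0 \<le> s" "s \<le> t" "t \<le> T"
    and "\<And>r. s \<le> r \<Longrightarrow> r \<le> t \<Longrightarrow> y r \<in> frontier D \<Longrightarrow> inward_normal D (y r) \<bullet> v \<le> c"
  shows "(k t - k s) \<bullet> v \<le> c * (l t - l s)"
  using assms unfolding reflecting_def by auto

text \<open>The inequality is tested with the direction of the increment itself, and
  \<open>c = 1\<close> is admissible because normals are unit vectors.\<close>

lemma reflecting_norm_le:
  assumes "C2_domain D" "reflecting D T y k l" "0 \<le> s" "s \<le> t" "t \<le> T"
  shows "norm (k t - k s) \<le> l t - l s"
proof -
  have "(k t - k s) \<bullet> sgn (k t - k s) \<le> 1 * (l t - l s)"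
  proof (rule reflectingD[OF assms(2-5)])
    fix r assume "y r \<in> frontier D"
    then have "inward_normal D (y r) \<bullet> sgn (k t - k s) \<le> 1 * norm (sgn (k t - k s))"
      using norm_cauchy_schwarz[of "inward_normal D (y r)" "sgn (k t - k s)"]
        norm_inward_normal[OF assms(1)] by simp
    also have "\<dots> \<le> 1" by (simp add: norm_sgn)
    finally show "inward_normal D (y r) \<bullet> sgn (k t - k s) \<le> 1" .
  qed
  moreover have "(k t - k s) \<bullet> sgn (k t - k s) = norm (k t - k s)"
    by (simp add: sgn_div_norm dot_square_norm power2_eq_square divide_simps)
  ultimately show ?thesis by simp
qed

text \<open>With \<open>v = 0\<close> and \<open>c = -1\<close> the premise on boundary points is
  vacuous, and the inequality turns into an upper bound on the growth of \<open>l\<close>.\<close>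

lemma reflecting_local_time_constant:
  assumes "reflecting D T y k l" "0 \<le> s" "s \<le> t" "t \<le> T"
    and "\<And>r. s \<le> r \<Longrightarrow> r \<le> t \<Longrightarrow> y r \<notin> frontier D"
  shows "l t \<le> l s"
  using reflectingD[OF assms(1-4), of 0 "-1"] assms(5) by simp

text \<open>In the clock \<open>A = l1 + l2\<close> the squared distance of two solutions satisfies a discrete Gronwall
  inequality with a quadratic error, which vanishes as the mesh of the clock goes to zero.\<close>

lemma reflecting_unique_path:
  fixes y1 y2 :: "real \<Rightarrow> 'a::euclidean_space"
  assumes D: "C2_domain D" "bounded D" and T: "0 \<le> T"
    and r1: "reflecting D T y1 k1 l1" and r2: "reflecting D T y2 k2 l2"
    and m: "mono_on {0..T} l1" "mono_on {0..T} l2"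
    and c: "continuous_on {0..T} l1" "continuous_on {0..T} l2"
    and cl: "\<And>t. 0 \<le> t \<Longrightarrow> t \<le> T \<Longrightarrow> y1 t \<in> closure D" "\<And>t. 0 \<le> t \<Longrightarrow> t \<le> T \<Longrightarrow> y2 t \<in> closure D"
    and diff: "\<And>t. 0 \<le> t \<Longrightarrow> t \<le> T \<Longrightarrow> y1 t - y2 t = (k1 t - k1 0) - (k2 t - k2 0)"
  shows "y1 T = y2 T"
proof -
  obtain C where C: "C \<ge> 0" "\<And>p y. p \<in> frontier D \<Longrightarrow> y \<in> closure D \<Longrightarrow>
     inward_normal D p \<bullet> (p - y) \<le> C * (norm (p - y))\<^sup>2"
    using exterior_ball[OF D] by metis
  define A where "A t = l1 t + l2 t" for t
  define F where "F t = y1 t - y2 t" for t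
  \<comment> \<open>Collects the quadratic errors of one step, \<open>4 * C * h + 2\<close> with
    \<open>h \<le> 1\<close>.\<close>
  define K where "K = 4 * C + 2"
  have K: "K \<ge> 0" using C by (simp add: K_def)
  have Am: "A s \<le> A t" if "0 \<le> s" "s \<le> t" "t \<le> T" for s t
    using mono_onD[OF m(1), of s t] mono_onD[OF m(2), of s t] that by (auto simp: A_def)
  have F0: "F 0 = 0" using diff[of 0] T by (simp add: F_def)
  have Finc: "F t - F s = (k1 t - k1 s) - (k2 t - k2 s)" if "0 \<le> s" "s \<le> t" "t \<le> T" for s t
    using diff[of s] diff[of t] that by (simp add: F_def)
  \<comment> \<open>\<open>F\<close> is a difference of pushing terms only, so it moves no faster
    than the clock.\<close>
  have Flip: "norm (F t - F s) \<le> A t - A s" if "0 \<le> s" "s \<le> t" "t \<le> T" for s t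
  proof -
    have "norm (F t - F s) \<le> norm (k1 t - k1 s) + norm (k2 t - k2 s)"
      unfolding Finc[OF that] by (rule norm_triangle_ineq4)
    also have "\<dots> \<le> (l1 t - l1 s) + (l2 t - l2 s)"
      using reflecting_norm_le[OF D(1) r1 that] reflecting_norm_le[OF D(1) r2 that] by (rule add_mono)
    finally show ?thesis by (simp add: A_def)
  qed
  have step: "(norm (F t))\<^sup>2 \<le> (norm (F s))\<^sup>2 + 4 * C * (norm (F s))\<^sup>2 * h + K * h\<^sup>2"
    if st: "0 \<le> s" "s \<le> t" "t \<le> T" and h: "A t - A s \<le> h" "h \<le> 1" for s t h
  proof -
    have h0: "0 \<le> h" using Am[OF st] h by simp
    \<comment> \<open>The difference of the squared norms of \<open>F t\<close> and
      \<open>F s\<close> is exactly the product of \<open>F t - F s\<close> with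
      \<open>F t + F s\<close>; this identity stands in for the differential of the square.\<close>
    define w where "w = F t + F s"
    \<comment> \<open>Bounds the normal component of \<open>w\<close>: up to \<open>2 * h\<close>,
      \<open>w\<close> is twice \<open>F r\<close>, and the squared norm of \<open>F r\<close> is at
      most twice that of \<open>F s\<close> plus twice the square of \<open>h\<close>.\<close>
    define c where "c = 4 * C * (norm (F s))\<^sup>2 + 4 * C * h\<^sup>2 + 2 * h"
    \<comment> \<open>The sign \<open>\<sigma>\<close> treats both solutions at once: the exterior
      ball estimate concerns \<open>p - y\<close>, which is \<open>F r\<close> when \<open>p\<close>
      lies on \<open>y1\<close> and \<open>- F r\<close> when it lies on \<open>y2\<close>.\<close>
    have bnd: "\<sigma> * (inward_normal D p \<bullet> w) \<le> c"
      if p: "p \<in> frontier D" and r: "s \<le> r" "r \<le> t" and \<sigma>: "\<sigma> = 1 \<or> \<sigma> = -1"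
        and in1: "\<sigma> * (inward_normal D p \<bullet> F r) \<le> C * (norm (F r))\<^sup>2" for p r and \<sigma> :: real
    proof -
      let ?n = "inward_normal D p"
      have 1: "norm (F t - F r) + norm (F s - F r) \<le> 2 * h"
        using Flip[of r t] Flip[of s r] Am[of s r] Am[of r t] st r h
        by (auto simp: norm_minus_commute)
      have 2: "\<sigma> * (?n \<bullet> w) = 2 * (\<sigma> * (?n \<bullet> F r)) + \<sigma> * (?n \<bullet> ((F t - F r) + (F s - F r)))"
        unfolding w_def by (simp add: inner_add_right inner_diff_right algebra_simps)
      have "\<sigma> * (?n \<bullet> ((F t - F r) + (F s - F r))) \<le> \<bar>?n \<bullet> ((F t - F r) + (F s - F r))\<bar>"
        using \<sigma> by auto
      also have "\<dots> \<le> norm ?n * norm ((F t - F r) + (F s - F r))" by (rule Cauchy_Schwarz_ineq2)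
      also have "\<dots> \<le> 2 * h"
        using 1 norm_triangle_ineq[of "F t - F r" "F s - F r"] norm_inward_normal[OF D(1) p] by simp
      finally have 3: "\<sigma> * (?n \<bullet> ((F t - F r) + (F s - F r))) \<le> 2 * h" .
      have "norm (F r) \<le> norm (F s) + h"
        using norm_triangle_ineq[of "F s" "F r - F s"] Flip[of s r] Am[of r t] st r h by simp
      then have "(norm (F r))\<^sup>2 \<le> (norm (F s) + h)\<^sup>2" by (rule power_mono) simp
      also have "\<dots> \<le> 2 * (norm (F s))\<^sup>2 + 2 * h\<^sup>2"
        using sum_squares_bound[of "norm (F s)" h] by (simp add: power2_sum)
      finally have "C * (norm (F r))\<^sup>2 \<le> C * (2 * (norm (F s))\<^sup>2 + 2 * h\<^sup>2)"
        using C(1) by (rule mult_left_mono)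
      with 2 3 in1 show ?thesis unfolding c_def by (simp add: algebra_simps)
    qed
    have b1: "(k1 t - k1 s) \<bullet> w \<le> c * (l1 t - l1 s)"
    proof (rule reflectingD[OF r1 st])
      fix r assume r: "s \<le> r" "r \<le> t" "y1 r \<in> frontier D"
      show "inward_normal D (y1 r) \<bullet> w \<le> c"
        using bnd[OF r(3,1,2), of 1] C(2)[OF r(3) cl(2)[of r]] r st by (simp add: F_def)
    qed
    have b2: "(k2 t - k2 s) \<bullet> (- w) \<le> c * (l2 t - l2 s)"
    proof (rule reflectingD[OF r2 st])
      fix r assume r: "s \<le> r" "r \<le> t" "y2 r \<in> frontier D"
      have "- (inward_normal D (y2 r) \<bullet> F r) = inward_normal D (y2 r) \<bullet> (y2 r - y1 r)"
        by (simp add: F_def inner_diff_right)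
      moreover have "norm (F r) = norm (y2 r - y1 r)" by (simp add: F_def norm_minus_commute)
      ultimately show "inward_normal D (y2 r) \<bullet> (- w) \<le> c"
        using bnd[OF r(3,1,2), of "-1"] C(2)[OF r(3) cl(1)[of r]] r st by simp
    qed
    have "(norm (F t))\<^sup>2 - (norm (F s))\<^sup>2 = (F t - F s) \<bullet> w"
      by (simp add: w_def power2_norm_eq_inner inner_add_right inner_diff_left inner_diff_right inner_commute)
    also have "\<dots> = (k1 t - k1 s) \<bullet> w + (k2 t - k2 s) \<bullet> (- w)"
      unfolding Finc[OF st] by (simp add: inner_diff_left)
    also have "\<dots> \<le> c * (A t - A s)" using b1 b2 by (simp add: A_def algebra_simps)
    also have "\<dots> \<le> c * h"
      using h C(1) h0 by (intro mult_left_mono) (auto simp: c_def)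
    also have "\<dots> = 4 * C * (norm (F s))\<^sup>2 * h + (4 * C * h + 2) * h\<^sup>2"
      by (simp add: c_def algebra_simps power2_eq_square)
    also have "(4 * C * h + 2) * h\<^sup>2 \<le> K * h\<^sup>2"
      unfolding K_def using h C(1) h0 by (intro mult_right_mono) (auto intro: mult_left_le)
    finally show ?thesis by simp
  qed
  \<comment> \<open>The induction counts clock steps of length \<open>h\<close>, not time steps, so
    the bound involves only the total local time.\<close>
  have ind: "(norm (F t))\<^sup>2 \<le> real i * K * h\<^sup>2 * exp (4 * C * h * real i)"
    if "0 \<le> t" "t \<le> T" "A t - A 0 \<le> real i * h" and h: "0 < h" "h \<le> 1" for t i h
    using that(1-3)
  proof (induction i arbitrary: t)
    case 0
    then have "A t - A 0 = 0" using Am[of 0 t] by simp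
    then have "norm (F t) \<le> 0" using Flip[of 0 t] F0 0 by simp
    then show ?case by simp
  next
    case (Suc i)
    let ?b = "\<lambda>i. real i * K * h\<^sup>2 * exp (4 * C * h * real i)"
    show ?case
    proof (cases "A t - A 0 \<le> real i * h")
      case True
      then have "(norm (F t))\<^sup>2 \<le> ?b i" using Suc by simp
      also have "\<dots> \<le> ?b (Suc i)"
      proof (intro mult_mono)
        show "exp (4 * C * h * real i) \<le> exp (4 * C * h * real (Suc i))"
          unfolding exp_le_cancel_iff using h C(1) by (intro mult_left_mono) simp_all
      qed (use h C(1) K in simp_all)
      finally show ?thesis .
    next
      case False
      have "continuous_on {0..t} A"
        unfolding A_def using Suc.prems c
        by (intro continuous_intros) (auto elim: continuous_on_subset)
      \<comment> \<open>Continuity of the clock provides a time at which exactly \<open>i\<close>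
        steps are used up.\<close>
      then have "\<exists>s\<ge>0. s \<le> t \<and> A s = A 0 + real i * h"
        using False h(1) Suc.prems by (intro IVT') auto
      then obtain s where s: "0 \<le> s" "s \<le> t" "A s = A 0 + real i * h" by auto
      have IH: "(norm (F s))\<^sup>2 \<le> ?b i" using Suc.IH[of s] s Suc.prems by simp
      have "(norm (F t))\<^sup>2 \<le> (norm (F s))\<^sup>2 + 4 * C * (norm (F s))\<^sup>2 * h + K * h\<^sup>2"
        using s Suc.prems h by (intro step) (auto simp: algebra_simps)
      also have "\<dots> = (norm (F s))\<^sup>2 * (1 + 4 * C * h) + K * h\<^sup>2" by (simp add: algebra_simps)
      also have "\<dots> \<le> (norm (F s))\<^sup>2 * exp (4 * C * h) + K * h\<^sup>2"
        by (intro add_mono mult_left_mono[OF exp_ge_add_one_self]) auto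
      also have "\<dots> \<le> ?b i * exp (4 * C * h) + K * h\<^sup>2 * exp (4 * C * h * real (Suc i))"
      proof (intro add_mono mult_right_mono IH)
        have "0 \<le> 4 * C * h * real (Suc i)" using h C(1) by simp
        then have "1 \<le> exp (4 * C * h * real (Suc i))" by (simp only: one_le_exp_iff)
        then show "K * h\<^sup>2 \<le> K * h\<^sup>2 * exp (4 * C * h * real (Suc i))"
          using K mult_left_mono[of 1 "exp (4 * C * h * real (Suc i))" "K * h\<^sup>2"] by (simp only: mult_1_right mult_nonneg_nonneg zero_le_power2)
      qed simp
      also have "\<dots> = ?b (Suc i)"
        by (simp add: algebra_simps exp_add)
      finally show ?thesis .
    qed
  qed
  define a where "a = A T - A 0"
  have a: "a \<ge> 0" using Am[of 0 T] T by (simp add: a_def)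
  \<comment> \<open>About \<open>a / h\<close> steps, each with an error of order \<open>h\<close>
    squared, leave a total of order \<open>h\<close>.\<close>
  have bound: "(norm (F T))\<^sup>2 \<le> (a + 1) * K * exp (4 * C * (a + 1)) * h" if h: "0 < h" "h \<le> 1" for h
  proof -
    define i where "i = nat \<lceil>a / h\<rceil>"
    have "0 \<le> a / h" using a h by simp
    then have i: "a / h \<le> real i" "real i \<le> a / h + 1" unfolding i_def by linarith+
    then have i1: "a \<le> real i * h" and i2: "h * real i \<le> a + 1"
      using h by (auto simp: field_simps)
    have "(norm (F T))\<^sup>2 \<le> real i * K * h\<^sup>2 * exp (4 * C * h * real i)"
      using ind[of T i h] T h i1 by (simp add: a_def)
    also have "\<dots> = (h * real i) * K * exp (4 * C * (h * real i)) * h"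
      by (simp add: power2_eq_square algebra_simps)
    also have "\<dots> \<le> (a + 1) * K * exp (4 * C * (a + 1)) * h"
    proof (intro mult_mono)
      show "exp (4 * C * (h * real i)) \<le> exp (4 * C * (a + 1))"
        unfolding exp_le_cancel_iff using i2 C(1) by (intro mult_left_mono) simp_all
    qed (use i2 h K C(1) a in simp_all)
    finally show ?thesis .
  qed
  have "((\<lambda>h::real. (a + 1) * K * exp (4 * C * (a + 1)) * h) \<longlongrightarrow> (a + 1) * K * exp (4 * C * (a + 1)) * 0) (at_right 0)"
    by (intro tendsto_intros)
  moreover have "eventually (\<lambda>h. (norm (F T))\<^sup>2 \<le> (a + 1) * K * exp (4 * C * (a + 1)) * h) (at_right (0::real))"
    unfolding eventually_at_right_field using bound by (intro exI[of _ 1]) auto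
  ultimately have "(norm (F T))\<^sup>2 \<le> 0"
    using tendsto_lowerbound by fastforce
  then show ?thesis by (simp add: F_def)
qed

text \<open>On a short time interval the normal along the common path is nearly a constant unit
  vector, by continuity of \<open>y\<close>. The pushing term projected on it equals the local time
  up to a factor between \<open>1 - e\<close> and 1. Equal pushing terms therefore force equal local
  times up to \<open>e\<close> times the clock; on intervals away from the frontier neither local
  time grows.\<close>

lemma reflecting_unique_local_time:
  fixes y :: "real \<Rightarrow> 'a::euclidean_space"
  assumes D: "C2_domain D" "bounded D" and T: "0 \<le> T"
    and r1: "reflecting D T y k1 l1" and r2: "reflecting D T y k2 l2"
    and m: "mono_on {0..T} l1" "mono_on {0..T} l2"
    and cy: "continuous_on {0..T} y"
    and diff: "\<And>t. 0 \<le> t \<Longrightarrow> t \<le> T \<Longrightarrow> k1 t - k1 0 = k2 t - k2 0"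
  shows "l1 T - l1 0 = l2 T - l2 0"
proof -
  define A where "A t = l1 t + l2 t" for t
  have Am: "l1 s \<le> l1 t" "l2 s \<le> l2 t" if "0 \<le> s" "s \<le> t" "t \<le> T" for s t
    using mono_onD[OF m(1), of s t] mono_onD[OF m(2), of s t] that by auto
  have bound: "\<bar>(l1 T - l1 0) - (l2 T - l2 0)\<bar> \<le> e * (A T - A 0)" if e: "0 < e" for e
  proof -
    have "uniformly_continuous_on (frontier D) (inward_normal D)"
      by (intro compact_uniformly_continuous continuous_on_inward_normal D compact_frontier_bounded)
    then obtain d1 where d1: "d1 > 0" "\<And>p q. p \<in> frontier D \<Longrightarrow> q \<in> frontier D \<Longrightarrow> dist q p < d1 \<Longrightarrow>
        dist (inward_normal D q) (inward_normal D p) < e"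
      using e unfolding uniformly_continuous_on_def by metis
    have "uniformly_continuous_on {0..T} y" using cy by (intro compact_uniformly_continuous) auto
    then obtain d where d: "d > 0" "\<And>s t. s \<in> {0..T} \<Longrightarrow> t \<in> {0..T} \<Longrightarrow> dist t s < d \<Longrightarrow> dist (y t) (y s) < d1"
      using d1(1) unfolding uniformly_continuous_on_def by metis
    have loc: "\<bar>(l1 t - l1 s) - (l2 t - l2 s)\<bar> \<le> e * (A t - A s)"
      if st: "0 \<le> s" "s \<le> t" "t \<le> T" "t - s < d" for s t
    proof (cases "\<exists>r\<in>{s..t}. y r \<in> frontier D")
      case True
      then obtain r0 where r0: "s \<le> r0" "r0 \<le> t" "y r0 \<in> frontier D" by auto
      let ?n = "inward_normal D (y r0)"
      have close: "1 - e \<le> inward_normal D (y r) \<bullet> ?n" if r: "s \<le> r" "r \<le> t" "y r \<in> frontier D" for r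
      proof -
        have "norm (inward_normal D (y r) - ?n) \<le> e"
          using d1(2)[of "y r0" "y r"] d(2)[of r0 r] r r0 st by (auto simp: dist_norm)
        then have "\<bar>(inward_normal D (y r) - ?n) \<bullet> ?n\<bar> \<le> e"
          using Cauchy_Schwarz_ineq2[of "inward_normal D (y r) - ?n" ?n] norm_inward_normal[OF D(1) r0(3)] by simp
        moreover have "?n \<bullet> ?n = 1" using norm_inward_normal[OF D(1) r0(3)] by (simp add: dot_square_norm)
        ultimately show ?thesis by (simp add: inner_diff_left)
      qed
      have up: "inward_normal D (y r) \<bullet> ?n \<le> 1" if "y r \<in> frontier D" for r
        using norm_cauchy_schwarz[of "inward_normal D (y r)" ?n] norm_inward_normal[OF D(1)] that r0(3) by simp
      have lo: "inward_normal D (y r) \<bullet> (- ?n) \<le> - (1 - e)" if r: "s \<le> r" "r \<le> t" "y r \<in> frontier D" for r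
        using close[OF r] by simp
      have eqk: "k1 t - k1 s = k2 t - k2 s" 
      proof -
        have "(k1 t - k1 0) - (k1 s - k1 0) = (k2 t - k2 0) - (k2 s - k2 0)"
          using diff[of s] diff[of t] st by simp
        then show ?thesis by simp
      qed
      have "(k1 t - k1 s) \<bullet> ?n \<le> 1 * (l1 t - l1 s)" using st up by (intro reflectingD[OF r1]) auto
      moreover have "(k2 t - k2 s) \<bullet> ?n \<le> 1 * (l2 t - l2 s)" using st up by (intro reflectingD[OF r2]) auto
      moreover have "- ((k1 t - k1 s) \<bullet> ?n) \<le> - (1 - e) * (l1 t - l1 s)"
        unfolding inner_minus_right[symmetric] using st lo by (intro reflectingD[OF r1]) auto
      moreover have "- ((k2 t - k2 s) \<bullet> ?n) \<le> - (1 - e) * (l2 t - l2 s)"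
        unfolding inner_minus_right[symmetric] using st lo by (intro reflectingD[OF r2]) auto
      ultimately have "(1 - e) * (l1 t - l1 s) \<le> l2 t - l2 s" "(1 - e) * (l2 t - l2 s) \<le> l1 t - l1 s"
        unfolding eqk by argo+
      moreover have "0 \<le> e * (l1 t - l1 s)" "0 \<le> e * (l2 t - l2 s)" using Am[of s t] st e by auto
      ultimately show ?thesis by (simp add: A_def algebra_simps abs_le_iff)
    next
      case False
      then have "l1 t \<le> l1 s" "l2 t \<le> l2 s"
        using reflecting_local_time_constant[OF r1 st(1-3)] reflecting_local_time_constant[OF r2 st(1-3)] by auto
      then show ?thesis using Am[OF st(1-3)] by (simp add: A_def)
    qed
    \<comment> \<open>Pieces of length \<open>d / 2\<close> stay strictly below the modulus
      \<open>d\<close> required by \<open>loc\<close>.\<close>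
    have "\<bar>(l1 t - l1 0) - (l2 t - l2 0)\<bar> \<le> e * (A t - A 0)"
      if "0 \<le> t" "t \<le> T" "t \<le> real i * (d / 2)" for t i
      using that
    proof (induction i arbitrary: t)
      case 0
      then show ?case by simp
    next
      case (Suc i)
      show ?case
      proof (cases "t \<le> real i * (d / 2)")
        case True
        then show ?thesis using Suc by simp
      next
        case False
        let ?s = "real i * (d / 2)"
        have s: "0 \<le> ?s" using d(1) by simp
        have 1: "\<bar>(l1 ?s - l1 0) - (l2 ?s - l2 0)\<bar> \<le> e * (A ?s - A 0)"
          using Suc.IH[of ?s] s False Suc.prems by simp
        have "\<bar>(l1 t - l1 ?s) - (l2 t - l2 ?s)\<bar> \<le> e * (A t - A ?s)"
          using s False Suc.prems d(1) by (intro loc) (auto simp: algebra_simps)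
        with 1 show ?thesis by (simp add: algebra_simps)
      qed
    qed
    moreover obtain i where "T / (d / 2) \<le> real i" using real_arch_simple by blast
    then have "T \<le> real i * (d / 2)" using d(1) by (simp add: field_simps)
    ultimately show ?thesis using T by blast
  qed
  have "A T - A 0 \<ge> 0" using Am[of 0 T] T by (simp add: A_def)
  have "\<bar>(l1 T - l1 0) - (l2 T - l2 0)\<bar> \<le> 0 + e" if "0 < e" for e
  proof -
    \<comment> \<open>The added 1 guards against a clock that does not move at all.\<close>
    have "\<bar>(l1 T - l1 0) - (l2 T - l2 0)\<bar> \<le> e / (A T - A 0 + 1) * (A T - A 0)"
      using \<open>A T - A 0 \<ge> 0\<close> that by (intro bound) simp
    also have "\<dots> \<le> e" using \<open>A T - A 0 \<ge> 0\<close> that by (simp add: divide_simps)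
    finally show ?thesis by simp
  qed
  then have "\<bar>(l1 T - l1 0) - (l2 T - l2 0)\<bar> \<le> 0" by (rule field_le_epsilon)
  then show ?thesis by simp
qed

section \<open>Stieltjes integrals of the normal\<close>

lemma reflecting_shift:
  assumes "reflecting D (a + T) y k l" "0 \<le> a"
  shows "reflecting D T (\<lambda>u. y (a + u)) (\<lambda>u. k (a + u)) (\<lambda>u. l (a + u))"
  unfolding reflecting_def
proof (intro allI impI, elim conjE)
  fix s t v c
  assume st: "0 \<le> s" "s \<le> t" "t \<le> T"
    and *: "\<forall>r\<in>{s..t}. y (a + r) \<in> frontier D \<longrightarrow> inward_normal D (y (a + r)) \<bullet> v \<le> c"
  show "(k (a + t) - k (a + s)) \<bullet> v \<le> c * (l (a + t) - l (a + s))"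
  proof (rule reflectingD[OF assms(1)])
    fix r assume "a + s \<le> r" "r \<le> a + t" "y r \<in> frontier D"
    then show "inward_normal D (y r) \<bullet> v \<le> c" using *[rule_format, of "r - a"] by simp
  qed (use st assms(2) in auto)
qed

context
  fixes l :: "real \<Rightarrow> real"
  assumes l: "local_time_path l"
begin

lemma local_time_path_max_mono: "s \<le> t \<Longrightarrow> l (max 0 s) \<le> l (max 0 t)"
  using l unfolding local_time_path_def by (auto intro: mono_onD)

lemma local_time_path_mono: "0 \<le> s \<Longrightarrow> s \<le> t \<Longrightarrow> l s \<le> l t"
  using local_time_path_max_mono[of s t] by simp

lemma local_time_path_nonneg: "0 \<le> t \<Longrightarrow> 0 \<le> l t"
  using local_time_path_mono[of 0 t] l by (simp add: local_time_path_def)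

lemma local_time_path_max_continuous: "continuous_on S (\<lambda>s. l (max 0 s))"
proof -
  have "continuous_on {0..} l" using l by (simp add: local_time_path_def)
  then show ?thesis
    by (rule continuous_on_compose2) (auto intro!: continuous_intros)
qed

lemma sets_stieltjes [simp, measurable_cong]: "sets (stieltjes l) = sets borel"
  by (simp add: stieltjes_def)

lemma space_stieltjes [simp]: "space (stieltjes l) = UNIV"
  by (simp add: stieltjes_def)

lemma emeasure_stieltjes_Ioc:
  assumes "0 \<le> a" "a \<le> b"
  shows "emeasure (stieltjes l) {a<..b} = ennreal (l b - l a)"
proof -
  have "emeasure (stieltjes l) {a<..b} = ennreal (l (max 0 b) - l (max 0 a))"
    unfolding stieltjes_def
  proof (rule emeasure_interval_measure_Ioc)
    fix x show "continuous (at_right x) (\<lambda>s. l (max 0 s))"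
      using local_time_path_max_continuous[of UNIV]
      by (meson UNIV_I continuous_at_imp_continuous_at_within continuous_on_eq_continuous_at open_UNIV)
  qed (use assms local_time_path_max_mono in auto)
  with assms show ?thesis by simp
qed

lemma emeasure_stieltjes_Icc:
  assumes "0 \<le> a" "a \<le> b"
  shows "emeasure (stieltjes l) {a..b} = ennreal (l b - l a)"
proof -
  have "emeasure (stieltjes l) {a..b} = ennreal (l (max 0 b) - l (max 0 a))"
    unfolding stieltjes_def
    by (rule emeasure_interval_measure_Icc)
       (use assms local_time_path_max_mono local_time_path_max_continuous in auto)
  with assms show ?thesis by simp
qed

lemma stieltjes_set_integrable:
  fixes g :: "real \<Rightarrow> 'b::{banach, second_countable_topology}"
  assumes "g \<in> borel_measurable borel" "\<And>s. norm (g s) \<le> K" "0 \<le> a" "a \<le> b"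
  shows "set_integrable (stieltjes l) {a..b} g" "set_integrable (stieltjes l) {a<..b} g"
proof -
  show *: "set_integrable (stieltjes l) {a..b} g"
    unfolding set_integrable_def
  proof (rule integrableI_bounded_set[where A = "{a..b}" and B = K])
    show "(\<lambda>x. indicat_real {a..b} x *\<^sub>R g x) \<in> borel_measurable (stieltjes l)"
      using assms(1) by measurable
    have "0 \<le> K" using assms(2)[of 0] norm_ge_zero order_trans by blast
    with assms(2) show "AE x\<in>{a..b} in stieltjes l. norm (indicat_real {a..b} x *\<^sub>R g x) \<le> K"
      by (auto simp: indicator_def)
  qed (use assms emeasure_stieltjes_Icc[of a b] in auto)
  then show "set_integrable (stieltjes l) {a<..b} g"
    by (rule set_integrable_subset) auto
qed

text \<open>A continuous \<open>l\<close> has no atom at 0, so the closed intervals in the equations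
  add nothing at the start.\<close>

lemma stieltjes_integral_at_0: "(LINT s:{0..0}|stieltjes l. f s) = (0 :: 'b::{banach, second_countable_topology})"
proof -
  have "emeasure (stieltjes l) {0..0} = 0" using emeasure_stieltjes_Icc[of 0 0] by simp
  then have "AE s in stieltjes l. s \<notin> {0..0}"
    by (intro AE_not_in) (auto simp: null_sets_def)
  then have "(LINT s|stieltjes l. indicator {0..0} s *\<^sub>R f s) = 0"
    by (intro integral_eq_zero_AE) (auto elim!: eventually_mono)
  then show ?thesis by (simp only: set_lebesgue_integral_def)
qed

text \<open>Bridge from the equations to \<open>reflecting\<close>: the projected integrand is at
  most \<open>c\<close> at boundary times, and the support condition removes all other
  times.\<close>

lemma reflecting_stieltjes_integral:
  fixes y :: "real \<Rightarrow> 'a::euclidean_space"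
  assumes D: "C2_domain D"
    and meas: "(\<lambda>s. y (max 0 s)) \<in> borel_measurable borel"
    and supp: "AE s in stieltjes l. 0 \<le> s \<longrightarrow> y s \<in> frontier D"
  shows "reflecting D T y (\<lambda>t. LINT s:{0..t}|stieltjes l. inward_normal D (y s)) l"
  unfolding reflecting_def
proof (intro allI impI, elim conjE)
  fix s t v c
  assume st: "0 \<le> s" "s \<le> t" "t \<le> T"
    and *: "\<forall>r\<in>{s..t}. y r \<in> frontier D \<longrightarrow> inward_normal D (y r) \<bullet> v \<le> c"
  \<comment> \<open>Freezing the path before time 0 makes the integrand measurable on the whole
    line, where \<open>stieltjes l\<close> lives.\<close>
  define g where "g r = inward_normal D (y (max 0 r))" for r
  have gm: "g \<in> borel_measurable borel"
    unfolding g_def using measurable_compose[OF meas borel_measurable_inward_normal[OF D]] .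
  have gb: "norm (g r) \<le> 1" for r
    unfolding g_def using norm_inward_normal[OF D, of "y (max 0 r)"] by (auto simp: inward_normal_def)
  have eq: "(LINT s:{0..t}|stieltjes l. inward_normal D (y s)) = (LINT s:{0..t}|stieltjes l. g s)" for t
    unfolding set_lebesgue_integral_def g_def
    by (intro Bochner_Integration.integral_cong) (auto simp: indicator_def max_def)
  have "(LINT s:{0..t}|stieltjes l. g s) =
      (LINT s:{0..s}|stieltjes l. g s) + (LINT s:{s<..t}|stieltjes l. g s)"
  proof -
    have "{0..t} = {0..s} \<union> {s<..t}" "{0..s} \<inter> {s<..t} = {}" using st by auto
    then show ?thesis
      using set_integral_Un[of "{0..s}" "{s<..t}" "stieltjes l" g] st
        stieltjes_set_integrable[OF gm gb, of 0 s] stieltjes_set_integrable[OF gm gb, of s t] by auto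
  qed
  then have "((LINT s:{0..t}|stieltjes l. inward_normal D (y s)) -
      (LINT s:{0..s}|stieltjes l. inward_normal D (y s))) \<bullet> v = (LINT s:{s<..t}|stieltjes l. g s) \<bullet> v"
    unfolding eq by simp
  also have "\<dots> = (LINT r|stieltjes l. (indicator {s<..t} r *\<^sub>R g r) \<bullet> v)"
    using stieltjes_set_integrable(2)[OF gm gb st(1,2)]
    unfolding set_lebesgue_integral_def set_integrable_def
    by (intro integral_inner_left[symmetric])
  also have "\<dots> \<le> (LINT r|stieltjes l. indicator {s<..t} r * c)"
  proof (rule integral_mono_AE)
    show "integrable (stieltjes l) (\<lambda>r. (indicator {s<..t} r *\<^sub>R g r) \<bullet> v)"
      using stieltjes_set_integrable(2)[OF gm gb st(1,2)] unfolding set_integrable_def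
      by (intro integrable_inner_left)
    show "integrable (stieltjes l) (\<lambda>r. indicator {s<..t} r * c)"
      using stieltjes_set_integrable(2)[of "\<lambda>_. c" "\<bar>c\<bar>" s t] st unfolding set_integrable_def by simp
    show "AE r in stieltjes l. (indicator {s<..t} r *\<^sub>R g r) \<bullet> v \<le> indicator {s<..t} r * c"
      using supp
    proof eventually_elim
      case (elim r)
      show ?case
        using elim * st by (cases "r \<in> {s<..t}") (auto simp: g_def max_def)
    qed
  qed
  also have "\<dots> = c * (l t - l s)"
  proof -
    have "measure (stieltjes l) {s<..t} = l t - l s"
      using emeasure_stieltjes_Ioc[of s t] st local_time_path_mono[of s t] by (simp add: measure_def)
    then show ?thesis using emeasure_stieltjes_Ioc[of s t] st by simp
  qed
  finally show "((LINT s:{0..t}|stieltjes l. inward_normal D (y s)) -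
      (LINT s:{0..s}|stieltjes l. inward_normal D (y s))) \<bullet> v \<le> c * (l t - l s)" .
qed

end

text \<open>Sampling at the next grid point strictly to the right gives step functions, which
  converge pointwise by right continuity.\<close>

lemma right_continuous_borel_measurable:
  fixes f :: "real \<Rightarrow> 'a::metric_space"
  assumes "\<And>t. (f \<longlongrightarrow> f t) (at_right t)"
  shows "f \<in> borel_measurable borel"
proof (rule borel_measurable_LIMSEQ_metric)
  define q where "q m s = (real_of_int \<lfloor>real (Suc m) * s\<rfloor> + 1) / real (Suc m)" for m s
  show "(\<lambda>s. f (q m s)) \<in> borel_measurable borel" for m
  proof -
    have "(\<lambda>s. (\<lambda>i. f ((real_of_int i + 1) / real (Suc m))) \<lfloor>real (Suc m) * s\<rfloor>) \<in> borel_measurable borel"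
      by (rule measurable_compose[of _ _ "count_space UNIV"]) measurable
    then show ?thesis by (simp only: q_def)
  qed
  show "(\<lambda>m. f (q m s)) \<longlonglongrightarrow> f s" for s
  proof -
    have gt: "s < q m s" for m
      unfolding q_def by (simp add: field_simps del: of_nat_Suc) linarith
    have le: "q m s \<le> s + 1 / real (Suc m)" for m
      unfolding q_def by (simp add: field_simps del: of_nat_Suc)
    have "(\<lambda>m. s + 1 / real (Suc m)) \<longlonglongrightarrow> s + 0"
      by (intro tendsto_intros LIMSEQ_Suc[OF lim_1_over_n])
    then have "(\<lambda>m. q m s) \<longlonglongrightarrow> s"
      by (intro tendsto_sandwich[of "\<lambda>_. s" "\<lambda>m. q m s" sequentially "\<lambda>m. s + 1 / real (Suc m)"]
          always_eventually allI less_imp_le[OF gt] le tendsto_const) simp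
    then have "filterlim (\<lambda>m. q m s) (at_right s) sequentially"
      using gt by (simp add: filterlim_at less_imp_neq[symmetric])
    with assms[of s] show ?thesis by (rule filterlim_compose)
  qed
qed

lemma cadlag_borel_measurable:
  fixes f :: "real \<Rightarrow> 'a::metric_space"
  assumes "cadlag f"
  shows "(\<lambda>s. f (max 0 s)) \<in> borel_measurable borel"
proof (rule right_continuous_borel_measurable)
  fix t :: real
  show "((\<lambda>s. f (max 0 s)) \<longlongrightarrow> f (max 0 t)) (at_right t)"
  proof (cases "0 \<le> t")
    case True
    then have "(f \<longlongrightarrow> f t) (at_right t)" using assms by (simp add: cadlag_def)
    moreover have "eventually (\<lambda>s. f s = f (max 0 s)) (at_right t)"
      using True by (auto simp: eventually_at_filter max_def)
    ultimately show ?thesis using True by (auto intro: Lim_transform_eventually)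
  next
    case False
    then have "eventually (\<lambda>s. f 0 = f (max 0 s)) (at_right t)"
      unfolding eventually_at_right_field by (intro exI[of _ 0]) auto
    then show ?thesis using False by (auto intro: Lim_transform_eventually[OF tendsto_const])
  qed
qed

section \<open>Paths with jumps from the boundary\<close>

lemma hitting_time_eqI:
  assumes "0 \<le> s" "a \<omega> \<le> L s \<omega>" "\<And>r. 0 \<le> r \<Longrightarrow> r < s \<Longrightarrow> L r \<omega> < a \<omega>"
  shows "hitting_time L a \<omega> = ereal s"
  unfolding hitting_time_def
proof (rule antisym)
  show "Inf {ereal t |t. 0 \<le> t \<and> a \<omega> \<le> L t \<omega>} \<le> ereal s"
    using assms by (intro Inf_lower) auto
  show "ereal s \<le> Inf {ereal t |t. 0 \<le> t \<and> a \<omega> \<le> L t \<omega>}"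
    using assms(3) by (intro Inf_greatest) (force simp: not_less[symmetric])
qed

text \<open>Continuity makes the level attained exactly, and the earliest such time is the infimum
  of a closed set.\<close>

lemma local_time_path_first_hit:
  assumes "local_time_path l" "0 \<le> a" "0 \<le> t" "a \<le> l t"
  shows "\<exists>s\<ge>0. s \<le> t \<and> l s = a \<and> (\<forall>r. 0 \<le> r \<and> r < s \<longrightarrow> l r < a)"
proof -
  have c: "continuous_on {0..t} l"
    using assms(1) unfolding local_time_path_def by (auto elim: continuous_on_subset)
  define S where "S = {s\<in>{0..t}. l s = a}"
  have "\<exists>s\<ge>0. s \<le> t \<and> l s = a"
    using assms c by (intro IVT') (auto simp: local_time_path_def)
  then have ne: "S \<noteq> {}" by (auto simp: S_def)
  have "closed S" unfolding S_def using c
    by (intro continuous_closed_preimage_constant) auto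
  moreover have bb: "bdd_below S" by (auto simp: S_def intro!: bdd_belowI[of _ 0])
  ultimately have in': "Inf S \<in> S" using ne by (intro closed_contains_Inf)
  have "l r < a" if "0 \<le> r" "r < Inf S" for r
  proof -
    have "l r \<le> a" using local_time_path_mono[OF assms(1), of r "Inf S"] that in' by (auto simp: S_def)
    moreover have "r \<notin> S" using cInf_lower[OF _ bb, of r] that by auto
    then have "l r \<noteq> a" using that in' by (auto simp: S_def)
    ultimately show ?thesis by simp
  qed
  then show ?thesis using in' by (intro exI[of _ "Inf S"]) (simp add: S_def)
qed

lemma reflecting_cong:
  assumes "reflecting D T y k l" "\<And>t. 0 \<le> t \<Longrightarrow> t \<le> T \<Longrightarrow> y' t = y t"
  shows "reflecting D T y' k l"
  unfolding reflecting_def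
proof (intro allI impI, elim conjE)
  fix s t v c
  assume st: "0 \<le> s" "s \<le> t" "t \<le> T"
    and *: "\<forall>r\<in>{s..t}. y' r \<in> frontier D \<longrightarrow> inward_normal D (y' r) \<bullet> v \<le> c"
  show "(k t - k s) \<bullet> v \<le> c * (l t - l s)"
  proof (rule reflectingD[OF assms(1) st])
    fix r assume r: "s \<le> r" "r \<le> t" "y r \<in> frontier D"
    then have "y' r = y r" using st by (intro assms(2)) auto
    then show "inward_normal D (y r) \<bullet> v \<le> c" using * r by (metis atLeastAtMost_iff)
  qed
qed

text \<open>One fixed outcome outside a null set. The jump times \<open>\<sigma>\<close> are real
  numbers because finiteness is settled before the locale is entered; index 0 belongs to the level 0
  and marks the start.\<close>

locale jump_path =
  fixes D :: "'a::euclidean_space set" and x :: 'a and b :: "real \<Rightarrow> 'a"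
    and \<l> :: "nat \<Rightarrow> real" and Z :: "nat \<Rightarrow> 'a" and X :: "real \<Rightarrow> 'a" and L :: "real \<Rightarrow> real"
    and W :: "nat \<Rightarrow> real \<Rightarrow> 'a" and LW :: "nat \<Rightarrow> real \<Rightarrow> real" and \<sigma> :: "nat \<Rightarrow> real"
  assumes D: "C2_domain D" "bounded D"
    and X_cadlag: "cadlag X" and X_closure: "\<And>t. 0 \<le> t \<Longrightarrow> X t \<in> closure D"
    and L_path: "local_time_path L"
    and X_support: "AE s in stieltjes L. 0 \<le> s \<longrightarrow> X s \<in> frontier D"
    and b: "continuous_on {0..} b" "b 0 = 0"
    and X_eq: "\<And>t. 0 \<le> t \<Longrightarrow> X t = x + b t + (LINT s:{0..t}|stieltjes L. inward_normal D (X s)) +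
        (\<Sum>k | 1 \<le> k \<and> \<l> k \<le> L t. Z k - left_limit X (\<sigma> k))"
    and \<l>: "\<l> 0 = 0" "strict_mono \<l>" "\<And>c. finite {k. \<l> k \<le> c}"
    and \<sigma>: "\<And>k. 0 \<le> \<sigma> k" "\<And>k. L (\<sigma> k) = \<l> k" "\<And>k r. 0 \<le> r \<Longrightarrow> r < \<sigma> k \<Longrightarrow> L r < \<l> k"
    and W_cont: "\<And>k. continuous_on {0..} (W k)" and W_closure: "\<And>k t. 0 \<le> t \<Longrightarrow> W k t \<in> closure D"
    and LW_path: "\<And>k. local_time_path (LW k)"
    and W_support: "\<And>k. AE s in stieltjes (LW k). 0 \<le> s \<longrightarrow> W k s \<in> frontier D"
    and W_eq: "\<And>k t. 0 \<le> t \<Longrightarrow> W k t = (if k = 0 then x else Z k) + (b (\<sigma> k + t) - b (\<sigma> k)) +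
        (LINT s:{0..t}|stieltjes (LW k). inward_normal D (W k s))"
begin

abbreviation "K t \<equiv> LINT s:{0..t}|stieltjes L. inward_normal D (X s)"
abbreviation "KW k t \<equiv> LINT s:{0..t}|stieltjes (LW k). inward_normal D (W k s)"
abbreviation "J m \<equiv> (\<Sum>k\<in>{1..m}. Z k - left_limit X (\<sigma> k))"
abbreviation "start m \<equiv> (if m = 0 then x else Z m)"

lemma strict_mono_\<sigma>: "strict_mono \<sigma>"
proof (rule strict_monoI)
  fix j k :: nat assume "j < k"
  then have "L (\<sigma> j) < L (\<sigma> k)" using \<l>(2) by (simp add: \<sigma>(2) strict_mono_less)
  then show "\<sigma> j < \<sigma> k"
    using local_time_path_mono[OF L_path, of "\<sigma> k" "\<sigma> j"] \<sigma>(1)[of k] by (meson not_le)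
qed

lemma \<sigma>_0: "\<sigma> 0 = 0"
proof (rule ccontr)
  assume "\<sigma> 0 \<noteq> 0"
  then have "L 0 < \<l> 0" using \<sigma>(1)[of 0] by (intro \<sigma>(3)) auto
  then show False using L_path \<l>(1) by (simp add: local_time_path_def)
qed

text \<open>Converts the condition on levels in the jump sum into a condition on times.\<close>

lemma level_reached_iff:
  assumes "0 \<le> t"
  shows "\<l> k \<le> L t \<longleftrightarrow> \<sigma> k \<le> t"
proof (cases "\<sigma> k \<le> t")
  case True
  then show ?thesis using local_time_path_mono[OF L_path \<sigma>(1) True] by (simp add: \<sigma>(2))
next
  case False
  then show ?thesis using \<sigma>(3)[OF assms, of k] by simp
qed

lemma finite_jumps: "finite {k. \<sigma> k \<le> t}"
proof (cases "0 \<le> t")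
  case True
  then show ?thesis using \<l>(3)[of "L t"] by (simp add: level_reached_iff)
next
  case False
  have "\<not> \<sigma> k \<le> t" for k using False \<sigma>(1)[of k] by linarith
  then show ?thesis by simp
qed

lemma ex_interval:
  assumes "0 \<le> t"
  obtains m where "\<sigma> m \<le> t" "t < \<sigma> (Suc m)"
proof -
  define m where "m = Max {k. \<sigma> k \<le> t}"
  have "m \<in> {k. \<sigma> k \<le> t}" unfolding m_def
    using finite_jumps[of t] assms \<sigma>_0 by (intro Max_in) (auto intro!: exI[of _ 0])
  moreover have "\<not> \<sigma> (Suc m) \<le> t"
    using Max_ge[OF finite_jumps[of t], of "Suc m"] by (auto simp: m_def[symmetric])
  ultimately show thesis by (intro that[of m]) auto
qed

lemma jump_index_set:
  assumes "\<sigma> m \<le> t" "t < \<sigma> (Suc m)"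
  shows "{k. 1 \<le> k \<and> \<l> k \<le> L t} = {1..m}"
proof -
  have t: "0 \<le> t" using assms(1) \<sigma>(1)[of m] by simp
  have iff: "\<sigma> k \<le> t \<longleftrightarrow> k \<le> m" for k
    using assms strict_mono_less_eq[OF strict_mono_\<sigma>, of k m]
      strict_mono_less_eq[OF strict_mono_\<sigma>, of "Suc m" k] by linarith
  show ?thesis by (simp only: level_reached_iff[OF t] iff atLeastAtMost_def atLeast_def atMost_def) blast
qed

lemma X_on_interval:
  assumes "\<sigma> m \<le> t" "t < \<sigma> (Suc m)"
  shows "X t = x + b t + K t + J m"
proof -
  have "0 \<le> t" using assms(1) \<sigma>(1)[of m] by linarith
  from X_eq[OF this] show ?thesis unfolding jump_index_set[OF assms] .
qed

lemma reflecting_X: "reflecting D T X K L"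
proof (rule reflecting_stieltjes_integral)
  show "local_time_path L" by (rule L_path)
  show "C2_domain D" by (rule D(1))
  show "(\<lambda>s. X (max 0 s)) \<in> borel_measurable borel" by (rule cadlag_borel_measurable[OF X_cadlag])
  show "AE s in stieltjes L. 0 \<le> s \<longrightarrow> X s \<in> frontier D" by (rule X_support)
qed

lemma reflecting_W: "reflecting D T (W k) (KW k) (LW k)"
proof (rule reflecting_stieltjes_integral[OF LW_path D(1) _ W_support])
  have "continuous_on UNIV (\<lambda>s. W k (max 0 s))"
    using W_cont[of k] by (rule continuous_on_compose2) (auto intro!: continuous_intros)
  then show "(\<lambda>s. W k (max 0 s)) \<in> borel_measurable borel"
    by (rule borel_measurable_continuous_onI)
qed

text \<open>The increments are dominated by those of the continuous \<open>L\<close>. Hence only the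
  jump sum can make \<open>X\<close> discontinuous.\<close>

lemma K_continuous: "continuous_on {0..} K"
  unfolding continuous_on_def
proof
  fix t :: real assume t: "t \<in> {0..}"
  have "(L \<longlongrightarrow> L t) (at t within {0..})"
    using L_path t by (auto simp: local_time_path_def continuous_on_def)
  then have "((\<lambda>s. \<bar>L s - L t\<bar>) \<longlongrightarrow> 0) (at t within {0..})"
    by (intro tendsto_eq_intros | simp)+
  moreover have "norm (K s - K t) \<le> \<bar>L s - L t\<bar>" if "0 \<le> s" for s
    using reflecting_norm_le[OF D(1) reflecting_X[of "max s t"], of s t]
      reflecting_norm_le[OF D(1) reflecting_X[of "max s t"], of t s] t that
    by (cases "s \<le> t") (auto simp: norm_minus_commute max_def)
  then have "eventually (\<lambda>s. norm (K s - K t) \<le> \<bar>L s - L t\<bar>) (at t within {0..})"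
    by (auto simp: eventually_at_filter)
  ultimately have "((\<lambda>s. K s - K t) \<longlongrightarrow> 0) (at t within {0..})"
    by (rule Lim_null_comparison[rotated])
  then show "(K \<longlongrightarrow> K t) (at t within {0..})" by (simp add: LIM_zero_iff)
qed

text \<open>The formula valid before the next jump is continuous up to and including the jump time,
  and its value there, without the new jump term, is the left limit.\<close>

lemma left_limit_X:
  assumes "\<sigma> m < t" "t \<le> \<sigma> (Suc m)"
  shows "left_limit X t = x + b t + K t + J m"
  unfolding left_limit_def[of X t]
proof (rule tendsto_Lim)
  have t: "0 < t" using assms(1) \<sigma>(1)[of m] by simp
  have "continuous_on {0..} (\<lambda>t. x + b t + K t + J m)"
    by (intro continuous_intros b K_continuous)
  then have "((\<lambda>t. x + b t + K t + J m) \<longlongrightarrow> x + b t + K t + J m) (at t within {0..})"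
    using t by (simp add: continuous_on_def)
  moreover have "at t within {0..} = at t"
    using t by (intro at_within_open_subset[of t "{0<..}"]) auto
  ultimately have "((\<lambda>t. x + b t + K t + J m) \<longlongrightarrow> x + b t + K t + J m) (at_left t)"
    by (simp add: filterlim_at_split)
  moreover have "eventually (\<lambda>s. x + b s + K s + J m = X s) (at_left t)"
    unfolding eventually_at_left_field
    using assms X_on_interval[of m] by (intro exI[of _ "\<sigma> m"]) auto
  ultimately show "(X \<longlongrightarrow> x + b t + K t + J m) (at_left t)"
    by (rule Lim_transform_eventually)
qed (rule trivial_limit_at_left_real)

text \<open>For positive \<open>m\<close> the last jump term is the mark minus the left limit, so it
  cancels everything accumulated before.\<close>

lemma X_\<sigma>: "X (\<sigma> m) = start m"
proof (cases m)
  case 0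
  have "X (\<sigma> 0) = x + b 0 + K 0"
    using X_on_interval[of 0 "\<sigma> 0"] strict_monoD[OF strict_mono_\<sigma>, of 0 1] by (simp add: \<sigma>_0)
  moreover have "K 0 = 0" by (rule stieltjes_integral_at_0[OF L_path])
  ultimately show ?thesis using 0 b by simp
next
  case (Suc n)
  have "X (\<sigma> (Suc n)) = x + b (\<sigma> (Suc n)) + K (\<sigma> (Suc n)) + J (Suc n)"
    using strict_mono_\<sigma> by (intro X_on_interval) (auto simp: strict_mono_less)
  moreover have "left_limit X (\<sigma> (Suc n)) = x + b (\<sigma> (Suc n)) + K (\<sigma> (Suc n)) + J n"
    using strict_mono_\<sigma> by (intro left_limit_X) (auto simp: strict_mono_less)
  ultimately show ?thesis using Suc by simp
qed

lemma X_on_interval_from_start: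
  assumes "\<sigma> m \<le> t" "t < \<sigma> (Suc m)"
  shows "X t = start m + (b t - b (\<sigma> m)) + (K t - K (\<sigma> m))"
proof -
  have "X t - X (\<sigma> m) = (b t - b (\<sigma> m)) + (K t - K (\<sigma> m))"
    using X_on_interval[OF assms] X_on_interval[of m "\<sigma> m"] assms by simp
  then have "X t = X (\<sigma> m) + ((b t - b (\<sigma> m)) + (K t - K (\<sigma> m)))" by (simp add: algebra_simps)
  then show ?thesis by (simp only: X_\<sigma> add.assoc)
qed

lemma L_shift_continuous: "continuous_on {0..} (\<lambda>r. L (\<sigma> m + r))"
proof (rule continuous_on_compose2[where g = L and f = "\<lambda>r. \<sigma> m + r" and t = "{0..}"])
  show "continuous_on {0..} L" using L_path by (simp add: local_time_path_def)
  show "continuous_on {0..} ((+) (\<sigma> m))" by (intro continuous_intros)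
  show "(+) (\<sigma> m) ` {0..} \<subseteq> {0..}" using \<sigma>(1)[of m] by auto
qed

text \<open>Both paths start from the same point and are driven by the same increments of
  \<open>b\<close>, so the driving terms cancel in the difference and pathwise uniqueness applies on
  \<open>{0..u}\<close>. Staying strictly before the next jump keeps the jump sum constant.\<close>

lemma W_eq_X:
  assumes "0 \<le> u" "\<sigma> m + u < \<sigma> (Suc m)"
  shows "W m u = X (\<sigma> m + u)"
proof -
  have KW0: "KW m 0 = 0" by (rule stieltjes_integral_at_0[OF LW_path])
  have cL: "continuous_on {0..u} (\<lambda>r. L (\<sigma> m + r))"
    by (rule continuous_on_subset[OF L_shift_continuous]) auto
  have "X (\<sigma> m + u) = W m u"
  proof (rule reflecting_unique_path[OF D assms(1) reflecting_shift[OF reflecting_X \<sigma>(1)[of m]] reflecting_W[of u m]])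
    show "mono_on {0..u} (\<lambda>r. L (\<sigma> m + r))"
      using local_time_path_mono[OF L_path] \<sigma>(1)[of m] by (intro mono_onI) simp
    show "mono_on {0..u} (LW m)" using local_time_path_mono[OF LW_path] by (intro mono_onI) simp
    show "continuous_on {0..u} (LW m)"
      by (rule continuous_on_subset[of "{0..}"]) (use LW_path[of m] in \<open>auto simp: local_time_path_def\<close>)
    fix t assume t: "0 \<le> t" "t \<le> u"
    show "X (\<sigma> m + t) \<in> closure D" using X_closure \<sigma>(1)[of m] t by simp
    show "W m t \<in> closure D" using W_closure t by simp
    show "X (\<sigma> m + t) - W m t = (K (\<sigma> m + t) - K (\<sigma> m + 0)) - (KW m t - KW m 0)"
      unfolding KW0 using X_on_interval_from_start[of m "\<sigma> m + t"] W_eq[OF t(1), of m] t assms by simp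
  qed (fact cL)
  then show ?thesis by simp
qed

text \<open>With equal paths the two equations force equal pushing terms, so uniqueness of the local
  time along a common path applies.\<close>

lemma LW_eq_L:
  assumes "0 \<le> u" "\<sigma> m + u < \<sigma> (Suc m)"
  shows "LW m u = L (\<sigma> m + u) - \<l> m"
proof -
  have "LW m u - LW m 0 = L (\<sigma> m + u) - L (\<sigma> m + 0)"
  proof (rule reflecting_unique_local_time[OF D assms(1) reflecting_W[of u m]])
    show "reflecting D u (W m) (\<lambda>r. K (\<sigma> m + r)) (\<lambda>r. L (\<sigma> m + r))"
      by (rule reflecting_cong[OF reflecting_shift[OF reflecting_X \<sigma>(1)[of m]]])
         (use W_eq_X assms in auto)
    show "mono_on {0..u} (\<lambda>r. L (\<sigma> m + r))"
      using local_time_path_mono[OF L_path] \<sigma>(1)[of m] by (intro mono_onI) simp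
    show "mono_on {0..u} (LW m)" using local_time_path_mono[OF LW_path] by (intro mono_onI) simp
    show "continuous_on {0..u} (W m)" using W_cont[of m] by (rule continuous_on_subset) auto
    fix t assume t: "0 \<le> t" "t \<le> u"
    have "KW m t = K (\<sigma> m + t) - K (\<sigma> m)" if t: "0 \<le> t" "t \<le> u" for t
      using X_on_interval_from_start[of m "\<sigma> m + t"] W_eq[OF t(1), of m] W_eq_X[of t m] t assms by simp
    from this[OF t] this[of 0] assms(1)
    show "KW m t - KW m 0 = K (\<sigma> m + t) - K (\<sigma> m + 0)" by simp
  qed
  then show ?thesis using LW_path[of m] \<sigma>(2)[of m] by (simp add: local_time_path_def)
qed

text \<open>The two local times are known to agree only before the jump. Both are continuous, unlike
  \<open>X\<close>, so equality passes to the endpoint by left limits.\<close>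

lemma LW_lifetime: "LW m (\<sigma> (Suc m) - \<sigma> m) = \<l> (Suc m) - \<l> m"
proof -
  let ?d = "\<sigma> (Suc m) - \<sigma> m"
  have d: "0 < ?d" using strict_mono_\<sigma> by (simp add: strict_mono_less)
  have w: "at ?d within {0..} = at ?d" using d by (intro at_within_open_subset[of ?d "{0<..}"]) auto
  have "continuous_on {0..} (LW m)" using LW_path[of m] by (simp add: local_time_path_def)
  then have "(LW m \<longlongrightarrow> LW m ?d) (at ?d)"
    using d w unfolding continuous_on_def by (metis atLeast_iff less_imp_le)
  then have 1: "(LW m \<longlongrightarrow> LW m ?d) (at_left ?d)" by (simp add: filterlim_at_split)
  have "continuous_on {0..} (\<lambda>u. L (\<sigma> m + u) - \<l> m)"
    by (intro continuous_on_diff L_shift_continuous continuous_on_const)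
  then have "((\<lambda>u. L (\<sigma> m + u) - \<l> m) \<longlongrightarrow> L (\<sigma> m + ?d) - \<l> m) (at ?d)"
    using d w unfolding continuous_on_def by (metis atLeast_iff less_imp_le)
  then have "((\<lambda>u. L (\<sigma> m + u) - \<l> m) \<longlongrightarrow> L (\<sigma> m + ?d) - \<l> m) (at_left ?d)"
    by (simp add: filterlim_at_split)
  moreover have "eventually (\<lambda>u. L (\<sigma> m + u) - \<l> m = LW m u) (at_left ?d)"
    unfolding eventually_at_left_field using d LW_eq_L[of _ m] by (intro exI[of _ 0]) auto
  ultimately have "(LW m \<longlongrightarrow> L (\<sigma> m + ?d) - \<l> m) (at_left ?d)"
    by (rule Lim_transform_eventually)
  with 1 have "LW m ?d = L (\<sigma> m + ?d) - \<l> m" by (rule tendsto_unique[rotated]) simp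
  then show ?thesis by (simp add: \<sigma>(2))
qed

lemma LW_before_lifetime:
  assumes "0 \<le> u" "u < \<sigma> (Suc m) - \<sigma> m"
  shows "LW m u < \<l> (Suc m) - \<l> m"
proof -
  have "LW m u = L (\<sigma> m + u) - \<l> m" using assms by (intro LW_eq_L) auto
  moreover have "L (\<sigma> m + u) < \<l> (Suc m)" using assms \<sigma>(1)[of m] by (intro \<sigma>(3)) auto
  ultimately show ?thesis by simp
qed

lemma left_limit_eq_X:
  assumes "0 < t" "t \<notin> range \<sigma>"
  shows "left_limit X t = X t"
proof -
  obtain m where m: "\<sigma> m \<le> t" "t < \<sigma> (Suc m)" using ex_interval[OF less_imp_le[OF assms(1)]] by blast
  have "\<sigma> m \<noteq> t" using assms(2) by blast
  then have "\<sigma> m < t" using m(1) by simp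
  then show ?thesis using left_limit_X[OF _ less_imp_le[OF m(2)]] X_on_interval[OF m] by simp
qed

lemma finite_discontinuities: "finite {t\<in>{0<..T}. left_limit X t \<noteq> X t}"
proof (rule finite_subset)
  show "{t\<in>{0<..T}. left_limit X t \<noteq> X t} \<subseteq> \<sigma> ` {k. \<sigma> k \<le> T}"
  proof
    fix t assume "t \<in> {t\<in>{0<..T}. left_limit X t \<noteq> X t}"
    then have t: "0 < t" "t \<le> T" "left_limit X t \<noteq> X t" by auto
    then have "t \<in> range \<sigma>" using left_limit_eq_X[of t] by blast
    with t show "t \<in> \<sigma> ` {k. \<sigma> k \<le> T}" by auto
  qed
qed (rule finite_imageI[OF finite_jumps])

lemma concatenation_sums:
  assumes "0 \<le> t"
  shows "(\<lambda>k. indicator {ereal (\<sigma> k)..<ereal (\<sigma> (Suc k))} (ereal t) *\<^sub>R W k (t - \<sigma> k)) sums X t"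
proof -
  obtain m where m: "\<sigma> m \<le> t" "t < \<sigma> (Suc m)" using ex_interval[OF assms] by blast
  have "(\<lambda>k. if k = m then W m (t - \<sigma> m) else 0) sums W m (t - \<sigma> m)" by (rule sums_single)
  moreover have "(\<lambda>k. if k = m then W m (t - \<sigma> m) else 0) =
      (\<lambda>k. indicator {ereal (\<sigma> k)..<ereal (\<sigma> (Suc k))} (ereal t) *\<^sub>R W k (t - \<sigma> k))"
  proof
    fix k
    have "\<sigma> k \<le> t \<and> t < \<sigma> (Suc k) \<longleftrightarrow> k = m"
      using m strict_mono_less_eq[OF strict_mono_\<sigma>, of "Suc m" k]
        strict_mono_less_eq[OF strict_mono_\<sigma>, of "Suc k" m] by (auto simp: not_less_eq_eq[symmetric])
    then show "(if k = m then W m (t - \<sigma> m) else 0) =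
      indicator {ereal (\<sigma> k)..<ereal (\<sigma> (Suc k))} (ereal t) *\<^sub>R W k (t - \<sigma> k)"
      by (auto simp: indicator_def)
  qed
  moreover have "W m (t - \<sigma> m) = X t" using W_eq_X[of "t - \<sigma> m" m] m by simp
  ultimately show ?thesis by simp
qed

end

section \<open>Generated and augmented sigma-algebras\<close>

lemma gen_eq:
  assumes "f \<in> space M \<rightarrow> space N"
  shows "gen M N f = {f -` A \<inter> space M | A. A \<in> sets N}"
  unfolding gen_def using assms by (rule sets_vimage_algebra2)

lemma sigma_algebra_gen: "sigma_algebra (space M) (gen M N f)"
  unfolding gen_def by (metis sets.sigma_algebra_axioms space_vimage_algebra)

lemma space_in_gen: "space M \<in> gen M N f"
  unfolding gen_def using sets.top[of "vimage_algebra (space M) f N"] by simp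

lemma gen_subset_sets:
  assumes "f \<in> measurable N N'" "space N = space M"
  shows "gen M N' f \<subseteq> sets N"
proof -
  have "f \<in> space M \<rightarrow> space N'" using measurable_space[OF assms(1)] assms(2) by auto
  then show ?thesis using measurable_sets[OF assms(1)] assms(2) by (auto simp: gen_eq)
qed

lemma measurable_if_gen_subset:
  assumes "gen M N f \<subseteq> sets N'" "space N' = space M" "f \<in> space M \<rightarrow> space N"
  shows "f \<in> measurable N' N"
proof (rule measurableI)
  fix A assume "A \<in> sets N"
  then show "f -` A \<inter> space N' \<in> sets N'" using assms by (auto simp: gen_eq)
qed (use assms in auto)

lemma gen_path_subset_sets:
  assumes "\<And>t. t \<in> T \<Longrightarrow> Y t \<in> borel_measurable N" "space N = space M"
  shows "gen_path M T Y \<subseteq> sets N"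
proof (rule gen_subset_sets)
  show "path T Y \<in> N \<rightarrow>\<^sub>M path_space T"
    unfolding path_def by (rule measurable_restrict) (rule assms(1))
qed (rule assms(2))

lemma path_in_space: "path T Y \<in> space M \<rightarrow> space (path_space T)"
  by (auto simp: path_def space_PiM)

lemma measurable_if_gen_path_subset:
  assumes "gen_path M T Y \<subseteq> sets N" "space N = space M" "t \<in> T"
  shows "Y t \<in> borel_measurable N"
proof -
  have "path T Y \<in> N \<rightarrow>\<^sub>M path_space T"
    by (rule measurable_if_gen_subset[OF assms(1,2) path_in_space])
  then have "(\<lambda>\<omega>. path T Y \<omega> t) \<in> borel_measurable N"
    using measurable_component_singleton[OF assms(3)] by (rule measurable_compose)
  then show ?thesis using assms(3) by (simp add: path_def)
qed

lemma gen_path_eq_sigma_sets: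
  "gen_path M T Y = sigma_sets (space M) {Y t -` A \<inter> space M | t A. t \<in> T \<and> A \<in> sets borel}"
  (is "_ = sigma_sets _ ?G")
proof
  have G: "?G \<subseteq> Pow (space M)" by auto
  show "gen_path M T Y \<subseteq> sigma_sets (space M) ?G"
  proof -
    have "gen_path M T Y \<subseteq> sets (sigma (space M) ?G)"
    proof (rule gen_path_subset_sets)
      fix t assume "t \<in> T"
      then show "Y t \<in> borel_measurable (sigma (space M) ?G)"
        by (intro measurableI) (auto simp: space_measure_of[OF G] intro!: in_measure_of[OF G])
    qed (simp add: space_measure_of[OF G])
    then show ?thesis by (simp add: sets_measure_of[OF G])
  qed
  show "sigma_sets (space M) ?G \<subseteq> gen_path M T Y"
  proof (rule sigma_algebra.sigma_sets_subset[OF sigma_algebra_gen], safe)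
    fix t and A :: "'b set" assume t: "t \<in> T" "A \<in> sets borel"
    let ?N = "vimage_algebra (space M) (path T Y) (path_space T)"
    have "Y t \<in> borel_measurable ?N"
      by (rule measurable_if_gen_path_subset[OF _ _ t(1)]) (simp_all add: gen_def)
    from measurable_sets[OF this t(2)] show "Y t -` A \<inter> space M \<in> gen_path M T Y"
      by (simp add: gen_def)
  qed
qed

lemma gen_path_mono:
  assumes "S \<subseteq> T" shows "gen_path M S Y \<subseteq> gen_path M T Y"
  unfolding gen_path_eq_sigma_sets using assms by (intro sigma_sets_mono') auto

lemma augmented_generator_subset: "G \<subseteq> sets M \<Longrightarrow> G \<union> null_sets M \<subseteq> Pow (space M)"
  using sets.space_closed[of M] null_setsD2[of _ M] by auto

lemma space_augmented [simp]: "G \<subseteq> sets M \<Longrightarrow> space (augmented M G) = space M"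
  unfolding augmented_def
  by (intro space_measure_of augmented_generator_subset)

lemma sets_augmented: "G \<subseteq> sets M \<Longrightarrow> sets (augmented M G) = sigma_sets (space M) (G \<union> null_sets M)"
  unfolding augmented_def
  by (intro sets_measure_of augmented_generator_subset)

lemma augmented_superset: "G \<subseteq> sets M \<Longrightarrow> G \<subseteq> sets (augmented M G)"
  unfolding sets_augmented by auto

lemma null_sets_augmented: "G \<subseteq> sets M \<Longrightarrow> null_sets M \<subseteq> sets (augmented M G)"
  unfolding sets_augmented by auto

lemma augmented_subset:
  assumes "G \<subseteq> sets M" "G \<subseteq> sets N" "null_sets M \<subseteq> sets N" "space N = space M"
  shows "sets (augmented M G) \<subseteq> sets N"
  unfolding sets_augmented[OF assms(1)] assms(4)[symmetric]
  using assms(2,3) by (intro sets.sigma_sets_subset) auto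

lemma augmented_subset_sets: "G \<subseteq> sets M \<Longrightarrow> sets (augmented M G) \<subseteq> sets M"
  by (rule augmented_subset) auto

lemma augmented_mono:
  assumes "G \<subseteq> sets M" "G' \<subseteq> sets M" "G \<subseteq> sets (augmented M G')"
  shows "sets (augmented M G) \<subseteq> sets (augmented M G')"
  using assms by (intro augmented_subset null_sets_augmented) auto

lemma measurable_augmented_mono:
  assumes "G \<subseteq> sets M" "G' \<subseteq> sets M" "G \<subseteq> sets (augmented M G')" "f \<in> measurable (augmented M G) N"
  shows "f \<in> measurable (augmented M G') N"
  by (rule subsetD[OF measurable_mono[OF order_refl refl augmented_mono[OF assms(1-3)]] assms(4)])
     (simp add: assms(1,2))

lemma measurable_augmented_imp_measurable:
  assumes "G \<subseteq> sets M" "f \<in> measurable (augmented M G) N"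
  shows "f \<in> measurable M N"
  by (rule subsetD[OF measurable_mono[OF order_refl refl augmented_subset_sets[OF assms(1)]] assms(2)])
     (simp add: assms(1))

text \<open>The two differences are null sets, hence already available. This transfers measurability
  along almost sure identities.\<close>

lemma augmented_AE_cong:
  assumes G: "G \<subseteq> sets M" and A: "A \<in> sets (augmented M G)" and B: "B \<in> sets M"
    and "AE \<omega> in M. \<omega> \<in> A \<longleftrightarrow> \<omega> \<in> B"
  shows "B \<in> sets (augmented M G)"
proof -
  have AM: "A \<in> sets M" using A augmented_subset_sets[OF G] by auto
  have "A - B \<in> null_sets M"
    by (rule iffD2[OF AE_iff_null_sets]) (use assms(4) AM B in \<open>auto elim: eventually_mono\<close>)
  moreover have "B - A \<in> null_sets M"
    by (rule iffD2[OF AE_iff_null_sets]) (use assms(4) AM B in \<open>auto elim: eventually_mono\<close>)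
  ultimately have "(A - (A - B)) \<union> (B - A) \<in> sets (augmented M G)"
    using A null_sets_augmented[OF G] by blast
  also have "(A - (A - B)) \<union> (B - A) = B" by auto
  finally show ?thesis .
qed

lemma measurable_augmented_AE_cong:
  assumes G: "G \<subseteq> sets M" and f: "f \<in> measurable (augmented M G) N" and g: "g \<in> measurable M N"
    and "AE \<omega> in M. f \<omega> = g \<omega>"
  shows "g \<in> measurable (augmented M G) N"
proof (rule measurableI)
  fix \<omega> assume "\<omega> \<in> space (augmented M G)"
  then show "g \<omega> \<in> space N" using measurable_space[OF g] G by simp
next
  fix A assume A: "A \<in> sets N"
  have "g -` A \<inter> space M \<in> sets (augmented M G)"
  proof (rule augmented_AE_cong[OF G])
    show "f -` A \<inter> space M \<in> sets (augmented M G)" using measurable_sets[OF f A] G by simp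
    show "g -` A \<inter> space M \<in> sets M" using measurable_sets[OF g A] .
    show "AE \<omega> in M. \<omega> \<in> f -` A \<inter> space M \<longleftrightarrow> \<omega> \<in> g -` A \<inter> space M"
      using assms(4) by eventually_elim auto
  qed
  then show "g -` A \<inter> space (augmented M G) \<in> sets (augmented M G)" using G by simp
qed

text \<open>Induction over the completed sigma-algebra, each generating null set being replaced by
  the empty set.\<close>

lemma augmented_AE_E:
  assumes G: "G \<subseteq> sets M" and A: "A \<in> sets (augmented M G)"
  shows "\<exists>A'\<in>sigma_sets (space M) G. AE \<omega> in M. \<omega> \<in> A \<longleftrightarrow> \<omega> \<in> A'"
  using A unfolding sets_augmented[OF G]
proof (induction rule: sigma_sets.induct)
  case (Basic a)
  then show ?case
  proof
    assume "a \<in> null_sets M"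
    then have "AE \<omega> in M. \<omega> \<notin> a" by (rule AE_not_in)
    then show ?thesis by (intro bexI[of _ "{}"]) (auto intro: sigma_sets.Empty)
  qed (auto intro: sigma_sets.Basic)
next
  case Empty
  then show ?case by (intro bexI[of _ "{}"]) (auto intro: sigma_sets.Empty)
next
  case (Compl a)
  then obtain a' where a': "a' \<in> sigma_sets (space M) G" "AE \<omega> in M. \<omega> \<in> a \<longleftrightarrow> \<omega> \<in> a'" by blast
  then show ?case
    by (intro bexI[of _ "space M - a'"]) (auto intro: sigma_sets.Compl elim: eventually_mono)
next
  case (Union a)
  then have "\<forall>i. \<exists>a'. a' \<in> sigma_sets (space M) G \<and> (AE \<omega> in M. \<omega> \<in> a i \<longleftrightarrow> \<omega> \<in> a')" by blast
  from choice[OF this] obtain a' where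
    a': "\<And>i. a' i \<in> sigma_sets (space M) G" "\<And>i. AE \<omega> in M. \<omega> \<in> a i \<longleftrightarrow> \<omega> \<in> a' i" by blast
  have "AE \<omega> in M. \<forall>i. \<omega> \<in> a i \<longleftrightarrow> \<omega> \<in> a' i" using a'(2) by (simp add: AE_all_countable)
  then have "AE \<omega> in M. \<omega> \<in> (\<Union>i. a i) \<longleftrightarrow> \<omega> \<in> (\<Union>i. a' i)" by eventually_elim auto
  then show ?case using a'(1) by (intro bexI[of _ "\<Union>i. a' i"]) (auto intro: sigma_sets.Union)
qed

text \<open>A pi-system argument with completion built in: product formulas checked on generators
  survive both the passage to the sigma-algebra and the addition of null sets.\<close>

lemma (in prob_space) indep_event_augmented:
  assumes H: "H \<in> events" and P: "P \<subseteq> events" "Int_stable P"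
    and ind: "\<And>a. a \<in> P \<Longrightarrow> prob (H \<inter> a) = prob H * prob a"
    and C: "C \<in> sets (augmented M P)"
  shows "prob (H \<inter> C) = prob H * prob C"
proof -
  have "indep_set {H} P" using H P ind by (intro indep_setI) auto
  then have "indep_set (sigma_sets (space M) {H}) (sigma_sets (space M) P)"
    using P(2) by (intro indep_set_sigma_sets) (auto simp: Int_stable_def)
  then have sig: "prob (H \<inter> a) = prob H * prob a" if "a \<in> sigma_sets (space M) P" for a
    using that by (intro indep_setD) auto
  obtain C' where C': "C' \<in> sigma_sets (space M) P" "AE \<omega> in M. \<omega> \<in> C \<longleftrightarrow> \<omega> \<in> C'"
    using augmented_AE_E[OF P(1) C] by blast
  have CM: "C \<in> events" using C augmented_subset_sets[OF P(1)] by auto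
  have CM': "C' \<in> events" using C'(1) sets.sigma_sets_subset[OF P(1)] by auto
  have "prob (H \<inter> C) = prob (H \<inter> C')"
    using C'(2) H CM CM' by (intro finite_measure_eq_AE) auto
  also have "\<dots> = prob H * prob C'" using C'(1) by (rule sig)
  also have "prob C' = prob C"
    using C'(2) CM CM' by (intro finite_measure_eq_AE) (auto elim: eventually_mono)
  finally show ?thesis .
qed

text \<open>The intersections \<open>a \<inter> b\<close> form an intersection-stable family, which
  contains both generators because each of them contains the whole space.\<close>

lemma (in prob_space) indep_event_augmented_join:
  assumes H: "H \<in> events" and P: "P1 \<subseteq> events" "Int_stable P1" "space M \<in> P1"
    "P2 \<subseteq> events" "Int_stable P2" "space M \<in> P2"
    and ind: "\<And>a b. a \<in> P1 \<Longrightarrow> b \<in> P2 \<Longrightarrow> prob (H \<inter> (a \<inter> b)) = prob H * prob (a \<inter> b)"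
    and C: "C \<in> sets (augmented M (P1 \<union> P2))"
  shows "prob (H \<inter> C) = prob H * prob C"
proof (rule indep_event_augmented[OF H])
  let ?P = "{a \<inter> b | a b. a \<in> P1 \<and> b \<in> P2}"
  show Pe: "?P \<subseteq> events" using P(1,4) by auto
  show "Int_stable ?P"
  proof (rule Int_stableI)
    fix c c' assume "c \<in> ?P" "c' \<in> ?P"
    then obtain a b a' b' where *: "a \<in> P1" "b \<in> P2" "a' \<in> P1" "b' \<in> P2" "c = a \<inter> b" "c' = a' \<inter> b'"
      by blast
    then have "c \<inter> c' = (a \<inter> a') \<inter> (b \<inter> b')" by auto
    moreover have "a \<inter> a' \<in> P1" "b \<inter> b' \<in> P2"
      using * Int_stableD[OF P(2)] Int_stableD[OF P(5)] by auto
    ultimately show "c \<inter> c' \<in> ?P" by blast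
  qed
  have "P1 \<union> P2 \<subseteq> ?P"
  proof
    fix a assume a: "a \<in> P1 \<union> P2"
    then have "a \<subseteq> space M" using P(1,4) sets.sets_into_space by blast
    then have "a = a \<inter> space M" "a = space M \<inter> a" by auto
    then show "a \<in> ?P" using a P(3,6) by blast
  qed
  then have "sets (augmented M (P1 \<union> P2)) \<subseteq> sets (augmented M ?P)"
    using P(1,4) Pe augmented_superset[OF Pe] by (intro augmented_mono) auto
  then show "C \<in> sets (augmented M ?P)" using C by auto
qed (use ind in auto)

lemma sigma_algebra_imp_Int_stable: "sigma_algebra \<Omega> S \<Longrightarrow> Int_stable S"
  using algebra.Int_stable sigma_algebra.axioms(1) by (metis)

text \<open>Rounding the random time leaves countably many deterministic times; continuity of the
  paths removes the rounding.\<close>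

lemma measurable_process_at:
  fixes Y :: "real \<Rightarrow> 'w \<Rightarrow> 'a::metric_space"
  assumes Y: "\<And>t. 0 \<le> t \<Longrightarrow> Y t \<in> borel_measurable N"
    and c: "\<And>\<omega>. \<omega> \<in> space N \<Longrightarrow> continuous_on {0..} (\<lambda>t. Y t \<omega>)"
    and S: "S \<in> borel_measurable N" "\<And>\<omega>. \<omega> \<in> space N \<Longrightarrow> 0 \<le> S \<omega>"
  shows "(\<lambda>\<omega>. Y (S \<omega>) \<omega>) \<in> borel_measurable N"
proof (rule borel_measurable_LIMSEQ_metric)
  \<comment> \<open>Rounding is downward. The \<open>max 0\<close> is there because the countable
    decomposition runs over all integers, including negative ones.\<close>
  define q where "q m s = max 0 (real_of_int \<lfloor>real (Suc m) * s\<rfloor> / real (Suc m))" for m s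
  show "(\<lambda>\<omega>. Y (q m (S \<omega>)) \<omega>) \<in> borel_measurable N" for m
    unfolding q_def
    by (rule measurable_compose_countable'[where f = "\<lambda>i. Y (max 0 (real_of_int i / real (Suc m)))"
          and g = "\<lambda>\<omega>. \<lfloor>real (Suc m) * S \<omega>\<rfloor>" and I = UNIV])
       (use Y S(1) in \<open>auto intro!: measurable_compose[OF _ measurable_real_floor] borel_measurable_times\<close>)
  show "(\<lambda>m. Y (q m (S \<omega>)) \<omega>) \<longlonglongrightarrow> Y (S \<omega>) \<omega>" if \<omega>: "\<omega> \<in> space N" for \<omega>
  proof -
    let ?s = "S \<omega>"
    have s: "0 \<le> ?s" using S(2)[OF \<omega>] .
    have q: "q m ?s \<le> ?s" "?s - 1 / real (Suc m) \<le> q m ?s" for m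
    proof -
      have "real_of_int \<lfloor>real (Suc m) * ?s\<rfloor> / real (Suc m) \<le> ?s"
        by (simp add: divide_le_eq mult.commute del: of_nat_Suc)
      then show "q m ?s \<le> ?s" using s by (simp add: q_def)
      have "real (Suc m) * ?s - 1 \<le> real_of_int \<lfloor>real (Suc m) * ?s\<rfloor>" by linarith
      then have "(real (Suc m) * ?s - 1) / real (Suc m) \<le> real_of_int \<lfloor>real (Suc m) * ?s\<rfloor> / real (Suc m)"
        by (rule divide_right_mono) simp
      then show "?s - 1 / real (Suc m) \<le> q m ?s"
        by (simp add: q_def diff_divide_distrib del: of_nat_Suc)
    qed
    have "(\<lambda>m. ?s - 1 / real (Suc m)) \<longlonglongrightarrow> ?s - 0"
      by (intro tendsto_diff tendsto_const LIMSEQ_Suc[OF lim_1_over_n])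
    then have lim: "(\<lambda>m. q m ?s) \<longlonglongrightarrow> ?s"
      using q by (intro tendsto_sandwich[of "\<lambda>m. ?s - 1 / real (Suc m)" "\<lambda>m. q m ?s" sequentially "\<lambda>_. ?s"]
          always_eventually allI) auto
    show ?thesis
      by (rule continuous_on_tendsto_compose[OF c[OF \<omega>] lim]) (use s in \<open>auto simp: q_def\<close>)
  qed
qed

section \<open>Brownian increments\<close>

definition increments_in :: "'w measure \<Rightarrow> (real \<Rightarrow> 'w \<Rightarrow> 'a::real_normed_vector) \<Rightarrow> (nat \<Rightarrow> real) \<Rightarrow>
    nat \<Rightarrow> (nat \<Rightarrow> 'a set) \<Rightarrow> 'w set" where
  "increments_in M Y t n C = {\<omega>\<in>space M. \<forall>i<n. Y (t (Suc i)) \<omega> - Y (t i) \<omega> \<in> C i}"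

lemma increments_in_sets:
  fixes Y :: "real \<Rightarrow> 'w \<Rightarrow> 'a::{real_normed_vector, second_countable_topology}"
  assumes "\<And>i. i \<le> n \<Longrightarrow> Y (t i) \<in> borel_measurable N" "\<And>i. i < n \<Longrightarrow> C i \<in> sets borel" "space N = space M"
  shows "increments_in M Y t n C \<in> sets N"
proof -
  have "{\<omega>\<in>space N. \<forall>i\<in>{..<n}. Y (t (Suc i)) \<omega> - Y (t i) \<omega> \<in> C i} \<in> sets N"
  proof (rule sets.sets_Collect_finite_All)
    fix i assume i: "i \<in> {..<n}"
    have "(\<lambda>\<omega>. Y (t (Suc i)) \<omega> - Y (t i) \<omega>) -` C i \<inter> space N \<in> sets N"
      using i by (intro measurable_sets[OF borel_measurable_diff] assms(1,2)) auto
    then show "{\<omega>\<in>space N. Y (t (Suc i)) \<omega> - Y (t i) \<omega> \<in> C i} \<in> sets N"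
      by (simp add: vimage_def Int_def conj_commute)
  qed simp
  then show ?thesis unfolding increments_in_def assms(3) Ball_def lessThan_iff .
qed

text \<open>Cylinder sets of the path are generated by the increments along the sorted times, because the
  path starts at \<open>0\<close>.\<close>

lemma (in prob_space) indep_event_gen_path:
  fixes Y :: "real \<Rightarrow> 'a \<Rightarrow> 'b::{real_normed_vector, second_countable_topology}"
  assumes Y: "\<And>t. t \<in> T \<Longrightarrow> Y t \<in> borel_measurable M" and T: "0 \<in> T" "T \<subseteq> {0..}"
    and Y0: "\<And>\<omega>. \<omega> \<in> space M \<Longrightarrow> Y 0 \<omega> = 0" and H: "H \<in> events"
    and ind: "\<And>t n C. mono t \<Longrightarrow> t 0 = 0 \<Longrightarrow> range t \<subseteq> T \<Longrightarrow> (\<And>i. closed (C i)) \<Longrightarrow>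
        prob (H \<inter> increments_in M Y t n C) = prob H * prob (increments_in M Y t n C)"
    and E: "E \<in> gen_path M T Y"
  shows "prob (H \<inter> E) = prob H * prob E"
proof -
  define P where "P = {{\<omega>\<in>space M. \<forall>u\<in>J. Y u \<omega> \<in> A u} | J A. finite J \<and> J \<subseteq> T \<and> (\<forall>u. A u \<in> sets borel)}"
  have cyl: "{\<omega>\<in>space M. \<forall>u\<in>J. Y u \<omega> \<in> A u} \<in> sets N"
    if "finite J" "\<And>u. A u \<in> sets borel" "\<And>u. u \<in> J \<Longrightarrow> Y u \<in> borel_measurable N" "space N = space M" for J A N
  proof -
    have "{\<omega>\<in>space N. \<forall>u\<in>J. Y u \<omega> \<in> A u} \<in> sets N"
    proof (rule sets.sets_Collect_finite_All)
      fix u assume "u \<in> J"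
      from measurable_sets[OF that(3)[OF this] that(2)[of u]]
      show "{\<omega>\<in>space N. Y u \<omega> \<in> A u} \<in> sets N" by (simp add: vimage_def Int_def conj_commute)
    qed (rule that(1))
    then show ?thesis by (simp add: that(4))
  qed
  have Pe: "P \<subseteq> events" unfolding P_def using cyl[of _ _ M] Y by blast
  have Ps: "Int_stable P"
  proof (rule Int_stableI)
    fix a b assume ab: "a \<in> P" "b \<in> P"
    obtain J A where 1: "a = {\<omega>\<in>space M. \<forall>u\<in>J. Y u \<omega> \<in> A u} \<and> finite J \<and> J \<subseteq> T \<and> (\<forall>u. A u \<in> sets borel)"
      using ab(1) unfolding P_def by (elim CollectE exE)
    obtain K C where 2: "b = {\<omega>\<in>space M. \<forall>u\<in>K. Y u \<omega> \<in> C u} \<and> finite K \<and> K \<subseteq> T \<and> (\<forall>u. C u \<in> sets borel)"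
      using ab(2) unfolding P_def by (elim CollectE exE)
    note * = 1[THEN conjunct1] 2[THEN conjunct1]
    let ?A = "\<lambda>u. (if u \<in> J then A u else UNIV) \<inter> (if u \<in> K then C u else UNIV)"
    have "a \<inter> b = {\<omega>\<in>space M. \<forall>u\<in>J \<union> K. Y u \<omega> \<in> ?A u}" unfolding * by auto
    moreover have "finite (J \<union> K)" "J \<union> K \<subseteq> T" "\<forall>u. ?A u \<in> sets borel" using 1 2 by (simp_all add: sets.Int)
    ultimately show "a \<inter> b \<in> P" unfolding P_def by (intro CollectI exI[of _ "J \<union> K"] exI[of _ ?A] conjI)
  qed
  have indP: "prob (H \<inter> a) = prob H * prob a" if a: "a \<in> P" for a
  proof -
    obtain J A where "a = {\<omega>\<in>space M. \<forall>u\<in>J. Y u \<omega> \<in> A u} \<and> finite J \<and> J \<subseteq> T \<and> (\<forall>u. A u \<in> sets borel)"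
      using a unfolding P_def by (elim CollectE exE)
    then have JA: "a = {\<omega>\<in>space M. \<forall>u\<in>J. Y u \<omega> \<in> A u}" "finite J" "J \<subseteq> T" "\<And>u. A u \<in> sets borel"
      by simp_all
    \<comment> \<open>Time 0 is added so that path values are sums of increments.\<close>
    define xs where "xs = sorted_list_of_set (insert 0 J)"
    have xs: "sorted xs" "set xs = insert 0 J"
      unfolding xs_def by (simp_all only: sorted_sorted_list_of_set set_sorted_list_of_set finite_insert JA(2))
    then have xs_ne: "xs \<noteq> []" by auto
    define n where "n = length xs"
    have n: "0 < n" using xs_ne by (simp add: n_def)
    \<comment> \<open>Constant from the last time on, because the hypothesis speaks of infinite
      monotone sequences.\<close>
    define t where "t i = xs ! min i (n - 1)" for i
    have t_in: "t i \<in> set xs" for i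
    proof -
      have "min i (n - 1) < length xs" using n unfolding n_def by linarith
      then show ?thesis unfolding t_def by (rule nth_mem)
    qed
    have mono: "mono t"
    proof (rule monoI)
      fix i j :: nat assume "i \<le> j"
      then have "min i (n - 1) \<le> min j (n - 1)" "min j (n - 1) < length xs"
        using n unfolding n_def by linarith+
      then show "t i \<le> t j" unfolding t_def by (rule sorted_nth_mono[OF xs(1)])
    qed
    have "set xs \<subseteq> T" using xs(2) JA(3) T(1) by simp
    with t_in have t_T: "range t \<subseteq> T" by blast
    have "0 \<in> set xs" using xs(2) by simp
    then obtain i where i: "i < n" "xs ! i = 0" unfolding n_def in_set_conv_nth by blast
    have "min i (n - 1) = i" using i(1) by linarith
    then have "t i = 0" using i(2) by (simp only: t_def)
    moreover have "t 0 \<in> T" using t_T by blast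
    then have "0 \<le> t 0" using T(2) by auto
    ultimately have t0: "t 0 = 0" using monoD[OF mono, of 0 i] by simp
    define P' where "P' = {increments_in M Y t n C | C. \<forall>i. closed (C i)}"
    have P'e: "P' \<subseteq> events"
      unfolding P'_def using t_T by (auto intro!: increments_in_sets Y borel_closed)
    have P's: "Int_stable P'"
    proof (rule Int_stableI)
      fix c d assume "c \<in> P'" "d \<in> P'"
      then obtain C C' where C: "c = increments_in M Y t n C \<and> (\<forall>i. closed (C i))"
        "d = increments_in M Y t n C' \<and> (\<forall>i. closed (C' i))" unfolding P'_def by (elim CollectE exE)
      then have "c \<inter> d = increments_in M Y t n (\<lambda>i. C i \<inter> C' i)" unfolding increments_in_def by auto
      moreover have "\<forall>i. closed (C i \<inter> C' i)" using C by (simp add: closed_Int)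
      ultimately show "c \<inter> d \<in> P'" unfolding P'_def by (intro CollectI exI conjI)
    qed
    let ?N = "sigma (space M) P'"
    have P'p: "P' \<subseteq> Pow (space M)" unfolding P'_def increments_in_def by auto
    have spN: "space ?N = space M" by (rule space_measure_of[OF P'p])
    \<comment> \<open>Closed sets generate the Borel sets, so events with closed \<open>C\<close>
      already determine each increment.\<close>
    have inc: "(\<lambda>\<omega>. Y (t (Suc i)) \<omega> - Y (t i) \<omega>) \<in> borel_measurable ?N" if i: "i < n" for i
      unfolding borel_eq_closed
    proof (rule measurable_measure_of)
      fix S :: "'b set" assume "S \<in> Collect closed"
      then have "\<forall>k. closed ((if k = i then S else UNIV) :: 'b set)" by auto
      then have "increments_in M Y t n (\<lambda>k. if k = i then S else UNIV) \<in> P'"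
        unfolding P'_def by (intro CollectI exI conjI) (rule refl)
      also have "increments_in M Y t n (\<lambda>k. if k = i then S else UNIV) =
          (\<lambda>\<omega>. Y (t (Suc i)) \<omega> - Y (t i) \<omega>) -` S \<inter> space M"
        unfolding increments_in_def using i by auto
      finally show "(\<lambda>\<omega>. Y (t (Suc i)) \<omega> - Y (t i) \<omega>) -` S \<inter> space ?N \<in> sets ?N"
        unfolding spN by (rule in_measure_of[OF P'p])
    qed auto
    have Yt: "m \<le> n \<Longrightarrow> Y (t m) \<in> borel_measurable ?N" for m
    proof (induction m)
      case 0
      have "(\<lambda>_. 0) \<in> borel_measurable ?N" by simp
      then show ?case
        by (rule measurable_cong[THEN iffD1, rotated]) (simp add: t0 Y0 spN)
    next
      case (Suc m)
      then have "(\<lambda>\<omega>. Y (t m) \<omega> + (Y (t (Suc m)) \<omega> - Y (t m) \<omega>)) \<in> borel_measurable ?N"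
        using inc[of m] by (intro borel_measurable_add) auto
      then show ?case by simp
    qed
    have "a \<in> sets ?N"
      unfolding JA(1)
    proof (rule cyl[OF JA(2,4)])
      fix u assume "u \<in> J"
      then have "u \<in> set xs" using xs(2) by simp
      then obtain i where i: "i < n" "xs ! i = u" unfolding n_def in_set_conv_nth by blast
      have "min i (n - 1) = i" using i(1) by linarith
      then have "t i = u" using i(2) by (simp only: t_def)
      then show "Y u \<in> borel_measurable ?N" using Yt[of i] i(1) by simp
    qed (rule spN)
    then have "a \<in> sigma_sets (space M) P'" by (simp add: sets_measure_of[OF P'p])
    also have "\<dots> \<subseteq> sets (augmented M P')"
      unfolding sets_augmented[OF P'e] by (rule sigma_sets_mono') auto
    finally have aP: "a \<in> sets (augmented M P')" .
    have indP': "prob (H \<inter> c) = prob H * prob c" if c: "c \<in> P'" for c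
    proof -
      obtain C where C: "c = increments_in M Y t n C \<and> (\<forall>i. closed (C i))"
        using c unfolding P'_def by (elim CollectE exE)
      then have "prob (H \<inter> increments_in M Y t n C) = prob H * prob (increments_in M Y t n C)"
        by (intro ind mono t0 t_T) simp
      with C show ?thesis by simp
    qed
    show ?thesis by (rule indep_event_augmented[OF H P'e P's indP' aP])
  qed
  have "gen_path M T Y \<subseteq> sigma_sets (space M) P"
    unfolding gen_path_eq_sigma_sets
  proof (rule sigma_sets_mono', safe)
    fix t and A :: "'b set" assume *: "t \<in> T" "A \<in> sets borel"
    have "Y t -` A \<inter> space M = {\<omega>\<in>space M. \<forall>u\<in>{t}. Y u \<omega> \<in> (\<lambda>_. A) u}" by auto
    then show "Y t -` A \<inter> space M \<in> P" unfolding P_def using *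
      by (intro CollectI exI[of _ "{t}"] exI[of _ "\<lambda>_. A"] conjI) simp_all
  qed
  also have "\<dots> \<subseteq> sets (augmented M P)"
    unfolding sets_augmented[OF Pe] by (rule sigma_sets_mono') auto
  finally have "E \<in> sets (augmented M P)" using E by blast
  from indep_event_augmented[OF H Pe Ps indP this] show ?thesis .
qed

locale brownian = prob_space M for M :: "'w measure" +
  fixes B :: "real \<Rightarrow> 'w \<Rightarrow> 'a::euclidean_space"
  assumes BM: "standard_BM M B"
begin

lemma B_measurable: "0 \<le> t \<Longrightarrow> B t \<in> borel_measurable M"
  using BM[unfolded standard_BM_def, THEN conjunct1] by simp

lemma B_0: "\<omega> \<in> space M \<Longrightarrow> B 0 \<omega> = 0"
  using BM[unfolded standard_BM_def, THEN conjunct2, THEN conjunct1] by simp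

lemma B_continuous: "\<omega> \<in> space M \<Longrightarrow> continuous_on {0..} (\<lambda>t. B t \<omega>)"
  using BM[unfolded standard_BM_def, THEN conjunct2, THEN conjunct1] by simp

text \<open>Defined through \<open>B d\<close> and not through a density, so that increments of
  length 0 are covered too.\<close>

definition law :: "real \<Rightarrow> 'a set \<Rightarrow> real" where
  "law d C = prob (B d -` C \<inter> space M)"

lemma law_UNIV [simp]: "law d UNIV = 1"
  by (simp add: law_def prob_space)

lemma B_distributed:
  assumes "0 \<le> s" "s < t"
  shows "distributed M lborel (\<lambda>\<omega>. B t \<omega> - B s \<omega>)
        (\<lambda>y. \<Prod>b\<in>Basis. normal_density 0 (sqrt (t - s)) (y \<bullet> b))"
  using BM[unfolded standard_BM_def, THEN conjunct2, THEN conjunct2, THEN conjunct1] assms by simp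

lemma B_distributed_0:
  assumes "0 < t"
  shows "distributed M lborel (B t) (\<lambda>y. \<Prod>b\<in>Basis. normal_density 0 (sqrt t) (y \<bullet> b))"
proof -
  have "distr M lborel (\<lambda>\<omega>. B t \<omega> - B 0 \<omega>) = distr M lborel (B t)"
    by (rule distr_cong) (simp_all add: B_0)
  then show ?thesis using B_distributed[of 0 t] assms B_measurable[of t]
    unfolding distributed_def by simp
qed

lemma prob_increment:
  assumes st: "0 \<le> s" "s \<le> t" and C: "C \<in> sets borel"
  shows "prob ((\<lambda>\<omega>. B t \<omega> - B s \<omega>) -` C \<inter> space M) = law (t - s) C"
proof (cases "s = t")
  case True
  have "(\<lambda>\<omega>. B t \<omega> - B s \<omega>) -` C \<inter> space M = B (t - s) -` C \<inter> space M"
    using True by (auto simp: B_0)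
  then show ?thesis by (simp add: law_def)
next
  case False
  then have "distr M lborel (\<lambda>\<omega>. B t \<omega> - B s \<omega>) = distr M lborel (B (t - s))"
    using B_distributed[of s t] B_distributed_0[of "t - s"] st unfolding distributed_def by simp
  then have "emeasure (distr M lborel (\<lambda>\<omega>. B t \<omega> - B s \<omega>)) C = emeasure (distr M lborel (B (t - s))) C"
    by simp
  then show ?thesis
    using st C B_measurable[of t] B_measurable[of s] B_measurable[of "t - s"]
    by (simp add: emeasure_distr law_def measure_def)
qed

lemma prob_increments_in:
  assumes t: "mono t" "0 \<le> t 0" and C: "\<And>i. C i \<in> sets borel"
  shows "prob (increments_in M B t n C) = (\<Prod>i<n. law (t (Suc i) - t i) (C i))"
proof (cases "n = 0")
  case True
  then show ?thesis by (simp add: increments_in_def prob_space)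
next
  case False
  have t0: "0 \<le> t i" "t i \<le> t (Suc i)" for i using t monoD[OF t(1), of 0 i] monoD[OF t(1), of i "Suc i"] by auto
  have "indep_vars (\<lambda>_. borel) (\<lambda>i \<omega>. B (t (Suc i)) \<omega> - B (t i) \<omega>) UNIV"
    using BM[unfolded standard_BM_def, THEN conjunct2, THEN conjunct2, THEN conjunct2] t by simp
  then have "prob (\<Inter>i\<in>{..<n}. (\<lambda>\<omega>. B (t (Suc i)) \<omega> - B (t i) \<omega>) -` C i \<inter> space M) =
      (\<Prod>i<n. prob ((\<lambda>\<omega>. B (t (Suc i)) \<omega> - B (t i) \<omega>) -` C i \<inter> space M))"
    using False C by (intro indep_varsD) auto
  moreover have "(\<Inter>i\<in>{..<n}. (\<lambda>\<omega>. B (t (Suc i)) \<omega> - B (t i) \<omega>) -` C i \<inter> space M) = increments_in M B t n C"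
    unfolding increments_in_def using False by auto
  ultimately show ?thesis using t0 C by (simp add: prob_increment)
qed

lemma increments_in_events:
  assumes t: "mono t" "0 \<le> t 0" and C: "\<And>i. C i \<in> sets borel"
  shows "increments_in M B t n C \<in> events"
proof (rule increments_in_sets)
  fix i
  have "t 0 \<le> t i" using t(1) by (rule monoD) simp
  then show "B (t i) \<in> borel_measurable M" using t(2) by (intro B_measurable) simp
qed (use C in simp_all)

text \<open>Past and future times are spliced into one monotone sequence, so that the product
  formula for a single family of increments factorises.\<close>

lemma increments_indep_past:
  assumes t: "mono t" "0 \<le> q" "q \<le> t 0" and C: "\<And>i. C i \<in> sets borel"
    and E: "E \<in> gen_path M {0..q} B"
  shows "prob (increments_in M B t n C \<inter> E) = prob (increments_in M B t n C) * prob E"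
proof (rule indep_event_gen_path[OF _ _ _ B_0 _ _ E])
  show "increments_in M B t n C \<in> events" using t C by (intro increments_in_events) auto
next
  fix t' :: "nat \<Rightarrow> real" and m and C' :: "nat \<Rightarrow> 'a set"
  assume t': "mono t'" "t' 0 = 0" "range t' \<subseteq> {0..q}" and C': "\<And>i. closed (C' i)"
  \<comment> \<open>Past times up to index \<open>m\<close>, future times from \<open>Suc m\<close>
    on; the increment with index \<open>m\<close> bridges \<open>t' m\<close> and \<open>t 0\<close>
    and stays unconstrained.\<close>
  define s where "s i = (if i \<le> m then t' i else t (i - Suc m))" for i
  have "mono s"
  proof (rule incseq_SucI)
    fix i
    show "s i \<le> s (Suc i)"
    proof (cases "i = m")
      case True
      have "t' m \<le> q" using t'(3) by (auto simp: image_subset_iff)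
      then show ?thesis using True t(3) by (simp add: s_def)
    next
      case False
      then show ?thesis using monoD[OF t'(1), of i "Suc i"] monoD[OF t(1), of "i - Suc m" "Suc i - Suc m"]
        by (auto simp: s_def)
    qed
  qed
  have s0: "0 \<le> s 0" using t' by (simp add: s_def)
  define A1 where "A1 i = (if i < m then C' i else UNIV)" for i
  define A2 where "A2 i = (if i \<le> m then UNIV else C (i - Suc m))" for i
  have A: "A1 i \<in> sets borel" "A2 i \<in> sets borel" for i using C C' by (auto simp: A1_def A2_def)
  let ?n = "Suc m + n"
  have e1: "increments_in M B t' m C' = increments_in M B s ?n A1"
    unfolding increments_in_def s_def A1_def by auto
  have e2: "increments_in M B t n C = increments_in M B s ?n A2"
  proof -
    have "(\<forall>i<n. B (t (Suc i)) \<omega> - B (t i) \<omega> \<in> C i) \<longleftrightarrow>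
        (\<forall>i<?n. B (s (Suc i)) \<omega> - B (s i) \<omega> \<in> A2 i)" for \<omega>
    proof
      assume *: "\<forall>i<n. B (t (Suc i)) \<omega> - B (t i) \<omega> \<in> C i"
      show "\<forall>i<?n. B (s (Suc i)) \<omega> - B (s i) \<omega> \<in> A2 i"
      proof (intro allI impI)
        fix i assume i: "i < ?n"
        show "B (s (Suc i)) \<omega> - B (s i) \<omega> \<in> A2 i"
        proof (cases "i \<le> m")
          case False
          then have "Suc i - Suc m = Suc (i - Suc m)" "i - Suc m < n" using i by auto
          then show ?thesis using * False by (auto simp: s_def A2_def)
        qed (simp add: A2_def)
      qed
    next
      assume *: "\<forall>i<?n. B (s (Suc i)) \<omega> - B (s i) \<omega> \<in> A2 i"
      show "\<forall>i<n. B (t (Suc i)) \<omega> - B (t i) \<omega> \<in> C i"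
      proof (intro allI impI)
        fix i assume "i < n"
        then show "B (t (Suc i)) \<omega> - B (t i) \<omega> \<in> C i"
          using *[rule_format, of "Suc m + i"] by (simp add: s_def A2_def)
      qed
    qed
    then show ?thesis unfolding increments_in_def by simp
  qed
  have e3: "increments_in M B s ?n A2 \<inter> increments_in M B s ?n A1 = increments_in M B s ?n (\<lambda>i. A1 i \<inter> A2 i)"
    unfolding increments_in_def by auto
  have "prob (increments_in M B s ?n (\<lambda>i. A1 i \<inter> A2 i)) =
      (\<Prod>i<?n. law (s (Suc i) - s i) (A1 i \<inter> A2 i))"
    using A by (intro prob_increments_in[OF \<open>mono s\<close> s0]) auto
  \<comment> \<open>At each index at least one of the two sets is \<open>UNIV\<close>, which has law
    1.\<close>
  also have "\<dots> = (\<Prod>i<?n. law (s (Suc i) - s i) (A2 i) * law (s (Suc i) - s i) (A1 i))"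
    by (rule prod.cong) (auto simp: A1_def A2_def)
  also have "\<dots> = prob (increments_in M B s ?n A2) * prob (increments_in M B s ?n A1)"
    using A by (simp only: prod.distrib prob_increments_in[OF \<open>mono s\<close> s0])
  finally show "prob (increments_in M B t n C \<inter> increments_in M B t' m C') =
      prob (increments_in M B t n C) * prob (increments_in M B t' m C')"
    unfolding e1 e2 e3 .
next
  show "{0..q} \<subseteq> {0..}" "0 \<in> {0..q}" using t(2) by simp_all
qed (rule B_measurable, simp)

text \<open>The Gaussian density at time \<open>t\<close> is at most \<open>2 * pi * t\<close> to
  the power minus half the dimension, so its mass on a fixed ball tends to 0. Hence the path almost
  surely leaves every ball at some integer time.\<close>

lemma AE_unbounded:
  "AE \<omega> in M. \<forall>c. \<exists>t\<ge>0. c < norm (B t \<omega>)"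
proof -
  have bnd: "AE \<omega> in M. \<exists>t\<ge>0. real c < norm (B t \<omega>)" for c :: nat
  proof -
    define V where "V = measure lborel (cball (0::'a) (real c))"
    let ?d = "DIM('a)"
    have le: "prob {\<omega>\<in>space M. \<forall>k::nat. norm (B (real k) \<omega>) \<le> real c} \<le> V * (1 / sqrt (2 * pi * real (Suc m))) ^ ?d" for m :: nat
    proof -
      let ?t = "real (Suc m)"
      let ?f = "\<lambda>y::'a. \<Prod>b\<in>Basis. normal_density 0 (sqrt ?t) (y \<bullet> b)"
      have fle: "?f y \<le> (1 / sqrt (2 * pi * ?t)) ^ ?d" for y
      proof -
        have "?f y \<le> (\<Prod>b\<in>(Basis::'a set). 1 / sqrt (2 * pi * ?t))"
        proof (rule prod_mono, rule conjI)
          fix b :: 'a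
          show "normal_density 0 (sqrt ?t) (y \<bullet> b) \<le> 1 / sqrt (2 * pi * ?t)"
            unfolding normal_density_def by (simp add: divide_right_mono)
        qed simp
        then show ?thesis by simp
      qed
      have "emeasure M (B ?t -` cball 0 (real c) \<inter> space M) = (\<integral>\<^sup>+y. ennreal (?f y) * indicator (cball 0 (real c)) y \<partial>lborel)"
        by (rule distributed_emeasure[OF B_distributed_0]) auto
      also have "\<dots> \<le> (\<integral>\<^sup>+y. ennreal ((1 / sqrt (2 * pi * ?t)) ^ ?d) * indicator (cball (0::'a) (real c)) y \<partial>lborel)"
        by (rule nn_integral_mono) (auto simp: indicator_def intro!: ennreal_leI fle simp del: of_nat_Suc)
      also have "\<dots> = ennreal ((1 / sqrt (2 * pi * ?t)) ^ ?d) * emeasure lborel (cball (0::'a) (real c))"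
        by (rule nn_integral_cmult_indicator) simp
      also have "\<dots> = ennreal ((1 / sqrt (2 * pi * ?t)) ^ ?d * V)"
      proof -
        have "emeasure lborel (cball (0::'a) (real c)) \<noteq> \<infinity>"
          using emeasure_lborel_cball_finite[of "0::'a" "real c"] by simp
        from emeasure_eq_ennreal_measure[OF this[unfolded infinity_ennreal_def]]
        show ?thesis by (simp add: V_def ennreal_mult)
      qed
      finally have "prob (B ?t -` cball 0 (real c) \<inter> space M) \<le> (1 / sqrt (2 * pi * ?t)) ^ ?d * V"
        unfolding emeasure_eq_measure by (rule ennreal_le_iff[THEN iffD1, rotated]) (simp add: V_def)
      moreover have "prob {\<omega>\<in>space M. \<forall>k::nat. norm (B (real k) \<omega>) \<le> real c} \<le>
          prob (B ?t -` cball 0 (real c) \<inter> space M)"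
        using B_measurable[of ?t]
        by (intro finite_measure_mono) (auto intro!: measurable_sets simp del: of_nat_Suc)
      ultimately show ?thesis by (simp add: mult.commute)
    qed
    have "(\<lambda>m. V * (1 / sqrt (2 * pi * real (Suc m))) ^ ?d) \<longlonglongrightarrow> V * 0 ^ ?d"
    proof (intro tendsto_intros)
      have "(\<lambda>m. inverse (sqrt (2 * pi * real m))) \<longlonglongrightarrow> 0"
        by (intro tendsto_inverse_0_at_top filterlim_compose[OF sqrt_at_top]
            filterlim_tendsto_pos_mult_at_top[OF tendsto_const] filterlim_real_sequentially) auto
      from LIMSEQ_Suc[OF this] show "(\<lambda>m. 1 / sqrt (2 * pi * real (Suc m))) \<longlonglongrightarrow> 0"
        by (simp only: inverse_eq_divide)
    qed
    then have "prob {\<omega>\<in>space M. \<forall>k::nat. norm (B (real k) \<omega>) \<le> real c} \<le> V * 0 ^ ?d"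
      by (rule tendsto_lowerbound[OF _ always_eventually[OF allI[OF le]]]) simp
    then have "prob {\<omega>\<in>space M. \<forall>k::nat. norm (B (real k) \<omega>) \<le> real c} = 0"
      unfolding zero_power[OF DIM_positive[where 'a = 'a]] mult_zero_right
      by (intro antisym measure_nonneg)
    moreover have "{\<omega>\<in>space M. \<forall>k::nat. norm (B (real k) \<omega>) \<le> real c} \<in> events"
      using B_measurable by measurable
    ultimately have "AE \<omega> in M. \<not> (\<forall>k::nat. norm (B (real k) \<omega>) \<le> real c)"
      by (subst (asm) prob_eq_0) auto
    then show ?thesis by eventually_elim (metis not_le of_nat_0_le_iff)
  qed
  have "AE \<omega> in M. \<forall>c::nat. \<exists>t\<ge>0. real c < norm (B t \<omega>)" using bnd by (simp add: AE_all_countable)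
  then show ?thesis
  proof eventually_elim
    case (elim \<omega>)
    show ?case
    proof
      fix c :: real
      obtain n :: nat where "c \<le> real n" using real_arch_simple by blast
      moreover obtain t where "t \<ge> 0" "real n < norm (B t \<omega>)" using elim by blast
      ultimately show "\<exists>t\<ge>0. c < norm (B t \<omega>)" by (intro exI[of _ t]) auto
    qed
  qed
qed

end

text \<open>Continuous test functions are required because the strong Markov property is reached as
  a limit along discretised times.\<close>

lemma closed_indicator_approx:
  fixes C :: "'a::metric_space set"
  assumes "closed C"
  obtains g :: "nat \<Rightarrow> 'a \<Rightarrow> real" where "\<And>p. continuous_on UNIV (g p)" "\<And>p y. 0 \<le> g p y" "\<And>p y. g p y \<le> 1"
    "\<And>y. (\<lambda>p. g p y) \<longlonglongrightarrow> indicator C y"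
\<comment> \<open>The distance \<open>infdist\<close> to the empty set is 0, so the construction
  below would give the constant 1 there.\<close>
proof (cases "C = {}")
  case True
  then show thesis by (intro that[of "\<lambda>_ _. 0"]) auto
next
  case False
  define g where "g p y = max 0 (1 - real p * infdist y C)" for p :: nat and y
  show thesis
  proof (rule that[of g])
    fix y
    show "(\<lambda>p. g p y) \<longlonglongrightarrow> indicator C y"
    proof (cases "y \<in> C")
      case True
      then have "infdist y C = 0" by simp
      then show ?thesis using True by (simp add: g_def)
    next
      case y: False
      then have pos: "0 < infdist y C"
        using in_closed_iff_infdist_zero[OF assms False, of y] infdist_nonneg[of y C] by simp
      obtain N :: nat where N: "1 / infdist y C \<le> real N" using real_arch_simple by blast
      have "g p y = 0" if "N \<le> p" for p
      proof -
        have "1 / infdist y C \<le> real p" using N that by (meson of_nat_le_iff order_trans)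
        then have "1 \<le> real p * infdist y C" using pos by (simp add: field_simps)
        then show ?thesis by (simp add: g_def)
      qed
      then have "eventually (\<lambda>p. g p y = indicator C y) sequentially"
        using y by (intro eventually_sequentiallyI[of N]) simp
      then show ?thesis by (rule tendsto_eventually)
    qed
  qed (auto simp: g_def intro!: continuous_intros mult_nonneg_nonneg infdist_nonneg)
qed

lemma finite_measure_eqI_closed:
  fixes P Q :: "'a::topological_space measure"
  assumes "finite_measure P" "sets P = sets borel" "sets Q = sets borel"
    and "\<And>C. closed C \<Longrightarrow> emeasure P C = emeasure Q C"
  shows "P = Q"
proof (rule measure_eqI_generator_eq[where E = "Collect closed" and \<Omega> = UNIV and A = "\<lambda>_. UNIV"])
  interpret finite_measure P by fact
  show "emeasure P UNIV \<noteq> \<infinity>" by (simp add: emeasure_finite)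
  have "sets borel = sigma_sets UNIV (Collect (closed :: 'a set \<Rightarrow> bool))"
    by (subst borel_eq_closed) simp
  then show "sets P = sigma_sets UNIV (Collect closed)" "sets Q = sigma_sets UNIV (Collect closed)"
    using assms(2,3) by auto
qed (use assms(4) in \<open>auto simp: Int_stable_def\<close>)

text \<open>\<open>\<N>\<close> is noise known from time 0 on. Enlarging the filtration of
  \<open>B\<close> by an independent sigma-algebra keeps the increments independent of the past and
  lets stopping times depend on \<open>\<N>\<close>.\<close>

locale brownian_noise = brownian M B for M :: "'w measure" and B :: "real \<Rightarrow> 'w \<Rightarrow> 'a::euclidean_space" +
  fixes \<N> :: "'w set set"
  assumes noise: "sigma_algebra (space M) \<N>" "indep_set (gen_path M {0..} B) \<N>"
begin

abbreviation history :: "real \<Rightarrow> 'w measure" where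
  "history q \<equiv> augmented M (gen_path M {0..q} B \<union> \<N>)"

lemma gen_path_events: "gen_path M T B \<subseteq> events" if "T \<subseteq> {0..}"
  using that B_measurable by (intro gen_path_subset_sets) auto

lemma noise_events: "\<N> \<subseteq> events"
  using indep_setD_ev2[OF noise(2)] .

lemma history_generator: "gen_path M {0..q} B \<union> \<N> \<subseteq> events"
  using gen_path_events[of "{0..q}"] noise_events by auto

lemma history_events: "sets (history q) \<subseteq> events"
  by (rule augmented_subset_sets[OF history_generator])

lemma space_history [simp]: "space (history q) = space M"
  by (rule space_augmented[OF history_generator])

lemma history_mono: "q \<le> r \<Longrightarrow> sets (history q) \<subseteq> sets (history r)"
  using gen_path_mono[of "{0..q}" "{0..r}" M B] augmented_superset[OF history_generator[of r]]
  by (intro augmented_mono history_generator) auto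

text \<open>Independence from \<open>\<N>\<close> and from the Brownian past are used one after the
  other on events \<open>a \<inter> b\<close>, which generate the completed history.\<close>

lemma increments_indep_history:
  assumes t: "mono t" "0 \<le> q" "q \<le> t 0" and C: "\<And>i. C i \<in> sets borel" and H: "H \<in> sets (history q)"
  shows "prob (H \<inter> increments_in M B t n C) = prob H * (\<Prod>i<n. law (t (Suc i) - t i) (C i))"
proof -
  let ?Q = "increments_in M B t n C"
  have t0: "0 \<le> t i" for i using t monoD[OF t(1), of 0 i] by auto
  have Q: "?Q \<in> gen_path M {0..} B"
  proof -
    let ?N = "vimage_algebra (space M) (path {0..} B) (path_space {0..})"
    have "?Q \<in> sets ?N"
      by (intro increments_in_sets measurable_if_gen_path_subset[of M "{0..}"])
         (use t0 C in \<open>auto simp: gen_def\<close>)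
    then show ?thesis by (simp add: gen_def)
  qed
  have Qe: "?Q \<in> events" using Q gen_path_events[of "{0..}"] by auto
  have "prob (?Q \<inter> H) = prob ?Q * prob H"
  proof (rule indep_event_augmented_join[OF Qe _ _ _ _ _ _ _ H])
    fix a b assume a: "a \<in> gen_path M {0..q} B" and b: "b \<in> \<N>"
    have a': "a \<in> gen_path M {0..} B" using a gen_path_mono[of "{0..q}" "{0..}" M B] by auto
    interpret G: sigma_algebra "space M" "gen_path M {0..} B" by (rule sigma_algebra_gen)
    have "prob (?Q \<inter> (a \<inter> b)) = prob ((?Q \<inter> a) \<inter> b)" by (simp add: Int_assoc)
    also have "\<dots> = prob (?Q \<inter> a) * prob b" using Q a' b by (intro indep_setD[OF noise(2)]) auto
    also have "prob (?Q \<inter> a) = prob ?Q * prob a" using t C a by (intro increments_indep_past) auto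
    also have "prob ?Q * prob a * prob b = prob ?Q * prob (a \<inter> b)"
      using indep_setD[OF noise(2) a' b] by simp
    finally show "prob (?Q \<inter> (a \<inter> b)) = prob ?Q * prob (a \<inter> b)" .
  next
    interpret G: sigma_algebra "space M" "gen_path M {0..q} B" by (rule sigma_algebra_gen)
    show "space M \<in> gen_path M {0..q} B" by auto
    interpret N: sigma_algebra "space M" \<N> by (rule noise(1))
    show "space M \<in> \<N>" by auto
    show "Int_stable (gen_path M {0..q} B)" by (rule sigma_algebra_imp_Int_stable[OF sigma_algebra_gen])
    show "Int_stable \<N>" by (rule sigma_algebra_imp_Int_stable[OF noise(1)])
    show "gen_path M {0..q} B \<subseteq> events" by (rule gen_path_events) simp
    show "\<N> \<subseteq> events" by (rule noise_events)
  qed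
  then show ?thesis using t C t0 by (simp add: Int_commute prob_increments_in)
qed

text \<open>The event \<open>H\<close> enters as one further random variable, its indicator at index
  \<open>n\<close>, next to the \<open>n\<close> increments, so that the product rule for integrals
  applies to all factors at once.\<close>

lemma nn_integral_increments_history:
  fixes g :: "nat \<Rightarrow> 'a \<Rightarrow> real"
  assumes t: "mono t" "0 \<le> q" "q \<le> t 0" and g: "\<And>i. g i \<in> borel_measurable borel"
    and H: "H \<in> sets (history q)"
  shows "(\<integral>\<^sup>+\<omega>. indicator H \<omega> * (\<Prod>i<n. ennreal (g i (B (t (Suc i)) \<omega> - B (t i) \<omega>))) \<partial>M) =
     emeasure M H * (\<Prod>i<n. \<integral>\<^sup>+\<omega>. ennreal (g i (B (t (Suc i) - t i) \<omega>)) \<partial>M)"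
proof -
  have t0: "0 \<le> t i" "t i \<le> t (Suc i)" for i using t monoD[OF t(1), of 0 i] monoD[OF t(1), of i "Suc i"] by auto
  define V where "V i \<omega> = B (t (Suc i)) \<omega> - B (t i) \<omega>" for i \<omega>
  have V: "V i \<in> borel_measurable M" for i
    unfolding V_def using t0 by (intro borel_measurable_diff B_measurable) auto
  have He: "H \<in> events" using H history_events by auto
  define Y where "Y i = (if i < n then (\<lambda>\<omega>. ennreal (g i (V i \<omega>))) else indicator H)" for i
  have "indep_vars (\<lambda>_. borel) Y {..n}"
  proof (subst indep_vars_def2, intro conjI ballI)
    show "Y i \<in> borel_measurable M" for i
      unfolding Y_def using He g V by (auto intro!: measurable_compose[OF V measurable_compose[OF g measurable_ennreal]])
    have sub: "{Y i -` A \<inter> space M |A. A \<in> sets borel} \<subseteq>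
        (if i < n then {V i -` A \<inter> space M |A. A \<in> sets borel} else sets (history q))" for i
    proof (cases "i < n")
      case True
      show ?thesis
      proof
        fix S assume "S \<in> {Y i -` A \<inter> space M |A. A \<in> sets borel}"
        then obtain A where A: "A \<in> sets borel" "S = Y i -` A \<inter> space M" by auto
        let ?A = "(\<lambda>y. ennreal (g i y)) -` A"
        have "S = V i -` ?A \<inter> space M" using True A(2) by (auto simp: Y_def)
        moreover have "?A \<in> sets borel"
          using measurable_sets[OF measurable_compose[OF g[of i] measurable_ennreal] A(1)] by simp
        ultimately have "\<exists>A. S = V i -` A \<inter> space M \<and> A \<in> sets borel" by (intro exI[of _ ?A] conjI)
        then show "S \<in> (if i < n then {V i -` A \<inter> space M |A. A \<in> sets borel} else sets (history q))"
          using True by simp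
      qed
    next
      case False
      have iH: "(indicator H :: 'w \<Rightarrow> ennreal) \<in> borel_measurable (history q)" using H by simp
      show ?thesis
      proof
        fix S assume "S \<in> {Y i -` A \<inter> space M |A. A \<in> sets borel}"
        then obtain A where A: "A \<in> sets borel" "S = Y i -` A \<inter> space M" by auto
        then show "S \<in> (if i < n then {V i -` A \<inter> space M |A. A \<in> sets borel} else sets (history q))"
          using False measurable_sets[OF iH A(1)] by (simp add: Y_def)
      qed
    qed
    \<comment> \<open>At index \<open>n\<close> the family is enlarged to the whole of
      \<open>history q\<close>, so the product formula for increments and a history event can be
      applied directly.\<close>
    have "indep_sets (\<lambda>i. if i < n then {V i -` A \<inter> space M |A. A \<in> sets borel} else sets (history q)) {..n}"
    proof (subst indep_sets_finite)
      show "\<forall>A\<in>Pi {..n} (\<lambda>i. if i < n then {V i -` A \<inter> space M |A. A \<in> sets borel} else sets (history q)).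
          prob (\<Inter>j\<in>{..n}. A j) = (\<Prod>j\<in>{..n}. prob (A j))"
      proof
        fix A assume A: "A \<in> Pi {..n} (\<lambda>i. if i < n then {V i -` A \<inter> space M |A. A \<in> sets borel} else sets (history q))"
        have "\<forall>i. \<exists>C. i < n \<longrightarrow> A i = V i -` C \<inter> space M \<and> C \<in> sets borel"
        proof
          fix i show "\<exists>C. i < n \<longrightarrow> A i = V i -` C \<inter> space M \<and> C \<in> sets borel"
          proof (cases "i < n")
            case True
            then have "A i \<in> {V i -` A \<inter> space M |A. A \<in> sets borel}" using PiE[OF A, of i] by auto
            then show ?thesis by auto
          qed simp
        qed
        from choice[OF this] obtain C where C: "\<And>i. i < n \<Longrightarrow> A i = V i -` C i \<inter> space M \<and> C i \<in> sets borel" by blast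
        define C' where "C' i = (if i < n then C i else UNIV)" for i
        have C': "C' i \<in> sets borel" for i using C by (auto simp: C'_def)
        have An: "A n \<in> sets (history q)" using PiE[OF A, of n] by auto
        have An': "A n \<subseteq> space M" using An sets.sets_into_space by fastforce
        have "(\<Inter>j\<in>{..n}. A j) = A n \<inter> increments_in M B t n C'"
        proof -
          have "(\<Inter>j\<in>{..n}. A j) = A n \<inter> (\<Inter>j\<in>{..<n}. A j)"
            by (auto simp: lessThan_Suc_atMost[symmetric] less_Suc_eq)
          also have "(\<Inter>j\<in>{..<n}. A j) = (\<Inter>j\<in>{..<n}. V j -` C j \<inter> space M)"
            by (rule INF_cong) (simp_all add: C)
          also have "A n \<inter> \<dots> = A n \<inter> increments_in M B t n C'"
            using An' by (auto simp: increments_in_def C'_def V_def)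
          finally show ?thesis .
        qed
        then have "prob (\<Inter>j\<in>{..n}. A j) = prob (A n) * (\<Prod>i<n. law (t (Suc i) - t i) (C' i))"
          using increments_indep_history[OF t C' An] by simp
        also have "(\<Prod>i<n. law (t (Suc i) - t i) (C' i)) = (\<Prod>i<n. prob (A i))"
        proof (rule prod.cong[OF refl])
          fix i assume "i \<in> {..<n}"
          then have i: "i < n" by simp
          have "V i = (\<lambda>\<omega>. B (t (Suc i)) \<omega> - B (t i) \<omega>)" by (simp add: V_def fun_eq_iff)
          then show "law (t (Suc i) - t i) (C' i) = prob (A i)"
            using C[OF i] i prob_increment[OF t0, of "C i" i] by (simp add: C'_def)
        qed
        also have "prob (A n) * (\<Prod>i<n. prob (A i)) = (\<Prod>j\<in>{..n}. prob (A j))"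
          by (simp add: lessThan_Suc_atMost[symmetric] mult.commute)
        finally show "prob (\<Inter>j\<in>{..n}. A j) = (\<Prod>j\<in>{..n}. prob (A j))" .
      qed
      show "(if i < n then {V i -` A \<inter> space M |A. A \<in> sets borel} else sets (history q)) \<subseteq> events" for i
        using history_events measurable_sets[OF V] by auto
      show "space M \<in> (if i < n then {V i -` A \<inter> space M |A. A \<in> sets borel} else sets (history q))" for i
        using sets.top[of "history q"] by (auto intro!: exI[of _ UNIV])
    qed auto
    then show "indep_sets (\<lambda>i. {Y i -` A \<inter> space M |A. A \<in> sets borel}) {..n}"
      by (rule indep_sets_mono_sets) (use sub in blast)
  qed
  then have "(\<integral>\<^sup>+\<omega>. (\<Prod>i\<in>{..n}. Y i \<omega>) \<partial>M) = (\<Prod>i\<in>{..n}. \<integral>\<^sup>+\<omega>. Y i \<omega> \<partial>M)"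
    by (intro indep_vars_nn_integral) auto
  moreover have "(\<integral>\<^sup>+\<omega>. (\<Prod>i\<in>{..n}. Y i \<omega>) \<partial>M) =
      (\<integral>\<^sup>+\<omega>. indicator H \<omega> * (\<Prod>i<n. ennreal (g i (B (t (Suc i)) \<omega> - B (t i) \<omega>))) \<partial>M)"
    by (intro nn_integral_cong) (simp add: lessThan_Suc_atMost[symmetric] Y_def V_def mult.commute)
  moreover have "(\<Prod>i\<in>{..n}. \<integral>\<^sup>+\<omega>. Y i \<omega> \<partial>M) = emeasure M H * (\<Prod>i<n. \<integral>\<^sup>+\<omega>. ennreal (g i (V i \<omega>)) \<partial>M)"
    using He by (simp add: lessThan_Suc_atMost[symmetric] Y_def mult.commute)
  moreover have "(\<integral>\<^sup>+\<omega>. ennreal (g i (V i \<omega>)) \<partial>M) = (\<integral>\<^sup>+\<omega>. ennreal (g i (B (t (Suc i) - t i) \<omega>)) \<partial>M)" for i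
  proof -
    have eq: "distr M borel (V i) = distr M borel (B (t (Suc i) - t i))"
    proof (rule measure_eqI)
      fix C assume "C \<in> sets (distr M borel (V i))"
      then show "emeasure (distr M borel (V i)) C = emeasure (distr M borel (B (t (Suc i) - t i))) C"
        using V[of i] B_measurable[of "t (Suc i) - t i"] prob_increment[OF t0, of C i] t0
        by (simp add: emeasure_distr emeasure_eq_measure law_def V_def[abs_def])
    qed simp
    have "(\<integral>\<^sup>+\<omega>. ennreal (g i (V i \<omega>)) \<partial>M) = (\<integral>\<^sup>+y. ennreal (g i y) \<partial>distr M borel (V i))"
      using V g by (subst nn_integral_distr) auto
    also have "\<dots> = (\<integral>\<^sup>+\<omega>. ennreal (g i (B (t (Suc i) - t i) \<omega>)) \<partial>M)"
      unfolding eq using B_measurable[of "t (Suc i) - t i"] g t0 by (subst nn_integral_distr) auto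
    finally show ?thesis .
  qed
  ultimately show ?thesis by simp
qed

end

section \<open>The strong Markov property\<close>

locale brownian_stopping = brownian_noise M B \<N>
  for M :: "'w measure" and B :: "real \<Rightarrow> 'w \<Rightarrow> 'a::euclidean_space" and \<N> +
  fixes \<tau> :: "'w \<Rightarrow> ereal"
  assumes \<tau>_nonneg: "\<And>\<omega>. \<omega> \<in> space M \<Longrightarrow> 0 \<le> \<tau> \<omega>"
    and \<tau>_stopping: "\<And>t. 0 \<le> t \<Longrightarrow> {\<omega>\<in>space M. \<tau> \<omega> \<le> ereal t} \<in> sets (history t)"
    and \<tau>_finite: "AE \<omega> in M. \<tau> \<omega> < \<infinity>"
begin

text \<open>The stopped sigma-algebra of \<open>\<tau>\<close> for the enlarged filtration.\<close>

definition past :: "'w set set" where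
  "past = {H\<in>events. \<forall>t\<ge>0. H \<inter> {\<omega>\<in>space M. \<tau> \<omega> \<le> ereal t} \<in> sets (history t)}"

abbreviation "\<beta> \<equiv> increment_after B \<tau>"

text \<open>Rounding is upward, so the discretised time is still a stopping time. On infinite
  \<open>\<tau>\<close> the conversion to reals gives 0, which is why \<open>piece\<close> asks for
  finiteness separately.\<close>

definition grid_index :: "nat \<Rightarrow> 'w \<Rightarrow> nat" where
  "grid_index m \<omega> = nat \<lceil>real_of_ereal (\<tau> \<omega>) * real (Suc m)\<rceil>"

definition piece :: "nat \<Rightarrow> nat \<Rightarrow> 'w set" where
  "piece m j = {\<omega>\<in>space M. \<tau> \<omega> < \<infinity> \<and> grid_index m \<omega> = j}"

lemma past_events: "past \<subseteq> events" by (auto simp: past_def)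

lemma space_in_past: "space M \<in> past"
  using \<tau>_stopping by (auto simp: past_def Int_def)

lemma past_Int: "H \<in> past \<Longrightarrow> H' \<in> past \<Longrightarrow> H \<inter> H' \<in> past"
proof -
  assume *: "H \<in> past" "H' \<in> past"
  have "H \<inter> H' \<inter> S = (H \<inter> S) \<inter> (H' \<inter> S)" for S by auto
  with * show ?thesis by (auto simp: past_def)
qed

lemma \<tau>_measurable: "\<tau> \<in> borel_measurable M"
proof (rule borel_measurableI_le)
  fix y show "{\<omega> \<in> space M. \<tau> \<omega> \<le> y} \<in> events"
  proof (cases y)
    case (real r)
    show ?thesis
    proof (cases "0 \<le> r")
      case True
      from \<tau>_stopping[OF this] history_events[of r] show ?thesis unfolding real by blast
    next
      case False
      then have "\<not> \<tau> \<omega> \<le> y" if "\<omega> \<in> space M" for \<omega>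
        using \<tau>_nonneg[OF that] real by (metis ereal_less_eq(5) order_trans)
      then have "{\<omega> \<in> space M. \<tau> \<omega> \<le> y} = {}" by blast
      then show ?thesis by (simp only: sets.empty_sets)
    qed
  next
    case MInf
    have "\<not> \<tau> \<omega> \<le> y" if "\<omega> \<in> space M" for \<omega>
      using \<tau>_nonneg[OF that] MInf by auto
    then have "{\<omega> \<in> space M. \<tau> \<omega> \<le> y} = {}" by blast
    then show ?thesis by (simp only: sets.empty_sets)
  qed simp
qed

lemma \<tau>_cases:
  assumes "\<omega> \<in> space M" "\<tau> \<omega> < \<infinity>"
  obtains r where "0 \<le> r" "\<tau> \<omega> = ereal r"
  using assms \<tau>_nonneg[OF assms(1)] by (cases "\<tau> \<omega>") auto

lemma grid_index_le_iff:
  assumes "\<omega> \<in> space M" "\<tau> \<omega> < \<infinity>"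
  shows "grid_index m \<omega> \<le> j \<longleftrightarrow> \<tau> \<omega> \<le> ereal (real j / real (Suc m))"
proof -
  obtain r where r: "0 \<le> r" "\<tau> \<omega> = ereal r" by (rule \<tau>_cases[OF assms])
  have "grid_index m \<omega> \<le> j \<longleftrightarrow> \<lceil>r * real (Suc m)\<rceil> \<le> int j"
    unfolding grid_index_def r(2) by (simp add: nat_le_iff)
  also have "\<dots> \<longleftrightarrow> r * real (Suc m) \<le> real j" by (simp add: ceiling_le_iff)
  also have "\<dots> \<longleftrightarrow> r \<le> real j / real (Suc m)" by (simp add: pos_le_divide_eq del: of_nat_Suc)
  finally show ?thesis by (simp add: r(2))
qed

text \<open>A piece is the event that \<open>\<tau>\<close> is at most the grid time
  \<open>j / (m + 1)\<close>, minus the same event for \<open>j - 1\<close>; both are decided by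
  that grid time. For \<open>j = 0\<close> there is nothing to remove.\<close>

lemma past_Int_piece:
  assumes H: "H \<in> past"
  shows "H \<inter> piece m j \<in> sets (history (real j / real (Suc m)))"
proof -
  let ?S = "\<lambda>j. H \<inter> {\<omega>\<in>space M. \<tau> \<omega> \<le> ereal (real j / real (Suc m))}"
  have S: "?S i \<in> sets (history (real j / real (Suc m)))" if "i \<le> j" for i
  proof -
    have "?S i \<in> sets (history (real i / real (Suc m)))" using H by (simp add: past_def)
    moreover have "real i / real (Suc m) \<le> real j / real (Suc m)"
      using that by (intro divide_right_mono) simp_all
    ultimately show ?thesis using history_mono by blast
  qed
  have *: "\<omega> \<in> piece m j \<longleftrightarrow> \<tau> \<omega> \<le> ereal (real j / real (Suc m)) \<and>
      (j \<noteq> 0 \<longrightarrow> \<not> \<tau> \<omega> \<le> ereal (real (j - 1) / real (Suc m)))" if "\<omega> \<in> space M" for \<omega>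
  proof (cases "\<tau> \<omega> < \<infinity>")
    case True
    have "\<omega> \<in> piece m j \<longleftrightarrow> grid_index m \<omega> \<le> j \<and> (j \<noteq> 0 \<longrightarrow> \<not> grid_index m \<omega> \<le> j - 1)"
      using that True by (auto simp: piece_def)
    then show ?thesis unfolding grid_index_le_iff[OF that True] .
  qed (auto simp: piece_def)
  have Hs: "H \<subseteq> space M" using H past_events sets.sets_into_space by blast
  have "H \<inter> piece m j = ?S j - (if j = 0 then {} else ?S (j - 1))"
  proof (rule set_eqI)
    fix \<omega> show "\<omega> \<in> H \<inter> piece m j \<longleftrightarrow> \<omega> \<in> ?S j - (if j = 0 then {} else ?S (j - 1))"
    proof (cases "\<omega> \<in> space M")
      case True
      show ?thesis using *[OF True] True by auto
    next
      case False
      then show ?thesis using Hs by auto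
    qed
  qed
  also have "\<dots> \<in> sets (history (real j / real (Suc m)))"
    using S[of j] S[of "j - 1"] by auto
  finally show ?thesis .
qed

lemma piece_events: "piece m j \<in> events"
proof -
  have "space M \<inter> piece m j \<in> sets (history (real j / real (Suc m)))"
    by (rule past_Int_piece[OF space_in_past])
  moreover have "space M \<inter> piece m j = piece m j" by (auto simp: piece_def)
  ultimately show ?thesis using history_events by auto
qed

lemma grid_tendsto:
  assumes "\<omega> \<in> space M" "\<tau> \<omega> < \<infinity>"
  shows "(\<lambda>m. real (grid_index m \<omega>) / real (Suc m)) \<longlonglongrightarrow> real_of_ereal (\<tau> \<omega>)"
proof -
  obtain r where r: "0 \<le> r" "\<tau> \<omega> = ereal r" by (rule \<tau>_cases[OF assms])
  have lo: "r \<le> real (grid_index m \<omega>) / real (Suc m)" for m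
    using grid_index_le_iff[OF assms, of m "grid_index m \<omega>"] by (simp add: r(2))
  have hi: "real (grid_index m \<omega>) / real (Suc m) \<le> r + 1 / real (Suc m)" for m
  proof -
    have "0 \<le> r * real (Suc m)" using r(1) by simp
    then have "real (grid_index m \<omega>) \<le> r * real (Suc m) + 1"
      unfolding grid_index_def r(2) real_of_ereal.simps by linarith
    then have "real (grid_index m \<omega>) / real (Suc m) \<le> (r * real (Suc m) + 1) / real (Suc m)"
      by (rule divide_right_mono) simp
    then show ?thesis by (simp add: add_divide_distrib del: of_nat_Suc)
  qed
  have "(\<lambda>m. r + 1 / real (Suc m)) \<longlonglongrightarrow> r + 0"
    by (intro tendsto_add tendsto_const LIMSEQ_Suc[OF lim_1_over_n])
  then have "(\<lambda>m. r + 1 / real (Suc m)) \<longlonglongrightarrow> r" by simp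
  then have "(\<lambda>m. real (grid_index m \<omega>) / real (Suc m)) \<longlonglongrightarrow> r"
    by (rule tendsto_sandwich[OF always_eventually[OF allI[OF lo]] always_eventually[OF allI[OF hi]] tendsto_const])
  then show ?thesis by (simp add: r(2))
qed

lemma \<beta>_measurable: "0 \<le> t \<Longrightarrow> \<beta> t \<in> borel_measurable M"
proof -
  assume t: "0 \<le> t"
  have \<sigma>: "(\<lambda>\<omega>. real_of_ereal (\<tau> \<omega>)) \<in> borel_measurable M" using \<tau>_measurable by measurable
  have \<sigma>0: "0 \<le> real_of_ereal (\<tau> \<omega>)" if "\<omega> \<in> space M" for \<omega>
    using \<tau>_nonneg[OF that] by (rule real_of_ereal_pos)
  have 1: "(\<lambda>\<omega>. B (real_of_ereal (\<tau> \<omega>) + t) \<omega>) \<in> borel_measurable M"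
    by (rule measurable_process_at[OF B_measurable B_continuous borel_measurable_add[OF \<sigma>]]) (use \<sigma>0 t in auto)
  have 2: "(\<lambda>\<omega>. B (real_of_ereal (\<tau> \<omega>)) \<omega>) \<in> borel_measurable M"
    by (rule measurable_process_at[OF B_measurable B_continuous \<sigma>]) (use \<sigma>0 in auto)
  have "{\<omega>\<in>space M. \<tau> \<omega> < \<infinity>} \<in> events" using \<tau>_measurable by measurable
  then show ?thesis
    unfolding increment_after_def by (intro measurable_If borel_measurable_diff 1 2) auto
qed

text \<open>On each piece the rounded time is a constant, and the piece intersected with
  \<open>H\<close> is a history event of that time, so the formula for deterministic times applies
  piece by piece. Almost surely the pieces exhaust \<open>H\<close>.\<close>

lemma nn_integral_grid:
  fixes g :: "nat \<Rightarrow> 'a \<Rightarrow> real" and n :: nat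
  assumes t: "mono t" "0 \<le> t 0" and g: "\<And>i. g i \<in> borel_measurable borel" and H: "H \<in> past"
  defines "G \<equiv> \<lambda>q \<omega>. \<Prod>i<n. ennreal (g i (B (q + t (Suc i)) \<omega> - B (q + t i) \<omega>))"
  shows "(\<lambda>\<omega>. indicator (H \<inter> {\<omega>\<in>space M. \<tau> \<omega> < \<infinity>}) \<omega> * G (real (grid_index m \<omega>) / real (Suc m)) \<omega>)
      \<in> borel_measurable M" (is ?meas)
    and "(\<integral>\<^sup>+\<omega>. indicator (H \<inter> {\<omega>\<in>space M. \<tau> \<omega> < \<infinity>}) \<omega> * G (real (grid_index m \<omega>) / real (Suc m)) \<omega> \<partial>M) =
     emeasure M H * (\<Prod>i<n. \<integral>\<^sup>+\<omega>. ennreal (g i (B (t (Suc i) - t i) \<omega>)) \<partial>M)" (is ?int)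
proof -
  let ?F = "{\<omega>\<in>space M. \<tau> \<omega> < \<infinity>}"
  let ?q = "\<lambda>j. real j / real (Suc m)"
  have t0: "0 \<le> t i" for i using monoD[OF t(1), of 0 i] t(2) by simp
  have He: "H \<in> events" using H past_events by auto
  have Gm: "G q \<in> borel_measurable M" if "0 \<le> q" for q
    unfolding G_def
    by (intro borel_measurable_prod_ennreal measurable_compose[OF _ measurable_ennreal]
        measurable_compose[OF borel_measurable_diff g] B_measurable add_nonneg_nonneg that t0)
  have eq: "indicator (H \<inter> ?F) \<omega> * G (?q (grid_index m \<omega>)) \<omega> =
      (\<Sum>j. indicator (H \<inter> piece m j) \<omega> * G (?q j) \<omega>)" if "\<omega> \<in> space M" for \<omega>
  proof -
    have "(\<lambda>j. if j = grid_index m \<omega> then indicator (H \<inter> ?F) \<omega> * G (?q (grid_index m \<omega>)) \<omega> else 0) =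
        (\<lambda>j. indicator (H \<inter> piece m j) \<omega> * G (?q j) \<omega>)"
      using that by (auto simp: piece_def indicator_def fun_eq_iff)
    then show ?thesis
      using sums_single[of "grid_index m \<omega>" "\<lambda>_. indicator (H \<inter> ?F) \<omega> * G (?q (grid_index m \<omega>)) \<omega>"]
      by (simp only: sums_iff)
  qed
  have meas_term: "(\<lambda>\<omega>. indicator (H \<inter> piece m j) \<omega> * G (?q j) \<omega>) \<in> borel_measurable M" for j
    using He piece_events by (intro borel_measurable_times_ennreal borel_measurable_indicator Gm) auto
  have "(\<lambda>\<omega>. \<Sum>j. indicator (H \<inter> piece m j) \<omega> * G (?q j) \<omega>) \<in> borel_measurable M"
    by (intro borel_measurable_suminf_order meas_term)
  then show ?meas by (rule measurable_cong[THEN iffD2, rotated]) (rule eq)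
  let ?K = "\<Prod>i<n. \<integral>\<^sup>+\<omega>. ennreal (g i (B (t (Suc i) - t i) \<omega>)) \<partial>M"
  have "(\<integral>\<^sup>+\<omega>. indicator (H \<inter> ?F) \<omega> * G (?q (grid_index m \<omega>)) \<omega> \<partial>M) =
      (\<integral>\<^sup>+\<omega>. (\<Sum>j. indicator (H \<inter> piece m j) \<omega> * G (?q j) \<omega>) \<partial>M)"
    by (rule nn_integral_cong) (rule eq)
  also have "\<dots> = (\<Sum>j. \<integral>\<^sup>+\<omega>. indicator (H \<inter> piece m j) \<omega> * G (?q j) \<omega> \<partial>M)"
    by (rule nn_integral_suminf) (rule meas_term)
  also have "\<dots> = (\<Sum>j. emeasure M (H \<inter> piece m j) * ?K)"
  proof (rule suminf_cong)
    fix j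
    have m: "mono (\<lambda>i. ?q j + t i)" using t(1) by (auto simp: mono_def)
    have "(\<integral>\<^sup>+\<omega>. indicator (H \<inter> piece m j) \<omega> *
        (\<Prod>i<n. ennreal (g i (B (?q j + t (Suc i)) \<omega> - B (?q j + t i) \<omega>))) \<partial>M) =
      emeasure M (H \<inter> piece m j) * (\<Prod>i<n. \<integral>\<^sup>+\<omega>. ennreal (g i (B (?q j + t (Suc i) - (?q j + t i)) \<omega>)) \<partial>M)"
      by (rule nn_integral_increments_history[OF m _ _ g past_Int_piece[OF H]]) (use t0[of 0] in simp_all)
    then show "(\<integral>\<^sup>+\<omega>. indicator (H \<inter> piece m j) \<omega> * G (?q j) \<omega> \<partial>M) = emeasure M (H \<inter> piece m j) * ?K"
      unfolding G_def by simp
  qed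
  also have "\<dots> = (\<Sum>j. emeasure M (H \<inter> piece m j)) * ?K" by simp
  also have "(\<Sum>j. emeasure M (H \<inter> piece m j)) = emeasure M (\<Union>j. H \<inter> piece m j)"
    using He piece_events by (intro suminf_emeasure) (auto simp: disjoint_family_on_def piece_def)
  also have "\<dots> = emeasure M H"
  proof (rule emeasure_eq_AE)
    show "AE \<omega> in M. \<omega> \<in> (\<Union>j. H \<inter> piece m j) \<longleftrightarrow> \<omega> \<in> H"
      using \<tau>_finite AE_space by eventually_elim (auto simp: piece_def)
  qed (use He piece_events in auto)
  finally show ?int .
qed

text \<open>The right-hand side of the grid formula does not depend on \<open>m\<close>; continuity
  of the paths and of \<open>g\<close> moves the left-hand side to the true time, with 1 as
  dominating function.\<close>

lemma nn_integral_after: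
  fixes g :: "nat \<Rightarrow> 'a \<Rightarrow> real"
  assumes t: "mono t" "0 \<le> t 0" and g: "\<And>i. continuous_on UNIV (g i)" "\<And>i y. 0 \<le> g i y" "\<And>i y. g i y \<le> 1"
    and H: "H \<in> past"
  shows "(\<integral>\<^sup>+\<omega>. indicator (H \<inter> {\<omega>\<in>space M. \<tau> \<omega> < \<infinity>}) \<omega> * ennreal (\<Prod>i<n. g i (\<beta> (t (Suc i)) \<omega> - \<beta> (t i) \<omega>)) \<partial>M) =
     emeasure M H * (\<Prod>i<n. \<integral>\<^sup>+\<omega>. ennreal (g i (B (t (Suc i) - t i) \<omega>)) \<partial>M)"
proof -
  let ?H = "H \<inter> {\<omega>\<in>space M. \<tau> \<omega> < \<infinity>}"
  have t0: "0 \<le> t i" for i using monoD[OF t(1), of 0 i] t(2) by simp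
  have He: "?H \<in> events"
  proof -
    have "{\<omega>\<in>space M. \<tau> \<omega> < \<infinity>} \<in> events" using \<tau>_measurable by measurable
    then show ?thesis using H past_events by auto
  qed
  have gm: "g i \<in> borel_measurable borel" for i using g(1) by (rule borel_measurable_continuous_onI)
  define G where "G q \<omega> = (\<Prod>i<n. ennreal (g i (B (q + t (Suc i)) \<omega> - B (q + t i) \<omega>)))" for q \<omega>
  let ?u = "\<lambda>m \<omega>. indicator ?H \<omega> * G (real (grid_index m \<omega>) / real (Suc m)) \<omega>"
  let ?v = "\<lambda>\<omega>. indicator ?H \<omega> * ennreal (\<Prod>i<n. g i (\<beta> (t (Suc i)) \<omega> - \<beta> (t i) \<omega>))"
  have "(\<lambda>m. \<integral>\<^sup>+\<omega>. ?u m \<omega> \<partial>M) \<longlonglongrightarrow> (\<integral>\<^sup>+\<omega>. ?v \<omega> \<partial>M)"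
  proof (rule nn_integral_dominated_convergence[where w = "\<lambda>_. 1"])
    show "?u m \<in> borel_measurable M" for m
      unfolding G_def by (rule nn_integral_grid(1)[OF t gm H])
    show "?v \<in> borel_measurable M"
      by (intro borel_measurable_times_ennreal borel_measurable_indicator He
          measurable_compose[OF _ measurable_ennreal] borel_measurable_prod
          measurable_compose[OF borel_measurable_diff gm] \<beta>_measurable t0)
    show "AE \<omega> in M. ?u m \<omega> \<le> 1" for m
    proof (rule AE_I2)
      fix \<omega>
      have "G q \<omega> \<le> 1" for q
        unfolding G_def by (rule prod_le_1) (simp add: g(3) ennreal_le_1)
      then show "?u m \<omega> \<le> 1" by (simp add: indicator_def)
    qed
    show "(\<integral>\<^sup>+\<omega>. 1 \<partial>M) < \<infinity>" by (simp add: emeasure_space_1)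
    show "AE \<omega> in M. (\<lambda>m. ?u m \<omega>) \<longlonglongrightarrow> ?v \<omega>"
    proof (rule AE_I2)
      fix \<omega> assume \<omega>: "\<omega> \<in> space M"
      show "(\<lambda>m. ?u m \<omega>) \<longlonglongrightarrow> ?v \<omega>"
      proof (cases "\<omega> \<in> ?H")
        case True
        then have fin: "\<tau> \<omega> < \<infinity>" by simp
        let ?s = "real_of_ereal (\<tau> \<omega>)"
        let ?q = "\<lambda>m. real (grid_index m \<omega>) / real (Suc m)"
        have s: "0 \<le> ?s" using \<tau>_nonneg[OF \<omega>] by (rule real_of_ereal_pos)
        have B: "(\<lambda>m. B (?q m + t i) \<omega>) \<longlonglongrightarrow> B (?s + t i) \<omega>" for i
          by (rule continuous_on_tendsto_compose[OF B_continuous[OF \<omega>] tendsto_add[OF grid_tendsto[OF \<omega> fin] tendsto_const]])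
             (use s t0 in \<open>auto intro!: always_eventually\<close>)
        have "(\<lambda>m. \<Prod>i<n. g i (B (?q m + t (Suc i)) \<omega> - B (?q m + t i) \<omega>)) \<longlonglongrightarrow>
            (\<Prod>i<n. g i (B (?s + t (Suc i)) \<omega> - B (?s + t i) \<omega>))"
          by (intro tendsto_prod continuous_on_tendsto_compose[OF g(1)] tendsto_diff B) auto
        then have "(\<lambda>m. ennreal (\<Prod>i<n. g i (B (?q m + t (Suc i)) \<omega> - B (?q m + t i) \<omega>))) \<longlonglongrightarrow>
            ennreal (\<Prod>i<n. g i (B (?s + t (Suc i)) \<omega> - B (?s + t i) \<omega>))"
          by (rule tendsto_ennrealI)
        moreover have "ennreal (\<Prod>i<n. g i (B (?s + t (Suc i)) \<omega> - B (?s + t i) \<omega>)) = ?v \<omega>"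
          using True fin by (simp add: increment_after_def)
        moreover have "ennreal (\<Prod>i<n. g i (B (?q m + t (Suc i)) \<omega> - B (?q m + t i) \<omega>)) = ?u m \<omega>" for m
          using True by (simp add: G_def prod_ennreal g(2))
        ultimately show ?thesis by simp
      qed simp
    qed
  qed simp
  moreover have "(\<integral>\<^sup>+\<omega>. ?u m \<omega> \<partial>M) =
      emeasure M H * (\<Prod>i<n. \<integral>\<^sup>+\<omega>. ennreal (g i (B (t (Suc i) - t i) \<omega>)) \<partial>M)" for m
    unfolding G_def by (rule nn_integral_grid(2)[OF t gm H])
  ultimately show ?thesis by (simp add: LIMSEQ_const_iff)
qed

text \<open>Continuous functions are pushed to indicators of closed sets. Both sides converge by
  dominated convergence, and the finiteness event drops out because it has full probability.\<close>

lemma strong_markov: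
  assumes t: "mono t" "0 \<le> t 0" and C: "\<And>i. closed (C i)" and H: "H \<in> past"
  shows "prob (H \<inter> increments_in M \<beta> t n C) = prob H * (\<Prod>i<n. law (t (Suc i) - t i) (C i))"
proof -
  let ?F = "{\<omega>\<in>space M. \<tau> \<omega> < \<infinity>}"
  have t0: "0 \<le> t i" "0 \<le> t (Suc i) - t i" for i
    using monoD[OF t(1), of 0 i] monoD[OF t(1), of i "Suc i"] t(2) by auto
  have "\<forall>i. \<exists>g :: nat \<Rightarrow> 'a \<Rightarrow> real. (\<forall>p. continuous_on UNIV (g p)) \<and> (\<forall>p y. 0 \<le> g p y) \<and>
      (\<forall>p y. g p y \<le> 1) \<and> (\<forall>y. (\<lambda>p. g p y) \<longlonglongrightarrow> indicator (C i) y)"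
    using closed_indicator_approx[OF C] by metis
  from choice[OF this] obtain g :: "nat \<Rightarrow> nat \<Rightarrow> 'a \<Rightarrow> real" where
    g: "\<And>i p. continuous_on UNIV (g i p)" "\<And>i p y. 0 \<le> g i p y" "\<And>i p y. g i p y \<le> 1"
    "\<And>i y. (\<lambda>p. g i p y) \<longlonglongrightarrow> indicator (C i) y" by blast
  have g_abs: "\<bar>g i p y\<bar> \<le> 1" for i p y using g(2,3) by simp
  have gm: "g i p \<in> borel_measurable borel" for i p using g(1) by (rule borel_measurable_continuous_onI)
  have He: "H \<in> events" "?F \<in> events" using H past_events \<tau>_measurable by auto
  let ?V = "\<lambda>i \<omega>. \<beta> (t (Suc i)) \<omega> - \<beta> (t i) \<omega>"
  have V: "?V i \<in> borel_measurable M" for i using t0 by (intro borel_measurable_diff \<beta>_measurable) auto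
  let ?B = "\<lambda>i. B (t (Suc i) - t i)"
  have Bm: "?B i \<in> borel_measurable M" for i by (rule B_measurable[OF t0(2)])
  have int1: "(\<lambda>p. expectation (\<lambda>\<omega>. g i p (?B i \<omega>))) \<longlonglongrightarrow> expectation (\<lambda>\<omega>. indicator (C i) (?B i \<omega>))" for i
  proof (rule integral_dominated_convergence[where w = "\<lambda>_. 1"])
    show "(\<lambda>\<omega>. indicator (C i) (?B i \<omega>) :: real) \<in> borel_measurable M"
      using C[of i] by (intro measurable_compose[OF Bm] borel_measurable_indicator) simp
  qed (simp_all add: g g_abs measurable_compose[OF Bm gm])
  have law: "expectation (\<lambda>\<omega>. indicator (C i) (?B i \<omega>)) = law (t (Suc i) - t i) (C i)" for i
  proof -
    have "expectation (\<lambda>\<omega>. indicator (C i) (?B i \<omega>)) = expectation (indicator (?B i -` C i \<inter> space M))"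
      by (rule Bochner_Integration.integral_cong) (auto simp: indicator_def)
    also have "\<dots> = prob (?B i -` C i \<inter> space M)" by simp
    finally show ?thesis by (simp only: law_def)
  qed
  have int2: "(\<lambda>p. expectation (\<lambda>\<omega>. indicator (H \<inter> ?F) \<omega> * (\<Prod>i<n. g i p (?V i \<omega>)))) \<longlonglongrightarrow>
      expectation (\<lambda>\<omega>. indicator (H \<inter> ?F) \<omega> * (\<Prod>i<n. indicator (C i) (?V i \<omega>)))"
  proof (rule integral_dominated_convergence[where w = "\<lambda>_. 1"])
    show "(\<lambda>\<omega>. indicator (H \<inter> ?F) \<omega> * (\<Prod>i<n. indicator (C i) (?V i \<omega>)) :: real) \<in> borel_measurable M"
      using C He by (intro borel_measurable_times borel_measurable_prod measurable_compose[OF V] borel_measurable_indicator) auto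
    show "(\<lambda>\<omega>. indicator (H \<inter> ?F) \<omega> * (\<Prod>i<n. g i p (?V i \<omega>)) :: real) \<in> borel_measurable M" for p
      using He by (intro borel_measurable_times borel_measurable_prod measurable_compose[OF V gm] borel_measurable_indicator) auto
    show "AE \<omega> in M. norm (indicator (H \<inter> ?F) \<omega> * (\<Prod>i<n. g i p (?V i \<omega>))) \<le> 1" for p
    proof (rule AE_I2)
      fix \<omega>
      have "0 \<le> (\<Prod>i<n. g i p (?V i \<omega>))" by (intro prod_nonneg) (simp add: g)
      moreover have "(\<Prod>i<n. g i p (?V i \<omega>)) \<le> 1" by (intro prod_le_1) (simp add: g)
      ultimately show "norm (indicator (H \<inter> ?F) \<omega> * (\<Prod>i<n. g i p (?V i \<omega>))) \<le> 1"
        by (simp add: indicator_def)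
    qed
    show "AE \<omega> in M. (\<lambda>p. indicator (H \<inter> ?F) \<omega> * (\<Prod>i<n. g i p (?V i \<omega>))) \<longlonglongrightarrow>
        indicator (H \<inter> ?F) \<omega> * (\<Prod>i<n. indicator (C i) (?V i \<omega>))"
      by (intro AE_I2 tendsto_mult tendsto_const tendsto_prod g(4))
  qed simp
  have "expectation (\<lambda>\<omega>. indicator (H \<inter> ?F) \<omega> * (\<Prod>i<n. g i p (?V i \<omega>))) =
      prob H * (\<Prod>i<n. expectation (\<lambda>\<omega>. g i p (?B i \<omega>)))" for p
  proof -
    have nn: "(\<integral>\<^sup>+\<omega>. ennreal (g i p (?B i \<omega>)) \<partial>M) = ennreal (expectation (\<lambda>\<omega>. g i p (?B i \<omega>)))" for i
    proof (rule nn_integral_eq_integral)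
      show "integrable M (\<lambda>\<omega>. g i p (?B i \<omega>))"
        by (rule integrable_const_bound[where B = 1]) (simp_all add: g_abs measurable_compose[OF Bm gm])
    qed (simp add: g)
    have pos: "0 \<le> (\<Prod>i<n. g i p (?V i \<omega>))" for \<omega> by (intro prod_nonneg) (simp add: g)
    have "ennreal (expectation (\<lambda>\<omega>. indicator (H \<inter> ?F) \<omega> * (\<Prod>i<n. g i p (?V i \<omega>)))) =
        (\<integral>\<^sup>+\<omega>. ennreal (indicator (H \<inter> ?F) \<omega> * (\<Prod>i<n. g i p (?V i \<omega>))) \<partial>M)"
    proof (rule nn_integral_eq_integral[symmetric])
      show "integrable M (\<lambda>\<omega>. indicator (H \<inter> ?F) \<omega> * (\<Prod>i<n. g i p (?V i \<omega>)))"
      proof (rule integrable_const_bound[where B = 1])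
        show "(\<lambda>\<omega>. indicator (H \<inter> ?F) \<omega> * (\<Prod>i<n. g i p (?V i \<omega>)) :: real) \<in> borel_measurable M"
          using He by (intro borel_measurable_times borel_measurable_prod measurable_compose[OF V gm] borel_measurable_indicator) auto
        have "(\<Prod>i<n. g i p (?V i \<omega>)) \<le> 1" for \<omega> by (intro prod_le_1) (simp add: g)
        then show "AE \<omega> in M. norm (indicator (H \<inter> ?F) \<omega> * (\<Prod>i<n. g i p (?V i \<omega>))) \<le> 1"
          using pos by (intro AE_I2) (simp add: indicator_def)
      qed
    qed (simp add: pos)
    also have "\<dots> = (\<integral>\<^sup>+\<omega>. indicator (H \<inter> ?F) \<omega> * ennreal (\<Prod>i<n. g i p (?V i \<omega>)) \<partial>M)"
      by (intro nn_integral_cong) (simp add: indicator_def)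
    also have "\<dots> = emeasure M H * (\<Prod>i<n. \<integral>\<^sup>+\<omega>. ennreal (g i p (?B i \<omega>)) \<partial>M)"
      by (rule nn_integral_after[OF t _ _ _ H]) (simp_all add: g)
    also have "\<dots> = ennreal (prob H * (\<Prod>i<n. expectation (\<lambda>\<omega>. g i p (?B i \<omega>))))"
      unfolding nn emeasure_eq_measure
      by (simp add: prod_ennreal integral_nonneg g ennreal_mult prod_nonneg)
    finally show ?thesis
      by (rule ennreal_inj[THEN iffD1, rotated 2])
         (auto intro!: integral_nonneg prod_nonneg mult_nonneg_nonneg simp: g pos)
  qed
  then have "(\<lambda>p. prob H * (\<Prod>i<n. expectation (\<lambda>\<omega>. g i p (?B i \<omega>)))) \<longlonglongrightarrow>
      expectation (\<lambda>\<omega>. indicator (H \<inter> ?F) \<omega> * (\<Prod>i<n. indicator (C i) (?V i \<omega>)))"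
    using int2 by simp
  moreover have "(\<lambda>p. prob H * (\<Prod>i<n. expectation (\<lambda>\<omega>. g i p (?B i \<omega>)))) \<longlonglongrightarrow>
      prob H * (\<Prod>i<n. law (t (Suc i) - t i) (C i))"
    unfolding law[symmetric] by (intro tendsto_mult tendsto_const tendsto_prod int1)
  ultimately have "expectation (\<lambda>\<omega>. indicator (H \<inter> ?F) \<omega> * (\<Prod>i<n. indicator (C i) (?V i \<omega>))) =
      prob H * (\<Prod>i<n. law (t (Suc i) - t i) (C i))" by (rule LIMSEQ_unique)
  moreover have "expectation (\<lambda>\<omega>. indicator (H \<inter> ?F) \<omega> * (\<Prod>i<n. indicator (C i) (?V i \<omega>))) =
      expectation (indicat_real ((H \<inter> ?F) \<inter> increments_in M \<beta> t n C))"
  proof (rule Bochner_Integration.integral_cong[OF refl])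
    fix \<omega> assume "\<omega> \<in> space M"
    moreover have "(\<Prod>i<n. indicator (C i) (?V i \<omega>)) = (if \<forall>i<n. ?V i \<omega> \<in> C i then 1 else 0 :: real)"
      by (auto simp: indicator_def)
    ultimately show "indicator (H \<inter> ?F) \<omega> * (\<Prod>i<n. indicator (C i) (?V i \<omega>)) =
        (indicator ((H \<inter> ?F) \<inter> increments_in M \<beta> t n C) \<omega> :: real)"
      by (auto simp: increments_in_def indicator_def)
  qed
  moreover have inc: "increments_in M \<beta> t n C \<in> events"
    using t0 C by (intro increments_in_sets \<beta>_measurable borel_closed) auto
  moreover have "prob ((H \<inter> ?F) \<inter> increments_in M \<beta> t n C) = prob (H \<inter> increments_in M \<beta> t n C)"
  proof (rule finite_measure_eq_AE)
    show "AE \<omega> in M. \<omega> \<in> H \<inter> ?F \<inter> increments_in M \<beta> t n C \<longleftrightarrow> \<omega> \<in> H \<inter> increments_in M \<beta> t n C"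
      using \<tau>_finite AE_space by eventually_elim auto
  qed (use He inc in auto)
  ultimately show ?thesis using He by simp
qed

lemma prob_increments_after:
  assumes "mono t" "0 \<le> t 0" "\<And>i. closed (C i)"
  shows "prob (increments_in M \<beta> t n C) = (\<Prod>i<n. law (t (Suc i) - t i) (C i))"
proof -
  have eq: "space M \<inter> increments_in M \<beta> t n C = increments_in M \<beta> t n C"
    unfolding increments_in_def by blast
  have "prob (space M \<inter> increments_in M \<beta> t n C) = prob (space M) * (\<Prod>i<n. law (t (Suc i) - t i) (C i))"
    by (rule strong_markov[OF assms space_in_past])
  then show ?thesis unfolding eq prob_space by simp
qed

lemma \<beta>_0: "\<omega> \<in> space M \<Longrightarrow> \<beta> 0 \<omega> = 0"
  by (simp add: increment_after_def)

lemma indep_after: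
  assumes "H \<in> past" "E \<in> gen_path M {0..} \<beta>"
  shows "prob (H \<inter> E) = prob H * prob E"
proof (rule indep_event_gen_path[OF _ _ _ \<beta>_0 _ _ assms(2)])
  fix t :: "nat \<Rightarrow> real" and n and C :: "nat \<Rightarrow> 'a set"
  assume t: "mono t" "t 0 = 0" and C: "\<And>i. closed (C i)"
  show "prob (H \<inter> increments_in M \<beta> t n C) = prob H * prob (increments_in M \<beta> t n C)"
  proof -
    have t0: "0 \<le> t 0" using t(2) by simp
    show ?thesis
      unfolding strong_markov[OF t(1) t0 C assms(1)] prob_increments_after[OF t(1) t0 C] by (rule refl)
  qed
next
  show "H \<in> events" using assms(1) past_events by auto
  show "(0::real) \<in> {0..}" "{0..} \<subseteq> {0::real..}" by simp_all
qed (rule \<beta>_measurable, simp)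

lemma prob_increment_after:
  assumes st: "0 \<le> s" "s \<le> t" and C: "closed C"
  shows "prob ((\<lambda>\<omega>. \<beta> t \<omega> - \<beta> s \<omega>) -` C \<inter> space M) = law (t - s) C"
proof -
  define r where "r i = (if i = 0 then s else t)" for i :: nat
  have "mono r" using st by (auto simp: r_def mono_def)
  moreover have "increments_in M \<beta> r 1 (\<lambda>_. C) = (\<lambda>\<omega>. \<beta> t \<omega> - \<beta> s \<omega>) -` C \<inter> space M"
    by (auto simp: increments_in_def r_def)
  moreover have "0 \<le> r 0" using st by (simp add: r_def)
  ultimately show ?thesis using prob_increments_after[of r "\<lambda>_. C" 1] C by (simp add: r_def)
qed

text \<open>Laws and independence are known on closed sets only; uniqueness of measures and the
  pi-system of closed preimages extend them to Borel sets.\<close>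

lemma standard_BM_after: "standard_BM M \<beta>"
  unfolding standard_BM_def
proof (intro conjI allI impI ballI)
  show "\<beta> t \<in> borel_measurable M" if "0 \<le> t" for t using that by (rule \<beta>_measurable)
  show "\<beta> 0 \<omega> = 0" if "\<omega> \<in> space M" for \<omega> using that by (rule \<beta>_0)
  show "continuous_on {0..} (\<lambda>t. \<beta> t \<omega>)" if \<omega>: "\<omega> \<in> space M" for \<omega>
  proof (cases "\<tau> \<omega> < \<infinity>")
    case True
    let ?s = "real_of_ereal (\<tau> \<omega>)"
    have s: "0 \<le> ?s" using \<tau>_nonneg[OF \<omega>] by (rule real_of_ereal_pos)
    have "continuous_on {0..} (\<lambda>t. B (?s + t) \<omega>)"
    proof (rule continuous_on_compose2[OF B_continuous[OF \<omega>], of _ "\<lambda>t. ?s + t"])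
      show "continuous_on {0..} (\<lambda>t. ?s + t)" by (intro continuous_intros)
    qed (use s in auto)
    then show ?thesis using True by (simp add: increment_after_def continuous_on_diff)
  next
    case False
    then show ?thesis by (simp add: increment_after_def)
  qed
next
  fix s t :: real assume "0 \<le> s \<and> s < t"
  then have st: "0 \<le> s" "s < t" "0 \<le> t" "0 < t - s" by auto
  have m: "(\<lambda>\<omega>. \<beta> t \<omega> - \<beta> s \<omega>) \<in> borel_measurable M"
    using st by (intro borel_measurable_diff \<beta>_measurable)
  have Bm: "B (t - s) \<in> borel_measurable M" using st by (intro B_measurable) simp
  have "distr M lborel (\<lambda>\<omega>. \<beta> t \<omega> - \<beta> s \<omega>) = distr M lborel (B (t - s))"
  proof (rule finite_measure_eqI_closed)
    show "finite_measure (distr M lborel (\<lambda>\<omega>. \<beta> t \<omega> - \<beta> s \<omega>))"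
      using m by (intro finite_measure_distr) simp
    fix C :: "'a set" assume "closed C"
    then show "emeasure (distr M lborel (\<lambda>\<omega>. \<beta> t \<omega> - \<beta> s \<omega>)) C = emeasure (distr M lborel (B (t - s))) C"
      using m Bm prob_increment_after[of s t C] st
      by (simp add: emeasure_distr emeasure_eq_measure law_def)
  qed simp_all
  then show "distributed M lborel (\<lambda>\<omega>. \<beta> t \<omega> - \<beta> s \<omega>)
      (\<lambda>y. \<Prod>b\<in>Basis. normal_density 0 (sqrt (t - s)) (y \<bullet> b))"
    using B_distributed_0[OF st(4)] m unfolding distributed_def by simp
next
  fix t :: "nat \<Rightarrow> real" assume t': "0 \<le> t 0 \<and> mono t"
  then have t: "mono t" "0 \<le> t 0" by auto
  have t0: "0 \<le> t i" "t i \<le> t (Suc i)" for i using monoD[OF t(1), of 0 i] monoD[OF t(1), of i "Suc i"] t(2) by auto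
  let ?V = "\<lambda>i \<omega>. \<beta> (t (Suc i)) \<omega> - \<beta> (t i) \<omega>"
  let ?E = "\<lambda>i. {?V i -` C \<inter> space M | C. closed C}"
  have V: "?V i \<in> borel_measurable M" for i using t0 by (intro borel_measurable_diff \<beta>_measurable)
  have "indep_sets ?E UNIV"
  proof (rule indep_setsI)
    show "?E i \<subseteq> events" for i using measurable_sets[OF V[of i]] by auto
    fix A J assume J: "J \<noteq> {}" "J \<subseteq> UNIV" "finite J" "\<forall>j\<in>J. A j \<in> ?E j"
    have "\<forall>j\<in>J. \<exists>C. A j = ?V j -` C \<inter> space M \<and> closed C" using J(4) by simp
    from bchoice[OF this] obtain C where C: "\<And>j. j \<in> J \<Longrightarrow> A j = ?V j -` C j \<inter> space M \<and> closed (C j)" by blast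
    \<comment> \<open>Indices outside \<open>J\<close> are left free, which turns a finite subfamily
      into an initial block of increments.\<close>
    define C' where "C' j = (if j \<in> J then C j else UNIV)" for j
    have C': "closed (C' j)" for j using C by (simp add: C'_def)
    define n where "n = Suc (Max J)"
    have n: "J \<subseteq> {..<n}" using J(3) by (auto simp: n_def less_Suc_eq_le)
    have "(\<Inter>j\<in>J. A j) = (\<Inter>j\<in>J. ?V j -` C j \<inter> space M)" by (rule INF_cong) (simp_all add: C)
    also have "\<dots> = increments_in M \<beta> t n C'"
      using J(1) n by (auto simp: increments_in_def C'_def)
    finally have "prob (\<Inter>j\<in>J. A j) = (\<Prod>i<n. law (t (Suc i) - t i) (C' i))"
      using prob_increments_after[OF t C'] by simp
    also have "\<dots> = (\<Prod>i\<in>J. law (t (Suc i) - t i) (C' i))"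
      using n by (intro prod.mono_neutral_right) (auto simp: C'_def)
    also have "\<dots> = (\<Prod>j\<in>J. prob (A j))"
    proof (rule prod.cong[OF refl])
      fix j assume j: "j \<in> J"
      show "law (t (Suc j) - t j) (C' j) = prob (A j)"
        using C[OF j] j prob_increment_after[OF t0, of "C j" j] by (simp add: C'_def)
    qed
    finally show "prob (\<Inter>j\<in>J. A j) = (\<Prod>j\<in>J. prob (A j))" .
  qed
  then have "indep_sets (\<lambda>i. sigma_sets (space M) (?E i)) UNIV"
  proof (rule indep_sets_sigma)
    fix i
    show "Int_stable (?E i)"
    proof (rule Int_stableI)
      fix a b assume "a \<in> ?E i" "b \<in> ?E i"
      then obtain C C' where "a = ?V i -` C \<inter> space M" "closed C" "b = ?V i -` C' \<inter> space M" "closed C'" by auto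
      then have "a \<inter> b = ?V i -` (C \<inter> C') \<inter> space M \<and> closed (C \<inter> C')" by auto
      then show "a \<inter> b \<in> ?E i" by blast
    qed
  qed
  then have "indep_sets (\<lambda>i. {?V i -` A \<inter> space M |A. A \<in> sets borel}) UNIV"
  proof (rule indep_sets_mono_sets)
    fix i
    have sub: "?E i \<subseteq> Pow (space M)" by auto
    have "?V i \<in> borel_measurable (sigma (space M) (?E i))"
      unfolding borel_eq_closed
    proof (rule measurable_measure_of)
      fix S :: "'a set" assume "S \<in> Collect closed"
      then have "?V i -` S \<inter> space M \<in> ?E i" by auto
      then show "?V i -` S \<inter> space (sigma (space M) (?E i)) \<in> sets (sigma (space M) (?E i))"
        unfolding space_measure_of[OF sub] by (rule in_measure_of[OF sub])
    qed auto
    from measurable_sets[OF this]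
    show "{?V i -` A \<inter> space M |A. A \<in> sets borel} \<subseteq> sigma_sets (space M) (?E i)"
      unfolding space_measure_of[OF sub] sets_measure_of[OF sub] by auto
  qed
  then show "indep_vars (\<lambda>_. borel) ?V UNIV"
    unfolding indep_vars_def2 using V by simp
qed

end

section \<open>Atoms of a Poisson random measure\<close>

lemma emeasure_count_space_eq_0_iff: "S \<subseteq> A \<Longrightarrow> emeasure (count_space A) S = 0 \<longleftrightarrow> S = {}"
  by (cases "finite S") auto

locale poisson_atoms = prob_space M for M :: "'w measure" +
  fixes D :: "'a::euclidean_space set" and \<mu> :: "'a measure" and \<nu> :: "'w \<Rightarrow> (real \<times> 'a) measure"
    and \<l> :: "nat \<Rightarrow> 'w \<Rightarrow> real" and Z :: "nat \<Rightarrow> 'w \<Rightarrow> 'a"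
  assumes \<mu>_prob: "prob_space \<mu>" and sets_\<mu>: "sets \<mu> = sets (restrict_space borel D)"
    and prm: "poisson_random_measure M (jump_intensity \<mu>) \<nu>"
    and \<l>_measurable': "\<And>k. 1 \<le> k \<Longrightarrow> \<l> k \<in> borel_measurable M" and \<l>_0: "\<And>\<omega>. \<l> 0 \<omega> = 0"
    and Z_measurable: "\<And>k. 1 \<le> k \<Longrightarrow> Z k \<in> measurable M (restrict_space borel D)"
    and atoms: "AE \<omega> in M. (\<forall>k\<ge>1. 0 \<le> \<l> k \<omega>) \<and> strict_mono_on {1..} (\<lambda>k. \<l> k \<omega>) \<and>
           \<nu> \<omega> = distr (count_space {1..}) (jump_intensity \<mu>) (\<lambda>k. (\<l> k \<omega>, Z k \<omega>))"
begin

interpretation \<mu>: prob_space \<mu> by (rule \<mu>_prob)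

abbreviation "\<Lambda> \<equiv> jump_intensity \<mu>"

definition N :: "(real \<times> 'a) set \<Rightarrow> 'w \<Rightarrow> ennreal" where "N C \<omega> = emeasure (\<nu> \<omega>) C"

lemma space_\<mu>: "space \<mu> = D"
  using sets_eq_imp_space_eq[OF sets_\<mu>] by (simp add: space_restrict_space)

lemma D_sets: "D \<in> sets \<mu>" using sets.top[of \<mu>] by (simp add: space_\<mu>)

lemma space_\<Lambda>: "space \<Lambda> = {0..} \<times> D"
  by (simp add: jump_intensity_def space_pair_measure space_\<mu> space_restrict_space)

lemma \<l>_measurable: "\<l> k \<in> borel_measurable M"
proof (cases k)
  case 0
  have "\<l> 0 = (\<lambda>_. 0)" by (simp add: fun_eq_iff \<l>_0)
  then show ?thesis using 0 by simp
qed (simp add: \<l>_measurable')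

lemma Z_borel: "1 \<le> k \<Longrightarrow> Z k \<in> borel_measurable M"
  using measurable_restrict_space2_iff[of "Z k" M borel D] Z_measurable[of k] by simp

lemma Z_in_D: "1 \<le> k \<Longrightarrow> \<omega> \<in> space M \<Longrightarrow> Z k \<omega> \<in> D"
  using measurable_space[OF Z_measurable, of k \<omega>] by (simp add: space_restrict_space)

lemma N_measurable: "C \<in> sets \<Lambda> \<Longrightarrow> N C \<in> borel_measurable M"
  using prm unfolding poisson_random_measure_def N_def[abs_def] by simp

lemma strip_sets: "0 \<le> a \<Longrightarrow> A \<in> sets \<mu> \<Longrightarrow> {a..<b} \<times> A \<in> sets \<Lambda>"
  unfolding jump_intensity_def
  by (rule pair_measureI) (auto simp: sets_restrict_space_iff)

lemma emeasure_strip: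
  assumes "0 \<le> a" "a \<le> b" "A \<in> sets \<mu>"
  shows "emeasure \<Lambda> ({a..<b} \<times> A) = ennreal ((b - a) * measure \<mu> A)"
proof -
  have "emeasure \<Lambda> ({a..<b} \<times> A) = emeasure (restrict_space lborel {0..}) {a..<b} * emeasure \<mu> A"
    unfolding jump_intensity_def
    by (rule \<mu>.emeasure_pair_measure_Times) (use assms in \<open>auto simp: sets_restrict_space_iff\<close>)
  also have "emeasure (restrict_space lborel {0..}) {a..<b} = emeasure lborel {a..<b}"
    using assms by (intro emeasure_restrict_space) auto
  also have "\<dots> = ennreal (b - a)" using assms by simp
  finally show ?thesis by (simp add: \<mu>.emeasure_eq_measure ennreal_mult' assms)
qed

lemma prob_N_eq:
  assumes "C \<in> sets \<Lambda>" "emeasure \<Lambda> C < \<infinity>"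
  shows "prob {\<omega>\<in>space M. N C \<omega> = of_nat m} = exp (- measure \<Lambda> C) * measure \<Lambda> C ^ m / fact m"
  using prm assms unfolding poisson_random_measure_def N_def by simp

lemma prob_void:
  assumes "0 \<le> a" "a \<le> b" "A \<in> sets \<mu>"
  shows "prob {\<omega>\<in>space M. N ({a..<b} \<times> A) \<omega> = 0} = exp (- ((b - a) * measure \<mu> A))"
proof -
  have "0 \<le> (b - a) * measure \<mu> A" using assms by simp
  then show ?thesis
    using prob_N_eq[OF strip_sets[OF assms(1,3)], of b 0] emeasure_strip[OF assms]
    by (simp add: measure_def)
qed

lemma N_event: "C \<in> sets \<Lambda> \<Longrightarrow> {\<omega>\<in>space M. N C \<omega> = c} \<in> events"
  using N_measurable[of C] by measurable

text \<open>The Poisson weights sum to 1, so the natural numbers already carry the full law of the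
  count.\<close>

lemma AE_N_finite:
  assumes C: "C \<in> sets \<Lambda>" "emeasure \<Lambda> C < \<infinity>"
  shows "AE \<omega> in M. N C \<omega> < \<infinity>"
proof -
  let ?E = "\<lambda>m::nat. {\<omega>\<in>space M. N C \<omega> = of_nat m}"
  have "(\<lambda>m. prob (?E m)) sums prob (\<Union>m. ?E m)"
    using N_event[OF C(1)] by (intro finite_measure_UNION) (auto simp: disjoint_family_on_def)
  moreover have "(\<lambda>m. prob (?E m)) sums 1"
  proof -
    let ?c = "measure \<Lambda> C"
    have "(\<lambda>m. exp (- ?c) * (?c ^ m / fact m)) sums (exp (- ?c) * exp ?c)"
      using exp_converges[of ?c] by (intro sums_mult) (simp add: divide_inverse mult.commute)
    then show ?thesis unfolding prob_N_eq[OF C] by (simp add: exp_minus)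
  qed
  ultimately have "prob (\<Union>m. ?E m) = 1" by (rule sums_unique2)
  then have "AE \<omega> in M. \<omega> \<in> (\<Union>m. ?E m)" using N_event[OF C(1)] by (subst (asm) prob_eq_1) auto
  then show ?thesis by eventually_elim (auto simp: less_top[symmetric])
qed

section \<open>Almost sure structure of the atoms\<close>

definition atoms_in :: "'w \<Rightarrow> (real \<times> 'a) set \<Rightarrow> nat set" where
  "atoms_in \<omega> C = {k. 1 \<le> k \<and> (\<l> k \<omega>, Z k \<omega>) \<in> C}"

text \<open>Strict monotonicity includes index 0, whose level is 0, so it also says that no atom
  sits at level 0.\<close>

definition regular :: "'w \<Rightarrow> bool" where
  "regular \<omega> \<longleftrightarrow> \<omega> \<in> space M \<and> strict_mono (\<lambda>k. \<l> k \<omega>) \<and> (\<forall>c. finite {k. \<l> k \<omega> \<le> c}) \<and>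
     (\<forall>C\<in>sets \<Lambda>. N C \<omega> = emeasure (count_space {1..}) (atoms_in \<omega> C))"

lemma AE_regular: "AE \<omega> in M. regular \<omega>"
proof -
  \<comment> \<open>The assumptions allow an atom at level 0; it is excluded almost surely because
    this set has intensity 0.\<close>
  have zero_set: "{0} \<times> D \<in> sets \<Lambda>"
    unfolding jump_intensity_def
    by (rule pair_measureI) (auto simp: sets_restrict_space_iff D_sets)
  have "emeasure \<Lambda> ({0} \<times> D) = emeasure (restrict_space lborel {0..}) {0::real} * emeasure \<mu> D"
    unfolding jump_intensity_def
    by (rule \<mu>.emeasure_pair_measure_Times) (auto simp: sets_restrict_space_iff D_sets)
  also have "emeasure (restrict_space lborel {0..}) {0::real} = emeasure lborel {0::real}"
    by (intro emeasure_restrict_space) auto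
  finally have "emeasure \<Lambda> ({0} \<times> D) = 0" by simp
  then have "prob {\<omega>\<in>space M. N ({0} \<times> D) \<omega> = 0} = 1"
    using prob_N_eq[OF zero_set, of 0] by (simp add: measure_def)
  then have 0: "AE \<omega> in M. N ({0} \<times> D) \<omega> = 0"
    using N_event[OF zero_set] by (subst (asm) prob_eq_1) (auto elim: eventually_mono)
  \<comment> \<open>Finite counts below every integer give finitely many levels below any
    bound.\<close>
  have fin: "AE \<omega> in M. \<forall>n::nat. N ({0..<real n} \<times> D) \<omega> < \<infinity>"
  proof (subst AE_all_countable, intro allI)
    fix n :: nat
    show "AE \<omega> in M. N ({0..<real n} \<times> D) \<omega> < \<infinity>"
      by (rule AE_N_finite) (use strip_sets[OF _ D_sets, of 0 "real n"] emeasure_strip[OF _ _ D_sets, of 0 "real n"] in auto)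
  qed
  show ?thesis
    using 0 fin atoms AE_space
  proof eventually_elim
    case (elim \<omega>)
    have Zin: "(\<l> k \<omega>, Z k \<omega>) \<in> space \<Lambda>" if "1 \<le> k" for k
      using elim(3) Z_in_D[OF that elim(4)] that by (simp add: space_\<Lambda>)
    have N: "N C \<omega> = emeasure (count_space {1..}) (atoms_in \<omega> C)" if C: "C \<in> sets \<Lambda>" for C
    proof -
      have "N C \<omega> = emeasure (distr (count_space {1..}) \<Lambda> (\<lambda>k. (\<l> k \<omega>, Z k \<omega>))) C"
        using elim(3) by (simp add: N_def)
      also have "\<dots> = emeasure (count_space {1..}) ((\<lambda>k. (\<l> k \<omega>, Z k \<omega>)) -` C \<inter> {1..})"
        using C Zin by (subst emeasure_distr) auto
      also have "(\<lambda>k. (\<l> k \<omega>, Z k \<omega>)) -` C \<inter> {1..} = atoms_in \<omega> C"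
        unfolding atoms_in_def by auto
      finally show ?thesis .
    qed
    have pos: "0 < \<l> k \<omega>" if k: "1 \<le> k" for k
    proof -
      have "atoms_in \<omega> ({0} \<times> D) = {}"
        using N[OF zero_set] elim(1) emeasure_count_space_eq_0_iff[of "atoms_in \<omega> ({0} \<times> D)" "{1..}"]
        by (auto simp: atoms_in_def)
      then have "\<l> k \<omega> \<noteq> 0" using k Z_in_D[OF k elim(4)] unfolding atoms_in_def by blast
      moreover have "0 \<le> \<l> k \<omega>" using elim(3) k by blast
      ultimately show ?thesis by simp
    qed
    have "strict_mono (\<lambda>k. \<l> k \<omega>)"
    proof (rule strict_monoI)
      fix i j :: nat assume ij: "i < j"
      show "\<l> i \<omega> < \<l> j \<omega>"
      proof (cases "i = 0")
        case True
        then show ?thesis using pos[of j] ij by (simp add: \<l>_0)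
      next
        case False
        have "strict_mono_on {1..} (\<lambda>k. \<l> k \<omega>)" using elim(3) by blast
        from strict_mono_onD[OF this, of i j] show ?thesis using ij False by simp
      qed
    qed
    moreover have "finite {k. \<l> k \<omega> \<le> c}" for c
    proof -
      obtain n :: nat where n: "c < real n" using reals_Archimedean2 by blast
      have "emeasure (count_space {1..}) (atoms_in \<omega> ({0..<real n} \<times> D)) < \<infinity>"
        using elim(2) N[OF strip_sets[OF order_refl D_sets]] by simp
      then have "finite (atoms_in \<omega> ({0..<real n} \<times> D))"
        by (rule contrapos_pp) (simp add: emeasure_count_space_infinite atoms_in_def subset_eq)
      moreover have "{k. \<l> k \<omega> \<le> c} \<subseteq> insert 0 (atoms_in \<omega> ({0..<real n} \<times> D))"
      proof
        fix k assume k: "k \<in> {k. \<l> k \<omega> \<le> c}"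
        show "k \<in> insert 0 (atoms_in \<omega> ({0..<real n} \<times> D))"
        proof (cases "k = 0")
          case False
          then show ?thesis using k n pos[of k] Z_in_D[OF _ elim(4), of k] by (simp add: atoms_in_def)
        qed simp
      qed
      ultimately show ?thesis by (meson finite_insert finite_subset)
    qed
    ultimately show ?case using N elim(4) by (simp add: regular_def)
  qed
qed

lemma regular_N_eq_0:
  assumes "regular \<omega>" "C \<in> sets \<Lambda>"
  shows "N C \<omega> = 0 \<longleftrightarrow> (\<forall>k\<ge>1. (\<l> k \<omega>, Z k \<omega>) \<notin> C)"
proof -
  have "atoms_in \<omega> C \<subseteq> {1..}" by (auto simp: atoms_in_def)
  then have "N C \<omega> = 0 \<longleftrightarrow> atoms_in \<omega> C = {}"
    using assms emeasure_count_space_eq_0_iff[of "atoms_in \<omega> C" "{1..}"] by (simp add: regular_def)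
  then show ?thesis by (auto simp: atoms_in_def)
qed

lemma regular_strip_eq_0:
  assumes "regular \<omega>" "0 \<le> a" "A \<in> sets \<mu>"
  shows "N ({a..<b} \<times> A) \<omega> = 0 \<longleftrightarrow> (\<forall>k\<ge>1. a \<le> \<l> k \<omega> \<and> \<l> k \<omega> < b \<longrightarrow> Z k \<omega> \<notin> A)"
  unfolding regular_N_eq_0[OF assms(1) strip_sets[OF assms(2,3)]] by auto

lemma regular_less_iff: "regular \<omega> \<Longrightarrow> \<l> i \<omega> < \<l> j \<omega> \<longleftrightarrow> i < j"
  using strict_mono_less[of "\<lambda>k. \<l> k \<omega>" i j] by (simp add: regular_def)

lemma regular_le_iff: "regular \<omega> \<Longrightarrow> \<l> i \<omega> \<le> \<l> j \<omega> \<longleftrightarrow> i \<le> j"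
  using strict_mono_less_eq[of "\<lambda>k. \<l> k \<omega>" i j] by (simp add: regular_def)

lemma regular_nonneg: "regular \<omega> \<Longrightarrow> 0 \<le> \<l> i \<omega>"
  using regular_le_iff[of \<omega> 0 i] by (simp add: \<l>_0)

text \<open>Independence is known for counts, so levels have to be read from them; the half-open
  strip matches the strict inequality.\<close>

lemma regular_level_iff:
  assumes r: "regular \<omega>" and q: "0 \<le> q" and i: "1 \<le> i"
  shows "\<l> i \<omega> < q \<longleftrightarrow> of_nat i \<le> N ({0..<q} \<times> D) \<omega>"
proof -
  define S where "S = atoms_in \<omega> ({0..<q} \<times> D)"
  have S: "S = {k. 1 \<le> k \<and> \<l> k \<omega> < q}"
    using r regular_nonneg[OF r] Z_in_D[of _ \<omega>] by (auto simp: S_def atoms_in_def regular_def)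
  have "finite {k. \<l> k \<omega> \<le> q}" using r by (simp add: regular_def)
  then have fin: "finite S" by (rule finite_subset[rotated]) (auto simp: S)
  have "N ({0..<q} \<times> D) \<omega> = emeasure (count_space {1..}) S"
    using r strip_sets[OF order_refl D_sets] by (simp add: regular_def S_def)
  also have "\<dots> = of_nat (card S)"
    using fin by (subst emeasure_count_space_finite) (auto simp: S)
  finally have N: "N ({0..<q} \<times> D) \<omega> = of_nat (card S)" .
  show ?thesis
  proof
    assume "\<l> i \<omega> < q"
    then have "{1..i} \<subseteq> S" using regular_le_iff[OF r, of _ i] by (force simp: S)
    from card_mono[OF fin this] show "of_nat i \<le> N ({0..<q} \<times> D) \<omega>" unfolding N by simp
  next
    assume "of_nat i \<le> N ({0..<q} \<times> D) \<omega>"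
    then have c: "i \<le> card S" unfolding N by simp
    show "\<l> i \<omega> < q"
    proof (rule ccontr)
      assume *: "\<not> \<l> i \<omega> < q"
      have "S \<subseteq> {1..<i}"
      proof
        fix k assume "k \<in> S"
        then have "\<l> k \<omega> < \<l> i \<omega>" "1 \<le> k" using * by (auto simp: S)
        then show "k \<in> {1..<i}" using regular_less_iff[OF r] by simp
      qed
      from card_mono[OF _ this] have "card S \<le> i - 1" by simp
      with c i show False by simp
    qed
  qed
qed

section \<open>Independence of counts over disjoint regions\<close>

definition counts_in :: "nat \<Rightarrow> (nat \<Rightarrow> (real \<times> 'a) set) \<Rightarrow> (nat \<Rightarrow> ennreal set) \<Rightarrow> 'w set" where
  "counts_in m C U = {\<omega>\<in>space M. \<forall>i<m. N (C i) \<omega> \<in> U i}"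

text \<open>The atoms of the finite algebra generated by the \<open>C i\<close>: the index
  \<open>n\<close> encodes in binary the set of those \<open>i\<close> whose \<open>C i\<close>
  contain the point. Index 0 would be the points outside all of them and is made empty, so that
  cells stay inside the union. Disjoint cells are used because the random measure has independent
  counts over disjoint sets.\<close>

definition cell :: "nat \<Rightarrow> (nat \<Rightarrow> (real \<times> 'a) set) \<Rightarrow> nat \<Rightarrow> (real \<times> 'a) set" where
  "cell m C n = (if n = 0 then {} else {p\<in>space \<Lambda>. {i. i < m \<and> p \<in> C i} = set_decode n})"

lemma cell_sets:
  assumes "\<And>i. i < m \<Longrightarrow> C i \<in> sets \<Lambda>"
  shows "cell m C n \<in> sets \<Lambda>"
proof (cases "set_decode n \<subseteq> {..<m} \<and> n \<noteq> 0")
  case True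
  have "cell m C n = {p\<in>space \<Lambda>. \<forall>i\<in>{..<m}. p \<in> C i \<longleftrightarrow> i \<in> set_decode n}"
    using True by (auto simp: cell_def)
  also have "\<dots> \<in> sets \<Lambda>"
  proof (rule sets.sets_Collect_finite_All)
    fix i assume i: "i \<in> {..<m}"
    show "{p\<in>space \<Lambda>. p \<in> C i \<longleftrightarrow> i \<in> set_decode n} \<in> sets \<Lambda>"
    proof (cases "i \<in> set_decode n")
      case True
      then have "{p\<in>space \<Lambda>. p \<in> C i \<longleftrightarrow> i \<in> set_decode n} = space \<Lambda> \<inter> C i" by auto
      then show ?thesis using assms[of i] i by auto
    next
      case False
      then have "{p\<in>space \<Lambda>. p \<in> C i \<longleftrightarrow> i \<in> set_decode n} = space \<Lambda> - C i" by auto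
      then show ?thesis using assms[of i] i by auto
    qed
  qed simp
  finally show ?thesis .
next
  case False
  then have "cell m C n = {}" by (auto simp: cell_def)
  then show ?thesis by simp
qed

lemma cell_disjoint: "n \<noteq> n' \<Longrightarrow> cell m C n \<inter> cell m C n' = {}"
proof -
  assume "n \<noteq> n'"
  then have "set_decode n \<noteq> set_decode n'" by (metis set_decode_inverse)
  then show ?thesis by (auto simp: cell_def)
qed

lemma cell_subset: "cell m C n \<subseteq> (\<Union>i<m. C i)"
proof
  fix p assume p: "p \<in> cell m C n"
  then have "n \<noteq> 0" and eq: "{i. i < m \<and> p \<in> C i} = set_decode n" by (auto simp: cell_def split: if_splits)
  then have "set_decode n \<noteq> {}" by (metis set_decode_inverse set_encode_empty)
  then obtain i where "i \<in> set_decode n" by blast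
  then show "p \<in> (\<Union>i<m. C i)" using eq by blast
qed

lemma Union_cells:
  assumes i: "i < m" and C: "C i \<subseteq> space \<Lambda>"
  shows "C i = (\<Union>n. if i \<in> set_decode n then cell m C n else {})"
proof
  show "C i \<subseteq> (\<Union>n. if i \<in> set_decode n then cell m C n else {})"
  proof
    fix p assume p: "p \<in> C i"
    let ?S = "{i. i < m \<and> p \<in> C i}"
    have fin: "finite ?S" by simp
    have dec: "set_decode (set_encode ?S) = ?S" using fin by (rule set_encode_inverse)
    have iS: "i \<in> ?S" using i p by simp
    then have "set_encode ?S \<noteq> 0" using dec by (metis empty_iff set_decode_zero)
    then have "p \<in> cell m C (set_encode ?S)" using p C dec by (auto simp: cell_def)
    then show "p \<in> (\<Union>n. if i \<in> set_decode n then cell m C n else {})"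
      using iS dec by (intro UN_I[of "set_encode ?S"]) auto
  qed
  show "(\<Union>n. if i \<in> set_decode n then cell m C n else {}) \<subseteq> C i"
    by (auto simp: cell_def split: if_splits)
qed

lemma N_cells:
  assumes i: "i < m" and C: "\<And>i. i < m \<Longrightarrow> C i \<in> sets \<Lambda>" and \<omega>: "\<omega> \<in> space M"
  shows "N (C i) \<omega> = (\<Sum>n. if i \<in> set_decode n then N (cell m C n) \<omega> else 0)"
proof -
  have s: "sets (\<nu> \<omega>) = sets \<Lambda>" using prm \<omega> unfolding poisson_random_measure_def by simp
  let ?F = "\<lambda>n. if i \<in> set_decode n then cell m C n else {}"
  have "N (C i) \<omega> = emeasure (\<nu> \<omega>) (\<Union>n. ?F n)"
    unfolding N_def by (rule arg_cong[OF Union_cells[of i m C]]) (rule i, rule sets.sets_into_space[OF C[OF i]])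
  also have "\<dots> = (\<Sum>n. emeasure (\<nu> \<omega>) (?F n))"
  proof (rule suminf_emeasure[symmetric])
    have "cell m C n \<in> sets \<Lambda>" for n by (rule cell_sets[OF C])
    then show "range ?F \<subseteq> sets (\<nu> \<omega>)" unfolding s by auto
    show "disjoint_family ?F" using cell_disjoint by (auto simp: disjoint_family_on_def)
  qed
  also have "\<dots> = (\<Sum>n. if i \<in> set_decode n then N (cell m C n) \<omega> else 0)"
    by (intro suminf_cong) (simp add: N_def)
  finally show ?thesis .
qed

lemma counts_in_sets:
  assumes C: "\<And>i. i < m \<Longrightarrow> N (C i) \<in> borel_measurable K" and U: "\<And>i. i < m \<Longrightarrow> U i \<in> sets borel"
    and K: "space K = space M"
  shows "counts_in m C U \<in> sets K"
proof -
  have "{\<omega>\<in>space K. \<forall>i\<in>{..<m}. N (C i) \<omega> \<in> U i} \<in> sets K"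
  proof (rule sets.sets_Collect_finite_All)
    fix i assume "i \<in> {..<m}"
    then have "N (C i) -` U i \<inter> space K \<in> sets K" using C U by (intro measurable_sets) auto
    then show "{\<omega>\<in>space K. N (C i) \<omega> \<in> U i} \<in> sets K" by (simp add: vimage_def Int_def conj_commute)
  qed simp
  then show ?thesis unfolding counts_in_def K Ball_def lessThan_iff .
qed

text \<open>Within one family the sets may overlap. The cells of both families, interleaved at even
  and odd indices, form one disjoint sequence with independent counts, and grouping by parity
  separates the two families again.\<close>

lemma counts_in_indep:
  assumes C: "\<And>i. i < m \<Longrightarrow> C i \<in> sets \<Lambda>" and C': "\<And>i. i < m' \<Longrightarrow> C' i \<in> sets \<Lambda>"
    and disj: "\<And>i j. i < m \<Longrightarrow> j < m' \<Longrightarrow> C i \<inter> C' j = {}"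
    and U: "\<And>i. i < m \<Longrightarrow> U i \<in> sets borel" and U': "\<And>i. i < m' \<Longrightarrow> U' i \<in> sets borel"
  shows "prob (counts_in m C U \<inter> counts_in m' C' U') = prob (counts_in m C U) * prob (counts_in m' C' U')"
proof -
  define A where "A k = (if even k then cell m C (k div 2) else cell m' C' (k div 2))" for k :: nat
  have A: "A k \<in> sets \<Lambda>" for k using cell_sets[of m C] cell_sets[of m' C'] C C' by (simp add: A_def)
  have cross: "cell m C n \<inter> cell m' C' n' = {}" for n n'
    using cell_subset[of m C n] cell_subset[of m' C' n'] disj by blast
  have "disjoint_family A"
    unfolding disjoint_family_on_def
  proof (intro ballI impI)
    fix k k' :: nat assume "k \<noteq> k'"
    then have "even k = even k' \<Longrightarrow> k div 2 \<noteq> k' div 2"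
      by (metis dvd_mult_div_cancel odd_two_times_div_two_succ)
    then show "A k \<inter> A k' = {}"
      using cell_disjoint[of "k div 2" "k' div 2"] cross cross[of "k' div 2" "k div 2"]
      by (auto simp: A_def Int_commute)
  qed
  then have "indep_vars (\<lambda>_. borel) (\<lambda>k. N (A k)) UNIV"
    using prm A unfolding poisson_random_measure_def N_def[abs_def] by (simp add: image_subset_iff)
  let ?E = "\<lambda>k. {N (A k) -` V \<inter> space M | V. V \<in> sets borel}"
  let ?I = "\<lambda>b. {k. even k = b}"
  have un: "(\<Union>b\<in>UNIV. ?I b) = UNIV" by auto
  have "indep_sets ?E (\<Union>b\<in>UNIV. ?I b)"
    unfolding un using \<open>indep_vars (\<lambda>_. borel) (\<lambda>k. N (A k)) UNIV\<close>
    unfolding indep_vars_def2 by (rule conjunct2)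
  then have ind: "indep_sets (\<lambda>b. sigma_sets (space M) (\<Union>k\<in>?I b. ?E k)) UNIV"
  proof (rule indep_sets_collect_sigma)
    show "Int_stable (?E k)" for k
    proof (rule Int_stableI)
      fix a b assume "a \<in> ?E k" "b \<in> ?E k"
      then obtain V V' where "a = N (A k) -` V \<inter> space M" "V \<in> sets borel" "b = N (A k) -` V' \<inter> space M" "V' \<in> sets borel" by auto
      then have "a \<inter> b = N (A k) -` (V \<inter> V') \<inter> space M \<and> V \<inter> V' \<in> sets borel" by auto
      then show "a \<inter> b \<in> ?E k" by blast
    qed
  qed (auto simp: disjoint_family_on_def)
  have sub: "(\<Union>k\<in>?I b. ?E k) \<subseteq> Pow (space M)" for b by auto
  let ?K = "\<lambda>b. sigma (space M) (\<Union>k\<in>?I b. ?E k)"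
  have spK: "space (?K b) = space M" for b by (rule space_measure_of[OF sub])
  have NA: "N (A k) \<in> borel_measurable (?K (even k))" for k
  proof (rule measurableI)
    fix V :: "ennreal set" assume "V \<in> sets borel"
    then have "N (A k) -` V \<inter> space M \<in> (\<Union>j\<in>?I (even k). ?E j)" by (intro UN_I[of k]) auto
    then show "N (A k) -` V \<inter> space (?K (even k)) \<in> sets (?K (even k))"
      unfolding spK by (rule in_measure_of[OF sub])
  qed simp
  have e: "N (C i) \<in> borel_measurable (?K True)" if i: "i < m" for i
  proof -
    have "(\<lambda>\<omega>. \<Sum>n. if i \<in> set_decode n then N (cell m C n) \<omega> else 0) \<in> borel_measurable (?K True)"
    proof (rule borel_measurable_suminf_order)
      fix n
      have "N (cell m C n) \<in> borel_measurable (?K True)" using NA[of "2 * n"] by (simp add: A_def)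
      then show "(\<lambda>\<omega>. if i \<in> set_decode n then N (cell m C n) \<omega> else 0) \<in> borel_measurable (?K True)" by simp
    qed
    then show ?thesis
      by (rule measurable_cong[THEN iffD2, rotated]) (rule N_cells[OF i C], simp_all only: spK)
  qed
  have o: "N (C' i) \<in> borel_measurable (?K False)" if i: "i < m'" for i
  proof -
    have "(\<lambda>\<omega>. \<Sum>n. if i \<in> set_decode n then N (cell m' C' n) \<omega> else 0) \<in> borel_measurable (?K False)"
    proof (rule borel_measurable_suminf_order)
      fix n
      have "N (cell m' C' n) \<in> borel_measurable (?K False)" using NA[of "2 * n + 1"] by (simp add: A_def)
      then show "(\<lambda>\<omega>. if i \<in> set_decode n then N (cell m' C' n) \<omega> else 0) \<in> borel_measurable (?K False)" by simp
    qed
    then show ?thesis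
      by (rule measurable_cong[THEN iffD2, rotated]) (rule N_cells[OF i C'], simp_all only: spK)
  qed
  have "counts_in m C U \<in> sets (?K True)" by (rule counts_in_sets[OF e U spK])
  moreover have "counts_in m' C' U' \<in> sets (?K False)" by (rule counts_in_sets[OF o U' spK])
  ultimately have mem: "counts_in m C U \<in> sigma_sets (space M) (\<Union>k\<in>?I True. ?E k)"
    "counts_in m' C' U' \<in> sigma_sets (space M) (\<Union>k\<in>?I False. ?E k)"
    unfolding sets_measure_of[OF sub] by blast+
  have "indep_set (sigma_sets (space M) (\<Union>k\<in>?I True. ?E k)) (sigma_sets (space M) (\<Union>k\<in>?I False. ?E k))"
    unfolding indep_set_def
    by (rule indep_sets_cong[THEN iffD1, OF refl _ ind]) (simp split: bool.split)
  from indep_setD[OF this mem] show ?thesis .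
qed

text \<open>An intersection-stable generator. Measurability is asked of the sets \<open>C i\<close>
  and not of \<open>R\<close>, so a region may be written loosely, such as
  \<open>{..<q} \<times> UNIV\<close>.\<close>

definition region_events :: "(real \<times> 'a) set \<Rightarrow> 'w set set" where
  "region_events R = {counts_in m C U | m C U. (\<forall>i<m. C i \<in> sets \<Lambda> \<and> C i \<subseteq> R \<and> U i \<in> sets borel)}"

abbreviation region :: "(real \<times> 'a) set \<Rightarrow> 'w measure" where
  "region R \<equiv> augmented M (region_events R)"

lemma region_events_events: "region_events R \<subseteq> events"
proof
  fix a assume "a \<in> region_events R"
  then obtain m C U where *: "a = counts_in m C U \<and> (\<forall>i<m. C i \<in> sets \<Lambda> \<and> C i \<subseteq> R \<and> U i \<in> sets borel)"
    unfolding region_events_def by (elim CollectE exE)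
  then show "a \<in> events" by (auto intro!: counts_in_sets N_measurable)
qed

lemma space_region [simp]: "space (region R) = space M"
  by (rule space_augmented[OF region_events_events])

lemma Int_stable_region_events: "Int_stable (region_events R)"
proof (rule Int_stableI)
  fix a b assume ab: "a \<in> region_events R" "b \<in> region_events R"
  obtain m C U where 1: "a = counts_in m C U \<and> (\<forall>i<m. C i \<in> sets \<Lambda> \<and> C i \<subseteq> R \<and> U i \<in> sets borel)"
    using ab(1) unfolding region_events_def by (elim CollectE exE)
  obtain m' C' U' where 2: "b = counts_in m' C' U' \<and> (\<forall>i<m'. C' i \<in> sets \<Lambda> \<and> C' i \<subseteq> R \<and> U' i \<in> sets borel)"
    using ab(2) unfolding region_events_def by (elim CollectE exE)
  let ?C = "\<lambda>i. if i < m then C i else C' (i - m)"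
  let ?U = "\<lambda>i. if i < m then U i else U' (i - m)"
  have "(\<forall>i<m + m'. N (?C i) \<omega> \<in> ?U i) \<longleftrightarrow> (\<forall>i<m. N (C i) \<omega> \<in> U i) \<and> (\<forall>i<m'. N (C' i) \<omega> \<in> U' i)" for \<omega>
  proof (intro iffI conjI allI impI; (elim conjE)?)
    fix i assume *: "\<forall>i<m + m'. N (?C i) \<omega> \<in> ?U i"
    { assume "i < m" then show "N (C i) \<omega> \<in> U i" using *[rule_format, of i] by simp }
    { assume "i < m'" then show "N (C' i) \<omega> \<in> U' i" using *[rule_format, of "m + i"] by simp }
  next
    fix i assume "i < m + m'" "\<forall>i<m. N (C i) \<omega> \<in> U i" "\<forall>i<m'. N (C' i) \<omega> \<in> U' i"
    then show "N (?C i) \<omega> \<in> ?U i" by (cases "i < m") auto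
  qed
  then have "a \<inter> b = counts_in (m + m') ?C ?U"
    using 1 2 unfolding counts_in_def by auto
  moreover have "\<forall>i<m + m'. ?C i \<in> sets \<Lambda> \<and> ?C i \<subseteq> R \<and> ?U i \<in> sets borel"
    using 1 2 by auto
  ultimately show "a \<inter> b \<in> region_events R"
    unfolding region_events_def by (intro CollectI exI conjI)
qed

text \<open>One side is extended at a time: first a generator against a full region event, then the
  roles are exchanged.\<close>

lemma region_indep:
  assumes R: "R \<inter> R' = {}" and a: "a \<in> sets (region R)" and b: "b \<in> sets (region R')"
  shows "prob (a \<inter> b) = prob a * prob b"
proof -
  have gen: "prob (a \<inter> b) = prob a * prob b" if a: "a \<in> region_events R" and b: "b \<in> region_events R'" for a b
  proof -
    obtain m C U where 1: "a = counts_in m C U \<and> (\<forall>i<m. C i \<in> sets \<Lambda> \<and> C i \<subseteq> R \<and> U i \<in> sets borel)"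
      using a unfolding region_events_def by (elim CollectE exE)
    obtain m' C' U' where 2: "b = counts_in m' C' U' \<and> (\<forall>i<m'. C' i \<in> sets \<Lambda> \<and> C' i \<subseteq> R' \<and> U' i \<in> sets borel)"
      using b unfolding region_events_def by (elim CollectE exE)
    show ?thesis unfolding 1[THEN conjunct1] 2[THEN conjunct1]
    proof (rule counts_in_indep)
      fix i j assume "i < m" "j < m'"
      then have "C i \<subseteq> R" "C' j \<subseteq> R'" using 1 2 by auto
      then show "C i \<inter> C' j = {}" using R by blast
    qed (use 1 2 in auto)
  qed
  have step: "prob (a \<inter> b) = prob a * prob b" if a: "a \<in> region_events R" for a
  proof (rule indep_event_augmented[OF _ region_events_events Int_stable_region_events _ b])
    show "a \<in> events" using a region_events_events by blast
  qed (rule gen[OF a])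
  have "prob (b \<inter> a) = prob b * prob a"
  proof (rule indep_event_augmented[OF _ region_events_events Int_stable_region_events _ a])
    show "b \<in> events" using b augmented_subset_sets[OF region_events_events] by blast
    fix c assume "c \<in> region_events R"
    from step[OF this] show "prob (b \<inter> c) = prob b * prob c" by (simp add: Int_commute mult.commute)
  qed
  then show ?thesis by (simp add: Int_commute mult.commute)
qed

lemma N_measurable_region:
  assumes "C \<in> sets \<Lambda>" "C \<subseteq> R"
  shows "N C \<in> borel_measurable (region R)"
proof (rule measurableI)
  fix V :: "ennreal set" assume V: "V \<in> sets borel"
  have "N C -` V \<inter> space M = counts_in 1 (\<lambda>_. C) (\<lambda>_. V)" by (auto simp: counts_in_def)
  also have "\<dots> \<in> region_events R"
    unfolding region_events_def using assms V by (intro CollectI exI conjI) (rule refl, simp)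
  finally show "N C -` V \<inter> space (region R) \<in> sets (region R)"
    using augmented_superset[OF region_events_events[of R]] by auto
qed simp

lemma region_mono: "R \<subseteq> R' \<Longrightarrow> sets (region R) \<subseteq> sets (region R')"
proof (rule augmented_mono[OF region_events_events region_events_events])
  assume R: "R \<subseteq> R'"
  have "region_events R \<subseteq> region_events R'"
  proof
    fix a assume "a \<in> region_events R"
    then obtain m C U where *: "a = counts_in m C U \<and> (\<forall>i<m. C i \<in> sets \<Lambda> \<and> C i \<subseteq> R \<and> U i \<in> sets borel)"
      unfolding region_events_def by (elim CollectE exE)
    then have "\<forall>i<m. C i \<in> sets \<Lambda> \<and> C i \<subseteq> R' \<and> U i \<in> sets borel" using R by blast
    with * show "a \<in> region_events R'" unfolding region_events_def by (intro CollectI exI conjI) auto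
  qed
  then show "region_events R \<subseteq> sets (region R')"
    using augmented_superset[OF region_events_events[of R']] by blast
qed

section \<open>Levels and marks observable below a level\<close>

abbreviation "before_level q \<equiv> region ({..<q} \<times> UNIV)"
abbreviation "after_level q \<equiv> region ({q..} \<times> UNIV)"

lemma before_level_mono: "q \<le> q' \<Longrightarrow> sets (before_level q) \<subseteq> sets (before_level q')"
  by (rule region_mono) auto

lemma after_level_mono: "q' \<le> q \<Longrightarrow> sets (after_level q) \<subseteq> sets (after_level q')"
  by (rule region_mono) auto

lemma region_events_sets: "a \<in> sets (region R) \<Longrightarrow> a \<in> events"
  using augmented_subset_sets[OF region_events_events] by blast

lemma before_after_indep:
  "a \<in> sets (before_level q) \<Longrightarrow> b \<in> sets (after_level q) \<Longrightarrow> prob (a \<inter> b) = prob a * prob b"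
  by (rule region_indep) auto

lemma N_eq_event:
  assumes "C \<in> sets \<Lambda>" "C \<subseteq> R"
  shows "{\<omega>\<in>space M. N C \<omega> = 0} \<in> sets (region R)" "{\<omega>\<in>space M. N C \<omega> \<noteq> 0} \<in> sets (region R)"
proof -
  have "{\<omega>\<in>space (region R). N C \<omega> = 0} \<in> sets (region R)"
    using N_measurable_region[OF assms] by measurable
  then show 1: "{\<omega>\<in>space M. N C \<omega> = 0} \<in> sets (region R)" by simp
  have "{\<omega>\<in>space M. N C \<omega> \<noteq> 0} = space (region R) - {\<omega>\<in>space M. N C \<omega> = 0}" by auto
  also have "\<dots> \<in> sets (region R)" by (rule sets.Diff[OF sets.top 1])
  finally show "{\<omega>\<in>space M. N C \<omega> \<noteq> 0} \<in> sets (region R)" .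
qed

text \<open>The level is recovered from the count of \<open>{0..<q} \<times> D\<close>; the identity
  is almost sure, which the completion absorbs.\<close>

lemma level_event: "{\<omega>\<in>space M. \<l> i \<omega> < q} \<in> sets (before_level q)"
proof (cases "i = 0")
  case True
  then have "{\<omega>\<in>space M. \<l> i \<omega> < q} = (if 0 < q then space (before_level q) else {})" by (auto simp: \<l>_0)
  also have "\<dots> \<in> sets (before_level q)" by (simp only: sets.top sets.empty_sets split: if_split) simp
  finally show ?thesis .
next
  case False
  then have i: "1 \<le> i" by simp
  have B: "{\<omega>\<in>space M. \<l> i \<omega> < q} \<in> events" using \<l>_measurable[of i] by measurable
  show ?thesis
  proof (cases "0 \<le> q")
    case True
    have A: "{\<omega>\<in>space (before_level q). of_nat i \<le> N ({0..<q} \<times> D) \<omega>} \<in> sets (before_level q)"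
      using N_measurable_region[OF strip_sets[OF order_refl D_sets], of q "{..<q} \<times> UNIV"] by measurable auto
    have "AE \<omega> in M. \<omega> \<in> {\<omega>\<in>space (before_level q). of_nat i \<le> N ({0..<q} \<times> D) \<omega>} \<longleftrightarrow>
        \<omega> \<in> {\<omega>\<in>space M. \<l> i \<omega> < q}"
      using AE_regular
    proof eventually_elim
      case (elim \<omega>)
      show ?case using regular_level_iff[OF elim True i] by simp
    qed
    from augmented_AE_cong[OF region_events_events A B this] show ?thesis .
  next
    case False
    have "AE \<omega> in M. \<omega> \<in> {} \<longleftrightarrow> \<omega> \<in> {\<omega>\<in>space M. \<l> i \<omega> < q}"
      using AE_regular
    proof eventually_elim
      case (elim \<omega>)
      show ?case using regular_nonneg[OF elim, of i] False by simp
    qed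
    from augmented_AE_cong[OF region_events_events sets.empty_sets B this] show ?thesis .
  qed
qed

lemma level_event_le: "q' \<le> q \<Longrightarrow> {\<omega>\<in>space M. \<l> i \<omega> < q'} \<in> sets (before_level q)"
  using level_event[of i q'] before_level_mono by blast

text \<open>A mark is not a count, so the \<open>i\<close>-th atom is isolated in a rational window:
  \<open>r\<close> lies between the previous level and its own, \<open>s\<close> between its own and
  the next. Its mark is then in \<open>A\<close> exactly if the strip over \<open>A\<close> in that
  window is not empty.\<close>

lemma mark_event:
  assumes i: "1 \<le> i" and A: "A \<in> sets \<mu>"
  shows "{\<omega>\<in>space M. Z i \<omega> \<in> A \<and> \<l> i \<omega> < q} \<in> sets (before_level q)"
proof -
  define S where "S r s = ({\<omega>\<in>space M. \<l> (i - 1) \<omega> < of_rat r} - {\<omega>\<in>space M. \<l> i \<omega> < of_rat r}) \<inter>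
      ({\<omega>\<in>space M. \<l> i \<omega> < of_rat s} - {\<omega>\<in>space M. \<l> (Suc i) \<omega> < of_rat s}) \<inter>
      {\<omega>\<in>space M. N ({of_rat r..<of_rat s} \<times> A) \<omega> \<noteq> 0}" for r s :: rat
  \<comment> \<open>The bound on \<open>s\<close> keeps the window below \<open>q\<close>, so that
    its count is observable there.\<close>
  define Q where "Q = {(r, s). 0 \<le> r \<and> r < s \<and> real_of_rat s < q}"
  have S: "S r s \<in> sets (before_level q)" if rs: "(r, s) \<in> Q" for r s
  proof -
    have le: "real_of_rat r \<le> q" "real_of_rat s \<le> q" "0 \<le> real_of_rat r"
      using rs of_rat_less[of r s, where 'a = real] unfolding Q_def by auto
    have "{real_of_rat r..<of_rat s} \<times> A \<subseteq> {..<q} \<times> UNIV" using le by auto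
    then show ?thesis
      unfolding S_def using le level_event_le N_eq_event(2)[OF strip_sets[OF le(3) A]]
      by (intro sets.Int sets.Diff) auto
  qed
  have "countable Q" by (rule countable_subset[of _ UNIV]) auto
  then have "(\<Union>p\<in>Q. S (fst p) (snd p)) \<in> sets (before_level q)"
    using S by (intro sets.countable_UN'') auto
  moreover have "{\<omega>\<in>space M. Z i \<omega> \<in> A \<and> \<l> i \<omega> < q} \<in> events"
  proof -
    have "A \<in> sets (restrict_space borel D)" using A sets_\<mu> by simp
    then have "Z i -` A \<inter> space M \<in> events" using Z_measurable[OF i] by (rule measurable_sets[rotated])
    moreover have "{\<omega>\<in>space M. \<l> i \<omega> < q} \<in> events" using \<l>_measurable[of i] by measurable
    moreover have "{\<omega>\<in>space M. Z i \<omega> \<in> A \<and> \<l> i \<omega> < q} = (Z i -` A \<inter> space M) \<inter> {\<omega>\<in>space M. \<l> i \<omega> < q}" by auto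
    ultimately show ?thesis by auto
  qed
  moreover have "AE \<omega> in M. \<omega> \<in> (\<Union>p\<in>Q. S (fst p) (snd p)) \<longleftrightarrow> \<omega> \<in> {\<omega>\<in>space M. Z i \<omega> \<in> A \<and> \<l> i \<omega> < q}"
    using AE_regular
  proof eventually_elim
    case (elim \<omega>)
    have \<omega>: "\<omega> \<in> space M" using elim by (simp add: regular_def)
    show ?case
    proof
      assume "\<omega> \<in> (\<Union>p\<in>Q. S (fst p) (snd p))"
      then obtain r s where rs: "(r, s) \<in> Q" "\<omega> \<in> S r s" by auto
      then have c: "0 \<le> real_of_rat r" "real_of_rat s < q" "\<l> (i - 1) \<omega> < of_rat r" "\<l> i \<omega> < of_rat s"
        "\<not> \<l> (Suc i) \<omega> < of_rat s" "N ({of_rat r..<of_rat s} \<times> A) \<omega> \<noteq> 0"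
        using \<omega> by (auto simp: S_def Q_def)
      obtain k where k: "1 \<le> k" "of_rat r \<le> \<l> k \<omega>" "\<l> k \<omega> < of_rat s" "Z k \<omega> \<in> A"
        using c(6) regular_strip_eq_0[OF elim c(1) A] by blast
      have "\<l> (i - 1) \<omega> < \<l> k \<omega>" "\<l> k \<omega> < \<l> (Suc i) \<omega>" using c k by auto
      then have "k = i" using regular_less_iff[OF elim] i by simp
      then show "\<omega> \<in> {\<omega>\<in>space M. Z i \<omega> \<in> A \<and> \<l> i \<omega> < q}" using k c \<omega> by simp
    next
      assume "\<omega> \<in> {\<omega>\<in>space M. Z i \<omega> \<in> A \<and> \<l> i \<omega> < q}"
      then have Zi: "Z i \<omega> \<in> A" "\<l> i \<omega> < q" by auto
      have "\<l> (i - 1) \<omega> < \<l> i \<omega>" "\<l> i \<omega> < \<l> (Suc i) \<omega>" using i by (simp_all add: regular_less_iff[OF elim])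
      then obtain r s where r: "\<l> (i - 1) \<omega> < of_rat r" "of_rat r < \<l> i \<omega>"
        and s: "\<l> i \<omega> < of_rat s" "of_rat s < min q (\<l> (Suc i) \<omega>)"
        using of_rat_dense[of "\<l> (i - 1) \<omega>" "\<l> i \<omega>"] of_rat_dense[of "\<l> i \<omega>" "min q (\<l> (Suc i) \<omega>)"] Zi by auto
      have r0: "0 \<le> real_of_rat r" using r(1) regular_nonneg[OF elim, of "i - 1"] by linarith
      have "real_of_rat r < of_rat s" using r s by linarith
      then have "r < s" by (simp only: of_rat_less)
      moreover have "0 \<le> r" using r0 by (simp only: zero_le_of_rat_iff)
      ultimately have Q: "(r, s) \<in> Q" using s by (simp add: Q_def)
      have "N ({of_rat r..<of_rat s} \<times> A) \<omega> \<noteq> 0"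
        unfolding regular_strip_eq_0[OF elim r0 A] using i r s Zi by (auto intro!: exI[of _ i])
      then have "\<omega> \<in> S r s" using r s \<omega> by (simp add: S_def)
      with Q show "\<omega> \<in> (\<Union>p\<in>Q. S (fst p) (snd p))" by force
    qed
  qed
  ultimately show ?thesis by (rule augmented_AE_cong[OF region_events_events])
qed

definition atom_history :: "nat \<Rightarrow> 'w set set" where
  "atom_history k = sigma_sets (space M) (\<Union>i\<in>{1..k}. gen M borel (\<l> i) \<union> gen M borel (Z i))"

lemma atom_history_generator: "(\<Union>i\<in>{1..k}. gen M borel (\<l> i) \<union> gen M borel (Z i)) \<subseteq> events"
proof (intro UN_least Un_least)
  fix i assume "i \<in> {1..k}"
  then have i: "1 \<le> i" by simp
  show "gen M borel (\<l> i) \<subseteq> events" by (rule gen_subset_sets[OF \<l>_measurable refl])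
  show "gen M borel (Z i) \<subseteq> events" by (rule gen_subset_sets[OF Z_borel[OF i] refl])
qed

lemma atom_history_events: "atom_history k \<subseteq> events"
  unfolding atom_history_def by (rule sets.sigma_sets_subset[OF atom_history_generator])

lemma sigma_algebra_atom_history: "sigma_algebra (space M) (atom_history k)"
  unfolding atom_history_def
  by (rule sigma_algebra_sigma_sets[OF order_trans[OF atom_history_generator sets.space_closed]])

text \<open>The analogue of the stopping time property on the level axis: on the event
  \<open>\<l> k < q\<close> the first \<open>k\<close> atoms almost surely all lie strictly below
  \<open>q\<close>. Complements and unions, taken relative to this event, give the
  induction.\<close>

lemma atom_history_before:
  assumes "H \<in> atom_history k"
  shows "H \<inter> {\<omega>\<in>space M. \<l> k \<omega> < q} \<in> sets (before_level q)"
  using assms unfolding atom_history_def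
proof (induction rule: sigma_sets.induct)
  case (Basic a)
  then obtain i where i: "1 \<le> i" "i \<le> k" "a \<in> gen M borel (\<l> i) \<or> a \<in> gen M borel (Z i)" by auto
  let ?L = "{\<omega>\<in>space M. \<l> k \<omega> < q}"
  from i(3) show ?case
  proof
    assume "a \<in> gen M borel (\<l> i)"
    then obtain V where V: "a = \<l> i -` V \<inter> space M" "V \<in> sets borel" by (auto simp: gen_eq)
    \<comment> \<open>Equals \<open>\<l> i\<close> on the event in question and is set to
      \<open>q\<close> elsewhere, so that no level beyond \<open>q\<close> is read.\<close>
    define f where "f \<omega> = (if \<l> k \<omega> < q then \<l> i \<omega> else q)" for \<omega>
    have "f \<in> borel_measurable (before_level q)"
      unfolding borel_measurable_iff_less
    proof
      fix c
      have "{\<omega>\<in>space M. f \<omega> < c} = (if c \<le> q then {\<omega>\<in>space M. \<l> k \<omega> < q} \<inter> {\<omega>\<in>space M. \<l> i \<omega> < c}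
          else ({\<omega>\<in>space M. \<l> k \<omega> < q} \<inter> {\<omega>\<in>space M. \<l> i \<omega> < q}) \<union> (space M - {\<omega>\<in>space M. \<l> k \<omega> < q})
            \<union> {\<omega>\<in>space M. \<l> k \<omega> < q \<and> q \<le> \<l> i \<omega> \<and> \<l> i \<omega> < c})"
        by (auto simp: f_def)
      also have "\<dots> \<in> sets (before_level q)"
      proof (cases "c \<le> q")
        case True
        then show ?thesis using level_event_le[of q q k] level_event_le[of c q i] by auto
      next
        case False
        \<comment> \<open>Empty up to a null set, since levels increase and
          \<open>i \<le> k\<close>.\<close>
        have "{\<omega>\<in>space M. \<l> k \<omega> < q \<and> q \<le> \<l> i \<omega> \<and> \<l> i \<omega> < c} \<in> sets (before_level q)"
        proof (rule augmented_AE_cong[OF region_events_events sets.empty_sets])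
          show "{\<omega>\<in>space M. \<l> k \<omega> < q \<and> q \<le> \<l> i \<omega> \<and> \<l> i \<omega> < c} \<in> events"
            using \<l>_measurable[of k] \<l>_measurable[of i] by measurable
          show "AE \<omega> in M. \<omega> \<in> {} \<longleftrightarrow> \<omega> \<in> {\<omega>\<in>space M. \<l> k \<omega> < q \<and> q \<le> \<l> i \<omega> \<and> \<l> i \<omega> < c}"
            using AE_regular
          proof eventually_elim
            case (elim \<omega>)
            have "\<l> i \<omega> \<le> \<l> k \<omega>" using regular_le_iff[OF elim] i(2) by simp
            then show ?case by auto
          qed
        qed
        moreover have "space M \<in> sets (before_level q)" using sets.top[of "before_level q"] by simp
        ultimately show ?thesis using False level_event_le[of q q k] level_event_le[of q q i] by auto
      qed
      finally show "{w \<in> space (before_level q). f w < c} \<in> sets (before_level q)" by simp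
    qed
    from measurable_sets[OF this V(2)] have "f -` V \<inter> space M \<in> sets (before_level q)" by simp
    moreover have "a \<inter> ?L = (f -` V \<inter> space M) \<inter> ?L" unfolding V(1) by (auto simp: f_def)
    ultimately show ?thesis using level_event[of k q] by auto
  next
    assume "a \<in> gen M borel (Z i)"
    then obtain V where V: "a = Z i -` V \<inter> space M" "V \<in> sets borel" by (auto simp: gen_eq)
    have VD: "V \<inter> D \<in> sets \<mu>" unfolding sets_\<mu> using V(2) by (auto simp: sets_restrict_space)
    have "{\<omega>\<in>space M. Z i \<omega> \<in> V \<inter> D \<and> \<l> i \<omega> < q} \<inter> ?L \<in> sets (before_level q)"
      using mark_event[OF i(1) VD, of q] level_event[of k q] by auto
    moreover have "a \<inter> ?L \<in> events"
      using region_events_sets[OF level_event[of k q]] measurable_sets[OF Z_borel[OF i(1)] V(2)] V(1) by auto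
    moreover have "AE \<omega> in M. \<omega> \<in> {\<omega>\<in>space M. Z i \<omega> \<in> V \<inter> D \<and> \<l> i \<omega> < q} \<inter> ?L \<longleftrightarrow> \<omega> \<in> a \<inter> ?L"
      using AE_regular
    proof eventually_elim
      case (elim \<omega>)
      have "\<l> i \<omega> \<le> \<l> k \<omega>" using regular_le_iff[OF elim] i(2) by simp
      moreover have "\<omega> \<in> space M" using elim by (simp add: regular_def)
      ultimately show ?case using Z_in_D[OF i(1), of \<omega>] by (auto simp: V(1))
    qed
    ultimately show ?thesis by (rule augmented_AE_cong[OF region_events_events])
  qed
next
  case Empty
  then show ?case by simp
next
  case (Compl a)
  have "(space M - a) \<inter> {\<omega>\<in>space M. \<l> k \<omega> < q} = {\<omega>\<in>space M. \<l> k \<omega> < q} - (a \<inter> {\<omega>\<in>space M. \<l> k \<omega> < q})" by auto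
  then show ?case using Compl.IH level_event[of k q] by auto
next
  case (Union a)
  have "(\<Union>i. a i) \<inter> {\<omega>\<in>space M. \<l> k \<omega> < q} = (\<Union>i. a i \<inter> {\<omega>\<in>space M. \<l> k \<omega> < q})" by auto
  also have "\<dots> \<in> sets (before_level q)" using Union.IH by (intro sets.countable_UN) auto
  finally show ?case .
qed

text \<open>The event that the first atom at a level at least \<open>r\<close> has its mark in
  \<open>A\<close>, expressed through counts: some rational window starting at \<open>r\<close>
  contains an atom with mark in \<open>A\<close> and none with a mark outside.\<close>

definition first_mark_in :: "real \<Rightarrow> 'a set \<Rightarrow> 'w set" where
  "first_mark_in r A = (\<Union>s\<in>{s::rat. r < of_rat s}.
     {\<omega>\<in>space M. N ({r..<of_rat s} \<times> (D - A)) \<omega> = 0} \<inter> {\<omega>\<in>space M. N ({r..<of_rat s} \<times> A) \<omega> \<noteq> 0})"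

lemma first_mark_in_sets:
  assumes "0 \<le> r" "A \<in> sets \<mu>"
  shows "first_mark_in r A \<in> sets (after_level r)"
  unfolding first_mark_in_def
proof (rule sets.countable_UN'')
  fix s :: rat assume "s \<in> {s. r < real_of_rat s}"
  have "D - A \<in> sets \<mu>" using assms(2) D_sets by auto
  then show "{\<omega>\<in>space M. N ({r..<of_rat s} \<times> (D - A)) \<omega> = 0} \<inter> {\<omega>\<in>space M. N ({r..<of_rat s} \<times> A) \<omega> \<noteq> 0} \<in> sets (after_level r)"
    using assms by (intro sets.Int N_eq_event strip_sets) auto
qed (rule countable_subset[of _ UNIV], auto)

text \<open>Any nonempty window starting at \<open>r\<close> contains the first atom, so its mark
  cannot be outside \<open>A\<close>; conversely a window ending before the following atom sees the
  first one alone.\<close>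

lemma regular_first_mark:
  assumes reg: "regular \<omega>" and r: "0 \<le> r" and A: "A \<in> sets \<mu>"
    and k: "1 \<le> k" "r \<le> \<l> k \<omega>" "\<And>j. 1 \<le> j \<Longrightarrow> j < k \<Longrightarrow> \<l> j \<omega> < r"
  shows "\<omega> \<in> first_mark_in r A \<longleftrightarrow> Z k \<omega> \<in> A"
proof -
  have \<omega>: "\<omega> \<in> space M" using reg by (simp add: regular_def)
  have DA: "D - A \<in> sets \<mu>" using A D_sets by auto
  have ge: "k \<le> j" if "1 \<le> j" "r \<le> \<l> j \<omega>" for j using k(3)[of j] that by force
  show ?thesis
  proof
    assume "\<omega> \<in> first_mark_in r A"
    then obtain s :: rat where s: "N ({r..<of_rat s} \<times> (D - A)) \<omega> = 0" "N ({r..<of_rat s} \<times> A) \<omega> \<noteq> 0"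
      by (auto simp: first_mark_in_def)
    obtain j where j: "1 \<le> j" "r \<le> \<l> j \<omega>" "\<l> j \<omega> < of_rat s"
      using s(2) unfolding regular_strip_eq_0[OF reg r A] by blast
    have "\<l> k \<omega> \<le> \<l> j \<omega>" using ge[OF j(1,2)] regular_le_iff[OF reg] by simp
    then have "Z k \<omega> \<notin> D - A" using s(1) k(1,2) j(3) unfolding regular_strip_eq_0[OF reg r DA] by force
    then show "Z k \<omega> \<in> A" using Z_in_D[OF k(1) \<omega>] by blast
  next
    assume Z: "Z k \<omega> \<in> A"
    have "\<l> k \<omega> < \<l> (Suc k) \<omega>" using regular_less_iff[OF reg] by simp
    then obtain s where s: "\<l> k \<omega> < of_rat s" "of_rat s < \<l> (Suc k) \<omega>" using of_rat_dense by blast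
    have only: "j = k" if j: "1 \<le> j" "r \<le> \<l> j \<omega>" "\<l> j \<omega> < of_rat s" for j
    proof -
      have "\<l> j \<omega> < \<l> (Suc k) \<omega>" using j s by simp
      then show ?thesis using ge[OF j(1,2)] regular_less_iff[OF reg] by simp
    qed
    have "N ({r..<of_rat s} \<times> (D - A)) \<omega> = 0"
      unfolding regular_strip_eq_0[OF reg r DA] using only Z by blast
    moreover have "N ({r..<of_rat s} \<times> A) \<omega> \<noteq> 0"
      unfolding regular_strip_eq_0[OF reg r A] using k s Z by blast
    moreover have "r < of_rat s" using k(2) s(1) by simp
    ultimately show "\<omega> \<in> first_mark_in r A" using \<omega> by (auto simp: first_mark_in_def)
  qed
qed

lemma regular_first_atom:
  assumes reg: "regular \<omega>"
  obtains k where "1 \<le> k" "r \<le> \<l> k \<omega>" "\<And>j. 1 \<le> j \<Longrightarrow> j < k \<Longrightarrow> \<l> j \<omega> < r"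
proof -
  have "finite {k. \<l> k \<omega> \<le> r}" using reg by (simp add: regular_def)
  then have "\<exists>k. k \<notin> insert 0 {k. \<l> k \<omega> \<le> r}" by (intro ex_new_if_finite) auto
  then obtain k where "k \<noteq> 0" "\<not> \<l> k \<omega> \<le> r" by auto
  then have ex: "\<exists>k. 1 \<le> k \<and> r \<le> \<l> k \<omega>" by (intro exI[of _ k]) auto
  define k where "k = (LEAST k. 1 \<le> k \<and> r \<le> \<l> k \<omega>)"
  have "1 \<le> k \<and> r \<le> \<l> k \<omega>" unfolding k_def using ex by (rule LeastI_ex)
  moreover have "\<l> j \<omega> < r" if "1 \<le> j" "j < k" for j
    using not_less_Least[of j "\<lambda>k. 1 \<le> k \<and> r \<le> \<l> k \<omega>"] that unfolding k_def[symmetric] by auto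
  ultimately show thesis using that by blast
qed

text \<open>Cells of length \<open>h\<close> after \<open>r\<close> are searched in order:
  \<open>V j\<close> is the event that the first \<open>j\<close> cells are empty and the next one
  has an atom with mark in \<open>A\<close>. The probabilities form a geometric series. The result
  is only an upper bound because a cell may hold an earlier atom with another mark.\<close>

lemma prob_first_mark_le:
  assumes r: "0 \<le> r" and A: "A \<in> sets \<mu>" and h: "0 < h"
  shows "prob (first_mark_in r A) \<le> measure \<mu> A * exp h"
proof -
  let ?a = "measure \<mu> A"
  define V where "V j = {\<omega>\<in>space M. N ({r..<r + real j * h} \<times> D) \<omega> = 0} \<inter>
      {\<omega>\<in>space M. N ({r + real j * h..<r + real j * h + h} \<times> A) \<omega> \<noteq> 0}" for j :: nat
  define c where "c = 1 - exp (- (h * ?a))"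
  have V1: "{\<omega>\<in>space M. N ({r..<r + real j * h} \<times> D) \<omega> = 0} \<in> sets (before_level (r + real j * h))"
    and V2: "{\<omega>\<in>space M. N ({r + real j * h..<r + real j * h + h} \<times> A) \<omega> \<noteq> 0} \<in> sets (after_level (r + real j * h))" for j
    using r h A D_sets by (intro N_eq_event strip_sets; auto)+
  have Ve: "V j \<in> events" for j
    unfolding V_def using region_events_sets[OF V1] region_events_sets[OF V2] by blast
  have pV: "prob (V j) = exp (- h) ^ j * c" for j
  proof -
    have 0: "{r + real j * h..<r + real j * h + h} \<times> A \<in> sets \<Lambda>" using r h A by (intro strip_sets) auto
    have "{\<omega>\<in>space M. N ({r + real j * h..<r + real j * h + h} \<times> A) \<omega> \<noteq> 0} =
        space M - {\<omega>\<in>space M. N ({r + real j * h..<r + real j * h + h} \<times> A) \<omega> = 0}" by auto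
    then have "prob {\<omega>\<in>space M. N ({r + real j * h..<r + real j * h + h} \<times> A) \<omega> \<noteq> 0} = c"
      using N_event[OF 0, of 0] prob_void[of "r + real j * h" "r + real j * h + h" A] r h A
      by (simp add: prob_compl c_def)
    moreover have "prob {\<omega>\<in>space M. N ({r..<r + real j * h} \<times> D) \<omega> = 0} = exp (- h) ^ j"
      using prob_void[of r "r + real j * h" D] r h D_sets \<mu>.prob_space
      by (simp add: space_\<mu> exp_of_nat_mult[symmetric])
    ultimately show ?thesis unfolding V_def before_after_indep[OF V1 V2] by simp
  qed
  have c0: "0 \<le> c" using h by (simp add: c_def)
  have e1: "exp (- h) < 1" using h by simp
  have sums: "(\<lambda>j. exp (- h) ^ j * c) sums (1 / (1 - exp (- h)) * c)"
    using e1 by (intro sums_mult2 geometric_sums) simp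
  have sub: "AE \<omega> in M. \<omega> \<in> first_mark_in r A \<longrightarrow> \<omega> \<in> (\<Union>j. V j)"
    using AE_regular
  proof eventually_elim
    case (elim \<omega>)
    have \<omega>: "\<omega> \<in> space M" using elim by (simp add: regular_def)
    show ?case
    proof
      assume F: "\<omega> \<in> first_mark_in r A"
      obtain k where k: "1 \<le> k" "r \<le> \<l> k \<omega>" "\<And>j. 1 \<le> j \<Longrightarrow> j < k \<Longrightarrow> \<l> j \<omega> < r"
        using regular_first_atom[OF elim, of r] by blast
      have Z: "Z k \<omega> \<in> A" using regular_first_mark[OF elim r A k] F by simp
      \<comment> \<open>The cell that contains the first atom.\<close>
      define j where "j = nat \<lfloor>(\<l> k \<omega> - r) / h\<rfloor>"
      have "0 \<le> (\<l> k \<omega> - r) / h" using k(2) h by simp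
      then have "real j \<le> (\<l> k \<omega> - r) / h" "(\<l> k \<omega> - r) / h < real j + 1" unfolding j_def by linarith+
      then have j: "r + real j * h \<le> \<l> k \<omega>" "\<l> k \<omega> < r + real j * h + h" using h by (auto simp: field_simps)
      have rj: "0 \<le> r + real j * h" using r h by simp
      have "\<not> (r \<le> \<l> i \<omega> \<and> \<l> i \<omega> < r + real j * h)" if "1 \<le> i" for i
      proof
        assume i: "r \<le> \<l> i \<omega> \<and> \<l> i \<omega> < r + real j * h"
        then have "\<l> i \<omega> < \<l> k \<omega>" using j(1) by simp
        then have "i < k" using regular_less_iff[OF elim] by simp
        then show False using k(3)[OF that] i by simp
      qed
      then have "N ({r..<r + real j * h} \<times> D) \<omega> = 0"
        unfolding regular_strip_eq_0[OF elim r D_sets] by blast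
      moreover have "N ({r + real j * h..<r + real j * h + h} \<times> A) \<omega> \<noteq> 0"
        unfolding regular_strip_eq_0[OF elim rj A] using j k(1) Z by blast
      ultimately show "\<omega> \<in> (\<Union>j. V j)" using \<omega> by (auto simp: V_def)
    qed
  qed
  have "prob (first_mark_in r A) \<le> prob (\<Union>j. V j)"
    using sub Ve by (intro finite_measure_mono_AE) auto
  also have "\<dots> \<le> (\<Sum>j. prob (V j))"
    using Ve sums by (intro finite_measure_subadditive_countably) (auto simp: pV sums_iff)
  also have "\<dots> = 1 / (1 - exp (- h)) * c" using sums by (simp add: pV sums_iff)
  \<comment> \<open>The numerator \<open>c\<close> is at most \<open>h * ?a\<close>, the denominator
    at least \<open>h * exp (- h)\<close>; the quotient leaves the factor
    \<open>exp h\<close>.\<close>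
  also have "\<dots> \<le> ?a * exp h"
  proof -
    have "c \<le> h * ?a" using exp_ge_add_one_self[of "- (h * ?a)"] by (simp add: c_def)
    moreover have "h * exp (- h) \<le> 1 - exp (- h)"
    proof -
      have "(1 + h) * exp (- h) \<le> exp h * exp (- h)" by (intro mult_right_mono exp_ge_add_one_self) simp
      then show ?thesis by (simp add: exp_minus algebra_simps)
    qed
    moreover have "0 < h * exp (- h)" using h by simp
    ultimately have "c / (1 - exp (- h)) \<le> (h * ?a) / (h * exp (- h))"
      using c0 h by (intro frac_le) auto
    also have "\<dots> = ?a * exp h" using h by (simp add: exp_minus field_simps)
    finally show ?thesis by simp
  qed
  finally show ?thesis .
qed

text \<open>The upper bound holds for \<open>A\<close> and for \<open>D - A\<close>, and almost
  surely one of the two events occurs. Two bounds adding up to 1 must both be attained.\<close>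

lemma prob_first_mark:
  assumes r: "0 \<le> r" and A: "A \<in> sets \<mu>"
  shows "prob (first_mark_in r A) = measure \<mu> A"
proof -
  have le: "prob (first_mark_in r A) \<le> measure \<mu> A" if A: "A \<in> sets \<mu>" for A
  proof -
    have "((\<lambda>h. measure \<mu> A * exp h) \<longlongrightarrow> measure \<mu> A * exp 0) (at_right (0::real))"
      by (intro tendsto_intros)
    moreover have "eventually (\<lambda>h. prob (first_mark_in r A) \<le> measure \<mu> A * exp h) (at_right (0::real))"
      unfolding eventually_at_right_field using prob_first_mark_le[OF r A] by (intro exI[of _ 1]) auto
    ultimately have "prob (first_mark_in r A) \<le> measure \<mu> A * exp 0"
      by (rule tendsto_lowerbound) simp
    then show ?thesis by simp
  qed
  have DA: "D - A \<in> sets \<mu>" using A D_sets by auto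
  have e: "first_mark_in r A \<in> events" "first_mark_in r (D - A) \<in> events"
    using region_events_sets first_mark_in_sets[OF r] A DA by blast+
  have "AE \<omega> in M. \<omega> \<in> first_mark_in r A \<union> first_mark_in r (D - A)"
    using AE_regular
  proof eventually_elim
    case (elim \<omega>)
    have \<omega>: "\<omega> \<in> space M" using elim by (simp add: regular_def)
    obtain k where k: "1 \<le> k" "r \<le> \<l> k \<omega>" "\<And>j. 1 \<le> j \<Longrightarrow> j < k \<Longrightarrow> \<l> j \<omega> < r"
      using regular_first_atom[OF elim, of r] by blast
    show ?case
      using regular_first_mark[OF elim r A k] regular_first_mark[OF elim r DA k] Z_in_D[OF k(1) \<omega>] by auto
  qed
  then have "1 = prob (first_mark_in r A \<union> first_mark_in r (D - A))"
    using e by (subst prob_eq_1[THEN iffD2]) auto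
  also have "\<dots> \<le> prob (first_mark_in r A) + prob (first_mark_in r (D - A))"
    using e by (rule measure_Un_le)
  finally have "1 \<le> prob (first_mark_in r A) + prob (first_mark_in r (D - A))" .
  moreover have "measure \<mu> (D - A) = 1 - measure \<mu> A"
    using \<mu>.prob_compl[OF A] by (simp add: space_\<mu>)
  ultimately show ?thesis using le[OF A] le[OF DA] by linarith
qed

text \<open>For \<open>q\<close> above the \<open>k\<close>-th level and at most the next one, the
  event says, on regular outcomes, that the next atom comes no earlier than \<open>q + s\<close> and
  carries a mark in \<open>A\<close>.\<close>

definition next_atom :: "real \<Rightarrow> real \<Rightarrow> 'a set \<Rightarrow> 'w set" where
  "next_atom q s A = {\<omega>\<in>space M. N ({q..<q + s} \<times> D) \<omega> = 0} \<inter> first_mark_in (q + s) A"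

lemma next_atom_sets:
  assumes "0 \<le> q" "0 \<le> s" "A \<in> sets \<mu>"
  shows "next_atom q s A \<in> sets (after_level q)"
proof -
  have "first_mark_in (q + s) A \<in> sets (after_level q)"
    using first_mark_in_sets[of "q + s" A] after_level_mono[of q "q + s"] assms by auto
  moreover have "{\<omega>\<in>space M. N ({q..<q + s} \<times> D) \<omega> = 0} \<in> sets (after_level q)"
    using assms D_sets by (intro N_eq_event strip_sets) auto
  ultimately show ?thesis unfolding next_atom_def by (rule sets.Int[rotated])
qed

text \<open>The void strip and the first mark lie on opposite sides of the level
  \<open>q + s\<close> and are therefore independent; they contribute the exponential tail and the
  law of the mark.\<close>

lemma prob_next_atom:
  assumes "0 \<le> q" "0 \<le> s" "A \<in> sets \<mu>"
  shows "prob (next_atom q s A) = exp (- s) * measure \<mu> A"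
proof -
  have v: "{\<omega>\<in>space M. N ({q..<q + s} \<times> D) \<omega> = 0} \<in> sets (before_level (q + s))"
    using assms D_sets by (intro N_eq_event strip_sets) auto
  have f: "first_mark_in (q + s) A \<in> sets (after_level (q + s))"
    using assms by (intro first_mark_in_sets) simp_all
  have "prob (next_atom q s A) = prob {\<omega>\<in>space M. N ({q..<q + s} \<times> D) \<omega> = 0} * prob (first_mark_in (q + s) A)"
    unfolding next_atom_def by (rule before_after_indep[OF v f])
  then show ?thesis
    using prob_void[of q "q + s" D] prob_first_mark[of "q + s" A] assms D_sets \<mu>.prob_space
    by (simp add: space_\<mu>)
qed

lemma regular_next_atom:
  assumes reg: "regular \<omega>" and q: "0 \<le> q" "\<l> k \<omega> < q" "q \<le> \<l> (Suc k) \<omega>" and s: "0 \<le> s" and A: "A \<in> sets \<mu>"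
  shows "\<omega> \<in> next_atom q s A \<longleftrightarrow> q + s \<le> \<l> (Suc k) \<omega> \<and> Z (Suc k) \<omega> \<in> A"
proof -
  have \<omega>: "\<omega> \<in> space M" using reg by (simp add: regular_def)
  have up: "Suc k \<le> j" if "q \<le> \<l> j \<omega>" for j
    using that q(2) regular_less_iff[OF reg, of k j] by (simp add: Suc_le_eq)
  have "N ({q..<q + s} \<times> D) \<omega> = 0 \<longleftrightarrow> q + s \<le> \<l> (Suc k) \<omega>"
  proof
    assume "N ({q..<q + s} \<times> D) \<omega> = 0"
    then show "q + s \<le> \<l> (Suc k) \<omega>"
      unfolding regular_strip_eq_0[OF reg q(1) D_sets]
      using q(3) Z_in_D[of "Suc k", OF _ \<omega>] by (metis le_add1 not_le plus_1_eq_Suc)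
  next
    assume *: "q + s \<le> \<l> (Suc k) \<omega>"
    show "N ({q..<q + s} \<times> D) \<omega> = 0"
      unfolding regular_strip_eq_0[OF reg q(1) D_sets]
    proof (intro allI impI)
      fix j assume j: "q \<le> \<l> j \<omega> \<and> \<l> j \<omega> < q + s"
      then have "\<l> (Suc k) \<omega> \<le> \<l> j \<omega>" using up[of j] regular_le_iff[OF reg] by simp
      with j * show "Z j \<omega> \<notin> D" by simp
    qed
  qed
  moreover have "\<omega> \<in> first_mark_in (q + s) A \<longleftrightarrow> Z (Suc k) \<omega> \<in> A" if "q + s \<le> \<l> (Suc k) \<omega>"
  proof (rule regular_first_mark[OF reg _ A])
    fix j assume "j < Suc k"
    then have "\<l> j \<omega> \<le> \<l> k \<omega>" using regular_le_iff[OF reg] by simp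
    then show "\<l> j \<omega> < q + s" using q s by simp
  qed (use q s that in auto)
  ultimately show ?thesis using \<omega> by (auto simp: next_atom_def)
qed

section \<open>Independence of gaps and marks\<close>

abbreviation gap :: "nat \<Rightarrow> 'w \<Rightarrow> real" where "gap k \<equiv> \<lambda>\<omega>. \<l> (Suc k) \<omega> - \<l> k \<omega>"

lemma gap_measurable: "gap k \<in> borel_measurable M"
  by (intro borel_measurable_diff \<l>_measurable)

lemma gap_event: "{\<omega>\<in>space M. s < gap k \<omega>} \<in> events"
  using gap_measurable[of k] by measurable

lemma mark_events: "A \<in> sets \<mu> \<Longrightarrow> 1 \<le> k \<Longrightarrow> Z k -` A \<inter> space M \<in> events"
  using measurable_sets[OF Z_measurable, of k A] by (simp add: sets_\<mu>)

lemma grid_cell_iff: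
  assumes "0 \<le> y"
  shows "real j / real (Suc m) \<le> y \<and> y < real (Suc j) / real (Suc m) \<longleftrightarrow> j = nat \<lfloor>y * real (Suc m)\<rfloor>"
proof -
  have "real j / real (Suc m) \<le> y \<longleftrightarrow> real j \<le> y * real (Suc m)" by (rule pos_divide_le_eq) simp
  moreover have "y < real (Suc j) / real (Suc m) \<longleftrightarrow> y * real (Suc m) < real j + 1"
    by (subst pos_less_divide_eq) (simp_all add: add.commute)
  moreover have "real j \<le> y * real (Suc m) \<and> y * real (Suc m) < real j + 1 \<longleftrightarrow> \<lfloor>y * real (Suc m)\<rfloor> = int j"
    by (simp add: floor_eq_iff)
  moreover have "0 \<le> \<lfloor>y * real (Suc m)\<rfloor>" using assms by simp
  ultimately show ?thesis by auto
qed

text \<open>The level \<open>\<l> k\<close> is rounded up to the next grid point, after which the Poisson measure is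
  independent of the first \<open>k\<close> atoms; refining the grid recovers the next atom itself.\<close>

lemma joint_law:
  assumes H: "H \<in> atom_history k" and s: "0 \<le> s" and A: "A \<in> sets \<mu>"
  shows "prob (H \<inter> ({\<omega>\<in>space M. s < gap k \<omega>} \<inter> (Z (Suc k) -` A \<inter> space M))) = prob H * (exp (- s) * measure \<mu> A)"
proof -
  let ?T = "H \<inter> ({\<omega>\<in>space M. s < gap k \<omega>} \<inter> (Z (Suc k) -` A \<inter> space M))"
  let ?p = "exp (- s) * measure \<mu> A"
  have He: "H \<in> events" using H atom_history_events by blast
  have T: "?T \<in> events" using He gap_event mark_events[OF A, of "Suc k"] by auto
  \<comment> \<open>The upper end of the cell containing \<open>\<l> k\<close>: the part of
    \<open>H\<close> on that cell is decided strictly below \<open>q m j\<close>.\<close>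
  define q where "q m j = real (Suc j) / real (Suc m)" for m j :: nat
  define C where "C m j = H \<inter> {\<omega>\<in>space M. \<l> k \<omega> < q m j} - {\<omega>\<in>space M. \<l> k \<omega> < real j / real (Suc m)}" for m j :: nat
  define V where "V m = (\<Union>j. C m j \<inter> next_atom (q m j) s A)" for m
  have q0: "0 \<le> q m j" for m j by (simp add: q_def)
  have C: "C m j \<in> sets (before_level (q m j))" for m j
    unfolding C_def using atom_history_before[OF H] level_event_le[of "real j / real (Suc m)" "q m j" k]
    by (intro sets.Diff) (auto simp: q_def divide_right_mono)
  have Ce: "C m j \<in> events" for m j by (rule region_events_sets[OF C])
  have nx: "next_atom (q m j) s A \<in> sets (after_level (q m j))" for m j by (rule next_atom_sets[OF q0 s A])
  have nxe: "next_atom (q m j) s A \<in> events" for m j by (rule region_events_sets[OF nx])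
  have Ve: "V m \<in> events" for m unfolding V_def using Ce nxe by auto
  have Cin: "\<omega> \<in> C m j \<longleftrightarrow> \<omega> \<in> H \<and> j = nat \<lfloor>\<l> k \<omega> * real (Suc m)\<rfloor>" if "regular \<omega>" for \<omega> m j
    using grid_cell_iff[OF regular_nonneg[OF that], of j m k] that
    by (auto simp: C_def q_def regular_def)
  have disj: "disjoint_family (C m)" for m
  proof -
    have "C m i \<inter> C m j = {}" if "i < j" for i j
    proof -
      have "real (Suc i) / real (Suc m) \<le> real j / real (Suc m)" using that by (intro divide_right_mono) simp_all
      then show ?thesis by (auto simp: C_def q_def)
    qed
    then show ?thesis unfolding disjoint_family_on_def by (metis Int_commute linorder_neqE_nat)
  qed
  \<comment> \<open>Exact for every mesh, because the probability of \<open>next_atom\<close> does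
    not depend on the grid point; only the event has to converge.\<close>
  have PV: "prob (V m) = prob H * ?p" for m
  proof -
    have "(\<lambda>j. prob (C m j \<inter> next_atom (q m j) s A)) sums prob (V m)"
      unfolding V_def
    proof (rule finite_measure_UNION)
      show "disjoint_family (\<lambda>j. C m j \<inter> next_atom (q m j) s A)"
        using disj[of m] unfolding disjoint_family_on_def by blast
    qed (use Ce nxe in auto)
    moreover have "prob (C m j \<inter> next_atom (q m j) s A) = prob (C m j) * ?p" for j
      using before_after_indep[OF C nx] prob_next_atom[OF q0 s A] by simp
    ultimately have 1: "(\<lambda>j. prob (C m j) * ?p) sums prob (V m)" by simp
    have "(\<lambda>j. prob (C m j)) sums prob (\<Union>j. C m j)"
      using Ce disj by (intro finite_measure_UNION) auto
    moreover have "prob (\<Union>j. C m j) = prob H"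
    proof (rule finite_measure_eq_AE)
      show "AE \<omega> in M. \<omega> \<in> (\<Union>j. C m j) \<longleftrightarrow> \<omega> \<in> H"
        using AE_regular
      proof eventually_elim
        case (elim \<omega>)
        show ?case unfolding UN_iff Cin[OF elim] by simp
      qed
    qed (use Ce He in auto)
    ultimately have "(\<lambda>j. prob (C m j) * ?p) sums (prob H * ?p)" using sums_mult2 by fastforce
    with 1 show ?thesis by (rule sums_unique2)
  qed
  have "(\<lambda>m. expectation (indicat_real (V m))) \<longlonglongrightarrow> expectation (indicat_real ?T)"
  proof (rule integral_dominated_convergence[where w = "\<lambda>_. 1"])
    show "AE \<omega> in M. (\<lambda>m. indicat_real (V m) \<omega>) \<longlonglongrightarrow> indicat_real ?T \<omega>"
      using AE_regular
    proof eventually_elim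
      case (elim \<omega>)
      have \<omega>: "\<omega> \<in> space M" using elim by (simp add: regular_def)
      have gap: "0 < gap k \<omega>" using regular_less_iff[OF elim, of k "Suc k"] by simp
      \<comment> \<open>Once the mesh is below \<open>d\<close>, rounding up neither jumps over the
        next atom nor alters the comparison of \<open>s\<close> with the gap.\<close>
      define d where "d = (if s < gap k \<omega> then gap k \<omega> - s else gap k \<omega>)"
      have d: "0 < d" "d \<le> gap k \<omega>" using gap s by (auto simp: d_def)
      obtain m0 :: nat where m0: "1 / d < real m0" using reals_Archimedean2 by blast
      have "\<omega> \<in> V m \<longleftrightarrow> \<omega> \<in> ?T" if "m0 \<le> m" for m
      proof -
        define j where "j = nat \<lfloor>\<l> k \<omega> * real (Suc m)\<rfloor>"
        have jj: "real j / real (Suc m) \<le> \<l> k \<omega> \<and> \<l> k \<omega> < q m j"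
          using grid_cell_iff[OF regular_nonneg[OF elim], of j m k] by (simp add: j_def q_def)
        have h: "1 / real (Suc m) < d"
        proof -
          have "1 / d < real (Suc m)" using m0 that by simp
          then show ?thesis using d(1) by (simp add: divide_less_eq mult.commute del: of_nat_Suc)
        qed
        have qh: "q m j = real j / real (Suc m) + 1 / real (Suc m)"
          by (simp add: q_def add_divide_distrib del: of_nat_Suc) (simp add: add_divide_distrib)
        have ub: "q m j < \<l> k \<omega> + d" using jj h qh by linarith
        have "\<omega> \<in> V m \<longleftrightarrow> \<omega> \<in> H \<and> \<omega> \<in> next_atom (q m j) s A"
          unfolding V_def UN_iff Int_iff Cin[OF elim] j_def by blast
        also have "\<omega> \<in> next_atom (q m j) s A \<longleftrightarrow> q m j + s \<le> \<l> (Suc k) \<omega> \<and> Z (Suc k) \<omega> \<in> A"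
          by (rule regular_next_atom[OF elim q0 _ _ s A]) (use jj ub d in auto)
        also have "q m j + s \<le> \<l> (Suc k) \<omega> \<longleftrightarrow> s < gap k \<omega>"
        proof
          assume "q m j + s \<le> \<l> (Suc k) \<omega>"
          with jj show "s < gap k \<omega>" by linarith
        next
          assume "s < gap k \<omega>"
          then have "d = gap k \<omega> - s" by (simp add: d_def)
          with ub show "q m j + s \<le> \<l> (Suc k) \<omega>" by linarith
        qed
        finally show ?thesis using \<omega> by auto
      qed
      then have "eventually (\<lambda>m. indicat_real (V m) \<omega> = indicat_real ?T \<omega>) sequentially"
        unfolding indicator_def by (intro eventually_sequentiallyI[of m0]) (simp only:)
      then show ?case by (rule tendsto_eventually)
    qed
    show "AE \<omega> in M. norm (indicat_real (V m) \<omega>) \<le> 1" for m by (auto simp: indicator_def)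
    show "indicat_real ?T \<in> borel_measurable M" using T by (rule borel_measurable_indicator)
    show "indicat_real (V m) \<in> borel_measurable M" for m using Ve by (rule borel_measurable_indicator)
  qed simp
  then have "(\<lambda>m. prob (V m)) \<longlonglongrightarrow> prob ?T"
    using T Ve by (simp add: sets.Int_space_eq2)
  then show ?thesis unfolding PV by (simp add: LIMSEQ_const_iff)
qed

lemma AE_gap_pos: "AE \<omega> in M. 0 < gap k \<omega>"
  using AE_regular
proof eventually_elim
  case (elim \<omega>)
  then show ?case using regular_less_iff[OF elim, of k "Suc k"] by simp
qed

lemma space_atom_history: "space M \<in> atom_history k"
proof -
  interpret sigma_algebra "space M" "atom_history k" by (rule sigma_algebra_atom_history)
  show ?thesis by (rule top)
qed

lemma history_gap_mark_event:
  assumes "H \<in> atom_history k" "A \<in> sets \<mu>"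
  shows "H \<inter> ({\<omega>\<in>space M. s < gap k \<omega>} \<inter> (Z (Suc k) -` A \<inter> space M)) \<in> events"
proof -
  have "H \<in> events" using assms(1) atom_history_events by blast
  then show ?thesis
    by (rule sets.Int[OF _ sets.Int[OF gap_event mark_events[OF assms(2)]]]) simp
qed

lemma prob_history_mark:
  assumes H: "H \<in> atom_history k" and A: "A \<in> sets \<mu>"
  shows "prob (H \<inter> (Z (Suc k) -` A \<inter> space M)) = prob H * measure \<mu> A"
proof -
  have "prob (H \<inter> (Z (Suc k) -` A \<inter> space M)) =
      prob (H \<inter> ({\<omega>\<in>space M. 0 < gap k \<omega>} \<inter> (Z (Suc k) -` A \<inter> space M)))"
  proof (rule finite_measure_eq_AE)
    show "AE \<omega> in M. \<omega> \<in> H \<inter> (Z (Suc k) -` A \<inter> space M) \<longleftrightarrow>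
        \<omega> \<in> H \<inter> ({\<omega>\<in>space M. 0 < gap k \<omega>} \<inter> (Z (Suc k) -` A \<inter> space M))"
      using AE_gap_pos[of k] by eventually_elim auto
    show "H \<inter> (Z (Suc k) -` A \<inter> space M) \<in> events"
      using H atom_history_events[of k] mark_events[OF A, of "Suc k"] by auto
  qed (rule history_gap_mark_event[OF H A])
  then show ?thesis using joint_law[OF H order_refl A] by simp
qed

lemma prob_mark:
  assumes "A \<in> sets \<mu>"
  shows "prob (Z (Suc k) -` A \<inter> space M) = measure \<mu> A"
proof -
  have "space M \<inter> (Z (Suc k) -` A \<inter> space M) = Z (Suc k) -` A \<inter> space M" by auto
  then show ?thesis using prob_history_mark[OF space_atom_history assms, of k] by (simp add: prob_space)
qed

lemma distr_mark: "distr M \<mu> (Z (Suc k)) = \<mu>"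
proof (rule measure_eqI)
  have Zm: "Z (Suc k) \<in> measurable M \<mu>"
    using Z_measurable[of "Suc k"] measurable_cong_sets[OF refl sets_\<mu>, of M] by simp
  fix A assume "A \<in> sets (distr M \<mu> (Z (Suc k)))"
  then have A: "A \<in> sets \<mu>" by simp
  then show "emeasure (distr M \<mu> (Z (Suc k))) A = emeasure \<mu> A"
    using Zm prob_mark[OF A, of k] by (simp add: emeasure_distr emeasure_eq_measure \<mu>.emeasure_eq_measure)
qed simp

text \<open>Gaps are almost surely positive, so negative thresholds act like 0; they are covered
  because the rays that generate the Borel sets have arbitrary endpoints.\<close>

lemma prob_history_gap_mark:
  assumes H: "H \<in> atom_history k" and A: "A \<in> sets \<mu>"
  shows "prob (H \<inter> ({\<omega>\<in>space M. s < gap k \<omega>} \<inter> (Z (Suc k) -` A \<inter> space M))) =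
    prob H * (exp (- max 0 s) * measure \<mu> A)"
proof -
  have "prob (H \<inter> ({\<omega>\<in>space M. s < gap k \<omega>} \<inter> (Z (Suc k) -` A \<inter> space M))) =
      prob (H \<inter> ({\<omega>\<in>space M. max 0 s < gap k \<omega>} \<inter> (Z (Suc k) -` A \<inter> space M)))"
  proof (rule finite_measure_eq_AE)
    show "AE \<omega> in M. \<omega> \<in> H \<inter> ({\<omega>\<in>space M. s < gap k \<omega>} \<inter> (Z (Suc k) -` A \<inter> space M)) \<longleftrightarrow>
        \<omega> \<in> H \<inter> ({\<omega>\<in>space M. max 0 s < gap k \<omega>} \<inter> (Z (Suc k) -` A \<inter> space M))"
      using AE_gap_pos[of k] by eventually_elim auto
  qed (rule history_gap_mark_event[OF H A])+
  then show ?thesis using joint_law[OF H _ A, of "max 0 s"] by simp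
qed

lemma prob_gap: "prob {\<omega>\<in>space M. s < gap k \<omega>} = exp (- max 0 s)"
proof -
  have "space M \<inter> ({\<omega>\<in>space M. s < gap k \<omega>} \<inter> (Z (Suc k) -` D \<inter> space M)) = {\<omega>\<in>space M. s < gap k \<omega>}"
    using Z_in_D[of "Suc k"] by auto
  then show ?thesis
    using prob_history_gap_mark[OF space_atom_history D_sets, of s k] \<mu>.prob_space by (simp add: prob_space space_\<mu>)
qed

lemma distributed_gap: "distributed M lborel (gap k) (exponential_density 1)"
proof (rule exponential_distributed_iff[THEN iffD2, OF zero_less_one], intro conjI allI impI)
  show "gap k \<in> borel_measurable M" by (rule gap_measurable)
  fix a :: real assume a: "0 \<le> a"
  have "{\<omega>\<in>space M. gap k \<omega> \<le> a} = space M - {\<omega>\<in>space M. a < gap k \<omega>}" by auto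
  then show "prob {\<omega>\<in>space M. gap k \<omega> \<le> a} = 1 - exp (- a * 1)"
    using prob_compl[OF gap_event[of a k]] prob_gap[of a k] a by simp
qed

lemma gen_mark_iff:
  assumes "z \<in> gen M borel (Z (Suc k))"
  obtains A where "A \<in> sets \<mu>" "z = Z (Suc k) -` A \<inter> space M"
proof -
  obtain V where V: "V \<in> sets borel" "z = Z (Suc k) -` V \<inter> space M"
    using assms by (auto simp: gen_eq)
  have "V \<inter> D \<in> sets \<mu>" unfolding sets_\<mu> using V(1) by (auto simp: sets_restrict_space)
  moreover have "z = Z (Suc k) -` (V \<inter> D) \<inter> space M" using V(2) Z_in_D[of "Suc k"] by auto
  ultimately show thesis by (rule that)
qed

lemma gap_generator:
  "gen M borel (gap k) \<subseteq> sets (augmented M {{\<omega>\<in>space M. s < gap k \<omega>} | s. True})" (is "_ \<subseteq> sets (augmented M ?P)")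
proof (rule gen_subset_sets)
  have P: "?P \<subseteq> events" using gap_event by auto
  show "space (augmented M ?P) = space M" using P by simp
  show "gap k \<in> borel_measurable (augmented M ?P)"
    unfolding borel_measurable_iff_greater space_augmented[OF P]
    using augmented_superset[OF P] by blast
qed

text \<open>The rays \<open>s < gap k\<close> are intersection-stable and generate the sigma-algebra
  of the gap; on the side of the mark the joint law already admits every measurable
  \<open>A\<close>.\<close>

lemma indep_history_gap_mark:
  assumes H: "H \<in> atom_history k" and e: "e \<in> gen M borel (gap k)" and z: "z \<in> gen M borel (Z (Suc k))"
  shows "prob (H \<inter> (e \<inter> z)) = prob H * prob e * prob z"
proof -
  obtain A where A: "A \<in> sets \<mu>" "z = Z (Suc k) -` A \<inter> space M" by (rule gen_mark_iff[OF z])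
  have ze: "z \<in> events" using mark_events[OF A(1), of "Suc k"] A(2) by simp
  have He: "H \<in> events" using H atom_history_events by blast
  let ?P = "{{\<omega>\<in>space M. s < gap k \<omega>} | s. True}"
  have "prob (H \<inter> z \<inter> e) = prob (H \<inter> z) * prob e"
  proof (rule indep_event_augmented)
    show "H \<inter> z \<in> events" using He ze by auto
    show "?P \<subseteq> events" using gap_event by auto
    show "Int_stable ?P"
    proof (rule Int_stableI)
      fix a b assume "a \<in> ?P" "b \<in> ?P"
      then obtain s t where "a = {\<omega>\<in>space M. s < gap k \<omega>}" "b = {\<omega>\<in>space M. t < gap k \<omega>}" by auto
      then have "a \<inter> b = {\<omega>\<in>space M. max s t < gap k \<omega>}" by auto
      then show "a \<inter> b \<in> ?P" by blast
    qed
    show "e \<in> sets (augmented M ?P)" using gap_generator e by blast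
    fix a assume "a \<in> ?P"
    then obtain s where a: "a = {\<omega>\<in>space M. s < gap k \<omega>}" by auto
    have "H \<inter> z \<inter> a = H \<inter> (a \<inter> z)" by auto
    then have "prob (H \<inter> z \<inter> a) = prob H * (exp (- max 0 s) * measure \<mu> A)"
      using prob_history_gap_mark[OF H A(1), of s] by (simp only: a A(2))
    also have "\<dots> = prob (H \<inter> z) * prob a"
      using prob_history_mark[OF H A(1)] prob_gap[of s k] by (simp add: a A(2))
    finally show "prob (H \<inter> z \<inter> a) = prob (H \<inter> z) * prob a" .
  qed
  moreover have "H \<inter> z \<inter> e = H \<inter> (e \<inter> z)" by auto
  ultimately show ?thesis
    using prob_history_mark[OF H A(1)] prob_mark[OF A(1), of k] by (simp add: A(2))
qed

text \<open>Everything the atoms determine strictly before the \<open>k\<close>-th mark is read off.\<close>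

definition mark_past :: "nat \<Rightarrow> 'w set set" where
  "mark_past k = (case k of 0 \<Rightarrow> {{}, space M}
     | Suc j \<Rightarrow> sigma_sets (space M) (atom_history j \<union> gen M borel (gap j)))"

lemma gen_gap_events: "gen M borel (gap k) \<subseteq> events"
  by (rule gen_subset_sets[OF gap_measurable refl])

lemma mark_past_generator: "atom_history j \<union> gen M borel (gap j) \<subseteq> events"
  using atom_history_events gen_gap_events by blast

lemma mark_past_events: "mark_past k \<subseteq> events"
proof (cases k)
  case (Suc j)
  then show ?thesis unfolding mark_past_def using sets.sigma_sets_subset[OF mark_past_generator[of j]] by simp
qed (auto simp: mark_past_def)

lemma sigma_algebra_mark_past: "sigma_algebra (space M) (mark_past k)"
proof (cases k)
  case 0
  then show ?thesis by (simp add: mark_past_def sigma_algebra_trivial)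
next
  case (Suc j)
  then show ?thesis unfolding mark_past_def
    using sigma_algebra_sigma_sets[OF order_trans[OF mark_past_generator[of j] sets.space_closed]] by simp
qed

lemma gen_\<l>_atom_history: "1 \<le> i \<Longrightarrow> i \<le> k \<Longrightarrow> gen M borel (\<l> i) \<subseteq> atom_history k"
  unfolding atom_history_def by (auto intro!: sigma_sets.Basic)

lemma gen_Z_atom_history: "1 \<le> i \<Longrightarrow> i \<le> k \<Longrightarrow> gen M borel (Z i) \<subseteq> atom_history k"
  unfolding atom_history_def by (auto intro!: sigma_sets.Basic)

text \<open>The past of the mark contains the gap just before it, so earlier atoms, gap and mark are
  separated by the triple product formula and the first two are joined again.\<close>

lemma indep_mark_past_mark:
  assumes J: "J \<in> mark_past (Suc k)" and z: "z \<in> gen M borel (Z (Suc k))"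
  shows "prob (J \<inter> z) = prob J * prob z"
proof -
  have ze: "z \<in> events" using z gen_subset_sets[OF Z_borel[of "Suc k"] refl] by auto
  have "prob (z \<inter> J) = prob z * prob J"
  proof (rule indep_event_augmented_join[OF ze])
    show "atom_history k \<subseteq> events" by (rule atom_history_events)
    show "gen M borel (gap k) \<subseteq> events" by (rule gen_gap_events)
    show "Int_stable (atom_history k)" by (rule sigma_algebra_imp_Int_stable[OF sigma_algebra_atom_history])
    show "Int_stable (gen M borel (gap k))" by (rule sigma_algebra_imp_Int_stable[OF sigma_algebra_gen])
    show "space M \<in> atom_history k" by (rule space_atom_history)
    show sp: "space M \<in> gen M borel (gap k)"
      by (rule space_in_gen)
    show "J \<in> sets (augmented M (atom_history k \<union> gen M borel (gap k)))"
    proof -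
      have "J \<in> sigma_sets (space M) (atom_history k \<union> gen M borel (gap k))"
        using J by (simp add: mark_past_def)
      also have "\<dots> \<subseteq> sets (augmented M (atom_history k \<union> gen M borel (gap k)))"
        unfolding sets_augmented[OF mark_past_generator] by (rule sigma_sets_mono') simp
      finally show ?thesis .
    qed
    fix a b assume a: "a \<in> atom_history k" and b: "b \<in> gen M borel (gap k)"
    have zs: "space M \<in> gen M borel (Z (Suc k))"
      by (rule space_in_gen)
    have "b \<inter> space M = b" using b gen_gap_events sets.sets_into_space by blast
    then have "prob (a \<inter> b) = prob a * prob b"
      using indep_history_gap_mark[OF a b zs] by (simp add: prob_space)
    moreover have "z \<inter> (a \<inter> b) = a \<inter> (b \<inter> z)" by auto
    ultimately show "prob (z \<inter> (a \<inter> b)) = prob z * prob (a \<inter> b)"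
      using indep_history_gap_mark[OF a b z] by simp
  qed
  then show ?thesis by (simp add: Int_commute mult.commute)
qed

section \<open>Atoms as functions of the random measure\<close>

abbreviation atom_noise :: "'w set set" where "atom_noise \<equiv> gen_random_measure M \<Lambda> \<nu>"

lemma random_measure_path: "(\<lambda>\<omega>. restrict (\<lambda>A. emeasure (\<nu> \<omega>) A) (sets \<Lambda>)) \<in> M \<rightarrow>\<^sub>M PiM (sets \<Lambda>) (\<lambda>_. borel)"
  by (rule measurable_restrict) (use N_measurable[unfolded N_def[abs_def]] in simp)

lemma atom_noise_events: "atom_noise \<subseteq> events"
  unfolding gen_random_measure_def by (rule gen_subset_sets[OF random_measure_path refl])

lemma region_events_noise: "region_events R \<subseteq> sets (augmented M atom_noise)"
proof
  fix a assume "a \<in> region_events R"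
  then obtain m C U where *: "a = counts_in m C U \<and> (\<forall>i<m. C i \<in> sets \<Lambda> \<and> C i \<subseteq> R \<and> U i \<in> sets borel)"
    unfolding region_events_def by (elim CollectE exE)
  have Nm: "N C \<in> borel_measurable (augmented M atom_noise)" if C: "C \<in> sets \<Lambda>" for C
  proof -
    have "(\<lambda>\<omega>. restrict (\<lambda>A. emeasure (\<nu> \<omega>) A) (sets \<Lambda>)) \<in> augmented M atom_noise \<rightarrow>\<^sub>M PiM (sets \<Lambda>) (\<lambda>_. borel)"
      by (rule measurable_if_gen_subset)
         (use augmented_superset[OF atom_noise_events] in \<open>auto simp: gen_random_measure_def[symmetric] atom_noise_events space_PiM\<close>)
    then have "(\<lambda>\<omega>. restrict (\<lambda>A. emeasure (\<nu> \<omega>) A) (sets \<Lambda>) C) \<in> borel_measurable (augmented M atom_noise)"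
      using measurable_component_singleton[OF C] by (rule measurable_compose)
    then show ?thesis using C by (simp add: N_def[abs_def])
  qed
  show "a \<in> sets (augmented M atom_noise)"
    unfolding *[THEN conjunct1]
    by (rule counts_in_sets) (use * Nm atom_noise_events in auto)
qed

text \<open>Atom histories are observed only below deterministic levels, but the events
  \<open>\<l> k < n\<close> exhaust the space as \<open>n\<close> grows.\<close>

lemma atom_history_noise: "atom_history k \<subseteq> sets (augmented M atom_noise)"
proof
  fix H assume H: "H \<in> atom_history k"
  have "H \<inter> {\<omega>\<in>space M. \<l> k \<omega> < real n} \<in> sets (augmented M atom_noise)" for n :: nat
    using atom_history_before[OF H, of "real n"]
      augmented_mono[OF region_events_events atom_noise_events region_events_noise] by blast
  then have "(\<Union>n. H \<inter> {\<omega>\<in>space M. \<l> k \<omega> < real n}) \<in> sets (augmented M atom_noise)" by blast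
  moreover have "H \<subseteq> space M" using H atom_history_events sets.sets_into_space by blast
  then have "(\<Union>n. H \<inter> {\<omega>\<in>space M. \<l> k \<omega> < real n}) = H" using reals_Archimedean2 by fastforce
  ultimately show "H \<in> sets (augmented M atom_noise)" by simp
qed

end

section \<open>Concatenation of reflected pieces\<close>

lemma hitting_time_nonneg: "0 \<le> hitting_time L a \<omega>"
  unfolding hitting_time_def by (rule Inf_greatest) auto

text \<open>Continuity makes the infimum an attained time, so hitting is visible at time
  \<open>t\<close> itself. Negative levels, which levels and gaps take only on a null set, are hit
  at time 0.\<close>

lemma hitting_time_le_iff:
  assumes l: "local_time_path (\<lambda>t. L t \<omega>)" and t: "0 \<le> t"
  shows "hitting_time L a \<omega> \<le> ereal t \<longleftrightarrow> a \<omega> \<le> L t \<omega>"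
proof
  assume "a \<omega> \<le> L t \<omega>"
  then show "hitting_time L a \<omega> \<le> ereal t"
    unfolding hitting_time_def using t by (intro Inf_lower) auto
next
  assume le: "hitting_time L a \<omega> \<le> ereal t"
  show "a \<omega> \<le> L t \<omega>"
  proof (cases "0 \<le> a \<omega>")
    case True
    have "\<exists>u. 0 \<le> u \<and> a \<omega> \<le> L u \<omega>"
    proof (rule ccontr)
      assume "\<not> ?thesis"
      then have "{ereal t |t. 0 \<le> t \<and> a \<omega> \<le> L t \<omega>} = {}" by blast
      then have "hitting_time L a \<omega> = \<infinity>" unfolding hitting_time_def by (simp only: Inf_empty top_ereal_def)
      then show False using le by simp
    qed
    then obtain u where u: "0 \<le> u" "a \<omega> \<le> L u \<omega>" by blast
    obtain s where s: "0 \<le> s" "L s \<omega> = a \<omega>" "\<And>r. 0 \<le> r \<Longrightarrow> r < s \<Longrightarrow> L r \<omega> < a \<omega>"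
      using local_time_path_first_hit[OF l True u] by blast
    have "hitting_time L a \<omega> = ereal s" by (rule hitting_time_eqI) (use s in auto)
    then have "s \<le> t" using le by simp
    then show ?thesis using local_time_path_mono[OF l s(1)] s(2) by metis
  next
    case False
    then show ?thesis using local_time_path_nonneg[OF l t] by simp
  qed
qed

lemma measurable_hitting_time:
  assumes L: "\<And>t. 0 \<le> t \<Longrightarrow> L t \<in> borel_measurable N" and a: "a \<in> borel_measurable N"
    and l: "\<And>\<omega>. \<omega> \<in> space N \<Longrightarrow> local_time_path (\<lambda>t. L t \<omega>)"
  shows "hitting_time L a \<in> borel_measurable N"
proof (rule borel_measurableI_le)
  fix y show "{\<omega> \<in> space N. hitting_time L a \<omega> \<le> y} \<in> sets N"
  proof (cases "\<exists>t\<ge>0. y = ereal t")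
    case True
    then obtain t where t: "0 \<le> t" "y = ereal t" by blast
    have "hitting_time L a \<omega> \<le> ereal t \<longleftrightarrow> a \<omega> \<le> L t \<omega>" if "\<omega> \<in> space N" for \<omega>
      using l[OF that] t(1) by (rule hitting_time_le_iff)
    then have "{\<omega> \<in> space N. hitting_time L a \<omega> \<le> y} = {\<omega> \<in> space N. a \<omega> \<le> L t \<omega>}"
      unfolding t(2) by (intro Collect_cong conj_cong refl)
    also have "\<dots> \<in> sets N" using a L[OF t(1)] by measurable
    finally show ?thesis .
  next
    case False
    show ?thesis
    proof (cases "y = \<infinity>")
      case True
      then show ?thesis by simp
    next
      case nt: False
      have "y < 0"
      proof (rule ccontr)
        assume "\<not> y < 0"
        then have "y = ereal (real_of_ereal y)" "0 \<le> real_of_ereal y"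
          using nt by (cases y; simp)+
        then show False using False by blast
      qed
      then have "\<not> hitting_time L a \<omega> \<le> y" for \<omega>
        using hitting_time_nonneg[of L a \<omega>] by (meson leD order.trans not_le)
      then show ?thesis by simp
    qed
  qed
qed

text \<open>The two equations state the support condition differently, through \<open>D\<close> for
  \<open>X\<close> and through the complement of the frontier for the reflected pieces. For paths in
  the closure of an open \<open>D\<close> both leave only the frontier.\<close>

lemma AE_support_frontier:
  fixes X :: "real \<Rightarrow> 'a::euclidean_space"
  assumes l: "local_time_path l" and D: "open D" and U: "U = D \<or> U = - frontier D"
    and X: "(\<lambda>s. X (max 0 s)) \<in> borel_measurable borel" "\<And>t. 0 \<le> t \<Longrightarrow> X t \<in> closure D"
    and int: "(\<integral>\<^sup>+ s\<in>{0..}. indicator U (X s) \<partial>stieltjes l) = 0"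
  shows "AE s in stieltjes l. 0 \<le> s \<longrightarrow> X s \<in> frontier D"
proof -
  have Ub: "U \<in> sets borel" using U D by (auto intro: borel_open)
  have eq: "(\<lambda>s. indicator U (X s) * indicator {0..} s :: ennreal) = (\<lambda>s. indicator U (X (max 0 s)) * indicator {0..} s)"
    by (auto simp: indicator_def fun_eq_iff max_def)
  have "(\<lambda>s. indicator U (X (max 0 s)) * indicator {0..} s :: ennreal) \<in> borel_measurable (stieltjes l)"
    using measurable_compose[OF X(1) borel_measurable_indicator[OF Ub]] sets_stieltjes[OF l]
    by (intro borel_measurable_times_ennreal borel_measurable_indicator) (auto cong: measurable_cong_sets)
  then have "AE s in stieltjes l. indicator U (X (max 0 s)) * indicator {0..} s = (0::ennreal)"
    using int unfolding eq by (simp only: nn_integral_0_iff_AE)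
  then show ?thesis
  proof eventually_elim
    case (elim s)
    show ?case
    proof
      assume s: "0 \<le> s"
      then have "indicator U (X s) = (0::ennreal)" using elim by (simp add: max_def)
      then have "X s \<notin> U" by (simp add: indicator_eq_0_iff)
      then show "X s \<in> frontier D" using U X(2)[OF s] D by (auto simp: frontier_def interior_open)
    qed
  qed
qed

locale boundary_jump = poisson_atoms M D \<mu> \<nu> \<l> Z
  for M :: "'w measure" and D :: "'a::euclidean_space set" and \<mu> \<nu> \<l> Z +
  fixes x :: 'a and B :: "real \<Rightarrow> 'w \<Rightarrow> 'a" and X :: "real \<Rightarrow> 'w \<Rightarrow> 'a" and L :: "real \<Rightarrow> 'w \<Rightarrow> real"
    and W :: "nat \<Rightarrow> real \<Rightarrow> 'w \<Rightarrow> 'a" and LW :: "nat \<Rightarrow> real \<Rightarrow> 'w \<Rightarrow> real"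
  assumes D: "C2_domain D" "bounded D"
    and BM: "standard_BM M B"
    and B_indep: "indep_set (gen_path M {0..} B) (gen_random_measure M (jump_intensity \<mu>) \<nu>)"
    and jump: "strong_jump_solution M D \<mu> x B \<nu> \<l> Z X L"
    and reflected: "\<And>k. strong_skorokhod_solution M D (restart_position x Z k)
          (increment_after B (jump_time L \<l> k)) (W k) (LW k)"
begin

sublocale brownian_noise M B atom_noise
proof (intro brownian_noise.intro brownian.intro brownian_axioms.intro brownian_noise_axioms.intro)
  show "prob_space M" by (rule prob_space_axioms)
  show "standard_BM M B" by (rule BM)
  show "sigma_algebra (space M) atom_noise" unfolding gen_random_measure_def by (rule sigma_algebra_gen)
  show "indep_set (gen_path M {0..} B) atom_noise" by (rule B_indep)
qed

abbreviation "\<tau> \<equiv> jump_time L \<l>"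

lemma D_open: "open D" using D(1) by (simp add: C2_domain_def)

lemma X_path:
  assumes "\<omega> \<in> space M"
  shows "cadlag (\<lambda>t. X t \<omega>)" "0 \<le> t \<Longrightarrow> X t \<omega> \<in> closure D" "local_time_path (\<lambda>t. L t \<omega>)"
  using jump[unfolded strong_jump_solution_def, THEN conjunct1, rule_format, OF assms] by blast+

lemma XL_measurable:
  assumes "0 \<le> t"
  shows "pair_process X L t \<in> borel_measurable (history t)"
  using jump[unfolded strong_jump_solution_def, THEN conjunct2, THEN conjunct1] assms by blast

lemma X_equation:
  "AE \<omega> in M. \<forall>t\<ge>0. X t \<omega> = x + B t \<omega> +
        (LINT s:{0..t}|stieltjes (\<lambda>s. L s \<omega>). inward_normal D (X s \<omega>)) +
        (\<Sum>k | 1 \<le> k \<and> \<l> k \<omega> \<le> L t \<omega>. Z k \<omega> - left_limit (\<lambda>s. X s \<omega>) (real_of_ereal (\<tau> k \<omega>)))"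
  using jump[unfolded strong_jump_solution_def, THEN conjunct2, THEN conjunct2, THEN conjunct1] .

lemma X_support_integral:
  "AE \<omega> in M. (\<integral>\<^sup>+ s\<in>{0..}. indicator D (X s \<omega>) \<partial>stieltjes (\<lambda>s. L s \<omega>)) = 0"
  using jump[unfolded strong_jump_solution_def, THEN conjunct2, THEN conjunct2, THEN conjunct2] .

lemma W_path:
  assumes "\<omega> \<in> space M"
  shows "continuous_on {0..} (\<lambda>t. W k t \<omega>)" "0 \<le> t \<Longrightarrow> W k t \<omega> \<in> closure D" "local_time_path (\<lambda>t. LW k t \<omega>)"
  using reflected[of k, unfolded strong_skorokhod_solution_def, THEN conjunct1, rule_format, OF assms] by blast+

lemma WLW_measurable:
  assumes "0 \<le> t"
  shows "pair_process (W k) (LW k) t \<in> borel_measurable (augmented M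
      (gen M borel (restart_position x Z k) \<union> gen_path M {0..t} (increment_after B (\<tau> k))))"
  using reflected[of k, unfolded strong_skorokhod_solution_def, THEN conjunct2, THEN conjunct1] assms by blast

lemma W_equation:
  "AE \<omega> in M. \<forall>t\<ge>0. W k t \<omega> = restart_position x Z k \<omega> + increment_after B (\<tau> k) t \<omega> +
        (LINT s:{0..t}|stieltjes (\<lambda>s. LW k s \<omega>). inward_normal D (W k s \<omega>))"
  using reflected[of k, unfolded strong_skorokhod_solution_def, THEN conjunct2, THEN conjunct2, THEN conjunct1] .

lemma W_support_integral:
  "AE \<omega> in M. (\<integral>\<^sup>+ s\<in>{0..}. indicator (- frontier D) (W k s \<omega>) \<partial>stieltjes (\<lambda>s. LW k s \<omega>)) = 0"
  using reflected[of k, unfolded strong_skorokhod_solution_def, THEN conjunct2, THEN conjunct2, THEN conjunct2] .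

lemma X_support: "AE \<omega> in M. AE s in stieltjes (\<lambda>s. L s \<omega>). 0 \<le> s \<longrightarrow> X s \<omega> \<in> frontier D"
  using X_support_integral AE_space
proof eventually_elim
  case (elim \<omega>)
  show ?case
    by (rule AE_support_frontier[OF X_path(3)[OF elim(2)] D_open _ cadlag_borel_measurable[OF X_path(1)[OF elim(2)]]
        X_path(2)[OF elim(2)] elim(1)]) simp
qed

lemma W_support: "AE \<omega> in M. AE s in stieltjes (\<lambda>s. LW k s \<omega>). 0 \<le> s \<longrightarrow> W k s \<omega> \<in> frontier D"
  using W_support_integral[of k] AE_space
proof eventually_elim
  case (elim \<omega>)
  have "continuous_on UNIV (\<lambda>s. W k (max 0 s) \<omega>)"
    using W_path(1)[OF elim(2), of k] by (rule continuous_on_compose2) (auto intro!: continuous_intros)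
  then have m: "(\<lambda>s. W k (max 0 s) \<omega>) \<in> borel_measurable borel" by (rule borel_measurable_continuous_onI)
  show ?case
    by (rule AE_support_frontier[OF W_path(3)[OF elim(2)] D_open _ m W_path(2)[OF elim(2)] elim(1)]) simp
qed

text \<open>If the local time stayed below a level, only finitely many jump terms could occur and the
  equation would bound the Brownian path.\<close>

lemma levels_reached: "AE \<omega> in M. \<forall>k. \<exists>t\<ge>0. \<l> k \<omega> \<le> L t \<omega>"
  using AE_regular AE_unbounded X_equation X_support
proof eventually_elim
  case (elim \<omega>)
  have \<omega>: "\<omega> \<in> space M" using elim(1) by (simp add: regular_def)
  note l = X_path(3)[OF \<omega>]
  show ?case
  proof (rule allI, rule ccontr)
    fix k assume "\<not> (\<exists>t\<ge>0. \<l> k \<omega> \<le> L t \<omega>)"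
    then have below: "L t \<omega> < \<l> k \<omega>" if "0 \<le> t" for t using that by (meson not_le)
    let ?K = "\<lambda>t. LINT s:{0..t}|stieltjes (\<lambda>s. L s \<omega>). inward_normal D (X s \<omega>)"
    let ?d = "\<lambda>k. Z k \<omega> - left_limit (\<lambda>s. X s \<omega>) (real_of_ereal (\<tau> k \<omega>))"
    \<comment> \<open>For a fixed outcome the jump terms with index below \<open>k\<close> are
      finitely many constants, so this bound does not depend on time.\<close>
    define c where "c = (\<Sum>j<k. norm (?d j))"
    obtain R where R: "\<And>y. y \<in> closure D \<Longrightarrow> norm y \<le> R"
      using bounded_closure[OF D(2)] by (auto simp: bounded_iff)
    have bound: "norm (B t \<omega>) \<le> R + norm x + \<l> k \<omega> + c" if t: "0 \<le> t" for t
    proof -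
      let ?J = "{j. 1 \<le> j \<and> \<l> j \<omega> \<le> L t \<omega>}"
      have "?J \<subseteq> {..<k}"
      proof
        fix j assume "j \<in> ?J"
        then have "\<l> j \<omega> < \<l> k \<omega>" using below[OF t] by simp
        then show "j \<in> {..<k}" using regular_less_iff[OF elim(1)] by simp
      qed
      then have s: "norm (\<Sum>j\<in>?J. ?d j) \<le> c"
        unfolding c_def by (intro order_trans[OF norm_sum] sum_mono2) auto
      have "norm (?K t - ?K 0) \<le> L t \<omega> - L 0 \<omega>"
        by (rule reflecting_norm_le[OF D(1) reflecting_stieltjes_integral[OF l D(1)
            cadlag_borel_measurable[OF X_path(1)[OF \<omega>]] elim(4)] order_refl t order_refl])
      then have K: "norm (?K t) \<le> \<l> k \<omega>"
        using below[OF t] l unfolding stieltjes_integral_at_0[OF l] local_time_path_def by simp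
      have X: "norm (X t \<omega>) \<le> R" using R X_path(2)[OF \<omega> t] by blast
      have "B t \<omega> = X t \<omega> - x - ?K t - (\<Sum>j\<in>?J. ?d j)"
        using elim(3)[rule_format, OF t] by (simp add: algebra_simps)
      also have "norm \<dots> \<le> norm (X t \<omega> - x - ?K t) + norm (\<Sum>j\<in>?J. ?d j)" by (rule norm_triangle_ineq4)
      also have "norm (X t \<omega> - x - ?K t) \<le> norm (X t \<omega> - x) + norm (?K t)" by (rule norm_triangle_ineq4)
      also have "norm (X t \<omega> - x) \<le> norm (X t \<omega>) + norm x" by (rule norm_triangle_ineq4)
      finally show ?thesis using s K X by simp
    qed
    obtain t where "0 \<le> t" "R + norm x + \<l> k \<omega> + c < norm (B t \<omega>)" using elim(2) by blast
    with bound[of t] show False by simp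
  qed
qed

definition \<sigma> :: "nat \<Rightarrow> 'w \<Rightarrow> real" where "\<sigma> k \<omega> = real_of_ereal (\<tau> k \<omega>)"

text \<open>The event of full measure on which the pathwise identification is carried out;
  finiteness of all jump times is part of it.\<close>

definition good :: "'w \<Rightarrow> bool" where
  "good \<omega> \<longleftrightarrow> regular \<omega> \<and> (\<forall>k. \<tau> k \<omega> = ereal (\<sigma> k \<omega>)) \<and>
     jump_path D x (\<lambda>t. B t \<omega>) (\<lambda>k. \<l> k \<omega>) (\<lambda>k. Z k \<omega>) (\<lambda>t. X t \<omega>) (\<lambda>t. L t \<omega>)
       (\<lambda>k t. W k t \<omega>) (\<lambda>k t. LW k t \<omega>) (\<lambda>k. \<sigma> k \<omega>)"

lemma AE_good: "AE \<omega> in M. good \<omega>"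
proof -
  have W1: "AE \<omega> in M. \<forall>k. \<forall>t\<ge>0. W k t \<omega> = restart_position x Z k \<omega> + increment_after B (\<tau> k) t \<omega> +
        (LINT s:{0..t}|stieltjes (\<lambda>s. LW k s \<omega>). inward_normal D (W k s \<omega>))"
    using W_equation by (simp add: AE_all_countable)
  have W2: "AE \<omega> in M. \<forall>k. AE s in stieltjes (\<lambda>s. LW k s \<omega>). 0 \<le> s \<longrightarrow> W k s \<omega> \<in> frontier D"
    using W_support by (simp add: AE_all_countable)
  show ?thesis
    using AE_regular levels_reached X_equation X_support W1 W2
  proof eventually_elim
    case (elim \<omega>)
    have \<omega>: "\<omega> \<in> space M" using elim(1) by (simp add: regular_def)
    note l = X_path(3)[OF \<omega>]
    \<comment> \<open>Every level is reached, so each jump time is an attained real time; index 0 is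
      separate because \<open>jump_time\<close> sets it to 0 by convention.\<close>
    have hit: "\<tau> k \<omega> = ereal (\<sigma> k \<omega>) \<and> 0 \<le> \<sigma> k \<omega> \<and> L (\<sigma> k \<omega>) \<omega> = \<l> k \<omega> \<and>
        (\<forall>r. 0 \<le> r \<and> r < \<sigma> k \<omega> \<longrightarrow> L r \<omega> < \<l> k \<omega>)" for k
    proof (cases "k = 0")
      case True
      then have "\<sigma> k \<omega> = 0" "\<tau> k \<omega> = 0" by (simp_all add: \<sigma>_def jump_time_def)
      then show ?thesis using True l by (simp add: \<l>_0 local_time_path_def zero_ereal_def)
    next
      case False
      obtain t where "0 \<le> t" "\<l> k \<omega> \<le> L t \<omega>" using elim(2) by blast
      then obtain s where s: "0 \<le> s" "L s \<omega> = \<l> k \<omega>" "\<And>r. 0 \<le> r \<Longrightarrow> r < s \<Longrightarrow> L r \<omega> < \<l> k \<omega>"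
        using local_time_path_first_hit[OF l regular_nonneg[OF elim(1), of k]] by blast
      have "\<tau> k \<omega> = ereal s"
        using False unfolding jump_time_def by (simp add: hitting_time_eqI[of s "\<l> k"] s)
      then show ?thesis using s by (simp add: \<sigma>_def)
    qed
    have "jump_path D x (\<lambda>t. B t \<omega>) (\<lambda>k. \<l> k \<omega>) (\<lambda>k. Z k \<omega>) (\<lambda>t. X t \<omega>) (\<lambda>t. L t \<omega>)
       (\<lambda>k t. W k t \<omega>) (\<lambda>k t. LW k t \<omega>) (\<lambda>k. \<sigma> k \<omega>)"
    proof
      show "X t \<omega> = x + B t \<omega> + (LINT s:{0..t}|stieltjes (\<lambda>t. L t \<omega>). inward_normal D (X s \<omega>)) +
          (\<Sum>k | 1 \<le> k \<and> \<l> k \<omega> \<le> L t \<omega>. Z k \<omega> - left_limit (\<lambda>t. X t \<omega>) (\<sigma> k \<omega>))" if "0 \<le> t" for t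
        using elim(3)[rule_format, OF that] by (simp only: \<sigma>_def)
      show "W k t \<omega> = (if k = 0 then x else Z k \<omega>) + (B (\<sigma> k \<omega> + t) \<omega> - B (\<sigma> k \<omega>) \<omega>) +
          (LINT s:{0..t}|stieltjes (\<lambda>t. LW k t \<omega>). inward_normal D (W k s \<omega>))" if "0 \<le> t" for k t
      proof -
        have r: "restart_position x Z k \<omega> = (if k = 0 then x else Z k \<omega>)" by (simp add: restart_position_def)
        have "\<tau> k \<omega> = ereal (\<sigma> k \<omega>)" using hit[of k] by blast
        then have i: "increment_after B (\<tau> k) t \<omega> = B (\<sigma> k \<omega> + t) \<omega> - B (\<sigma> k \<omega>) \<omega>"
          by (simp add: increment_after_def)
        from elim(5) that show ?thesis unfolding r[symmetric] i[symmetric] by blast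
      qed
      show "strict_mono (\<lambda>k. \<l> k \<omega>)" "finite {k. \<l> k \<omega> \<le> c}" for c
        using elim(1) by (simp_all add: regular_def)
      show "AE s in stieltjes (\<lambda>t. LW k t \<omega>). 0 \<le> s \<longrightarrow> W k s \<omega> \<in> frontier D" for k
        using elim(6) by blast
      show "L r \<omega> < \<l> k \<omega>" if "0 \<le> r" "r < \<sigma> k \<omega>" for r k using hit[of k] that by blast
      show "AE s in stieltjes (\<lambda>t. L t \<omega>). 0 \<le> s \<longrightarrow> X s \<omega> \<in> frontier D" by (rule elim(4))
      show "0 \<le> \<sigma> k \<omega>" "L (\<sigma> k \<omega>) \<omega> = \<l> k \<omega>" for k using hit[of k] by blast+
    qed (fact D X_path[OF \<omega>] W_path[OF \<omega>] B_continuous[OF \<omega>] B_0[OF \<omega>] \<l>_0)+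
    then show ?case using elim(1) hit by (simp add: good_def)
  qed
qed

lemma good_path:
  assumes "good \<omega>"
  shows "jump_path D x (\<lambda>t. B t \<omega>) (\<lambda>k. \<l> k \<omega>) (\<lambda>k. Z k \<omega>) (\<lambda>t. X t \<omega>) (\<lambda>t. L t \<omega>)
       (\<lambda>k t. W k t \<omega>) (\<lambda>k t. LW k t \<omega>) (\<lambda>k. \<sigma> k \<omega>)"
  using assms by (simp add: good_def)

lemma good_\<tau>: "good \<omega> \<Longrightarrow> \<tau> k \<omega> = ereal (\<sigma> k \<omega>)"
  by (simp add: good_def)

lemma good_lifetime:
  assumes "good \<omega>"
  shows "lifetime LW \<l> k \<omega> = ereal (\<sigma> (Suc k) \<omega> - \<sigma> k \<omega>)"
proof -
  interpret jp: jump_path D x "\<lambda>t. B t \<omega>" "\<lambda>k. \<l> k \<omega>" "\<lambda>k. Z k \<omega>" "\<lambda>t. X t \<omega>" "\<lambda>t. L t \<omega>"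
    "\<lambda>k t. W k t \<omega>" "\<lambda>k t. LW k t \<omega>" "\<lambda>k. \<sigma> k \<omega>" by (rule good_path[OF assms])
  show ?thesis
    unfolding lifetime_def
  proof (rule hitting_time_eqI)
    show "0 \<le> \<sigma> (Suc k) \<omega> - \<sigma> k \<omega>" using strict_monoD[OF jp.strict_mono_\<sigma>, of k "Suc k"] by simp
    show "\<l> (Suc k) \<omega> - \<l> k \<omega> \<le> LW k (\<sigma> (Suc k) \<omega> - \<sigma> k \<omega>) \<omega>" using jp.LW_lifetime[of k] by simp
    show "LW k r \<omega> < \<l> (Suc k) \<omega> - \<l> k \<omega>" if "0 \<le> r" "r < \<sigma> (Suc k) \<omega> - \<sigma> k \<omega>" for r
      using jp.LW_before_lifetime[OF that] .
  qed
qed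

lemma pathwise_concatenation:
  assumes "good \<omega>"
  shows "(\<forall>T. finite {t\<in>{0<..T}. left_limit (\<lambda>s. X s \<omega>) t \<noteq> X t \<omega>} \<and>
                finite {k. 1 \<le> k \<and> \<tau> k \<omega> \<le> ereal T}) \<and>
           (\<forall>t\<ge>0. (\<lambda>k. indicator {\<tau> k \<omega>..<\<tau> (Suc k) \<omega>} (ereal t) *\<^sub>R
                         W k (t - real_of_ereal (\<tau> k \<omega>)) \<omega>) sums X t \<omega>) \<and>
           (\<forall>k. 0 < lifetime LW \<l> k \<omega> \<and> \<tau> (Suc k) \<omega> = \<tau> k \<omega> + lifetime LW \<l> k \<omega> \<and> \<tau> (Suc k) \<omega> < \<infinity> \<and>
                X (real_of_ereal (\<tau> (Suc k) \<omega>)) \<omega> = Z (Suc k) \<omega>)"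
proof -
  interpret jp: jump_path D x "\<lambda>t. B t \<omega>" "\<lambda>k. \<l> k \<omega>" "\<lambda>k. Z k \<omega>" "\<lambda>t. X t \<omega>" "\<lambda>t. L t \<omega>"
    "\<lambda>k t. W k t \<omega>" "\<lambda>k t. LW k t \<omega>" "\<lambda>k. \<sigma> k \<omega>" by (rule good_path[OF assms])
  show ?thesis
    unfolding good_\<tau>[OF assms] good_lifetime[OF assms] real_of_ereal.simps
  proof (intro conjI allI impI)
    fix T
    show "finite {t\<in>{0<..T}. left_limit (\<lambda>s. X s \<omega>) t \<noteq> X t \<omega>}" by (rule jp.finite_discontinuities)
    show "finite {k. 1 \<le> k \<and> ereal (\<sigma> k \<omega>) \<le> ereal T}"
      by (rule finite_subset[OF _ jp.finite_jumps[of T]]) auto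
  next
    fix t :: real assume "0 \<le> t"
    then show "(\<lambda>k. indicator {ereal (\<sigma> k \<omega>)..<ereal (\<sigma> (Suc k) \<omega>)} (ereal t) *\<^sub>R W k (t - \<sigma> k \<omega>) \<omega>) sums X t \<omega>"
      by (rule jp.concatenation_sums)
  next
    fix k
    show "0 < ereal (\<sigma> (Suc k) \<omega> - \<sigma> k \<omega>)" using strict_monoD[OF jp.strict_mono_\<sigma>, of k "Suc k"] by simp
    show "ereal (\<sigma> (Suc k) \<omega>) = ereal (\<sigma> k \<omega>) + ereal (\<sigma> (Suc k) \<omega> - \<sigma> k \<omega>)" by simp
    show "ereal (\<sigma> (Suc k) \<omega>) < \<infinity>" by simp
    show "X (\<sigma> (Suc k) \<omega>) \<omega> = Z (Suc k) \<omega>" using jp.X_\<sigma>[of "Suc k"] by simp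
  qed
qed

end

section \<open>Independence of the pieces\<close>

lemma measurable_pair_process_fst:
  fixes Y :: "real \<Rightarrow> 'w \<Rightarrow> 'a::euclidean_space" and K :: "real \<Rightarrow> 'w \<Rightarrow> real"
  assumes "pair_process Y K t \<in> borel_measurable N"
  shows "Y t \<in> borel_measurable N" "K t \<in> borel_measurable N"
proof -
  have "(fst :: 'a \<times> real \<Rightarrow> 'a) \<in> borel_measurable borel" "(snd :: 'a \<times> real \<Rightarrow> real) \<in> borel_measurable borel"
    by (intro borel_measurable_continuous_onI continuous_intros)+
  from measurable_compose[OF assms this(1)] measurable_compose[OF assms this(2)]
  show "Y t \<in> borel_measurable N" "K t \<in> borel_measurable N" by (simp_all add: pair_process_def)
qed

context boundary_jump
begin

section \<open>Jump times as stopping times\<close>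

lemma atom_noise_history: "sets (augmented M atom_noise) \<subseteq> sets (history t)"
  using augmented_superset[OF history_generator[of t]]
  by (intro augmented_mono[OF atom_noise_events history_generator]) auto

lemma atom_history_in_history: "atom_history k \<subseteq> sets (history t)"
  using atom_history_noise atom_noise_history by blast

text \<open>All atoms are known at time 0 in the enlarged filtration, so a random level may be
  compared with \<open>L t\<close> at any time.\<close>

lemma \<l>_history: "\<l> k \<in> borel_measurable (history t)"
proof (cases "k = 0")
  case True
  have "\<l> 0 = (\<lambda>_. 0)" by (simp add: fun_eq_iff \<l>_0)
  then show ?thesis using True by simp
next
  case False
  have "gen M borel (\<l> k) \<subseteq> sets (history t)"
    using gen_\<l>_atom_history[of k k] atom_history_in_history[of k t] False by auto
  then show ?thesis by (rule measurable_if_gen_subset) simp_all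
qed

lemma XL_history:
  assumes "0 \<le> t" "t \<le> s"
  shows "X t \<in> borel_measurable (history s)" "L t \<in> borel_measurable (history s)"
proof -
  show "X t \<in> borel_measurable (history s)" "L t \<in> borel_measurable (history s)"
    using measurable_pair_process_fst[OF XL_measurable[OF assms(1)]]
      measurable_mono[OF order_refl refl history_mono[OF assms(2)]] by (auto simp: subset_iff)
qed

lemma \<tau>_le_iff:
  assumes "\<omega> \<in> space M" "0 \<le> t"
  shows "\<tau> k \<omega> \<le> ereal t \<longleftrightarrow> k = 0 \<or> \<l> k \<omega> \<le> L t \<omega>"
  using hitting_time_le_iff[of L \<omega> t "\<l> k", OF X_path(3)[OF assms(1)] assms(2)] assms(2)
  by (simp add: jump_time_def zero_ereal_def)

lemma \<tau>_event:
  assumes "0 \<le> t"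
  shows "{\<omega>\<in>space M. \<tau> k \<omega> \<le> ereal t} \<in> sets (history t)"
proof -
  have "{\<omega>\<in>space M. \<tau> k \<omega> \<le> ereal t} = {\<omega>\<in>space (history t). k = 0 \<or> \<l> k \<omega> \<le> L t \<omega>}"
    unfolding space_history by (intro Collect_cong conj_cong refl \<tau>_le_iff assms)
  also have "\<dots> \<in> sets (history t)"
    using \<l>_history[of k t] XL_history(2)[OF assms order_refl] by measurable
  finally show ?thesis .
qed

sublocale stopped: brownian_stopping M B atom_noise "\<tau> k" for k
proof unfold_locales
  show "0 \<le> \<tau> k \<omega>" for \<omega> by (simp add: jump_time_def hitting_time_nonneg)
  show "{\<omega>\<in>space M. \<tau> k \<omega> \<le> ereal t} \<in> sets (history t)" if "0 \<le> t" for t by (rule \<tau>_event[OF that])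
  show "AE \<omega> in M. \<tau> k \<omega> < \<infinity>"
    using AE_good by eventually_elim (simp add: good_\<tau>)
qed

abbreviation "\<beta>' k \<equiv> increment_after B (\<tau> k)"
abbreviation "start_pos k \<equiv> restart_position x Z k"

lemma start_pos_0: "start_pos 0 = (\<lambda>_. x)"
  by (simp add: restart_position_def fun_eq_iff)

lemma start_pos_Suc: "start_pos (Suc k) = Z (Suc k)"
  by (simp add: restart_position_def fun_eq_iff)

lemma start_pos_measurable: "start_pos k \<in> borel_measurable M"
  by (cases k) (simp_all add: start_pos_0 start_pos_Suc Z_borel)

lemma gen_start_pos_events: "gen M borel (start_pos k) \<subseteq> events"
  by (rule gen_subset_sets[OF start_pos_measurable refl])

lemma gen_start_pos_0: "gen M borel (start_pos 0) \<subseteq> {{}, space M}"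
  unfolding start_pos_0 by (auto simp: gen_eq)

lemma trivial_atom_history: "{{}, space M} \<subseteq> atom_history k"
proof -
  interpret sigma_algebra "space M" "atom_history k" by (rule sigma_algebra_atom_history)
  show ?thesis by simp
qed

lemma gen_start_pos_atom_history: "gen M borel (start_pos k) \<subseteq> atom_history k"
proof (cases k)
  case 0
  then show ?thesis using gen_start_pos_0 trivial_atom_history by auto
next
  case (Suc j)
  then show ?thesis using gen_Z_atom_history[of k k] by (simp add: start_pos_Suc)
qed

lemma indep_mark_past_start:
  assumes "J \<in> mark_past k" "z \<in> gen M borel (start_pos k)"
  shows "prob (J \<inter> z) = prob J * prob z"
proof (cases k)
  case 0
  then have "z = {} \<or> z = space M" using assms(2) gen_start_pos_0 by auto
  moreover have "J \<inter> space M = J" using assms(1) mark_past_events sets.sets_into_space by blast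
  ultimately show ?thesis by (auto simp: prob_space)
next
  case (Suc j)
  then show ?thesis using indep_mark_past_mark[of J j z] assms by (simp add: start_pos_Suc)
qed

lemma measurable_atom_history:
  assumes "atom_history k \<subseteq> sets K'" "space K' = space M"
  shows "i \<le> k \<Longrightarrow> \<l> i \<in> borel_measurable K'" "1 \<le> i \<Longrightarrow> i \<le> k \<Longrightarrow> Z i \<in> borel_measurable K'"
proof -
  assume i: "i \<le> k"
  show "\<l> i \<in> borel_measurable K'"
  proof (cases "i = 0")
    case True
    have "\<l> 0 = (\<lambda>_. 0)" by (simp add: fun_eq_iff \<l>_0)
    then show ?thesis using True by simp
  next
    case False
    then have "gen M borel (\<l> i) \<subseteq> sets K'" using gen_\<l>_atom_history[of i k] i assms(1) by auto
    then show ?thesis by (rule measurable_if_gen_subset[OF _ assms(2)]) simp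
  qed
next
  assume i: "1 \<le> i" "i \<le> k"
  then have "gen M borel (Z i) \<subseteq> sets K'" using gen_Z_atom_history[of i k] assms(1) by auto
  then show "Z i \<in> borel_measurable K'" by (rule measurable_if_gen_subset[OF _ assms(2)]) simp
qed

lemma gen_gap_atom_history: "gen M borel (gap k) \<subseteq> atom_history (Suc k)"
proof -
  let ?K = "sigma (space M) (atom_history (Suc k))"
  have p: "atom_history (Suc k) \<subseteq> Pow (space M)"
    using order_trans[OF atom_history_events sets.space_closed] .
  have s: "sets ?K = atom_history (Suc k)" "space ?K = space M"
    using sigma_algebra.sigma_sets_eq[OF sigma_algebra_atom_history] sets_measure_of[OF p] space_measure_of[OF p] by auto
  have "gap k \<in> borel_measurable ?K"
    using s by (intro borel_measurable_diff measurable_atom_history[of "Suc k"]) auto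
  from gen_subset_sets[OF this s(2)] show ?thesis using s(1) by simp
qed

lemma mark_past_atom_history: "mark_past k \<subseteq> atom_history k"
proof (cases k)
  case 0
  then show ?thesis using trivial_atom_history by (simp add: mark_past_def)
next
  case (Suc j)
  have "atom_history j \<subseteq> atom_history (Suc j)"
    unfolding atom_history_def by (rule sigma_sets_mono'[OF UN_mono]) auto
  then have "atom_history j \<union> gen M borel (gap j) \<subseteq> atom_history (Suc j)"
    using gen_gap_atom_history[of j] by (rule Un_least)
  from sigma_algebra.sigma_sets_subset[OF sigma_algebra_atom_history this]
  show ?thesis using Suc by (simp add: mark_past_def)
qed

text \<open>The whole Brownian path together with what the atoms show before the mark
  \<open>Z k\<close>: the largest information from which the new starting point, gap and mark will
  be shown independent.\<close>

abbreviation base :: "nat \<Rightarrow> 'w measure" where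
  "base k \<equiv> augmented M (gen_path M {0..} B \<union> mark_past k)"

lemma base_generator: "gen_path M {0..} B \<union> mark_past k \<subseteq> events"
  using gen_path_events[of "{0..}"] mark_past_events by auto

lemma space_base [simp]: "space (base k) = space M"
  by (rule space_augmented[OF base_generator])

lemma B_base: "0 \<le> t \<Longrightarrow> B t \<in> borel_measurable (base k)"
  using augmented_superset[OF base_generator[of k]]
  by (intro measurable_if_gen_path_subset[of M "{0..}" B]) auto

lemma base_AE_cong:
  "f \<in> measurable (base k) K' \<Longrightarrow> g \<in> measurable M K' \<Longrightarrow> AE \<omega> in M. f \<omega> = g \<omega> \<Longrightarrow> g \<in> measurable (base k) K'"
  by (rule measurable_augmented_AE_cong[OF base_generator])

text \<open>The level with index \<open>k\<close> is the previous one plus a gap and is still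
  included; the start of piece \<open>k\<close> is the mark \<open>Z k\<close> for positive
  \<open>k\<close>, whence the strict inequality in the second claim.\<close>

lemma atoms_base:
  assumes "j \<le> k"
  shows "\<l> j \<in> borel_measurable (base k)" "j < k \<Longrightarrow> start_pos j \<in> borel_measurable (base k)"
proof -
  have mp: "mark_past k \<subseteq> sets (base k)" using augmented_superset[OF base_generator[of k]] by auto
  show "\<l> j \<in> borel_measurable (base k)"
  proof (cases k)
    case 0
    have "\<l> 0 = (\<lambda>_. 0)" by (simp add: fun_eq_iff \<l>_0)
    then show ?thesis using 0 assms by simp
  next
    case (Suc i)
    have sub: "atom_history i \<subseteq> sets (base k)" "gen M borel (gap i) \<subseteq> sets (base k)"
      using mp Suc by (auto simp: mark_past_def intro: sigma_sets.Basic)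
    have "\<l> i \<in> borel_measurable (base k)" by (rule measurable_atom_history(1)[OF sub(1)]) simp_all
    moreover have "gap i \<in> borel_measurable (base k)"
      by (rule measurable_if_gen_subset[OF sub(2)]) simp_all
    ultimately have "(\<lambda>\<omega>. \<l> i \<omega> + gap i \<omega>) \<in> borel_measurable (base k)" by (rule borel_measurable_add)
    then have "\<l> k \<in> borel_measurable (base k)" by (simp add: Suc)
    moreover have "j \<le> i \<Longrightarrow> \<l> j \<in> borel_measurable (base k)"
      by (rule measurable_atom_history(1)[OF sub(1)]) simp_all
    ultimately show ?thesis using assms Suc by (cases "j = k") auto
  qed
  show "start_pos j \<in> borel_measurable (base k)" if "j < k"
  proof (cases j)
    case 0
    then show ?thesis by (simp add: start_pos_0)
  next
    case (Suc i)
    from \<open>j < k\<close> have "\<exists>n. k = Suc n" by (intro gr0_implies_Suc) linarith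
    then obtain n where n: "k = Suc n" by blast
    have sub: "atom_history n \<subseteq> sets (base k)"
      using mp n by (auto simp: mark_past_def intro: sigma_sets.Basic)
    show ?thesis unfolding Suc start_pos_Suc
      by (rule measurable_atom_history(2)[OF sub]) (use Suc \<open>j < k\<close> n in auto)
  qed
qed

lemma \<beta>_base:
  assumes "\<tau> j \<in> borel_measurable (base k)" "0 \<le> t"
  shows "\<beta>' j t \<in> borel_measurable (base k)"
proof -
  have \<sigma>: "(\<lambda>\<omega>. real_of_ereal (\<tau> j \<omega>)) \<in> borel_measurable (base k)" using assms(1) by measurable
  have \<sigma>0: "0 \<le> real_of_ereal (\<tau> j \<omega>)" for \<omega>
    by (rule real_of_ereal_pos) (simp add: jump_time_def hitting_time_nonneg)
  have c: "continuous_on {0..} (\<lambda>t. B t \<omega>)" if "\<omega> \<in> space (base k)" for \<omega>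
    using that by (intro B_continuous) simp
  have 1: "(\<lambda>\<omega>. B (real_of_ereal (\<tau> j \<omega>) + t) \<omega>) \<in> borel_measurable (base k)"
    by (rule measurable_process_at[OF B_base c borel_measurable_add[OF \<sigma>]]) (use \<sigma>0 assms(2) in auto)
  have 2: "(\<lambda>\<omega>. B (real_of_ereal (\<tau> j \<omega>)) \<omega>) \<in> borel_measurable (base k)"
    by (rule measurable_process_at[OF B_base c \<sigma>]) (use \<sigma>0 in auto)
  have "{\<omega>\<in>space (base k). \<tau> j \<omega> < \<infinity>} \<in> sets (base k)" using assms(1) by measurable
  then show ?thesis
    unfolding increment_after_def by (intro measurable_If borel_measurable_diff 1 2) auto
qed

text \<open>Here the strength of the reflected solutions enters: a piece is adapted to its start and
  its driving increments, both of which lie in \<open>base k\<close>.\<close>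

lemma WLW_base:
  assumes "j < k" "\<tau> j \<in> borel_measurable (base k)" "0 \<le> t"
  shows "W j t \<in> borel_measurable (base k)" "LW j t \<in> borel_measurable (base k)"
proof -
  let ?G = "gen M borel (start_pos j) \<union> gen_path M {0..t} (\<beta>' j)"
  have 1: "gen M borel (start_pos j) \<subseteq> sets (base k)"
    using assms(1) by (intro gen_subset_sets atoms_base) auto
  have 2: "gen_path M {0..t} (\<beta>' j) \<subseteq> sets (base k)"
    by (intro gen_path_subset_sets \<beta>_base assms(2)) auto
  have G: "?G \<subseteq> sets (base k)" using 1 2 by auto
  have Ge: "?G \<subseteq> events" using G augmented_subset_sets[OF base_generator[of k]] by auto
  have "pair_process (W j) (LW j) t \<in> borel_measurable (base k)"
    by (rule measurable_augmented_mono[OF Ge base_generator G WLW_measurable[OF assms(3)]])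
  from measurable_pair_process_fst[OF this]
  show "W j t \<in> borel_measurable (base k)" "LW j t \<in> borel_measurable (base k)" .
qed

text \<open>Induction through the almost sure identity of \<open>\<tau> (Suc j)\<close> with
  \<open>\<tau> j\<close> plus a lifetime: the lifetime is a functional of piece \<open>j\<close>,
  whereas \<open>L\<close> itself is only known to be adapted to \<open>B\<close> and the full
  random measure.\<close>

lemma \<tau>_base: "j \<le> k \<Longrightarrow> \<tau> j \<in> borel_measurable (base k)"
proof (induction j)
  case 0
  have "\<tau> 0 = (\<lambda>_. 0)" by (simp add: jump_time_def fun_eq_iff)
  then show ?case by simp
next
  case (Suc j)
  then have j: "j < k" "\<tau> j \<in> borel_measurable (base k)" by auto
  have "lifetime LW \<l> j \<in> borel_measurable (base k)"
    unfolding lifetime_def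
  proof (rule measurable_hitting_time)
    show "LW j t \<in> borel_measurable (base k)" if "0 \<le> t" for t by (rule WLW_base(2)[OF j that])
    show "gap j \<in> borel_measurable (base k)" using Suc.prems by (intro borel_measurable_diff atoms_base(1)) auto
    show "local_time_path (\<lambda>t. LW j t \<omega>)" if "\<omega> \<in> space (base k)" for \<omega> using that by (intro W_path(3)) simp
  qed
  then have "(\<lambda>\<omega>. \<tau> j \<omega> + lifetime LW \<l> j \<omega>) \<in> borel_measurable (base k)"
    using j(2) by measurable
  moreover have "AE \<omega> in M. \<tau> j \<omega> + lifetime LW \<l> j \<omega> = \<tau> (Suc j) \<omega>"
    using AE_good by eventually_elim (simp add: good_\<tau> good_lifetime)
  ultimately show ?case by (intro base_AE_cong[OF _ stopped.\<tau>_measurable])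
qed

section \<open>The path before the k-th jump\<close>

abbreviation "killed k \<equiv> before (\<tau> k) X L"

text \<open>Stopping in time becomes truncation at a level, which removes the random time from the
  expression. The \<open>max 0\<close> accounts for exceptional outcomes with a negative
  level.\<close>

lemma stopped_local_time:
  assumes \<omega>: "\<omega> \<in> space M" and t: "0 \<le> t"
  shows "L (real_of_ereal (min (ereal t) (\<tau> k \<omega>))) \<omega> = min (L t \<omega>) (max 0 (\<l> k \<omega>))"
proof -
  note l = X_path(3)[OF \<omega>]
  have L0: "L 0 \<omega> = 0" using l by (simp add: local_time_path_def)
  have Lt: "0 \<le> L t \<omega>" by (rule local_time_path_nonneg[OF l t])
  consider "k = 0 \<or> \<l> k \<omega> \<le> 0" | "k \<noteq> 0" "0 < \<l> k \<omega>" "\<tau> k \<omega> \<le> ereal t" | "k \<noteq> 0" "0 < \<l> k \<omega>" "ereal t < \<tau> k \<omega>"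
    by (meson not_le)
  then show ?thesis
  proof cases
    case 1
    have "\<tau> k \<omega> \<le> ereal 0" using 1 L0 by (subst \<tau>_le_iff[OF \<omega>]) auto
    then have "\<tau> k \<omega> = 0" using stopped.\<tau>_nonneg[OF \<omega>, of k] by (simp add: zero_ereal_def antisym)
    moreover have "max 0 (\<l> k \<omega>) = 0" using 1 \<l>_0 by auto
    ultimately show ?thesis using L0 Lt t by (simp add: min_def zero_ereal_def)
  next
    case 2
    then have "\<l> k \<omega> \<le> L t \<omega>" using \<tau>_le_iff[OF \<omega> t, of k] by simp
    then obtain s where s: "0 \<le> s" "s \<le> t" "L s \<omega> = \<l> k \<omega>" "\<And>r. 0 \<le> r \<Longrightarrow> r < s \<Longrightarrow> L r \<omega> < \<l> k \<omega>"
      using local_time_path_first_hit[OF l, of "\<l> k \<omega>" t] 2 t by auto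
    have "\<tau> k \<omega> = ereal s"
      using 2(1) unfolding jump_time_def by (simp add: hitting_time_eqI[of s "\<l> k"] s)
    then show ?thesis using s 2 \<open>\<l> k \<omega> \<le> L t \<omega>\<close> by (simp add: min_def)
  next
    case 3
    from 3(3) have "\<not> \<tau> k \<omega> \<le> ereal t" by (simp only: not_le)
    then have "\<not> \<l> k \<omega> \<le> L t \<omega>" using \<tau>_le_iff[OF \<omega> t, of k] by simp
    moreover have "min (ereal t) (\<tau> k \<omega>) = ereal t" by (rule min_absorb1[OF less_imp_le[OF 3(3)]])
    ultimately show ?thesis by simp
  qed
qed

lemma killed_eq:
  assumes "\<omega> \<in> space M" "0 \<le> t"
  shows "killed k t \<omega> = (if \<tau> k \<omega> \<le> ereal t then 0 else X t \<omega>, min (L t \<omega>) (max 0 (\<l> k \<omega>)))"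
  using stopped_local_time[OF assms, of k] by (auto simp: before_def)

lemma killed_measurable_history:
  assumes "0 \<le> t" "t \<le> s"
  shows "killed k t \<in> borel_measurable (history s)"
proof -
  have e: "{\<omega>\<in>space (history s). \<tau> k \<omega> \<le> ereal t} \<in> sets (history s)"
    using \<tau>_event[OF assms(1), of k] history_mono[OF assms(2)] by auto
  have "(\<lambda>\<omega>. (if \<tau> k \<omega> \<le> ereal t then 0 else X t \<omega>, min (L t \<omega>) (max 0 (\<l> k \<omega>)))) \<in> borel_measurable (history s)"
    using e XL_history[OF assms] \<l>_history[of k s]
    by (intro borel_measurable_Pair measurable_If borel_measurable_min borel_measurable_max) auto
  then show ?thesis
    by (rule measurable_cong[THEN iffD2, rotated]) (use killed_eq assms(1) in simp)
qed

text \<open>The delicate case is a time \<open>t\<close> after \<open>s\<close>: once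
  \<open>\<tau> k\<close> has occurred, the pair is frozen at 0 and the level, and the level is
  known from the atoms at any time.\<close>

lemma killed_past:
  assumes t: "0 \<le> t" and A: "A \<in> sets borel"
  shows "killed k t -` A \<inter> space M \<in> stopped.past k"
  unfolding stopped.past_def
proof (intro CollectI conjI allI impI)
  have m: "killed k t -` A \<inter> space M \<in> sets (history s)" if "t \<le> s" for s
    using measurable_sets[OF killed_measurable_history[OF t that] A] by simp
  show "killed k t -` A \<inter> space M \<in> events" using m[OF order_refl] history_events by blast
  fix s :: real assume s: "0 \<le> s"
  show "killed k t -` A \<inter> space M \<inter> {\<omega>\<in>space M. \<tau> k \<omega> \<le> ereal s} \<in> sets (history s)"
  proof (cases "t \<le> s")
    case True
    then show ?thesis using m[OF True] \<tau>_event[OF s, of k] by auto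
  next
    case False
    have eq: "killed k t \<omega> = (0, max 0 (\<l> k \<omega>))" if \<omega>: "\<omega> \<in> space M" and le: "\<tau> k \<omega> \<le> ereal s" for \<omega>
    proof -
      have "\<tau> k \<omega> \<le> ereal t" using order_trans[OF le] False by simp
      moreover from this have "max 0 (\<l> k \<omega>) \<le> L t \<omega>"
        using \<tau>_le_iff[OF \<omega> t, of k] local_time_path_nonneg[OF X_path(3)[OF \<omega>] t] by (auto simp: \<l>_0)
      ultimately show ?thesis using killed_eq[OF \<omega> t, of k] by simp
    qed
    have "(\<lambda>\<omega>. (0::'a, max 0 (\<l> k \<omega>))) \<in> borel_measurable (history s)"
      using \<l>_history[of k s] by (intro borel_measurable_Pair borel_measurable_max) auto
    from measurable_sets[OF this A]
    have "(\<lambda>\<omega>. (0::'a, max 0 (\<l> k \<omega>))) -` A \<inter> space M \<in> sets (history s)" by simp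
    moreover have "killed k t -` A \<inter> space M \<inter> {\<omega>\<in>space M. \<tau> k \<omega> \<le> ereal s} =
        ((\<lambda>\<omega>. (0::'a, max 0 (\<l> k \<omega>))) -` A \<inter> space M) \<inter> {\<omega>\<in>space M. \<tau> k \<omega> \<le> ereal s}"
      using eq by auto
    ultimately show ?thesis using \<tau>_event[OF s, of k] by auto
  qed
qed

lemma gen_killed_past: "gen_path M {0..} (killed k) \<subseteq> stopped.past k"
proof
  fix a assume "a \<in> gen_path M {0..} (killed k)"
  then have "a \<in> sigma_sets (space M) {killed k t -` A \<inter> space M | t A. t \<in> {0..} \<and> A \<in> sets borel}"
    by (simp only: gen_path_eq_sigma_sets)
  then show "a \<in> stopped.past k"
  proof (induction rule: sigma_sets.induct)
    case (Basic a)
    then obtain t A where "a = killed k t -` A \<inter> space M" "0 \<le> t" "A \<in> sets borel" by auto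
    then show ?case using killed_past by simp
  next
    case Empty
    then show ?case by (simp add: stopped.past_def)
  next
    case (Compl a)
    show ?case unfolding stopped.past_def
    proof (intro CollectI conjI allI impI)
      show "space M - a \<in> events" using Compl.IH stopped.past_events by blast
      fix s :: real assume s: "0 \<le> s"
      have "(space M - a) \<inter> {\<omega>\<in>space M. \<tau> k \<omega> \<le> ereal s} =
          {\<omega>\<in>space M. \<tau> k \<omega> \<le> ereal s} - (a \<inter> {\<omega>\<in>space M. \<tau> k \<omega> \<le> ereal s})" by auto
      also have "\<dots> \<in> sets (history s)"
        using \<tau>_event[OF s, of k] Compl.IH s by (intro sets.Diff) (auto simp: stopped.past_def)
      finally show "(space M - a) \<inter> {\<omega>\<in>space M. \<tau> k \<omega> \<le> ereal s} \<in> sets (history s)" .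
    qed
  next
    case (Union a)
    show ?case unfolding stopped.past_def
    proof (intro CollectI conjI allI impI)
      show "(\<Union>i. a i) \<in> events" using Union.IH stopped.past_events by blast
      fix s :: real assume s: "0 \<le> s"
      have "(\<Union>i. a i) \<inter> {\<omega>\<in>space M. \<tau> k \<omega> \<le> ereal s} = (\<Union>i. a i \<inter> {\<omega>\<in>space M. \<tau> k \<omega> \<le> ereal s})" by auto
      also have "\<dots> \<in> sets (history s)"
        using Union.IH s by (intro sets.countable_UN) (auto simp: stopped.past_def)
      finally show "(\<Union>i. a i) \<inter> {\<omega>\<in>space M. \<tau> k \<omega> \<le> ereal s} \<in> sets (history s)" .
    qed
  qed
qed

text \<open>Before the \<open>k\<close>-th jump the process is put together from the first \<open>k\<close> reflected pieces, so it does
  not see the marks from \<open>Z k\<close> on.\<close>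

lemma killed_base:
  assumes t: "0 \<le> t"
  shows "killed k t \<in> borel_measurable (base k)"
proof -
  let ?I = "\<lambda>j \<omega>. \<tau> j \<omega> \<le> ereal t \<and> ereal t < \<tau> (Suc j) \<omega>"
  \<comment> \<open>The age of piece \<open>j\<close>; \<open>max 0\<close> keeps it a valid time on
    outcomes where the piece has not started.\<close>
  let ?u = "\<lambda>j \<omega>. max 0 (t - real_of_ereal (\<tau> j \<omega>))"
  have ev: "{\<omega>\<in>space (base k). ?I j \<omega>} \<in> sets (base k)" if "j < k" for j
  proof -
    have m: "\<tau> j \<in> borel_measurable (base k)" "\<tau> (Suc j) \<in> borel_measurable (base k)"
      using \<tau>_base that by auto
    show ?thesis using m by measurable
  qed
  have um: "?u j \<in> borel_measurable (base k)" if "j < k" for j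
  proof -
    have m: "\<tau> j \<in> borel_measurable (base k)" using \<tau>_base that by auto
    show ?thesis using m by measurable
  qed
  have W: "(\<lambda>\<omega>. W j (?u j \<omega>) \<omega>) \<in> borel_measurable (base k)" if j: "j < k" for j
    using W_path(1) by (intro measurable_process_at[OF WLW_base(1)[OF j \<tau>_base] _ um[OF j]]) (use j in auto)
  have LW: "(\<lambda>\<omega>. LW j (?u j \<omega>) \<omega>) \<in> borel_measurable (base k)" if j: "j < k" for j
    using W_path(3) by (intro measurable_process_at[OF WLW_base(2)[OF j \<tau>_base] _ um[OF j]])
      (use j in \<open>auto simp: local_time_path_def\<close>)
  \<comment> \<open>On a good outcome exactly one summand is active before the \<open>k\<close>-th
    jump and none from that jump on, which reproduces the killing at 0.\<close>
  define f1 where "f1 \<omega> = (\<Sum>j<k. if ?I j \<omega> then W j (?u j \<omega>) \<omega> else 0)" for \<omega>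
  define f2 where "f2 \<omega> = (if \<tau> k \<omega> \<le> ereal t then \<l> k \<omega>
      else (\<Sum>j<k. if ?I j \<omega> then \<l> j \<omega> + LW j (?u j \<omega>) \<omega> else 0))" for \<omega>
  have f1: "f1 \<in> borel_measurable (base k)"
    unfolding f1_def using ev W by (intro borel_measurable_sum measurable_If) auto
  have "{\<omega>\<in>space (base k). \<tau> k \<omega> \<le> ereal t} \<in> sets (base k)"
    using \<tau>_base[OF order_refl] by measurable
  then have f2: "f2 \<in> borel_measurable (base k)"
    unfolding f2_def using ev LW atoms_base(1)
    by (intro borel_measurable_sum measurable_If borel_measurable_add) auto
  have eq: "AE \<omega> in M. (f1 \<omega>, f2 \<omega>) = killed k t \<omega>"
    using AE_good
  proof eventually_elim
    case (elim \<omega>)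
    interpret jp: jump_path D x "\<lambda>t. B t \<omega>" "\<lambda>k. \<l> k \<omega>" "\<lambda>k. Z k \<omega>" "\<lambda>t. X t \<omega>" "\<lambda>t. L t \<omega>"
      "\<lambda>k t. W k t \<omega>" "\<lambda>k t. LW k t \<omega>" "\<lambda>k. \<sigma> k \<omega>" by (rule good_path[OF elim])
    have reg: "regular \<omega>" using elim by (simp add: good_def)
    have \<omega>: "\<omega> \<in> space M" using reg by (simp add: regular_def)
    have \<tau>: "\<tau> j \<omega> = ereal (\<sigma> j \<omega>)" for j by (rule good_\<tau>[OF elim])
    obtain m where m: "\<sigma> m \<omega> \<le> t" "t < \<sigma> (Suc m) \<omega>" by (rule jp.ex_interval[OF t])
    have I: "?I j \<omega> \<longleftrightarrow> j = m" for j
    proof -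
      have "\<sigma> j \<omega> \<le> t \<and> t < \<sigma> (Suc j) \<omega> \<longleftrightarrow> j = m"
        using m strict_mono_less_eq[OF jp.strict_mono_\<sigma>, of "Suc m" j]
          strict_mono_less_eq[OF jp.strict_mono_\<sigma>, of "Suc j" m] by (auto simp: not_less_eq_eq[symmetric])
      then show ?thesis by (simp add: \<tau>)
    qed
    have k: "\<tau> k \<omega> \<le> ereal t \<longleftrightarrow> k \<le> m"
      unfolding \<tau> ereal_less_eq using m strict_mono_less_eq[OF jp.strict_mono_\<sigma>, of k m]
        strict_mono_less_eq[OF jp.strict_mono_\<sigma>, of "Suc m" k] by linarith
    have u: "?u m \<omega> = t - \<sigma> m \<omega>" using m(1) by (simp add: \<tau>)
    have Wm: "W m (?u m \<omega>) \<omega> = X t \<omega>" unfolding u using jp.W_eq_X[of "t - \<sigma> m \<omega>" m] m by simp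
    have LWm: "\<l> m \<omega> + LW m (?u m \<omega>) \<omega> = L t \<omega>" unfolding u using jp.LW_eq_L[of "t - \<sigma> m \<omega>" m] m by simp
    have sum: "(\<Sum>j<k. if ?I j \<omega> then h j else 0) = (if m < k then h m else 0)" for h :: "nat \<Rightarrow> 'z::comm_monoid_add"
      unfolding I by simp
    have lk: "max 0 (\<l> k \<omega>) = \<l> k \<omega>" using regular_nonneg[OF reg, of k] by simp
    have Ll: "\<l> k \<omega> \<le> L t \<omega> \<longleftrightarrow> k \<le> m"
      using jp.level_reached_iff[OF t, of k] k by (simp add: \<tau>)
    show ?case
      unfolding killed_eq[OF \<omega> t] lk f1_def f2_def sum k using Wm LWm Ll by auto
  qed
  have m: "killed k t \<in> borel_measurable M"
    using measurable_augmented_imp_measurable[OF history_generator killed_measurable_history[OF t order_refl]] .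
  show ?thesis
    by (rule base_AE_cong[OF borel_measurable_Pair[OF f1 f2] m eq])
qed

lemma gen_killed_base: "gen_path M {0..} (killed k) \<subseteq> sets (base k)"
  by (rule gen_path_subset_sets) (simp_all add: killed_base)

section \<open>Joint independence at a jump\<close>

lemma noise_past: "sets (augmented M atom_noise) \<subseteq> stopped.past k"
proof
  fix H assume H: "H \<in> sets (augmented M atom_noise)"
  show "H \<in> stopped.past k" unfolding stopped.past_def
  proof (intro CollectI conjI allI impI)
    show "H \<in> events" using H augmented_subset_sets[OF atom_noise_events] by auto
    fix t :: real assume "0 \<le> t"
    then show "H \<inter> {\<omega>\<in>space M. \<tau> k \<omega> \<le> ereal t} \<in> sets (history t)"
      using H atom_noise_history[of t] by (intro sets.Int \<tau>_event) auto
  qed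
qed

lemma atoms_past:
  "gen M borel (start_pos k) \<subseteq> stopped.past k" "gen M borel (gap k) \<subseteq> stopped.past k"
  "gen M borel (Z (Suc k)) \<subseteq> stopped.past k"
proof -
  have h: "atom_history j \<subseteq> stopped.past k" for j
    using order_trans[OF atom_history_noise noise_past] .
  show "gen M borel (start_pos k) \<subseteq> stopped.past k"
    using order_trans[OF gen_start_pos_atom_history h] .
  show "gen M borel (gap k) \<subseteq> stopped.past k"
    using order_trans[OF gen_gap_atom_history h] .
  show "gen M borel (Z (Suc k)) \<subseteq> stopped.past k"
    using order_trans[OF gen_Z_atom_history[of "Suc k" "Suc k"] h] by simp
qed

lemma gen_Z_events: "gen M borel (Z (Suc k)) \<subseteq> events"
  by (rule gen_subset_sets[OF Z_borel refl]) simp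

lemma gen_B_indep_noise:
  assumes K: "K \<in> gen_path M {0..} B" and H: "H \<in> sets (augmented M atom_noise)"
  shows "prob (K \<inter> H) = prob K * prob H"
proof (rule indep_event_augmented[OF _ atom_noise_events sigma_algebra_imp_Int_stable[OF noise(1)] _ H])
  show "K \<in> events" using K gen_path_events[of "{0..}"] by auto
  show "prob (K \<inter> a) = prob K * prob a" if "a \<in> atom_noise" for a
    by (rule indep_setD[OF noise(2) K that])
qed

text \<open>The Brownian part is split from all atoms through the independence of \<open>B\<close>
  and the random measure. Among the atoms, the new gap and mark are split from the history, and then
  the start \<open>Z k\<close> from what precedes it.\<close>

lemma indep_base_new_atom:
  assumes A: "A \<in> sets (base k)" and z: "z \<in> gen M borel (start_pos k)"
    and e: "e \<in> gen M borel (gap k)" and g: "g \<in> gen M borel (Z (Suc k))"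
  shows "prob (A \<inter> (z \<inter> (e \<inter> g))) = prob A * (prob z * prob e * prob g)"
proof -
  let ?H = "z \<inter> (e \<inter> g)"
  have zH: "z \<in> atom_history k" using z gen_start_pos_atom_history by auto
  have ev: "z \<in> events" "e \<in> events" "g \<in> events"
    by (rule subsetD[OF atom_history_events zH], rule subsetD[OF gen_gap_events e], rule subsetD[OF gen_Z_events g])
  interpret AH: sigma_algebra "space M" "atom_history k" by (rule sigma_algebra_atom_history)
  have noise_sets: "z \<in> sets (augmented M atom_noise)" "e \<in> sets (augmented M atom_noise)" "g \<in> sets (augmented M atom_noise)"
    using zH e g atom_history_noise gen_gap_atom_history[of k] gen_Z_atom_history[of "Suc k" "Suc k"] by auto
  have pH: "prob ?H = prob z * prob e * prob g" by (rule indep_history_gap_mark[OF zH e g])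
  have "prob (?H \<inter> A) = prob ?H * prob A"
  proof (rule indep_event_augmented_join[OF _ _ _ _ _ _ _ _ A])
    show "?H \<in> events" using ev by auto
    show "gen_path M {0..} B \<subseteq> events" by (rule gen_path_events) simp
    show "mark_past k \<subseteq> events" by (rule mark_past_events)
    show "Int_stable (gen_path M {0..} B)" by (rule sigma_algebra_imp_Int_stable[OF sigma_algebra_gen])
    show "Int_stable (mark_past k)" by (rule sigma_algebra_imp_Int_stable[OF sigma_algebra_mark_past])
    show "space M \<in> gen_path M {0..} B" by (rule space_in_gen)
    show "space M \<in> mark_past k"
      by (rule algebra.top[OF sigma_algebra.axioms(1)[OF sigma_algebra_mark_past]])
    fix K J assume K: "K \<in> gen_path M {0..} B" and J: "J \<in> mark_past k"
    have JH: "J \<in> atom_history k" using J mark_past_atom_history by auto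
    then have JN: "J \<in> sets (augmented M atom_noise)" using atom_history_noise by auto
    have "prob (?H \<inter> (K \<inter> J)) = prob (K \<inter> ((J \<inter> z) \<inter> (e \<inter> g)))" by (rule arg_cong[where f = prob]) auto
    also have "\<dots> = prob K * prob ((J \<inter> z) \<inter> (e \<inter> g))"
      using JN noise_sets by (intro gen_B_indep_noise[OF K] sets.Int)
    also have "prob ((J \<inter> z) \<inter> (e \<inter> g)) = prob (J \<inter> z) * prob e * prob g"
      by (rule indep_history_gap_mark[OF AH.Int[OF JH zH] e g])
    also have "prob (J \<inter> z) = prob J * prob z" by (rule indep_mark_past_start[OF J z])
    also have "prob K * (prob J * prob z * prob e * prob g) = prob ?H * (prob K * prob J)"
      unfolding pH by simp
    also have "prob K * prob J = prob (K \<inter> J)" using gen_B_indep_noise[OF K JN] by simp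
    finally show "prob (?H \<inter> (K \<inter> J)) = prob ?H * prob (K \<inter> J)" .
  qed
  then show ?thesis unfolding pH by (simp add: Int_commute mult.commute)
qed

lemma gen_\<beta>_events: "gen_path M {0..} (\<beta>' k) \<subseteq> events"
  by (rule gen_path_subset_sets) (simp_all add: stopped.\<beta>_measurable)

lemma piece_generator: "gen M borel (start_pos k) \<union> gen_path M {0..} (\<beta>' k) \<subseteq> events"
  using gen_start_pos_events gen_\<beta>_events by auto

lemma gen_piece:
  "gen_path M {0..} (pair_process (W k) (LW k)) \<subseteq>
     sets (augmented M (gen M borel (start_pos k) \<union> gen_path M {0..} (\<beta>' k)))"
proof (rule gen_path_subset_sets)
  fix t :: real assume t: "t \<in> {0..}"
  have G: "gen M borel (start_pos k) \<union> gen_path M {0..t} (\<beta>' k) \<subseteq>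
      gen M borel (start_pos k) \<union> gen_path M {0..} (\<beta>' k)"
    using gen_path_mono[of "{0..t}" "{0..}" M "\<beta>' k"] by auto
  show "pair_process (W k) (LW k) t \<in> borel_measurable
      (augmented M (gen M borel (start_pos k) \<union> gen_path M {0..} (\<beta>' k)))"
    using t by (intro measurable_augmented_mono[OF order_trans[OF G piece_generator] piece_generator
      order_trans[OF G augmented_superset[OF piece_generator]] WLW_measurable]) simp
qed (rule space_augmented[OF piece_generator])

text \<open>Two independences are chained on generators \<open>z \<inter> b\<close> of the piece.
  The events \<open>A\<close>, \<open>z\<close>, \<open>e\<close> and \<open>g\<close> all lie in
  the past of \<open>\<tau> k\<close>, so the driving event \<open>b\<close> splits off; the
  remaining four are separated because \<open>A\<close> also lies in \<open>base k\<close>.\<close>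

lemma prob_piece:
  assumes A: "A \<in> gen_path M {0..} (killed k)" and C: "C \<in> gen_path M {0..} (pair_process (W k) (LW k))"
    and e: "e \<in> gen M borel (gap k)" and g: "g \<in> gen M borel (Z (Suc k))"
  shows "prob (A \<inter> C \<inter> e \<inter> g) = prob A * prob C * prob e * prob g"
proof -
  let ?H = "A \<inter> (e \<inter> g)"
  note Ab = subsetD[OF gen_killed_base A]
  have past: "A \<in> stopped.past k" "e \<in> stopped.past k" "g \<in> stopped.past k"
    by (rule subsetD[OF gen_killed_past A], rule subsetD[OF atoms_past(2) e], rule subsetD[OF atoms_past(3) g])
  \<comment> \<open>With the whole space as starting event, \<open>indep_base_new_atom\<close>
    yields the product for \<open>A\<close>, gap and mark alone.\<close>
  have s: "space M \<in> gen M borel (start_pos k)" by (rule space_in_gen)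
  have Hp: "?H \<in> stopped.past k" using past by (intro stopped.past_Int)
  have pH: "prob ?H = prob A * (prob e * prob g)"
  proof -
    have "e \<inter> g \<subseteq> space M" using past stopped.past_events sets.sets_into_space by blast
    then have "space M \<inter> (e \<inter> g) = e \<inter> g" by auto
    then show ?thesis using indep_base_new_atom[OF Ab s e g] by (simp add: prob_space)
  qed
  have "prob (?H \<inter> C) = prob ?H * prob C"
  proof (rule indep_event_augmented_join[OF _ _ _ _ _ _ _ _ subsetD[OF gen_piece C]])
    show "?H \<in> events" using Hp stopped.past_events by auto
    show "gen M borel (start_pos k) \<subseteq> events" by (rule gen_start_pos_events)
    show "gen_path M {0..} (\<beta>' k) \<subseteq> events" by (rule gen_\<beta>_events)
    show "Int_stable (gen M borel (start_pos k))" by (rule sigma_algebra_imp_Int_stable[OF sigma_algebra_gen])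
    show "Int_stable (gen_path M {0..} (\<beta>' k))" by (rule sigma_algebra_imp_Int_stable[OF sigma_algebra_gen])
    show "space M \<in> gen M borel (start_pos k)" by (rule space_in_gen)
    show "space M \<in> gen_path M {0..} (\<beta>' k)" by (rule space_in_gen)
    fix z b assume z: "z \<in> gen M borel (start_pos k)" and b: "b \<in> gen_path M {0..} (\<beta>' k)"
    have zp: "z \<in> stopped.past k" using z atoms_past(1) by auto
    have "prob (?H \<inter> (z \<inter> b)) = prob ((A \<inter> (z \<inter> (e \<inter> g))) \<inter> b)" by (rule arg_cong[where f = prob]) auto
    also have "\<dots> = prob (A \<inter> (z \<inter> (e \<inter> g))) * prob b"
      using past zp by (intro stopped.indep_after[OF _ b] stopped.past_Int)
    also have "prob (A \<inter> (z \<inter> (e \<inter> g))) = prob ?H * prob z"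
      unfolding indep_base_new_atom[OF Ab z e g] pH by simp
    also have "prob ?H * prob z * prob b = prob ?H * prob (z \<inter> b)"
      using stopped.indep_after[OF zp b] by simp
    finally show "prob (?H \<inter> (z \<inter> b)) = prob ?H * prob (z \<inter> b)" .
  qed
  moreover have "A \<inter> C \<inter> e \<inter> g = ?H \<inter> C" by auto
  ultimately show ?thesis unfolding pH by simp
qed

text \<open>Each of the four sigma-algebras contains the whole space, so the product formula over
  all four indices implies it for every subset of them.\<close>

lemma indep_piece:
  "indep_sets (\<lambda>i. [gen_path M {0..} (killed k), gen_path M {0..} (pair_process (W k) (LW k)),
     gen M borel (gap k), gen M borel (Z (Suc k))] ! i) {..<4}" (is "indep_sets ?F _")
proof -
  have I: "{..<4} = {0, 1, 2, 3::nat}" by auto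
  have F: "?F 0 = gen_path M {0..} (killed k)" "?F 1 = gen_path M {0..} (pair_process (W k) (LW k))"
    "?F 2 = gen M borel (gap k)" "?F 3 = gen M borel (Z (Suc k))" by simp_all
  show ?thesis
  proof (subst indep_sets_finite)
    show "{..<4::nat} \<noteq> {}" "finite {..<4::nat}" unfolding I by simp_all
    have s: "?F i \<subseteq> events \<and> space M \<in> ?F i" if "i = 0 \<or> i = 1 \<or> i = 2 \<or> i = 3" for i
    proof -
      have "gen_path M {0..} (killed k) \<subseteq> events" using order_trans[OF gen_killed_past stopped.past_events] .
      moreover have "gen_path M {0..} (pair_process (W k) (LW k)) \<subseteq> events"
        using order_trans[OF gen_piece augmented_subset_sets[OF piece_generator]] .
      ultimately show ?thesis using that by (elim disjE) (simp_all add: space_in_gen gen_gap_events gen_Z_events)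
    qed
    show "?F i \<subseteq> events" "space M \<in> ?F i" if "i \<in> {..<4}" for i
    proof -
      have "i = 0 \<or> i = 1 \<or> i = 2 \<or> i = 3" using that unfolding I by simp
      from s[OF this] show "?F i \<subseteq> events" "space M \<in> ?F i" by (rule conjunct1, rule conjunct2)
    qed
    show "\<forall>A\<in>Pi {..<4} ?F. prob (\<Inter>j\<in>{..<4}. A j) = (\<Prod>j\<in>{..<4}. prob (A j))"
    proof
      fix A assume A: "A \<in> Pi {..<4} ?F"
      have m: "A 0 \<in> gen_path M {0..} (killed k)" "A 1 \<in> gen_path M {0..} (pair_process (W k) (LW k))"
        "A 2 \<in> gen M borel (gap k)" "A 3 \<in> gen M borel (Z (Suc k))"
        using Pi_mem[OF A, of 0] Pi_mem[OF A, of 1] Pi_mem[OF A, of 2] Pi_mem[OF A, of 3] by simp_all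
      have "(\<Inter>j\<in>{..<4}. A j) = A 0 \<inter> A 1 \<inter> A 2 \<inter> A 3" unfolding I by (simp add: Int_assoc)
      then show "prob (\<Inter>j\<in>{..<4}. A j) = (\<Prod>j\<in>{..<4}. prob (A j))"
        using prob_piece[OF m] unfolding I by simp
    qed
  qed
qed

lemma reflected_BM_piece: "reflected_BM M D (start_pos k) (\<beta>' k) (W k) (LW k)"
  unfolding reflected_BM_def
proof (intro conjI)
  show "standard_BM M (\<beta>' k)" by (rule stopped.standard_BM_after)
  show "strong_skorokhod_solution M D (start_pos k) (\<beta>' k) (W k) (LW k)" by (rule reflected)
  show "indep_set (gen M borel (start_pos k)) (gen_path M {0..} (\<beta>' k))"
    by (intro indep_setI gen_start_pos_events gen_\<beta>_events stopped.indep_after subsetD[OF atoms_past(1)])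
qed

end

theorem lemma1:
  fixes M :: "'w measure"
    and D :: "(real ^ 'n) set" and \<mu> :: "(real ^ 'n) measure" and x :: "real ^ 'n"
    and B :: "real \<Rightarrow> 'w \<Rightarrow> (real ^ 'n)" and \<nu> :: "'w \<Rightarrow> (real \<times> (real ^ 'n)) measure"
    and \<l> :: "nat \<Rightarrow> 'w \<Rightarrow> real" and Z :: "nat \<Rightarrow> 'w \<Rightarrow> (real ^ 'n)"
    and X :: "real \<Rightarrow> 'w \<Rightarrow> (real ^ 'n)" and L :: "real \<Rightarrow> 'w \<Rightarrow> real"
    and W :: "nat \<Rightarrow> real \<Rightarrow> 'w \<Rightarrow> (real ^ 'n)" and LW :: "nat \<Rightarrow> real \<Rightarrow> 'w \<Rightarrow> real"
    and \<beta> :: "nat \<Rightarrow> real \<Rightarrow> 'w \<Rightarrow> (real ^ 'n)" and \<tau> \<xi> :: "nat \<Rightarrow> 'w \<Rightarrow> ereal"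
  assumes "prob_space M"
    and "C2_domain D" and "bounded D" and "x \<in> D"
    and "prob_space \<mu>" and "sets \<mu> = sets (restrict_space borel D)"
    and "standard_BM M B"
    and "poisson_random_measure M (jump_intensity \<mu>) \<nu>"
    and "prob_space.indep_set M (gen_path M {0..} B) (gen_random_measure M (jump_intensity \<mu>) \<nu>)"
    and "\<And>k. 1 \<le> k \<Longrightarrow> \<l> k \<in> borel_measurable M" and "\<And>\<omega>. \<l> 0 \<omega> = 0"
    and "\<And>k. 1 \<le> k \<Longrightarrow> Z k \<in> measurable M (restrict_space borel D)"
    and "AE \<omega> in M. (\<forall>k\<ge>1. 0 \<le> \<l> k \<omega>) \<and> strict_mono_on {1..} (\<lambda>k. \<l> k \<omega>) \<and>
           \<nu> \<omega> = distr (count_space {1..}) (jump_intensity \<mu>) (\<lambda>k. (\<l> k \<omega>, Z k \<omega>))"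
    and "strong_jump_solution M D \<mu> x B \<nu> \<l> Z X L"
    and "\<And>k. \<tau> k = jump_time L \<l> k"
    and "\<And>k. \<beta> k = increment_after B (\<tau> k)"
    and "\<And>k. strong_skorokhod_solution M D (restart_position x Z k) (\<beta> k) (W k) (LW k)"
    and "\<And>k. \<xi> k = lifetime LW \<l> k"
  shows "(AE \<omega> in M.
           (\<forall>T. finite {t\<in>{0<..T}. left_limit (\<lambda>s. X s \<omega>) t \<noteq> X t \<omega>} \<and>
                finite {k. 1 \<le> k \<and> \<tau> k \<omega> \<le> ereal T}) \<and>
           (\<forall>t\<ge>0. (\<lambda>k. indicator {\<tau> k \<omega>..<\<tau> (Suc k) \<omega>} (ereal t) *\<^sub>R
                         W k (t - real_of_ereal (\<tau> k \<omega>)) \<omega>) sums X t \<omega>) \<and>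
           (\<forall>k. 0 < \<xi> k \<omega> \<and> \<tau> (Suc k) \<omega> = \<tau> k \<omega> + \<xi> k \<omega> \<and> \<tau> (Suc k) \<omega> < \<infinity> \<and>
                X (real_of_ereal (\<tau> (Suc k) \<omega>)) \<omega> = Z (Suc k) \<omega>)) \<and>
         (\<forall>k. reflected_BM M D (restart_position x Z k) (\<beta> k) (W k) (LW k) \<and>
              distributed M lborel (\<lambda>\<omega>. \<l> (Suc k) \<omega> - \<l> k \<omega>) (exponential_density 1) \<and>
              distr M \<mu> (Z (Suc k)) = \<mu> \<and>
              prob_space.indep_sets M
                (\<lambda>i. [gen_path M {0..} (before (\<tau> k) X L),
                      gen_path M {0..} (pair_process (W k) (LW k)),
                      gen M borel (\<lambda>\<omega>. \<l> (Suc k) \<omega> - \<l> k \<omega>),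
                      gen M borel (Z (Suc k))] ! i) {..<4})"
proof -
  have eqs: "\<tau> = jump_time L \<l>" "\<beta> = (\<lambda>k. increment_after B (jump_time L \<l> k))" "\<xi> = lifetime LW \<l>"
    by (simp_all add: fun_eq_iff assms(15,16,18))
  interpret boundary_jump M D \<mu> \<nu> \<l> Z x B X L W LW
  proof (intro boundary_jump.intro boundary_jump_axioms.intro poisson_atoms.intro poisson_atoms_axioms.intro)
    show "strong_skorokhod_solution M D (restart_position x Z k) (increment_after B (jump_time L \<l> k)) (W k) (LW k)" for k
      using assms(17)[of k] unfolding eqs .
  qed (use assms in simp_all)
  show ?thesis
    unfolding eqs
    by (intro conjI allI eventually_mono[OF AE_good pathwise_concatenation]
        reflected_BM_piece distributed_gap distr_mark indep_piece)
qed

end
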